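(* Let $\Lambda$ be a $k$-graph. (1) For any right $\Lambda$-module $\mathcal{M}$ there is a pair of cochain maps \[\triangledown^*_{\mathcal{M}}\colon C^*(\Lambda,\mathcal{M})\to C^*_{\mathrm{cub}}(\Lambda,\mathcal{M}),\qquad \square^*_{\mathcal{M}}\colon C^*_{\mathrm{cub}}(\Lambda,\mathcal{M})\to C^*(\Lambda,\mathcal{M})\] defined by \[\triangledown^n_{\mathcal{M}}(f)(\eta)=\sum_{\sigma\in\Sigma_n}\mathrm{sgn}(\sigma)\,f(\eta_1^\sigma,\dots,\eta_n^\sigma)\] for $f\in C^n(\Lambda,\mathcal{M})$, $\eta\in Q_n(\Lambda)$, and \[\square^n_{\mathcal{M}}(g)(\lambda_0,\dots,\lambda_{n-1})=\sum_{K}\ \sum_{m\in[b+e_K,c]\cap\mathbb{N}^k}g\big(\lambda(m-e_K,m)\big)\cdot\lambda(m,d(\lambda))\] for $g\in C^n_{\mathrm{cub}}(\Lambda,\mathcal{M})$, $(\lambda_0,\dots,\lambda_{n-1})\in\Lambda^{*n}$, where $K$ ranges over the $n$-element subsets of $\{1,\dots,k\}$, $\lambda=\lambda_0\cdots\lambda_{n-1}$, $e_K=\sum_{j\in K}e_j$, \[b=\sum_{i=1}^n\sum_{j=K_{(i)}+1}^k d_j(\lambda_{i-1})e_j,\qquad c=\sum_{i=1}^n\sum_{j=K_{(i)}}^k d_j(\lambda_{i-1})e_j ,\] and $K_{(i)}$ is the $i$-th smallest element of $K$. These constitute a homotopy equivalence, and thus induce an isomorphism between $H^n(\Lambda,\mathcal{M})$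 and $H^n_{\mathrm{cub}}(\Lambda,\mathcal{M})$. (2) For any left $\Lambda$-module $\mathcal{N}$ there is a pair of chain maps \[\triangledown_*^{\mathcal{N}}\colon C_*^{\mathrm{cub}}(\Lambda,\mathcal{N})\to C_*(\Lambda,\mathcal{N}),\qquad \square_*^{\mathcal{N}}\colon C_*(\Lambda,\mathcal{N})\to C_*^{\mathrm{cub}}(\Lambda,\mathcal{N})\] defined by \[\triangledown_n^{\mathcal{N}}(\eta,a)=\sum_{\sigma\in\Sigma_n}\mathrm{sgn}(\sigma)\big((\eta_1^\sigma,\dots,\eta_n^\sigma),a\big)\] for $\eta\in Q_n(\Lambda)$, $a\in\mathcal{N}(s(\eta))$, and \[\square_n^{\mathcal{N}}\big((\lambda_0,\dots,\lambda_{n-1}),a\big)=\sum_{K}\ \sum_{m\in[b+e_K,c]\cap\mathbb{N}^k}\big(\lambda(m-e_K,m),\ \lambda(m,d(\lambda))\cdot a\big)\] for $(\lambda_0,\dots,\lambda_{n-1})\in\Lambda^{*n}$, $a\in\mathcal{N}(s(\lambda_{n-1}))$, with $K,\lambda,e_K,b,c$ given by the same formulas. These constitute a homotopy equivalence, and thus induce an isomorphism between $H_n(\Lambda,\mathcal{N})$ and $H_n^{\mathrm{cub}}(\Lambda,\mathcal{N})$. (All formulas are for all $n$; in negative degrees all groups are zero.)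
   Context: $\mathbb{N}$ includes $0$; $e_1,\dots,e_k$ are the canonical generators of $\mathbb{N}^k$. For $x,y\in\mathbb{N}^k$, $[x,y]$ is the set of $z\in\mathbb{R}^k$ with $x\le z\le y$ coordinatewise (empty if $x\not\le y$). $\Sigma_n$ is the symmetric group on $\{1,\dots,n\}$ and $\mathrm{sgn}$ the sign. **k-graphs.** A $k$-graph is a countable small category $\Lambda$ with a functor $d\colon\Lambda\to\mathbb{N}^k$ ($\mathbb{N}^k$ a one-object category under addition) with the factorization property: if $d(\lambda)=m+n$ there are unique $\mu,\nu$ with $d(\mu)=m$, $d(\nu)=n$, $\lambda=\mu\nu$. Here $\mu\nu$ is defined iff $s(\mu)=r(\nu)$. $\lambda\in\Lambda$ means $\lambda$ is a morphism; objects are identified with identity morphisms, exactly the morphisms of degree $0$ (vertices). $d_i(\lambda)$ is the $i$-th coordinate of $d(\lambda)$. For $0\le m\le n\le d(\lambda)$, $\lambda(m,n)$ is the unique morphism of degree $n-m$ with $\lambda=\lambda'\lambda(m,n)\lambda''$, $d(\lambda')=m$. $\Lambda^{*n}$ is the set of composable $n$-tuples $(\lambda_0,\dots,\lambda_{n-1})$, $s(\lambda_{i-1})=r(\lambda_i)$; $\Lambda^{*0}$ is the set of vertices (a $0$-tuple is a vertex $v$, with "$s(\lambda_{n-1})$" and "$\lambda_0\cdots\lambda_{n-1}$" meaning $v$). **Modules.** A right (left) $\Lambda$-module is a contravariant (covariant) functor from $\Lambda$ to abelian groups; the action is written $m\cdot\lambda$ for $m\in\mathcal{M}(r(\lambda))$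 (resp. $\lambda\cdot a$ for $a\in\mathcal{N}(s(\lambda))$). **Categorical complexes.** $C^n(\Lambda,\mathcal{M})=\prod_{(\lambda_0,\dots,\lambda_{n-1})\in\Lambda^{*n}}\mathcal{M}(s(\lambda_{n-1}))$ with \[\delta_n(f)(\lambda_0,\dots,\lambda_n)=f(\lambda_1,\dots,\lambda_n)+\sum_{i=1}^n(-1)^if(\lambda_0,\dots,\lambda_{i-1}\lambda_i,\dots,\lambda_n)+(-1)^{n+1}f(\lambda_0,\dots,\lambda_{n-1})\cdot\lambda_n,\] and $C_n(\Lambda,\mathcal{N})=\bigoplus_{\Lambda^{*n}}\mathcal{N}(s(\lambda_{n-1}))$, generated by pairs $((\lambda_0,\dots,\lambda_{n-1}),a)$, with \[\partial_n((\lambda_0,\dots,\lambda_{n-1}),a)=((\lambda_1,\dots,\lambda_{n-1}),a)+\sum_{i=1}^{n-1}(-1)^i((\lambda_0,\dots,\lambda_{i-1}\lambda_i,\dots,\lambda_{n-1}),a)+(-1)^n((\lambda_0,\dots,\lambda_{n-2}),\lambda_{n-1}\cdot a).\] (When a face is a $0$-tuple: $\delta_0(f)(\lambda_0)=f(s(\lambda_0))-f(r(\lambda_0))\cdot\lambda_0$ and $\partial_1((\lambda_0),a)=(s(\lambda_0),a)-(r(\lambda_0),\lambda_0\cdot a)$.) Their (co-)homology groups are the categorical groups $H^n(\Lambda,\mathcal{M})$, $H_n(\Lambda,\mathcal{N})$. **Cubical complexes.** $Q_n(\Lambda)=\{\eta\in\Lambda:\sum_id_i(\eta)=n,\ d_i(\eta)\in\{0,1\}\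 \forall i\}$. For $\lambda\in Q_n(\Lambda)$ with $d(\lambda)=\sum_{j=1}^ne_{c_j}$, $c_1<\dots<c_n$: $F^0_j(\lambda)=\lambda(0,d(\lambda)-e_{c_j})$, $F^1_j(\lambda)=\lambda(e_{c_j},d(\lambda))$, $S_j(\lambda)=\lambda(d(\lambda)-e_{c_j},d(\lambda))$. $C_n^{\mathrm{cub}}(\Lambda,\mathcal{N})=\bigoplus_{\lambda\in Q_n(\Lambda)}\mathcal{N}(s(\lambda))$, generated by pairs $(\lambda,a)$, with boundary $(\lambda,a)\mapsto\sum_{i=1}^n(-1)^i\big((F_i^0(\lambda),S_i(\lambda)\cdot a)-(F_i^1(\lambda),a)\big)$; $C^n_{\mathrm{cub}}(\Lambda,\mathcal{M})=\prod_{\lambda\in Q_n(\Lambda)}\mathcal{M}(s(\lambda))$ with $\delta_{n-1}(f)(\lambda)=\sum_{i=1}^n(-1)^i\big(f(F_i^0(\lambda))\cdot S_i(\lambda)-f(F_i^1(\lambda))\big)$. Their (co-)homology groups are $H_n^{\mathrm{cub}}(\Lambda,\mathcal{N})$ and $H^n_{\mathrm{cub}}(\Lambda,\mathcal{M})$. **Notation $\eta_i^\sigma$.** For $\eta\in Q_n(\Lambda)$ with $d(\eta)=\sum_{j=1}^ne_{c_j}$, $c_1<\dots<c_n$, and $\sigma\in\Sigma_n$, write uniquely $\eta=\eta_1^\sigma\cdots\eta_n^\sigma$ with $d(\eta_i^\sigma)=e_{c_{\sigma(i)}}$ (for $n=0$, the empty tuple is the vertex $\eta$). "Constitute a homotopy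 equivalence" means that the two maps are mutually inverse up to (co-)chain homotopy. *)

theory Defs
  imports
    "HOL-Algebra.FiniteProduct"
    "HOL-Algebra.Product_Groups"
    "HOL-Combinatorics.Permutations"
    "HOL-Library.Function_Algebras"
    "HOL-Library.Countable_Set"
begin

section \<open>The monoid of degrees\<close>

text \<open>
  The elements of \<open>\<nat>\<^sup>k\<close> are the functions \<open>nat \<Rightarrow> nat\<close> that vanish outside \<open>{1..k}\<close>; sums,
  differences and the order are pointwise.
\<close>

type_synonym vec = "nat \<Rightarrow> nat"

definition Nvec :: "nat \<Rightarrow> vec set" where
  "Nvec k = {x. \<forall>i. i \<notin> {1..k} \<longrightarrow> x i = 0}"

text \<open>\<open>scaled_unit a j\<close> is the vector \<open>a e\<^sub>j\<close>.\<close>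

definition scaled_unit :: "nat \<Rightarrow> nat \<Rightarrow> vec" where
  "scaled_unit a j = (\<lambda>i. if i = j then a else 0)"

abbreviation unit_vec :: "nat \<Rightarrow> vec" where
  "unit_vec j \<equiv> scaled_unit 1 j"

definition set_vec :: "nat set \<Rightarrow> vec" where
  "set_vec K = (\<Sum>j\<in>K. unit_vec j)"

text \<open>The \<open>i\<close>-th smallest element of a finite set, counting from \<open>i = 1\<close>.\<close>

definition nth_smallest :: "nat set \<Rightarrow> nat \<Rightarrow> nat" where
  "nth_smallest K i = sorted_list_of_set K ! (i - 1)"


section \<open>Higher-rank graphs\<close>

text \<open>
  Small categories are presented by their morphisms; an object is identified with its identity
  morphism.  \<open>rng\<close> is the codomain and \<open>src\<close> the domain, so that \<open>\<mu> \<cdot> \<nu>\<close> is meaningful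
  iff \<open>src \<mu> = rng \<nu>\<close>.
\<close>

record 'a kgraph =
  Mor :: "'a set"
  rng :: "'a \<Rightarrow> 'a"
  src :: "'a \<Rightarrow> 'a"
  cmp :: "'a \<Rightarrow> 'a \<Rightarrow> 'a" (infixl \<open>\<cdot>\<index>\<close> 70)
  deg :: "'a \<Rightarrow> vec"

definition Obj :: "'a kgraph \<Rightarrow> 'a set" where
  "Obj \<Lambda> = {v \<in> Mor \<Lambda>. rng \<Lambda> v = v \<and> src \<Lambda> v = v}"

locale k_graph =
  fixes k :: nat and \<Lambda> :: "'a kgraph" (structure)
  assumes rng_closed: "\<mu> \<in> Mor \<Lambda> \<Longrightarrow> rng \<Lambda> \<mu> \<in> Obj \<Lambda>"
    and src_closed: "\<mu> \<in> Mor \<Lambda> \<Longrightarrow> src \<Lambda> \<mu> \<in> Obj \<Lambda>"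
    and cmp_closed:
      "\<lbrakk>\<mu> \<in> Mor \<Lambda>; \<nu> \<in> Mor \<Lambda>; src \<Lambda> \<mu> = rng \<Lambda> \<nu>\<rbrakk> \<Longrightarrow> \<mu> \<cdot> \<nu> \<in> Mor \<Lambda>"
    and rng_cmp:
      "\<lbrakk>\<mu> \<in> Mor \<Lambda>; \<nu> \<in> Mor \<Lambda>; src \<Lambda> \<mu> = rng \<Lambda> \<nu>\<rbrakk> \<Longrightarrow> rng \<Lambda> (\<mu> \<cdot> \<nu>) = rng \<Lambda> \<mu>"
    and src_cmp:
      "\<lbrakk>\<mu> \<in> Mor \<Lambda>; \<nu> \<in> Mor \<Lambda>; src \<Lambda> \<mu> = rng \<Lambda> \<nu>\<rbrakk> \<Longrightarrow> src \<Lambda> (\<mu> \<cdot> \<nu>) = src \<Lambda> \<nu>"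
    and cmp_assoc:
      "\<lbrakk>\<mu> \<in> Mor \<Lambda>; \<nu> \<in> Mor \<Lambda>; \<rho> \<in> Mor \<Lambda>; src \<Lambda> \<mu> = rng \<Lambda> \<nu>; src \<Lambda> \<nu> = rng \<Lambda> \<rho>\<rbrakk>
        \<Longrightarrow> (\<mu> \<cdot> \<nu>) \<cdot> \<rho> = \<mu> \<cdot> (\<nu> \<cdot> \<rho>)"
    and rng_cmp_id: "\<mu> \<in> Mor \<Lambda> \<Longrightarrow> rng \<Lambda> \<mu> \<cdot> \<mu> = \<mu>"
    and cmp_src_id: "\<mu> \<in> Mor \<Lambda> \<Longrightarrow> \<mu> \<cdot> src \<Lambda> \<mu> = \<mu>"
    and countable_Mor: "countable (Mor \<Lambda>)"
    and deg_closed: "\<mu> \<in> Mor \<Lambda> \<Longrightarrow> deg \<Lambda> \<mu> \<in> Nvec k"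
    and deg_id: "v \<in> Obj \<Lambda> \<Longrightarrow> deg \<Lambda> v = 0"
    and deg_cmp:
      "\<lbrakk>\<mu> \<in> Mor \<Lambda>; \<nu> \<in> Mor \<Lambda>; src \<Lambda> \<mu> = rng \<Lambda> \<nu>\<rbrakk>
        \<Longrightarrow> deg \<Lambda> (\<mu> \<cdot> \<nu>) = deg \<Lambda> \<mu> + deg \<Lambda> \<nu>"
    and factorization:
      "\<lbrakk>\<xi> \<in> Mor \<Lambda>; m \<in> Nvec k; n \<in> Nvec k; deg \<Lambda> \<xi> = m + n\<rbrakk>
        \<Longrightarrow> \<exists>!(\<mu>, \<nu>). \<mu> \<in> Mor \<Lambda> \<and> \<nu> \<in> Mor \<Lambda> \<and> src \<Lambda> \<mu> = rng \<Lambda> \<nu> \<and>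
              deg \<Lambda> \<mu> = m \<and> deg \<Lambda> \<nu> = n \<and> \<xi> = \<mu> \<cdot> \<nu>"

text \<open>\<open>seg \<Lambda> \<xi> m n\<close> is the segment \<open>\<xi>(m, n)\<close>.\<close>

definition seg :: "'a kgraph \<Rightarrow> 'a \<Rightarrow> vec \<Rightarrow> vec \<Rightarrow> 'a" where
  "seg \<Lambda> \<xi> m n = (THE \<mu>. \<mu> \<in> Mor \<Lambda> \<and> deg \<Lambda> \<mu> = n - m \<and>
     (\<exists>\<alpha>\<in>Mor \<Lambda>. \<exists>\<beta>\<in>Mor \<Lambda>. src \<Lambda> \<alpha> = rng \<Lambda> \<mu> \<and> src \<Lambda> \<mu> = rng \<Lambda> \<beta> \<and>
        \<xi> = \<alpha> \<cdot>\<^bsub>\<Lambda>\<^esub> \<mu> \<cdot>\<^bsub>\<Lambda>\<^esub> \<beta> \<and> deg \<Lambda> \<alpha> = m))"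

text \<open>
  A composable \<open>n\<close>-tuple is encoded as a pair \<open>(v, ms)\<close> of the list \<open>ms\<close> of its \<open>n\<close> entries
  and the vertex \<open>v\<close> at which it starts.  For \<open>n > 0\<close> the vertex is redundant, being the range
  of the first entry; the \<open>0\<close>-tuple given by a vertex \<open>v\<close> is \<open>(v, [])\<close>.
\<close>

type_synonym 'a tup = "'a \<times> 'a list"

definition tuples :: "'a kgraph \<Rightarrow> nat \<Rightarrow> 'a tup set" where
  "tuples \<Lambda> n = {(v, ms). v \<in> Obj \<Lambda> \<and> set ms \<subseteq> Mor \<Lambda> \<and> length ms = n \<and>
     successively (\<lambda>\<mu> \<nu>. src \<Lambda> \<mu> = rng \<Lambda> \<nu>) ms \<and> (ms \<noteq> [] \<longrightarrow> v = rng \<Lambda> (hd ms))}"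

definition tup_src :: "'a kgraph \<Rightarrow> 'a tup \<Rightarrow> 'a" where
  "tup_src \<Lambda> t = (case t of (v, ms) \<Rightarrow> if ms = [] then v else src \<Lambda> (last ms))"

definition tup_prod :: "'a kgraph \<Rightarrow> 'a tup \<Rightarrow> 'a" where
  "tup_prod \<Lambda> t = (case t of (v, ms) \<Rightarrow> foldl (cmp \<Lambda>) v ms)"

text \<open>The three kinds of faces of \<open>(\<lambda>\<^sub>0, \<dots>, \<lambda>\<^sub>n)\<close>; \<open>face_mid i\<close> multiplies \<open>\<lambda>\<^sub>i\<^sub>-\<^sub>1\<close> and \<open>\<lambda>\<^sub>i\<close>.\<close>

definition face_first :: "'a kgraph \<Rightarrow> 'a tup \<Rightarrow> 'a tup" where
  "face_first \<Lambda> t = (case t of (v, ms) \<Rightarrow> (src \<Lambda> (hd ms), tl ms))"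

definition face_mid :: "'a kgraph \<Rightarrow> nat \<Rightarrow> 'a tup \<Rightarrow> 'a tup" where
  "face_mid \<Lambda> i t = (case t of (v, ms) \<Rightarrow>
     (v, take (i - 1) ms @ [ms ! (i - 1) \<cdot>\<^bsub>\<Lambda>\<^esub> ms ! i] @ drop (i + 1) ms))"

definition face_last :: "'a tup \<Rightarrow> 'a tup" where
  "face_last t = (case t of (v, ms) \<Rightarrow> (v, butlast ms))"

abbreviation last_entry :: "'a tup \<Rightarrow> 'a" where
  "last_entry t \<equiv> last (snd t)"


section \<open>Modules\<close>

text \<open>
  The abelian groups are the library's commutative groups, so they are written
  multiplicatively: a formal sum is a \<open>finprod\<close> and an integer coefficient is an exponent.
  \<open>act \<mu> x\<close> is \<open>x \<cdot> \<mu>\<close> for a right module and \<open>\<mu> \<cdot> x\<close> for a left module.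
\<close>

locale right_module =
  fixes \<Lambda> :: "'a kgraph" and M :: "'a \<Rightarrow> 'b monoid" and act :: "'a \<Rightarrow> 'b \<Rightarrow> 'b"
  assumes comm_group_M: "v \<in> Obj \<Lambda> \<Longrightarrow> comm_group (M v)"
    and act_hom: "\<mu> \<in> Mor \<Lambda> \<Longrightarrow> act \<mu> \<in> hom (M (rng \<Lambda> \<mu>)) (M (src \<Lambda> \<mu>))"
    and act_id: "\<lbrakk>v \<in> Obj \<Lambda>; x \<in> carrier (M v)\<rbrakk> \<Longrightarrow> act v x = x"
    and act_cmp:
      "\<lbrakk>\<mu> \<in> Mor \<Lambda>; \<nu> \<in> Mor \<Lambda>; src \<Lambda> \<mu> = rng \<Lambda> \<nu>; x \<in> carrier (M (rng \<Lambda> \<mu>))\<rbrakk>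
        \<Longrightarrow> act (\<mu> \<cdot>\<^bsub>\<Lambda>\<^esub> \<nu>) x = act \<nu> (act \<mu> x)"

locale left_module =
  fixes \<Lambda> :: "'a kgraph" and N :: "'a \<Rightarrow> 'b monoid" and act :: "'a \<Rightarrow> 'b \<Rightarrow> 'b"
  assumes comm_group_N: "v \<in> Obj \<Lambda> \<Longrightarrow> comm_group (N v)"
    and act_hom: "\<mu> \<in> Mor \<Lambda> \<Longrightarrow> act \<mu> \<in> hom (N (src \<Lambda> \<mu>)) (N (rng \<Lambda> \<mu>))"
    and act_id: "\<lbrakk>v \<in> Obj \<Lambda>; x \<in> carrier (N v)\<rbrakk> \<Longrightarrow> act v x = x"
    and act_cmp:
      "\<lbrakk>\<mu> \<in> Mor \<Lambda>; \<nu> \<in> Mor \<Lambda>; src \<Lambda> \<mu> = rng \<Lambda> \<nu>; x \<in> carrier (N (src \<Lambda> \<nu>))\<rbrakk>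
        \<Longrightarrow> act (\<mu> \<cdot>\<^bsub>\<Lambda>\<^esub> \<nu>) x = act \<mu> (act \<nu> x)"


section \<open>Complexes of abelian groups\<close>

text \<open>
  Complexes are indexed by \<open>nat\<close>, with zero groups understood in negative degrees.  A
  coboundary \<open>\<delta> n\<close> goes from degree \<open>n\<close> to degree \<open>n + 1\<close>; a boundary \<open>bd n\<close> goes from degree
  \<open>n\<close> to degree \<open>n - 1\<close> and is irrelevant for \<open>n = 0\<close>.
\<close>

definition cochain_complex :: "(nat \<Rightarrow> 'x monoid) \<Rightarrow> (nat \<Rightarrow> 'x \<Rightarrow> 'x) \<Rightarrow> bool" where
  "cochain_complex C \<delta> \<longleftrightarrow> (\<forall>n. comm_group (C n) \<and> \<delta> n \<in> hom (C n) (C (Suc n)) \<and>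
     (\<forall>x\<in>carrier (C n). \<delta> (Suc n) (\<delta> n x) = \<one>\<^bsub>C (Suc (Suc n))\<^esub>))"

definition cochain_map ::
  "(nat \<Rightarrow> 'x monoid) \<Rightarrow> (nat \<Rightarrow> 'x \<Rightarrow> 'x) \<Rightarrow> (nat \<Rightarrow> 'y monoid) \<Rightarrow> (nat \<Rightarrow> 'y \<Rightarrow> 'y) \<Rightarrow>
   (nat \<Rightarrow> 'x \<Rightarrow> 'y) \<Rightarrow> bool" where
  "cochain_map C \<delta> D \<epsilon> \<phi> \<longleftrightarrow> cochain_complex C \<delta> \<and> cochain_complex D \<epsilon> \<and>
     (\<forall>n. \<phi> n \<in> hom (C n) (D n) \<and> (\<forall>x\<in>carrier (C n). \<phi> (Suc n) (\<delta> n x) = \<epsilon> n (\<phi> n x)))"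

definition cochain_homotopic ::
  "(nat \<Rightarrow> 'x monoid) \<Rightarrow> (nat \<Rightarrow> 'x \<Rightarrow> 'x) \<Rightarrow> (nat \<Rightarrow> 'y monoid) \<Rightarrow> (nat \<Rightarrow> 'y \<Rightarrow> 'y) \<Rightarrow>
   (nat \<Rightarrow> 'x \<Rightarrow> 'y) \<Rightarrow> (nat \<Rightarrow> 'x \<Rightarrow> 'y) \<Rightarrow> bool" where
  "cochain_homotopic C \<delta> D \<epsilon> \<phi> \<psi> \<longleftrightarrow> (\<exists>h. (\<forall>n. h n \<in> hom (C (Suc n)) (D n)) \<and>
     (\<forall>x\<in>carrier (C 0). \<phi> 0 x = \<psi> 0 x \<otimes>\<^bsub>D 0\<^esub> h 0 (\<delta> 0 x)) \<and>
     (\<forall>n. \<forall>x\<in>carrier (C (Suc n)). \<phi> (Suc n) x =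
        \<psi> (Suc n) x \<otimes>\<^bsub>D (Suc n)\<^esub> h (Suc n) (\<delta> (Suc n) x) \<otimes>\<^bsub>D (Suc n)\<^esub> \<epsilon> n (h n x)))"

definition cochain_homotopy_equivalence ::
  "(nat \<Rightarrow> 'x monoid) \<Rightarrow> (nat \<Rightarrow> 'x \<Rightarrow> 'x) \<Rightarrow> (nat \<Rightarrow> 'y monoid) \<Rightarrow> (nat \<Rightarrow> 'y \<Rightarrow> 'y) \<Rightarrow>
   (nat \<Rightarrow> 'x \<Rightarrow> 'y) \<Rightarrow> (nat \<Rightarrow> 'y \<Rightarrow> 'x) \<Rightarrow> bool" where
  "cochain_homotopy_equivalence C \<delta> D \<epsilon> \<phi> \<psi> \<longleftrightarrow>
     cochain_map C \<delta> D \<epsilon> \<phi> \<and> cochain_map D \<epsilon> C \<delta> \<psi> \<and>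
     cochain_homotopic C \<delta> C \<delta> (\<lambda>n. \<psi> n \<circ> \<phi> n) (\<lambda>n. id) \<and>
     cochain_homotopic D \<epsilon> D \<epsilon> (\<lambda>n. \<phi> n \<circ> \<psi> n) (\<lambda>n. id)"

definition cocycle_group :: "(nat \<Rightarrow> 'x monoid) \<Rightarrow> (nat \<Rightarrow> 'x \<Rightarrow> 'x) \<Rightarrow> nat \<Rightarrow> 'x monoid" where
  "cocycle_group C \<delta> n = (C n)\<lparr>carrier := kernel (C n) (C (Suc n)) (\<delta> n)\<rparr>"

definition coboundaries :: "(nat \<Rightarrow> 'x monoid) \<Rightarrow> (nat \<Rightarrow> 'x \<Rightarrow> 'x) \<Rightarrow> nat \<Rightarrow> 'x set" where
  "coboundaries C \<delta> n = (case n of 0 \<Rightarrow> {\<one>\<^bsub>C 0\<^esub>} | Suc m \<Rightarrow> \<delta> m ` carrier (C m))"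

definition cohomology_group ::
  "(nat \<Rightarrow> 'x monoid) \<Rightarrow> (nat \<Rightarrow> 'x \<Rightarrow> 'x) \<Rightarrow> nat \<Rightarrow> 'x set monoid" where
  "cohomology_group C \<delta> n = cocycle_group C \<delta> n Mod coboundaries C \<delta> n"

text \<open>
  The induced map sends the class \<open>X\<close> of a cocycle \<open>x\<close> to the class of \<open>\<phi> n x\<close>, which is the
  same coset for all \<open>x \<in> X\<close> when \<open>\<phi>\<close> is a cochain map into \<open>(D, \<epsilon>)\<close>.
\<close>

definition cohomology_map ::
  "(nat \<Rightarrow> 'y monoid) \<Rightarrow> (nat \<Rightarrow> 'y \<Rightarrow> 'y) \<Rightarrow> (nat \<Rightarrow> 'x \<Rightarrow> 'y) \<Rightarrow> nat \<Rightarrow> 'x set \<Rightarrow> 'y set" where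
  "cohomology_map D \<epsilon> \<phi> n X = (\<Union>x\<in>X. coboundaries D \<epsilon> n #>\<^bsub>cocycle_group D \<epsilon> n\<^esub> \<phi> n x)"

definition chain_complex :: "(nat \<Rightarrow> 'x monoid) \<Rightarrow> (nat \<Rightarrow> 'x \<Rightarrow> 'x) \<Rightarrow> bool" where
  "chain_complex C bd \<longleftrightarrow> (\<forall>n. comm_group (C n) \<and> bd (Suc n) \<in> hom (C (Suc n)) (C n) \<and>
     (\<forall>x\<in>carrier (C (Suc (Suc n))). bd (Suc n) (bd (Suc (Suc n)) x) = \<one>\<^bsub>C n\<^esub>))"

definition chain_map ::
  "(nat \<Rightarrow> 'x monoid) \<Rightarrow> (nat \<Rightarrow> 'x \<Rightarrow> 'x) \<Rightarrow> (nat \<Rightarrow> 'y monoid) \<Rightarrow> (nat \<Rightarrow> 'y \<Rightarrow> 'y) \<Rightarrow>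
   (nat \<Rightarrow> 'x \<Rightarrow> 'y) \<Rightarrow> bool" where
  "chain_map C bd D bd' \<phi> \<longleftrightarrow> chain_complex C bd \<and> chain_complex D bd' \<and>
     (\<forall>n. \<phi> n \<in> hom (C n) (D n) \<and>
        (\<forall>x\<in>carrier (C (Suc n)). \<phi> n (bd (Suc n) x) = bd' (Suc n) (\<phi> (Suc n) x)))"

definition chain_homotopic ::
  "(nat \<Rightarrow> 'x monoid) \<Rightarrow> (nat \<Rightarrow> 'x \<Rightarrow> 'x) \<Rightarrow> (nat \<Rightarrow> 'y monoid) \<Rightarrow> (nat \<Rightarrow> 'y \<Rightarrow> 'y) \<Rightarrow>
   (nat \<Rightarrow> 'x \<Rightarrow> 'y) \<Rightarrow> (nat \<Rightarrow> 'x \<Rightarrow> 'y) \<Rightarrow> bool" where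
  "chain_homotopic C bd D bd' \<phi> \<psi> \<longleftrightarrow> (\<exists>h. (\<forall>n. h n \<in> hom (C n) (D (Suc n))) \<and>
     (\<forall>x\<in>carrier (C 0). \<phi> 0 x = \<psi> 0 x \<otimes>\<^bsub>D 0\<^esub> bd' 1 (h 0 x)) \<and>
     (\<forall>n. \<forall>x\<in>carrier (C (Suc n)). \<phi> (Suc n) x =
        \<psi> (Suc n) x \<otimes>\<^bsub>D (Suc n)\<^esub> bd' (Suc (Suc n)) (h (Suc n) x)
          \<otimes>\<^bsub>D (Suc n)\<^esub> h n (bd (Suc n) x)))"

definition chain_homotopy_equivalence ::
  "(nat \<Rightarrow> 'x monoid) \<Rightarrow> (nat \<Rightarrow> 'x \<Rightarrow> 'x) \<Rightarrow> (nat \<Rightarrow> 'y monoid) \<Rightarrow> (nat \<Rightarrow> 'y \<Rightarrow> 'y) \<Rightarrow>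
   (nat \<Rightarrow> 'x \<Rightarrow> 'y) \<Rightarrow> (nat \<Rightarrow> 'y \<Rightarrow> 'x) \<Rightarrow> bool" where
  "chain_homotopy_equivalence C bd D bd' \<phi> \<psi> \<longleftrightarrow>
     chain_map C bd D bd' \<phi> \<and> chain_map D bd' C bd \<psi> \<and>
     chain_homotopic C bd C bd (\<lambda>n. \<psi> n \<circ> \<phi> n) (\<lambda>n. id) \<and>
     chain_homotopic D bd' D bd' (\<lambda>n. \<phi> n \<circ> \<psi> n) (\<lambda>n. id)"

definition cycle_group :: "(nat \<Rightarrow> 'x monoid) \<Rightarrow> (nat \<Rightarrow> 'x \<Rightarrow> 'x) \<Rightarrow> nat \<Rightarrow> 'x monoid" where
  "cycle_group C bd n =
     (case n of 0 \<Rightarrow> C 0 | Suc m \<Rightarrow> (C n)\<lparr>carrier := kernel (C n) (C m) (bd n)\<rparr>)"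

definition boundaries :: "(nat \<Rightarrow> 'x monoid) \<Rightarrow> (nat \<Rightarrow> 'x \<Rightarrow> 'x) \<Rightarrow> nat \<Rightarrow> 'x set" where
  "boundaries C bd n = bd (Suc n) ` carrier (C (Suc n))"

definition homology_group ::
  "(nat \<Rightarrow> 'x monoid) \<Rightarrow> (nat \<Rightarrow> 'x \<Rightarrow> 'x) \<Rightarrow> nat \<Rightarrow> 'x set monoid" where
  "homology_group C bd n = cycle_group C bd n Mod boundaries C bd n"

definition homology_map ::
  "(nat \<Rightarrow> 'y monoid) \<Rightarrow> (nat \<Rightarrow> 'y \<Rightarrow> 'y) \<Rightarrow> (nat \<Rightarrow> 'x \<Rightarrow> 'y) \<Rightarrow> nat \<Rightarrow> 'x set \<Rightarrow> 'y set" where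
  "homology_map D bd' \<phi> n X = (\<Union>x\<in>X. boundaries D bd' n #>\<^bsub>cycle_group D bd' n\<^esub> \<phi> n x)"


section \<open>Maps out of direct sums\<close>

text \<open>\<open>gen I G i a\<close> is the generator \<open>(i, a)\<close> of \<open>sum_group I G\<close>.\<close>

definition gen :: "'i set \<Rightarrow> ('i \<Rightarrow> 'b monoid) \<Rightarrow> 'i \<Rightarrow> 'b \<Rightarrow> 'i \<Rightarrow> 'b" where
  "gen I G i a = (\<lambda>j\<in>I. if j = i then a else \<one>\<^bsub>G j\<^esub>)"

text \<open>
  \<open>lin_ext I G H \<phi>\<close> extends additively to \<open>sum_group I G\<close> the assignment
  \<open>(i, a) \<mapsto> \<phi> i a \<in> H\<close>, which has to be a homomorphism in \<open>a\<close>.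
\<close>

definition lin_ext ::
  "'i set \<Rightarrow> ('i \<Rightarrow> 'b monoid) \<Rightarrow> 'h monoid \<Rightarrow> ('i \<Rightarrow> 'b \<Rightarrow> 'h) \<Rightarrow> ('i \<Rightarrow> 'b) \<Rightarrow> 'h" where
  "lin_ext I G H \<phi> x = (\<Otimes>\<^bsub>H\<^esub>i\<in>{i \<in> I. x i \<noteq> \<one>\<^bsub>G i\<^esub>}. \<phi> i (x i))"

lemma lin_ext_gen:
  assumes "comm_group (G i)" "comm_group H" "i \<in> I" "\<phi> i \<in> hom (G i) H" "a \<in> carrier (G i)"
  shows "lin_ext I G H \<phi> (gen I G i a) = \<phi> i a"
proof -
  interpret G: comm_group "G i" by fact
  interpret H: comm_group H by fact
  have one: "\<phi> i \<one>\<^bsub>G i\<^esub> = \<one>\<^bsub>H\<^esub>"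
    using hom_one[OF assms(4)] G.is_group H.is_group by blast
  have mem: "\<phi> i a \<in> carrier H"
    using assms(4,5) by (auto simp: hom_def)
  show ?thesis
  proof (cases "a = \<one>\<^bsub>G i\<^esub>")
    case True
    then have "{j \<in> I. gen I G i a j \<noteq> \<one>\<^bsub>G j\<^esub>} = {}"
      by (auto simp: gen_def)
    then show ?thesis using True one unfolding lin_ext_def by (simp only: H.finprod_empty)
  next
    case False
    then have "{j \<in> I. gen I G i a j \<noteq> \<one>\<^bsub>G j\<^esub>} = {i}"
      using assms(3) by (auto simp: gen_def)
    then have "lin_ext I G H \<phi> (gen I G i a) = (\<Otimes>\<^bsub>H\<^esub>j\<in>{i}. \<phi> j (gen I G i a j))"
      unfolding lin_ext_def by (simp only:)
    then show ?thesis using mem assms(3) by (simp add: gen_def)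
  qed
qed


section \<open>The categorical complexes\<close>

definition cat_cochains ::
  "'a kgraph \<Rightarrow> ('a \<Rightarrow> 'b monoid) \<Rightarrow> nat \<Rightarrow> ('a tup \<Rightarrow> 'b) monoid" where
  "cat_cochains \<Lambda> M n = product_group (tuples \<Lambda> n) (\<lambda>t. M (tup_src \<Lambda> t))"

definition cat_coboundary ::
  "'a kgraph \<Rightarrow> ('a \<Rightarrow> 'b monoid) \<Rightarrow> ('a \<Rightarrow> 'b \<Rightarrow> 'b) \<Rightarrow> nat \<Rightarrow> ('a tup \<Rightarrow> 'b) \<Rightarrow> ('a tup \<Rightarrow> 'b)" where
  "cat_coboundary \<Lambda> M act n f = (\<lambda>t\<in>tuples \<Lambda> (Suc n). let G = M (tup_src \<Lambda> t) in
     f (face_first \<Lambda> t)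
     \<otimes>\<^bsub>G\<^esub> (\<Otimes>\<^bsub>G\<^esub>i\<in>{1..n}. f (face_mid \<Lambda> i t) [^]\<^bsub>G\<^esub> ((- 1) ^ i :: int))
     \<otimes>\<^bsub>G\<^esub> act (last_entry t) (f (face_last t)) [^]\<^bsub>G\<^esub> ((- 1) ^ (n + 1) :: int))"

definition cat_chains ::
  "'a kgraph \<Rightarrow> ('a \<Rightarrow> 'b monoid) \<Rightarrow> nat \<Rightarrow> ('a tup \<Rightarrow> 'b) monoid" where
  "cat_chains \<Lambda> N n = sum_group (tuples \<Lambda> n) (\<lambda>t. N (tup_src \<Lambda> t))"

abbreviation cat_gen ::
  "'a kgraph \<Rightarrow> ('a \<Rightarrow> 'b monoid) \<Rightarrow> nat \<Rightarrow> 'a tup \<Rightarrow> 'b \<Rightarrow> 'a tup \<Rightarrow> 'b" where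
  "cat_gen \<Lambda> N n t a \<equiv> gen (tuples \<Lambda> n) (\<lambda>t. N (tup_src \<Lambda> t)) t a"

definition cat_boundary ::
  "'a kgraph \<Rightarrow> ('a \<Rightarrow> 'b monoid) \<Rightarrow> ('a \<Rightarrow> 'b \<Rightarrow> 'b) \<Rightarrow> nat \<Rightarrow> ('a tup \<Rightarrow> 'b) \<Rightarrow> ('a tup \<Rightarrow> 'b)" where
  "cat_boundary \<Lambda> N act n = (let C = cat_chains \<Lambda> N (n - 1); g = cat_gen \<Lambda> N (n - 1) in
     lin_ext (tuples \<Lambda> n) (\<lambda>t. N (tup_src \<Lambda> t)) C (\<lambda>t a.
       g (face_first \<Lambda> t) a
       \<otimes>\<^bsub>C\<^esub> (\<Otimes>\<^bsub>C\<^esub>i\<in>{1..n - 1}. g (face_mid \<Lambda> i t) a [^]\<^bsub>C\<^esub> ((- 1) ^ i :: int))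
       \<otimes>\<^bsub>C\<^esub> g (face_last t) (act (last_entry t) a) [^]\<^bsub>C\<^esub> ((- 1) ^ n :: int)))"


section \<open>The cubical complexes\<close>

definition cubes :: "nat \<Rightarrow> 'a kgraph \<Rightarrow> nat \<Rightarrow> 'a set" where
  "cubes k \<Lambda> n = {\<eta> \<in> Mor \<Lambda>. (\<Sum>i=1..k. deg \<Lambda> \<eta> i) = n \<and> (\<forall>i\<in>{1..k}. deg \<Lambda> \<eta> i \<in> {0, 1})}"

text \<open>\<open>cube_dir \<Lambda> \<eta> j\<close> is \<open>c\<^sub>j\<close>, where \<open>d(\<eta>) = e\<^bsub>c\<^sub>1\<^esub> + \<dots> + e\<^bsub>c\<^sub>n\<^esub>\<close> and \<open>c\<^sub>1 < \<dots> < c\<^sub>n\<close>.\<close>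

definition cube_dir :: "'a kgraph \<Rightarrow> 'a \<Rightarrow> nat \<Rightarrow> nat" where
  "cube_dir \<Lambda> \<eta> j = nth_smallest {i. deg \<Lambda> \<eta> i \<noteq> 0} j"

definition face0 :: "'a kgraph \<Rightarrow> nat \<Rightarrow> 'a \<Rightarrow> 'a" where
  "face0 \<Lambda> j \<eta> = seg \<Lambda> \<eta> 0 (deg \<Lambda> \<eta> - unit_vec (cube_dir \<Lambda> \<eta> j))"

definition face1 :: "'a kgraph \<Rightarrow> nat \<Rightarrow> 'a \<Rightarrow> 'a" where
  "face1 \<Lambda> j \<eta> = seg \<Lambda> \<eta> (unit_vec (cube_dir \<Lambda> \<eta> j)) (deg \<Lambda> \<eta>)"

definition last_edge :: "'a kgraph \<Rightarrow> nat \<Rightarrow> 'a \<Rightarrow> 'a" where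
  "last_edge \<Lambda> j \<eta> = seg \<Lambda> \<eta> (deg \<Lambda> \<eta> - unit_vec (cube_dir \<Lambda> \<eta> j)) (deg \<Lambda> \<eta>)"

definition cub_cochains ::
  "nat \<Rightarrow> 'a kgraph \<Rightarrow> ('a \<Rightarrow> 'b monoid) \<Rightarrow> nat \<Rightarrow> ('a \<Rightarrow> 'b) monoid" where
  "cub_cochains k \<Lambda> M n = product_group (cubes k \<Lambda> n) (\<lambda>\<eta>. M (src \<Lambda> \<eta>))"

definition cub_coboundary ::
  "nat \<Rightarrow> 'a kgraph \<Rightarrow> ('a \<Rightarrow> 'b monoid) \<Rightarrow> ('a \<Rightarrow> 'b \<Rightarrow> 'b) \<Rightarrow> nat \<Rightarrow> ('a \<Rightarrow> 'b) \<Rightarrow> ('a \<Rightarrow> 'b)" where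
  "cub_coboundary k \<Lambda> M act n f = (\<lambda>\<eta>\<in>cubes k \<Lambda> (Suc n). let G = M (src \<Lambda> \<eta>) in
     \<Otimes>\<^bsub>G\<^esub>i\<in>{1..Suc n}.
       (act (last_edge \<Lambda> i \<eta>) (f (face0 \<Lambda> i \<eta>)) \<otimes>\<^bsub>G\<^esub> inv\<^bsub>G\<^esub> (f (face1 \<Lambda> i \<eta>)))
         [^]\<^bsub>G\<^esub> ((- 1) ^ i :: int))"

definition cub_chains ::
  "nat \<Rightarrow> 'a kgraph \<Rightarrow> ('a \<Rightarrow> 'b monoid) \<Rightarrow> nat \<Rightarrow> ('a \<Rightarrow> 'b) monoid" where
  "cub_chains k \<Lambda> N n = sum_group (cubes k \<Lambda> n) (\<lambda>\<eta>. N (src \<Lambda> \<eta>))"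

abbreviation cub_gen ::
  "nat \<Rightarrow> 'a kgraph \<Rightarrow> ('a \<Rightarrow> 'b monoid) \<Rightarrow> nat \<Rightarrow> 'a \<Rightarrow> 'b \<Rightarrow> 'a \<Rightarrow> 'b" where
  "cub_gen k \<Lambda> N n \<eta> a \<equiv> gen (cubes k \<Lambda> n) (\<lambda>\<eta>. N (src \<Lambda> \<eta>)) \<eta> a"

definition cub_boundary ::
  "nat \<Rightarrow> 'a kgraph \<Rightarrow> ('a \<Rightarrow> 'b monoid) \<Rightarrow> ('a \<Rightarrow> 'b \<Rightarrow> 'b) \<Rightarrow> nat \<Rightarrow> ('a \<Rightarrow> 'b) \<Rightarrow> ('a \<Rightarrow> 'b)" where
  "cub_boundary k \<Lambda> N act n = (let C = cub_chains k \<Lambda> N (n - 1); g = cub_gen k \<Lambda> N (n - 1) in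
     lin_ext (cubes k \<Lambda> n) (\<lambda>\<eta>. N (src \<Lambda> \<eta>)) C (\<lambda>\<eta> a.
       \<Otimes>\<^bsub>C\<^esub>i\<in>{1..n}.
         (g (face0 \<Lambda> i \<eta>) (act (last_edge \<Lambda> i \<eta>) a) \<otimes>\<^bsub>C\<^esub> inv\<^bsub>C\<^esub> (g (face1 \<Lambda> i \<eta>) a))
           [^]\<^bsub>C\<^esub> ((- 1) ^ i :: int)))"


section \<open>The comparison maps\<close>

text \<open>
  \<open>sigma_tup \<Lambda> n \<eta> \<sigma>\<close> is the factorization \<open>(\<eta>\<^sub>1\<^sup>\<sigma>, \<dots>, \<eta>\<^sub>n\<^sup>\<sigma>)\<close> of an \<open>n\<close>-cube \<open>\<eta>\<close>, encoded as
  an element of \<open>tuples \<Lambda> n\<close>.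
\<close>

definition sigma_tup :: "'a kgraph \<Rightarrow> nat \<Rightarrow> 'a \<Rightarrow> (nat \<Rightarrow> nat) \<Rightarrow> 'a tup" where
  "sigma_tup \<Lambda> n \<eta> \<sigma> = (THE t. t \<in> tuples \<Lambda> n \<and> tup_prod \<Lambda> t = \<eta> \<and>
     (\<forall>i\<in>{1..n}. deg \<Lambda> (snd t ! (i - 1)) = unit_vec (cube_dir \<Lambda> \<eta> (\<sigma> i))))"

definition lower_corner :: "nat \<Rightarrow> 'a kgraph \<Rightarrow> nat \<Rightarrow> nat set \<Rightarrow> 'a tup \<Rightarrow> vec" where
  "lower_corner k \<Lambda> n K t =
     (\<Sum>i\<in>{1..n}. \<Sum>j\<in>{nth_smallest K i + 1..k}. scaled_unit (deg \<Lambda> (snd t ! (i - 1)) j) j)"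

definition upper_corner :: "nat \<Rightarrow> 'a kgraph \<Rightarrow> nat \<Rightarrow> nat set \<Rightarrow> 'a tup \<Rightarrow> vec" where
  "upper_corner k \<Lambda> n K t =
     (\<Sum>i\<in>{1..n}. \<Sum>j\<in>{nth_smallest K i..k}. scaled_unit (deg \<Lambda> (snd t ! (i - 1)) j) j)"

text \<open>The set \<open>[b + e\<^sub>K, c] \<inter> \<nat>\<^sup>k\<close>.\<close>

definition box_points :: "nat \<Rightarrow> 'a kgraph \<Rightarrow> nat \<Rightarrow> nat set \<Rightarrow> 'a tup \<Rightarrow> vec set" where
  "box_points k \<Lambda> n K t =
     {m \<in> Nvec k. lower_corner k \<Lambda> n K t + set_vec K \<le> m \<and> m \<le> upper_corner k \<Lambda> n K t}"

definition n_subsets :: "nat \<Rightarrow> nat \<Rightarrow> nat set set" where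
  "n_subsets k n = {K. K \<subseteq> {1..k} \<and> card K = n}"

definition nabla_cochain ::
  "nat \<Rightarrow> 'a kgraph \<Rightarrow> ('a \<Rightarrow> 'b monoid) \<Rightarrow> nat \<Rightarrow> ('a tup \<Rightarrow> 'b) \<Rightarrow> ('a \<Rightarrow> 'b)" where
  "nabla_cochain k \<Lambda> M n f = (\<lambda>\<eta>\<in>cubes k \<Lambda> n. let G = M (src \<Lambda> \<eta>) in
     \<Otimes>\<^bsub>G\<^esub>\<sigma>\<in>{\<sigma>. \<sigma> permutes {1..n}}. f (sigma_tup \<Lambda> n \<eta> \<sigma>) [^]\<^bsub>G\<^esub> sign \<sigma>)"

definition box_cochain ::
  "nat \<Rightarrow> 'a kgraph \<Rightarrow> ('a \<Rightarrow> 'b monoid) \<Rightarrow> ('a \<Rightarrow> 'b \<Rightarrow> 'b) \<Rightarrow> nat \<Rightarrow> ('a \<Rightarrow> 'b) \<Rightarrow> ('a tup \<Rightarrow> 'b)" where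
  "box_cochain k \<Lambda> M act n g = (\<lambda>t\<in>tuples \<Lambda> n.
     let G = M (tup_src \<Lambda> t); \<xi> = tup_prod \<Lambda> t in
     \<Otimes>\<^bsub>G\<^esub>K\<in>n_subsets k n. \<Otimes>\<^bsub>G\<^esub>m\<in>box_points k \<Lambda> n K t.
       act (seg \<Lambda> \<xi> m (deg \<Lambda> \<xi>)) (g (seg \<Lambda> \<xi> (m - set_vec K) m)))"

definition nabla_chain ::
  "nat \<Rightarrow> 'a kgraph \<Rightarrow> ('a \<Rightarrow> 'b monoid) \<Rightarrow> nat \<Rightarrow> ('a \<Rightarrow> 'b) \<Rightarrow> ('a tup \<Rightarrow> 'b)" where
  "nabla_chain k \<Lambda> N n = (let C = cat_chains \<Lambda> N n in
     lin_ext (cubes k \<Lambda> n) (\<lambda>\<eta>. N (src \<Lambda> \<eta>)) C (\<lambda>\<eta> a.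
       \<Otimes>\<^bsub>C\<^esub>\<sigma>\<in>{\<sigma>. \<sigma> permutes {1..n}}.
         cat_gen \<Lambda> N n (sigma_tup \<Lambda> n \<eta> \<sigma>) a [^]\<^bsub>C\<^esub> sign \<sigma>))"

definition box_chain ::
  "nat \<Rightarrow> 'a kgraph \<Rightarrow> ('a \<Rightarrow> 'b monoid) \<Rightarrow> ('a \<Rightarrow> 'b \<Rightarrow> 'b) \<Rightarrow> nat \<Rightarrow> ('a tup \<Rightarrow> 'b) \<Rightarrow> ('a \<Rightarrow> 'b)" where
  "box_chain k \<Lambda> N act n = (let C = cub_chains k \<Lambda> N n in
     lin_ext (tuples \<Lambda> n) (\<lambda>t. N (tup_src \<Lambda> t)) C (\<lambda>t a.
       let \<xi> = tup_prod \<Lambda> t in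
       \<Otimes>\<^bsub>C\<^esub>K\<in>n_subsets k n. \<Otimes>\<^bsub>C\<^esub>m\<in>box_points k \<Lambda> n K t.
         cub_gen k \<Lambda> N n (seg \<Lambda> \<xi> (m - set_vec K) m) (act (seg \<Lambda> \<xi> m (deg \<Lambda> \<xi>)) a)))"

end

theory Submission
  imports Defs "HOL-Library.Poly_Mapping"
begin

text \<open>
  All maps in the statement are natural in the module, so they come from maps of free right
  modules: an operator assigns to each basis element, a composable tuple or a cube, a formal
  integer combination of pairs \<open>(j, \<rho>)\<close>, the basis element \<open>j\<close> translated by a morphism \<open>\<rho>\<close>.
  Evaluating such combinations in a right module gives maps of cochains (\<open>pull\<close>, contravariant in
  the operator), and in a left module maps of chains (\<open>push\<close>, covariant).  Both constructions
  respect composition and sums, so the two halves of the theorem are two images of the same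
  identities between four operators \<open>bar_bd\<close>, \<open>cub_bd\<close>, \<open>nabla\<close> and \<open>box\<close>: the last two commute
  with the boundaries (\<open>bar_bd_nabla\<close>, \<open>cub_bd_box\<close>), \<open>box \<circ> nabla\<close> is the identity (\<open>box_nabla\<close>),
  and \<open>nabla \<circ> box\<close> is homotopic to the identity (\<open>homotopy\<close>).

  By unique factorization, a composable tuple followed by a morphism is the same as a morphism \<open>\<xi>\<close>
  together with a chain of lattice points in the box \<open>[0, d(\<xi>)]\<close> that starts at \<open>0\<close>.  Likewise a
  cube inside \<open>\<xi>\<close> is a set \<open>K\<close> of directions and a lower corner \<open>a\<close>.  The four operators only see
  this picture: they are realizations in \<open>\<xi>\<close> of the operators \<open>simp_bd\<close>, \<open>cube_bd\<close>, \<open>nabla_sum\<close>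
  and \<open>box_sum\<close> on chains of points and on cubes of \<open>\<nat>\<^sup>k\<close>, which commute with translations.

  The operator \<open>nabla_sum\<close> triangulates a cube by the signed sum over all orders of traversing its
  directions.  In its boundary the inner faces cancel in pairs, because skipping a vertex forgets
  the order of the two steps that meet there, while the first and the last faces are triangulated
  faces of the cube (\<open>nabla_sum_chain_map\<close>).

  The operator \<open>box_sum\<close> is the Alexander-Whitney map on the product of \<open>k\<close> lines, followed by the
  subdivision of intervals into unit intervals.  Its coefficients are products of one condition
  for each coordinate, and it commutes with the boundaries because of a telescoping sum over the
  coordinates (\<open>box_sum_chain_map\<close>).  Applied to a triangulated cube, it only sees the path that
  traverses the directions in increasing order, and that path gives back the cube
  (\<open>box_sum_nabla_sum\<close>).

  The simplicial complex of all chains of points in \<open>[0, d(\<xi>)]\<close> is contracted by appending the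
  last point \<open>d(\<xi>)\<close>, which for tuples means making the trailing morphism into a last entry
  (\<open>cone\<close>).  The method of acyclic models then yields the homotopy from \<open>nabla \<circ> box\<close> to the
  identity by recursion on the degree, starting from their equality in degree \<open>0\<close>.
\<close>

section \<open>Evaluating formal sums in abelian groups\<close>

abbreviation "keys \<equiv> Poly_Mapping.keys"
abbreviation "lookup \<equiv> Poly_Mapping.lookup"

definition frag_eval :: "('g, 'm) monoid_scheme \<Rightarrow> ('z \<Rightarrow> 'g) \<Rightarrow> ('z \<Rightarrow>\<^sub>0 int) \<Rightarrow> 'g" where
  "frag_eval G \<phi> c = (\<Otimes>\<^bsub>G\<^esub>z\<in>keys c. \<phi> z [^]\<^bsub>G\<^esub> lookup c z)"

context comm_group
begin

lemma frag_eval_superset: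
  assumes "finite S" "keys c \<subseteq> S" "\<phi> \<in> S \<rightarrow> carrier G"
  shows "frag_eval G \<phi> c = (\<Otimes>z\<in>S. \<phi> z [^] lookup c z)"
  unfolding frag_eval_def
  by (rule finprod_mono_neutral_cong_left) (use assms in \<open>auto simp: in_keys_iff\<close>)

lemma frag_eval_closed [simp, intro]:
  assumes "\<phi> \<in> keys c \<rightarrow> carrier G"
  shows "frag_eval G \<phi> c \<in> carrier G"
  unfolding frag_eval_def by (rule finprod_closed) (use assms in auto)

lemma frag_eval_zero [simp]: "frag_eval G \<phi> 0 = \<one>"
  by (simp add: frag_eval_def)

lemma frag_eval_of [simp]: "\<phi> z \<in> carrier G \<Longrightarrow> frag_eval G \<phi> (frag_of z) = \<phi> z"
  by (simp add: frag_eval_def)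

lemma frag_eval_add:
  assumes "\<phi> \<in> keys a \<union> keys b \<rightarrow> carrier G"
  shows "frag_eval G \<phi> (a + b) = frag_eval G \<phi> a \<otimes> frag_eval G \<phi> b"
proof -
  let ?S = "keys a \<union> keys b"
  have "frag_eval G \<phi> (a + b) = (\<Otimes>z\<in>?S. \<phi> z [^] (lookup (a + b) z))"
    by (rule frag_eval_superset) (use assms Poly_Mapping.keys_add[of a b] in auto)
  also have "\<dots> = (\<Otimes>z\<in>?S. \<phi> z [^] (lookup a z) \<otimes> \<phi> z [^] (lookup b z))"
    by (rule finprod_cong') (use assms in \<open>auto simp: lookup_add int_pow_mult Pi_def\<close>)
  also have "\<dots> = (\<Otimes>z\<in>?S. \<phi> z [^] (lookup a z)) \<otimes> (\<Otimes>z\<in>?S. \<phi> z [^] (lookup b z))"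
    by (rule finprod_multf) (use assms in auto)
  also have "\<dots> = frag_eval G \<phi> a \<otimes> frag_eval G \<phi> b"
    by (subst (1 2) frag_eval_superset[of ?S]) (use assms in auto)
  finally show ?thesis .
qed

lemma frag_eval_cmul:
  assumes "\<phi> \<in> keys a \<rightarrow> carrier G"
  shows "frag_eval G \<phi> (frag_cmul n a) = frag_eval G \<phi> a [^] n"
proof -
  have fin: "finite A \<Longrightarrow> f \<in> A \<rightarrow> carrier G \<Longrightarrow> (\<Otimes>z\<in>A. f z [^] n) = finprod G f A [^] n"
    for f :: "'c \<Rightarrow> 'a" and A
  proof (induction A rule: finite_induct)
    case (insert x A)
    then have "f x \<in> carrier G" "f \<in> A \<rightarrow> carrier G" by auto
    with insert show ?case by (simp add: int_pow_distrib Pi_def)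
  qed auto
  have "frag_eval G \<phi> (frag_cmul n a) = (\<Otimes>z\<in>keys a. \<phi> z [^] (n * lookup a z))"
    by (subst frag_eval_superset[of "keys a"]) (use assms keys_cmul[of n a] in auto)
  also have "\<dots> = (\<Otimes>z\<in>keys a. (\<phi> z [^] lookup a z) [^] n)"
    by (rule finprod_cong') (use assms in \<open>auto simp: int_pow_pow mult.commute Pi_def\<close>)
  also have "\<dots> = frag_eval G \<phi> a [^] n"
    unfolding frag_eval_def by (rule fin) (use assms in auto)
  finally show ?thesis .
qed

lemma frag_eval_diff:
  assumes "\<phi> \<in> keys a \<union> keys b \<rightarrow> carrier G"
  shows "frag_eval G \<phi> (a - b) = frag_eval G \<phi> a \<otimes> inv (frag_eval G \<phi> b)"
proof -
  have "frag_eval G \<phi> (a - b) = frag_eval G \<phi> (a + frag_cmul (-1) b)" by simp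
  also have "\<dots> = frag_eval G \<phi> a \<otimes> frag_eval G \<phi> b [^] (-1::int)"
    by (subst frag_eval_add) (use assms in \<open>auto simp: frag_eval_cmul simp del: frag_cmul_minus_one\<close>)
  finally show ?thesis
    using assms by (simp add: int_pow_neg_int frag_eval_closed int_pow_neg)
qed

lemma frag_eval_sum:
  assumes "finite I" "\<And>i. i \<in> I \<Longrightarrow> \<phi> \<in> keys (c i) \<rightarrow> carrier G"
  shows "frag_eval G \<phi> (\<Sum>i\<in>I. c i) = (\<Otimes>i\<in>I. frag_eval G \<phi> (c i))"
  using assms
proof (induction I rule: finite_induct)
  case (insert i I)
  have "\<phi> \<in> keys (c i) \<union> keys (\<Sum>i\<in>I. c i) \<rightarrow> carrier G"
    using insert.prems Poly_Mapping.keys_sum[of c I] by (fastforce simp: Pi_def)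
  moreover have "(\<Otimes>j\<in>insert i I. frag_eval G \<phi> (c j)) = frag_eval G \<phi> (c i) \<otimes> (\<Otimes>j\<in>I. frag_eval G \<phi> (c j))"
    by (rule finprod_insert) (use insert in auto)
  ultimately show ?case using insert by (simp add: frag_eval_add)
qed simp

lemma frag_eval_cong:
  assumes "\<And>z. z \<in> keys c \<Longrightarrow> \<phi> z = \<psi> z" "\<psi> \<in> keys c \<rightarrow> carrier G"
  shows "frag_eval G \<phi> c = frag_eval G \<psi> c"
  unfolding frag_eval_def by (rule finprod_cong') (use assms in auto)

lemma frag_eval_mult:
  assumes "\<phi> \<in> keys c \<rightarrow> carrier G" "\<psi> \<in> keys c \<rightarrow> carrier G"
  shows "frag_eval G (\<lambda>z. \<phi> z \<otimes> \<psi> z) c = frag_eval G \<phi> c \<otimes> frag_eval G \<psi> c"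
proof -
  have "frag_eval G (\<lambda>z. \<phi> z \<otimes> \<psi> z) c = (\<Otimes>z\<in>keys c. \<phi> z [^] lookup c z \<otimes> \<psi> z [^] lookup c z)"
    unfolding frag_eval_def
    by (rule finprod_cong') (use assms in \<open>auto simp: int_pow_distrib Pi_def\<close>)
  then show ?thesis
    unfolding frag_eval_def using assms by (simp add: finprod_multf Pi_def)
qed

lemma frag_eval_hom:
  fixes \<phi> :: "'z \<Rightarrow> 'a"
  assumes H: "comm_group H" and h: "h \<in> hom G H" and \<phi>: "\<phi> \<in> keys c \<rightarrow> carrier G"
  shows "h (frag_eval G \<phi> c) = frag_eval H (\<lambda>z. h (\<phi> z)) c"
proof -
  interpret H: comm_group H by fact
  interpret group_hom G H h
    using h by (simp add: group_hom_def group_hom_axioms_def)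
  have fin: "h (finprod G f A) = (\<Otimes>\<^bsub>H\<^esub>x\<in>A. h (f x))" if "finite A" "f \<in> A \<rightarrow> carrier G" for f and A :: "'z set"
    using that
  proof (induction A rule: finite_induct)
    case (insert x A)
    then have "f x \<in> carrier G" "f \<in> A \<rightarrow> carrier G" by auto
    with insert show ?case by (simp add: Pi_def)
  qed auto
  have "h (frag_eval G \<phi> c) = (\<Otimes>\<^bsub>H\<^esub>z\<in>keys c. h (\<phi> z [^] lookup c z))"
    unfolding frag_eval_def by (rule fin) (use \<phi> in auto)
  also have "\<dots> = frag_eval H (\<lambda>z. h (\<phi> z)) c"
    unfolding frag_eval_def
    by (rule H.finprod_cong') (use \<phi> in \<open>auto simp: Pi_def hom_int_pow\<close>)
  finally show ?thesis .
qed

lemma frag_eval_extend: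
  assumes "\<And>y. y \<in> keys c \<Longrightarrow> \<phi> \<in> keys (b y) \<rightarrow> carrier G"
  shows "frag_eval G \<phi> (frag_extend b c) = frag_eval G (\<lambda>y. frag_eval G \<phi> (b y)) c"
proof -
  have "frag_eval G \<phi> (frag_extend b c) =
      (\<Otimes>y\<in>keys c. frag_eval G \<phi> (frag_cmul (lookup c y) (b y)))"
    unfolding frag_extend_def
    by (rule frag_eval_sum) (use assms keys_cmul in fastforce)+
  also have "\<dots> = (\<Otimes>y\<in>keys c. frag_eval G \<phi> (b y) [^] lookup c y)"
    by (rule finprod_cong') (use assms in \<open>auto simp: frag_eval_cmul frag_eval_closed\<close>)
  finally show ?thesis by (simp add: frag_eval_def)
qed

end

section \<open>Formal operators between free modules\<close>

text \<open>
  The free right module with one generator over the vertex \<open>s j\<close> for each \<open>j \<in> J\<close> has, at the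
  vertex \<open>w\<close>, the free abelian group on \<open>cells \<Lambda> J s w\<close>; the pair \<open>(j, \<rho>)\<close> is the generator \<open>j\<close>
  translated by \<open>\<rho>\<close>.  The action of \<open>\<Lambda>\<close> on it is \<open>rtrans\<close>, and a homomorphism between two such
  modules is the extension \<open>lin \<Lambda> A\<close> of its values \<open>A i\<close> on the generators.
\<close>

definition cells :: "'a kgraph \<Rightarrow> 'j set \<Rightarrow> ('j \<Rightarrow> 'a) \<Rightarrow> 'a \<Rightarrow> ('j \<times> 'a) set" where
  "cells \<Lambda> J s w = {(j, \<rho>). j \<in> J \<and> \<rho> \<in> Mor \<Lambda> \<and> rng \<Lambda> \<rho> = s j \<and> src \<Lambda> \<rho> = w}"

definition rtrans :: "'a kgraph \<Rightarrow> 'a \<Rightarrow> ('j \<times> 'a \<Rightarrow>\<^sub>0 int) \<Rightarrow> ('j \<times> 'a \<Rightarrow>\<^sub>0 int)" where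
  "rtrans \<Lambda> \<rho> c = frag_extend (\<lambda>(j, \<tau>). frag_of (j, \<tau> \<cdot>\<^bsub>\<Lambda>\<^esub> \<rho>)) c"

definition lin :: "'a kgraph \<Rightarrow> ('i \<Rightarrow> 'j \<times> 'a \<Rightarrow>\<^sub>0 int) \<Rightarrow> ('i \<times> 'a \<Rightarrow>\<^sub>0 int) \<Rightarrow> ('j \<times> 'a \<Rightarrow>\<^sub>0 int)" where
  "lin \<Lambda> A c = frag_extend (\<lambda>(i, \<rho>). rtrans \<Lambda> \<rho> (A i)) c"

definition operator ::
  "'a kgraph \<Rightarrow> 'i set \<Rightarrow> ('i \<Rightarrow> 'a) \<Rightarrow> 'j set \<Rightarrow> ('j \<Rightarrow> 'a) \<Rightarrow> ('i \<Rightarrow> 'j \<times> 'a \<Rightarrow>\<^sub>0 int) \<Rightarrow> bool" where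
  "operator \<Lambda> I s J s' A \<longleftrightarrow> (\<forall>i\<in>I. s i \<in> Obj \<Lambda> \<and> keys (A i) \<subseteq> cells \<Lambda> J s' (s i))"

lemma rtrans_zero [simp]: "rtrans \<Lambda> \<rho> 0 = 0"
  and rtrans_of [simp]: "rtrans \<Lambda> \<rho> (frag_of (j, \<tau>)) = frag_of (j, \<tau> \<cdot>\<^bsub>\<Lambda>\<^esub> \<rho>)"
  and rtrans_add: "rtrans \<Lambda> \<rho> (a + b) = rtrans \<Lambda> \<rho> a + rtrans \<Lambda> \<rho> b"
  and rtrans_diff: "rtrans \<Lambda> \<rho> (a - b) = rtrans \<Lambda> \<rho> a - rtrans \<Lambda> \<rho> b"
  and rtrans_cmul: "rtrans \<Lambda> \<rho> (frag_cmul n a) = frag_cmul n (rtrans \<Lambda> \<rho> a)"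
  by (simp_all add: rtrans_def frag_extend_add frag_extend_diff frag_extend_cmul)

lemma lin_zero [simp]: "lin \<Lambda> A 0 = 0"
  and lin_of [simp]: "lin \<Lambda> A (frag_of (i, \<rho>)) = rtrans \<Lambda> \<rho> (A i)"
  and lin_add: "lin \<Lambda> A (a + b) = lin \<Lambda> A a + lin \<Lambda> A b"
  and lin_diff: "lin \<Lambda> A (a - b) = lin \<Lambda> A a - lin \<Lambda> A b"
  and lin_cmul: "lin \<Lambda> A (frag_cmul n a) = frag_cmul n (lin \<Lambda> A a)"
  by (simp_all add: lin_def frag_extend_add frag_extend_diff frag_extend_cmul)

lemma operatorD:
  assumes "operator \<Lambda> I s J s' A" "i \<in> I"
  shows "s i \<in> Obj \<Lambda>" "keys (A i) \<subseteq> cells \<Lambda> J s' (s i)"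
  using assms by (auto simp: operator_def)

context k_graph
begin

lemma Obj_Mor: "v \<in> Obj \<Lambda> \<Longrightarrow> v \<in> Mor \<Lambda>"
  and rng_Obj: "v \<in> Obj \<Lambda> \<Longrightarrow> rng \<Lambda> v = v"
  and src_Obj: "v \<in> Obj \<Lambda> \<Longrightarrow> src \<Lambda> v = v"
  by (auto simp: Obj_def)

lemma rtrans_src:
  assumes "keys c \<subseteq> cells \<Lambda> J s w"
  shows "rtrans \<Lambda> w c = c"
  using assms by (induction c rule: frag_induction)
    (auto simp: rtrans_diff cells_def cmp_src_id)

lemma keys_rtrans:
  assumes "keys c \<subseteq> cells \<Lambda> J s (rng \<Lambda> \<rho>)" "\<rho> \<in> Mor \<Lambda>"
  shows "keys (rtrans \<Lambda> \<rho> c) \<subseteq> cells \<Lambda> J s (src \<Lambda> \<rho>)"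
  using assms(1) unfolding rtrans_def
  by (intro order.trans[OF keys_frag_extend])
    (use assms(2) in \<open>auto simp: cells_def cmp_closed rng_cmp src_cmp keys_frag_of\<close>)

lemma keys_lin:
  assumes "operator \<Lambda> I s J s' A" "keys c \<subseteq> cells \<Lambda> I s w"
  shows "keys (lin \<Lambda> A c) \<subseteq> cells \<Lambda> J s' w"
proof -
  have "keys (rtrans \<Lambda> \<rho> (A i)) \<subseteq> cells \<Lambda> J s' w" if "(i, \<rho>) \<in> keys c" for i \<rho>
    using keys_rtrans[of "A i" J s' \<rho>] that assms by (fastforce simp: operator_def cells_def)
  then show ?thesis
    unfolding lin_def by (intro order.trans[OF keys_frag_extend]) auto
qed

lemma rtrans_rtrans:
  assumes "keys c \<subseteq> cells \<Lambda> J s (rng \<Lambda> \<rho>)" "\<rho> \<in> Mor \<Lambda>" "\<tau> \<in> Mor \<Lambda>" "src \<Lambda> \<rho> = rng \<Lambda> \<tau>"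
  shows "rtrans \<Lambda> \<tau> (rtrans \<Lambda> \<rho> c) = rtrans \<Lambda> (\<rho> \<cdot> \<tau>) c"
  using assms(1) by (induction c rule: frag_induction)
    (use assms(2-) in \<open>auto simp: rtrans_diff cells_def cmp_assoc\<close>)

text \<open>
  Equivariance of \<open>lin \<Lambda> A\<close>; it needs the translations in \<open>c\<close> and in \<open>A\<close> to be composable, which is
  what \<open>operator\<close> records.
\<close>

lemma lin_rtrans:
  assumes "operator \<Lambda> I s J s' A" "keys c \<subseteq> cells \<Lambda> I s (rng \<Lambda> \<rho>)" "\<rho> \<in> Mor \<Lambda>"
  shows "lin \<Lambda> A (rtrans \<Lambda> \<rho> c) = rtrans \<Lambda> \<rho> (lin \<Lambda> A c)"
  using assms(2)
proof (induction c rule: frag_induction)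
  case (one x)
  obtain i \<tau> where x: "x = (i, \<tau>)" by (cases x)
  with one assms have "keys (A i) \<subseteq> cells \<Lambda> J s' (rng \<Lambda> \<tau>)"
    by (auto simp: operator_def cells_def)
  with one x assms(3) show ?case
    by (auto simp: rtrans_rtrans cells_def)
qed (auto simp: rtrans_diff lin_diff)

text \<open>
  Composites of homomorphisms of free modules are again given by their values on generators.  All
  later identities between operators are compared through this lemma.
\<close>

lemma lin_lin:
  assumes "operator \<Lambda> I s J s' A" "operator \<Lambda> J s' L s'' B" "keys c \<subseteq> cells \<Lambda> I s w"
  shows "lin \<Lambda> B (lin \<Lambda> A c) = lin \<Lambda> (\<lambda>i. lin \<Lambda> B (A i)) c"
  using assms(3)
proof (induction c rule: frag_induction)
  case (one x)
  obtain i \<rho> where x: "x = (i, \<rho>)" by (cases x)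
  with one assms(1) have "keys (A i) \<subseteq> cells \<Lambda> J s' (rng \<Lambda> \<rho>)"
    by (auto simp: operator_def cells_def)
  then have "lin \<Lambda> B (rtrans \<Lambda> \<rho> (A i)) = rtrans \<Lambda> \<rho> (lin \<Lambda> B (A i))"
    using one x by (intro lin_rtrans[OF assms(2)]) (auto simp: cells_def)
  then show ?case by (simp add: x)
qed (auto simp: lin_diff)

lemma operator_compose:
  assumes "operator \<Lambda> I s J s' A" "operator \<Lambda> J s' L s'' B"
  shows "operator \<Lambda> I s L s'' (\<lambda>i. lin \<Lambda> B (A i))"
  unfolding operator_def
  using keys_lin[OF assms(2) operatorD(2)[OF assms(1)]] operatorD(1)[OF assms(1)] by auto

lemma lin_cong:
  assumes "\<And>i. i \<in> I \<Longrightarrow> A i = B i" "keys c \<subseteq> cells \<Lambda> I s w"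
  shows "lin \<Lambda> A c = lin \<Lambda> B c"
  unfolding lin_def by (rule frag_extend_eq) (use assms in \<open>auto simp: cells_def\<close>)

lemma lin_unit:
  assumes "keys c \<subseteq> cells \<Lambda> I s w"
  shows "lin \<Lambda> (\<lambda>i. frag_of (i, s i)) c = c"
  using assms
  by (induction c rule: frag_induction) (auto simp: lin_diff cells_def dest: rng_cmp_id)

end

section \<open>The functors attached to modules\<close>

text \<open>
  A family \<open>f\<close> with \<open>f j \<in> M (s' j)\<close> is a homomorphism from the free right module on \<open>J\<close> to \<open>M\<close>, and
  \<open>pull\<close> is precomposition with the homomorphism of free modules given by \<open>A\<close>.  Dually, \<open>push\<close> is
  the tensor product over \<open>\<Lambda>\<close> of that homomorphism with a left module \<open>N\<close>.
\<close>

definition pull ::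
  "'i set \<Rightarrow> ('i \<Rightarrow> 'a) \<Rightarrow> ('a \<Rightarrow> 'b monoid) \<Rightarrow> ('a \<Rightarrow> 'b \<Rightarrow> 'b) \<Rightarrow> ('i \<Rightarrow> 'j \<times> 'a \<Rightarrow>\<^sub>0 int) \<Rightarrow> ('j \<Rightarrow> 'b) \<Rightarrow> 'i \<Rightarrow> 'b" where
  "pull I s M act A f = (\<lambda>i\<in>I. frag_eval (M (s i)) (\<lambda>(j, \<rho>). act \<rho> (f j)) (A i))"

definition push ::
  "'i set \<Rightarrow> ('i \<Rightarrow> 'a) \<Rightarrow> 'j set \<Rightarrow> ('j \<Rightarrow> 'a) \<Rightarrow> ('a \<Rightarrow> 'b monoid) \<Rightarrow> ('a \<Rightarrow> 'b \<Rightarrow> 'b) \<Rightarrow>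
    ('i \<Rightarrow> 'j \<times> 'a \<Rightarrow>\<^sub>0 int) \<Rightarrow> ('i \<Rightarrow> 'b) \<Rightarrow> 'j \<Rightarrow> 'b" where
  "push I s J s' N act A = lin_ext I (\<lambda>i. N (s i)) (sum_group J (\<lambda>j. N (s' j)))
     (\<lambda>i a. frag_eval (sum_group J (\<lambda>j. N (s' j))) (\<lambda>(j, \<rho>). gen J (\<lambda>j. N (s' j)) j (act \<rho> a)) (A i))"

lemma comm_group_product_group:
  assumes "\<And>i. i \<in> I \<Longrightarrow> comm_group (G i)"
  shows "comm_group (product_group I G)"
proof (rule group.group_comm_groupI)
  show "Group.group (product_group I G)"
    using assms by (simp add: comm_group.axioms(2))
qed (use assms in \<open>auto intro!: restrict_ext simp: PiE_iff comm_monoid.m_comm comm_group.axioms(1)\<close>)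

lemma comm_group_sum_group:
  assumes "\<And>i. i \<in> I \<Longrightarrow> comm_group (G i)"
  shows "comm_group (sum_group I G)"
proof (rule group.group_comm_groupI)
  show "Group.group (sum_group I G)"
    using assms by (simp add: comm_group.axioms(2))
next
  fix x y assume "x \<in> carrier (sum_group I G)" "y \<in> carrier (sum_group I G)"
  then show "x \<otimes>\<^bsub>sum_group I G\<^esub> y = y \<otimes>\<^bsub>sum_group I G\<^esub> x"
    using assms by (subst (asm) (1 2) carrier_sum_group)
      (auto intro!: restrict_ext simp: PiE_iff comm_monoid.m_comm comm_group.axioms)
qed

subsection \<open>Right modules\<close>

locale k_graph_right_module = k_graph k \<Lambda> + right_module \<Lambda> M act
  for k :: nat and \<Lambda> :: "'a kgraph" (structure) and M :: "'a \<Rightarrow> 'b monoid" and act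
begin

lemma act_mult:
  "\<lbrakk>\<rho> \<in> Mor \<Lambda>; x \<in> carrier (M (rng \<Lambda> \<rho>)); y \<in> carrier (M (rng \<Lambda> \<rho>))\<rbrakk>
    \<Longrightarrow> act \<rho> (x \<otimes>\<^bsub>M (rng \<Lambda> \<rho>)\<^esub> y) = act \<rho> x \<otimes>\<^bsub>M (src \<Lambda> \<rho>)\<^esub> act \<rho> y"
  and act_closed: "\<lbrakk>\<rho> \<in> Mor \<Lambda>; x \<in> carrier (M (rng \<Lambda> \<rho>))\<rbrakk> \<Longrightarrow> act \<rho> x \<in> carrier (M (src \<Lambda> \<rho>))"
  using act_hom[of \<rho>] by (auto simp: hom_def)

lemma act_cell_closed:
  assumes "f \<in> (\<Pi>\<^sub>E j\<in>J. carrier (M (s j)))" "C \<subseteq> cells \<Lambda> J s w"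
  shows "(\<lambda>(j, \<rho>). act \<rho> (f j)) \<in> C \<rightarrow> carrier (M w)"
  using assms act_closed by (fastforce simp: cells_def PiE_iff)

lemma pull_closed:
  assumes "operator \<Lambda> I s J s' A" "f \<in> (\<Pi>\<^sub>E j\<in>J. carrier (M (s' j)))"
  shows "pull I s M act A f \<in> (\<Pi>\<^sub>E i\<in>I. carrier (M (s i)))"
  unfolding pull_def
  by (auto intro!: comm_group.frag_eval_closed comm_group_M act_cell_closed[OF assms(2)] operatorD[OF assms(1)])

lemma pull_hom:
  assumes A: "operator \<Lambda> I s J s' A"
  shows "pull I s M act A \<in> hom (product_group J (\<lambda>j. M (s' j))) (product_group I (\<lambda>i. M (s i)))"
proof (rule homI)
  fix f g assume fg: "f \<in> carrier (product_group J (\<lambda>j. M (s' j)))" "g \<in> carrier (product_group J (\<lambda>j. M (s' j)))"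
  have "frag_eval (M (s i)) (\<lambda>(j, \<rho>). act \<rho> ((f \<otimes>\<^bsub>product_group J (\<lambda>j. M (s' j))\<^esub> g) j)) (A i)
      = frag_eval (M (s i)) (\<lambda>(j, \<rho>). act \<rho> (f j)) (A i) \<otimes>\<^bsub>M (s i)\<^esub> frag_eval (M (s i)) (\<lambda>(j, \<rho>). act \<rho> (g j)) (A i)"
    if "i \<in> I" for i
  proof -
    interpret G: comm_group "M (s i)" using comm_group_M operatorD[OF A that] by auto
    note cl = act_cell_closed[OF _ operatorD(2)[OF A that]]
    have f: "(\<lambda>(j, \<rho>). act \<rho> (f j)) \<in> keys (A i) \<rightarrow> carrier (M (s i))"
      and g: "(\<lambda>(j, \<rho>). act \<rho> (g j)) \<in> keys (A i) \<rightarrow> carrier (M (s i))"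
      by (rule cl, use fg in simp)+
    have "frag_eval (M (s i)) (\<lambda>(j, \<rho>). act \<rho> ((f \<otimes>\<^bsub>product_group J (\<lambda>j. M (s' j))\<^esub> g) j)) (A i)
      = frag_eval (M (s i)) (\<lambda>z. (\<lambda>(j, \<rho>). act \<rho> (f j)) z \<otimes>\<^bsub>M (s i)\<^esub> (\<lambda>(j, \<rho>). act \<rho> (g j)) z) (A i)"
    proof (rule G.frag_eval_cong)
      fix z assume "z \<in> keys (A i)"
      with operatorD(2)[OF A that] obtain j \<rho> where z: "z = (j, \<rho>)" "j \<in> J" "\<rho> \<in> Mor \<Lambda>" "rng \<Lambda> \<rho> = s' j" "src \<Lambda> \<rho> = s i"
        by (auto simp: cells_def)
      then show "(\<lambda>(j, \<rho>). act \<rho> ((f \<otimes>\<^bsub>product_group J (\<lambda>j. M (s' j))\<^esub> g) j)) z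
          = (\<lambda>(j, \<rho>). act \<rho> (f j)) z \<otimes>\<^bsub>M (s i)\<^esub> (\<lambda>(j, \<rho>). act \<rho> (g j)) z"
        using act_mult[of \<rho> "f j" "g j"] fg by (auto simp: PiE_iff)
    qed (blast intro: Pi_I G.m_closed funcset_mem[OF f] funcset_mem[OF g])
    also have "\<dots> = frag_eval (M (s i)) (\<lambda>(j, \<rho>). act \<rho> (f j)) (A i) \<otimes>\<^bsub>M (s i)\<^esub> frag_eval (M (s i)) (\<lambda>(j, \<rho>). act \<rho> (g j)) (A i)"
      by (rule G.frag_eval_mult[OF f g])
    finally show ?thesis .
  qed
  then show "pull I s M act A (f \<otimes>\<^bsub>product_group J (\<lambda>j. M (s' j))\<^esub> g)
      = pull I s M act A f \<otimes>\<^bsub>product_group I (\<lambda>i. M (s i))\<^esub> pull I s M act A g"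
    by (auto simp: pull_def intro!: restrict_ext)
qed (use pull_closed[OF A] in auto)

lemma pull_add:
  assumes "operator \<Lambda> I s J s' A" "operator \<Lambda> I s J s' B" "f \<in> (\<Pi>\<^sub>E j\<in>J. carrier (M (s' j)))"
  shows "pull I s M act (\<lambda>i. A i + B i) f =
    pull I s M act A f \<otimes>\<^bsub>product_group I (\<lambda>i. M (s i))\<^esub> pull I s M act B f"
  unfolding pull_def mult_product_group
proof (rule restrict_ext)
  fix i assume i: "i \<in> I"
  interpret G: comm_group "M (s i)" using comm_group_M operatorD[OF assms(1) i] by auto
  show "frag_eval (M (s i)) (\<lambda>(j, \<rho>). act \<rho> (f j)) (A i + B i) =
      (\<lambda>i\<in>I. frag_eval (M (s i)) (\<lambda>(j, \<rho>). act \<rho> (f j)) (A i)) i \<otimes>\<^bsub>M (s i)\<^esub>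
      (\<lambda>i\<in>I. frag_eval (M (s i)) (\<lambda>(j, \<rho>). act \<rho> (f j)) (B i)) i"
    using i by (simp add: G.frag_eval_add[OF act_cell_closed[OF assms(3)]]
        operatorD(2)[OF assms(1) i] operatorD(2)[OF assms(2) i])
qed

lemma pull_zero:
  assumes "\<And>i. i \<in> I \<Longrightarrow> s i \<in> Obj \<Lambda>"
  shows "pull I s M act (\<lambda>i. 0) f = \<one>\<^bsub>product_group I (\<lambda>i. M (s i))\<^esub>"
  using assms by (auto simp: pull_def frag_eval_def comm_group_M comm_monoid.finprod_empty comm_group.axioms(1)
      intro!: restrict_ext)

lemma pull_unit:
  assumes "\<And>i. i \<in> I \<Longrightarrow> s i \<in> Obj \<Lambda>" "f \<in> (\<Pi>\<^sub>E i\<in>I. carrier (M (s i)))"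
  shows "pull I s M act (\<lambda>i. frag_of (i, s i)) f = f"
proof
  fix i
  show "pull I s M act (\<lambda>i. frag_of (i, s i)) f i = f i"
  proof (cases "i \<in> I")
    case True
    interpret G: comm_group "M (s i)" using comm_group_M assms True by auto
    show ?thesis using True assms by (auto simp: pull_def act_id PiE_iff)
  qed (use assms in \<open>auto simp: pull_def PiE_iff extensional_def\<close>)
qed

text \<open>
  Because of this contravariant functoriality, an identity between composites of operators becomes
  an identity between composites of maps of cochains, in the opposite order.
\<close>

lemma pull_pull:
  assumes A: "operator \<Lambda> I s J s' A" and B: "operator \<Lambda> J s' L s'' B"
    and f: "f \<in> (\<Pi>\<^sub>E l\<in>L. carrier (M (s'' l)))"
  shows "pull I s M act A (pull J s' M act B f) = pull I s M act (\<lambda>i. lin \<Lambda> B (A i)) f"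
proof -
  have "frag_eval (M (s i)) (\<lambda>(j, \<rho>). act \<rho> (pull J s' M act B f j)) (A i)
      = frag_eval (M (s i)) (\<lambda>(l, \<tau>). act \<tau> (f l)) (lin \<Lambda> B (A i))" if i: "i \<in> I" for i
  proof -
    interpret G: comm_group "M (s i)" using comm_group_M operatorD[OF A i] by auto
    have key: "keys (rtrans \<Lambda> \<rho> (B j)) \<subseteq> cells \<Lambda> L s'' (s i)"
      "act \<rho> (pull J s' M act B f j) = frag_eval (M (s i)) (\<lambda>(l, \<tau>). act \<tau> (f l)) (rtrans \<Lambda> \<rho> (B j))"
      if "(j, \<rho>) \<in> keys (A i)" for j \<rho>
    proof -
      from that operatorD(2)[OF A i] have j: "j \<in> J" and \<rho>: "\<rho> \<in> Mor \<Lambda>" "rng \<Lambda> \<rho> = s' j" "src \<Lambda> \<rho> = s i"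
        by (auto simp: cells_def)
      interpret G': comm_group "M (s' j)" using comm_group_M operatorD[OF B j] by auto
      note kB = operatorD(2)[OF B j]
      show k: "keys (rtrans \<Lambda> \<rho> (B j)) \<subseteq> cells \<Lambda> L s'' (s i)"
        using keys_rtrans[of "B j" L s'' \<rho>] \<rho> kB by simp
      have h: "act \<rho> \<in> hom (M (s' j)) (M (s i))" using act_hom[OF \<rho>(1)] \<rho> by simp
      have "act \<rho> (pull J s' M act B f j) = act \<rho> (frag_eval (M (s' j)) (\<lambda>(l, \<tau>). act \<tau> (f l)) (B j))"
        by (simp add: pull_def j)
      also have "\<dots> = frag_eval (M (s i)) (\<lambda>z. act \<rho> ((\<lambda>(l, \<tau>). act \<tau> (f l)) z)) (B j)"
        by (rule G'.frag_eval_hom[OF G.comm_group_axioms h act_cell_closed[OF f kB]])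
      also have "\<dots> = frag_eval (M (s i)) (\<lambda>z. frag_eval (M (s i)) (\<lambda>(l, \<tau>). act \<tau> (f l)) ((\<lambda>(l, \<tau>). frag_of (l, \<tau> \<cdot> \<rho>)) z)) (B j)"
      proof -
        have *: "act \<rho> (act \<tau> (f l)) = act (\<tau> \<cdot> \<rho>) (f l)" "act (\<tau> \<cdot> \<rho>) (f l) \<in> carrier (M (s i))"
          if "(l, \<tau>) \<in> keys (B j)" for l \<tau>
        proof -
          have \<tau>: "l \<in> L" "\<tau> \<in> Mor \<Lambda>" "rng \<Lambda> \<tau> = s'' l" "src \<Lambda> \<tau> = s' j"
            using that kB by (auto simp: cells_def)
          then show "act \<rho> (act \<tau> (f l)) = act (\<tau> \<cdot> \<rho>) (f l)"
            using f \<rho> by (simp add: act_cmp PiE_iff)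
          show "act (\<tau> \<cdot> \<rho>) (f l) \<in> carrier (M (s i))"
            using act_closed[of "\<tau> \<cdot> \<rho>" "f l"] f \<rho> \<tau> by (simp add: cmp_closed rng_cmp src_cmp PiE_iff)
        qed
        show ?thesis
          by (rule G.frag_eval_cong) (use * in \<open>auto split: prod.splits\<close>)
      qed
      also have "\<dots> = frag_eval (M (s i)) (\<lambda>(l, \<tau>). act \<tau> (f l)) (rtrans \<Lambda> \<rho> (B j))"
        unfolding rtrans_def
      proof (rule G.frag_eval_extend[symmetric])
        fix z assume "z \<in> keys (B j)"
        then show "(\<lambda>(l, \<tau>). act \<tau> (f l)) \<in> keys ((\<lambda>(l, \<tau>). frag_of (l, \<tau> \<cdot> \<rho>)) z) \<rightarrow> carrier (M (s i))"
          using kB \<rho> by (intro act_cell_closed[OF f]) (auto simp: keys_frag_of cells_def cmp_closed rng_cmp src_cmp)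
      qed
      finally show "act \<rho> (pull J s' M act B f j) = frag_eval (M (s i)) (\<lambda>(l, \<tau>). act \<tau> (f l)) (rtrans \<Lambda> \<rho> (B j))" .
    qed
    have "frag_eval (M (s i)) (\<lambda>(j, \<rho>). act \<rho> (pull J s' M act B f j)) (A i)
      = frag_eval (M (s i)) (\<lambda>z. frag_eval (M (s i)) (\<lambda>(l, \<tau>). act \<tau> (f l)) ((\<lambda>(j, \<rho>). rtrans \<Lambda> \<rho> (B j)) z)) (A i)"
      by (rule G.frag_eval_cong)
        (use key(2) G.frag_eval_closed[OF act_cell_closed[OF f key(1)]] in \<open>auto split: prod.splits\<close>)
    also have "\<dots> = frag_eval (M (s i)) (\<lambda>(l, \<tau>). act \<tau> (f l)) (lin \<Lambda> B (A i))"
      unfolding lin_def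
    proof (rule G.frag_eval_extend[symmetric])
      fix z assume "z \<in> keys (A i)"
      then show "(\<lambda>(l, \<tau>). act \<tau> (f l)) \<in> keys ((\<lambda>(j, \<rho>). rtrans \<Lambda> \<rho> (B j)) z) \<rightarrow> carrier (M (s i))"
        using act_cell_closed[OF f key(1)[of "fst z" "snd z"]] by (simp add: case_prod_beta)
    qed
    finally show ?thesis .
  qed
  then show ?thesis by (auto simp: pull_def[of I] intro!: restrict_ext)
qed

end

lemma pull_cong:
  assumes "\<And>i. i \<in> I \<Longrightarrow> A i = B i"
  shows "pull I s M act A = pull I s M act B"
  using assms by (auto simp: pull_def fun_eq_iff)

subsection \<open>Left modules\<close>

lemma gen_hom:
  assumes "\<And>i. i \<in> I \<Longrightarrow> comm_group (G i)" "i \<in> I"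
  shows "gen I G i \<in> hom (G i) (sum_group I G)"
proof (rule homI)
  have gr: "\<And>i. i \<in> I \<Longrightarrow> Group.group (G i)" using assms(1) by (simp add: comm_group.axioms(2))
  have mon: "\<And>i. i \<in> I \<Longrightarrow> monoid (G i)" using gr by (simp add: group.is_monoid)
  fix a assume a: "a \<in> carrier (G i)"
  have "finite {j \<in> I. gen I G i a j \<noteq> \<one>\<^bsub>G j\<^esub>}"
    by (rule finite_subset[of _ "{i}"]) (auto simp: gen_def)
  then show "gen I G i a \<in> carrier (sum_group I G)"
    using a mon by (auto simp: carrier_sum_group[OF gr] gen_def)
  fix b assume b: "b \<in> carrier (G i)"
  show "gen I G i (a \<otimes>\<^bsub>G i\<^esub> b) = gen I G i a \<otimes>\<^bsub>sum_group I G\<^esub> gen I G i b"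
    using mon by (auto simp: gen_def intro!: restrict_ext)
qed

lemma lin_ext_superset:
  assumes H: "comm_group H" and G: "\<And>i. i \<in> I \<Longrightarrow> comm_group (G i)"
    and \<phi>: "\<And>i. i \<in> I \<Longrightarrow> \<phi> i \<in> hom (G i) H"
    and x: "\<And>i. i \<in> I \<Longrightarrow> x i \<in> carrier (G i)"
    and S: "finite S" "S \<subseteq> I" "{i \<in> I. x i \<noteq> \<one>\<^bsub>G i\<^esub>} \<subseteq> S"
  shows "lin_ext I G H \<phi> x = (\<Otimes>\<^bsub>H\<^esub>i\<in>S. \<phi> i (x i))"
proof -
  interpret H: comm_group H by fact
  have "\<phi> i \<one>\<^bsub>G i\<^esub> = \<one>\<^bsub>H\<^esub>" if "i \<in> I" for i
    using hom_one[OF \<phi>[OF that]] G[OF that] H.is_group by (simp add: comm_group.axioms(2))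
  then show ?thesis
    unfolding lin_ext_def
    by (intro H.finprod_mono_neutral_cong_left) (use S x \<phi> in \<open>auto simp: hom_def Pi_def\<close>)
qed

lemma lin_ext_hom:
  assumes H: "comm_group H" and G: "\<And>i. i \<in> I \<Longrightarrow> comm_group (G i)"
    and \<phi>: "\<And>i. i \<in> I \<Longrightarrow> \<phi> i \<in> hom (G i) H"
  shows "lin_ext I G H \<phi> \<in> hom (sum_group I G) H"
proof (rule homI)
  interpret H: comm_group H by fact
  have gr: "\<And>i. i \<in> I \<Longrightarrow> Group.group (G i)" using G by (simp add: comm_group.axioms(2))
  have mon: "\<And>i. i \<in> I \<Longrightarrow> monoid (G i)" using gr by (simp add: group.is_monoid)
  fix x assume x: "x \<in> carrier (sum_group I G)"
  then have x': "x i \<in> carrier (G i)" if "i \<in> I" for i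
    using that by (auto simp: carrier_sum_group[OF gr])
  then show "lin_ext I G H \<phi> x \<in> carrier H"
    unfolding lin_ext_def by (intro H.finprod_closed) (use \<phi> in \<open>auto simp: hom_def Pi_def\<close>)
  fix y assume y: "y \<in> carrier (sum_group I G)"
  then have y': "y i \<in> carrier (G i)" if "i \<in> I" for i
    using that by (auto simp: carrier_sum_group[OF gr])
  let ?S = "{i \<in> I. x i \<noteq> \<one>\<^bsub>G i\<^esub>} \<union> {i \<in> I. y i \<noteq> \<one>\<^bsub>G i\<^esub>}"
  have S: "finite ?S" using x y by (simp add: carrier_sum_group[OF gr])
  have supp: "{i \<in> I. (x \<otimes>\<^bsub>sum_group I G\<^esub> y) i \<noteq> \<one>\<^bsub>G i\<^esub>} \<subseteq> ?S"
    using mon by (auto dest: monoid.l_one)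
  have "lin_ext I G H \<phi> (x \<otimes>\<^bsub>sum_group I G\<^esub> y) = (\<Otimes>\<^bsub>H\<^esub>i\<in>?S. \<phi> i ((x \<otimes>\<^bsub>sum_group I G\<^esub> y) i))"
    by (rule lin_ext_superset[OF H G \<phi> _ S _ supp]) (use x' y' mon in \<open>auto simp: monoid.m_closed\<close>)
  also have "\<dots> = (\<Otimes>\<^bsub>H\<^esub>i\<in>?S. \<phi> i (x i) \<otimes>\<^bsub>H\<^esub> \<phi> i (y i))"
    by (rule H.finprod_cong') (use \<phi> x' y' in \<open>auto simp: hom_def Pi_def\<close>)
  also have "\<dots> = (\<Otimes>\<^bsub>H\<^esub>i\<in>?S. \<phi> i (x i)) \<otimes>\<^bsub>H\<^esub> (\<Otimes>\<^bsub>H\<^esub>i\<in>?S. \<phi> i (y i))"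
    by (rule H.finprod_multf) (use \<phi> x' y' in \<open>auto simp: hom_def Pi_def\<close>)
  also have "\<dots> = lin_ext I G H \<phi> x \<otimes>\<^bsub>H\<^esub> lin_ext I G H \<phi> y"
    using lin_ext_superset[OF H G \<phi> x' S] lin_ext_superset[OF H G \<phi> y' S] by auto
  finally show "lin_ext I G H \<phi> (x \<otimes>\<^bsub>sum_group I G\<^esub> y) = lin_ext I G H \<phi> x \<otimes>\<^bsub>H\<^esub> lin_ext I G H \<phi> y" .
qed

lemma sum_group_hom_eqI:
  assumes H: "Group.group H" and G: "\<And>i. i \<in> I \<Longrightarrow> comm_group (G i)"
    and h: "h \<in> hom (sum_group I G) H" and h': "h' \<in> hom (sum_group I G) H"
    and eq: "\<And>i a. \<lbrakk>i \<in> I; a \<in> carrier (G i)\<rbrakk> \<Longrightarrow> h (gen I G i a) = h' (gen I G i a)"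
    and x: "x \<in> carrier (sum_group I G)"
  shows "h x = h' x"
proof -
  have gr: "\<And>i. i \<in> I \<Longrightarrow> Group.group (G i)" using G by (simp add: comm_group.axioms(2))
  have mon: "\<And>i. i \<in> I \<Longrightarrow> monoid (G i)" using gr by (simp add: group.is_monoid)
  have S: "Group.group (sum_group I G)" using gr by simp
  have "finite {i \<in> I. x i \<noteq> \<one>\<^bsub>G i\<^esub>}" using x by (simp add: carrier_sum_group[OF gr])
  then show ?thesis using x
  proof (induction "{i \<in> I. x i \<noteq> \<one>\<^bsub>G i\<^esub>}" arbitrary: x rule: finite_induct)
    case empty
    then have "x = \<one>\<^bsub>sum_group I G\<^esub>"
      by (auto simp: carrier_sum_group[OF gr] PiE_iff extensional_def)
    then show ?case using hom_one[OF h S H] hom_one[OF h' S H] by metis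
  next
    case (insert i F)
    then have i: "i \<in> I" "x i \<in> carrier (G i)" by (auto simp: carrier_sum_group[OF gr])
    let ?y = "\<lambda>j\<in>I. if j = i then \<one>\<^bsub>G i\<^esub> else x j"
    have F: "F = {j \<in> I. ?y j \<noteq> \<one>\<^bsub>G j\<^esub>}" using insert.hyps by auto
    have y: "?y \<in> carrier (sum_group I G)"
      using insert.prems F \<open>finite F\<close> mon by (auto simp: carrier_sum_group[OF gr] PiE_iff)
    have g: "gen I G i (x i) \<in> carrier (sum_group I G)"
      by (rule hom_in_carrier[OF gen_hom]) (use G i in auto)
    have "x = gen I G i (x i) \<otimes>\<^bsub>sum_group I G\<^esub> ?y"
      using insert.prems mon i by (auto simp: carrier_sum_group[OF gr] gen_def PiE_iff extensional_def fun_eq_iff)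
    then show ?case
      using hom_mult[OF h g y] hom_mult[OF h' g y] insert.hyps(3)[OF F y] eq[OF i] by simp
  qed
qed

locale k_graph_left_module = k_graph k \<Lambda> + left_module \<Lambda> N act
  for k :: nat and \<Lambda> :: "'a kgraph" (structure) and N :: "'a \<Rightarrow> 'b monoid" and act
begin

lemma act_closed: "\<lbrakk>\<rho> \<in> Mor \<Lambda>; x \<in> carrier (N (src \<Lambda> \<rho>))\<rbrakk> \<Longrightarrow> act \<rho> x \<in> carrier (N (rng \<Lambda> \<rho>))"
  using act_hom[of \<rho>] by (auto simp: hom_def)

definition mods where "mods s = (\<lambda>i. N (s i))"

definition dsum where "dsum I s = sum_group I (mods s)"

text \<open>
  The element \<open>(j, \<rho>) \<otimes> a = j \<otimes> \<rho> a\<close> of the tensor product.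
\<close>

definition push_gen where
  "push_gen J s a = (\<lambda>(j, \<rho>). gen J (mods s) j (act \<rho> a))"

lemma comm_group_mods: "s i \<in> Obj \<Lambda> \<Longrightarrow> comm_group (mods s i)"
  by (simp add: mods_def comm_group_N)

lemma comm_group_dsum: "(\<And>i. i \<in> I \<Longrightarrow> s i \<in> Obj \<Lambda>) \<Longrightarrow> comm_group (dsum I s)"
  by (simp add: dsum_def comm_group_mods comm_group_sum_group)

lemma push_gen_hom:
  assumes "\<And>j. j \<in> J \<Longrightarrow> s j \<in> Obj \<Lambda>" "(j, \<rho>) \<in> cells \<Lambda> J s w"
  shows "(\<lambda>a. push_gen J s a (j, \<rho>)) \<in> hom (N w) (dsum J s)"
proof -
  have "gen J (mods s) j \<in> hom (mods s j) (dsum J s)"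
    unfolding dsum_def using assms by (intro gen_hom) (auto simp: comm_group_mods cells_def)
  moreover have "act \<rho> \<in> hom (N w) (mods s j)"
    using act_hom[of \<rho>] assms(2) by (auto simp: cells_def mods_def)
  ultimately show ?thesis
    using hom_compose[of "act \<rho>" "N w" "mods s j" "gen J (mods s) j" "dsum J s"]
    by (simp add: push_gen_def o_def)
qed

lemma push_gen_closed:
  assumes "\<And>j. j \<in> J \<Longrightarrow> s j \<in> Obj \<Lambda>" "C \<subseteq> cells \<Lambda> J s w" "a \<in> carrier (N w)"
  shows "push_gen J s a \<in> C \<rightarrow> carrier (dsum J s)"
  using push_gen_hom[OF assms(1)] assms(2,3) by (fastforce simp: hom_def)

lemma push_gen_closed1:
  assumes "\<And>j. j \<in> J \<Longrightarrow> s j \<in> Obj \<Lambda>" "(j, \<rho>) \<in> cells \<Lambda> J s w" "a \<in> carrier (N w)"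
  shows "push_gen J s a (j, \<rho>) \<in> carrier (dsum J s)"
  by (rule funcset_mem[OF push_gen_closed[where C = "{(j, \<rho>)}" and w = w]]) (use assms in auto)

lemma push_eval_hom:
  assumes s: "\<And>j. j \<in> J \<Longrightarrow> s j \<in> Obj \<Lambda>" and "w \<in> Obj \<Lambda>" and c: "keys c \<subseteq> cells \<Lambda> J s w"
  shows "(\<lambda>a. frag_eval (dsum J s) (push_gen J s a) c) \<in> hom (N w) (dsum J s)"
proof (rule homI)
  interpret D: comm_group "dsum J s" by (rule comm_group_dsum) (rule s)
  interpret W: comm_group "N w" by (rule comm_group_N) fact
  note cl = push_gen_closed[OF s c]
  fix a assume a: "a \<in> carrier (N w)"
  show "frag_eval (dsum J s) (push_gen J s a) c \<in> carrier (dsum J s)"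
    by (rule D.frag_eval_closed[OF cl[OF _ a]])
  fix b assume b: "b \<in> carrier (N w)"
  have "frag_eval (dsum J s) (push_gen J s (a \<otimes>\<^bsub>N w\<^esub> b)) c
      = frag_eval (dsum J s) (\<lambda>z. push_gen J s a z \<otimes>\<^bsub>dsum J s\<^esub> push_gen J s b z) c"
  proof (rule D.frag_eval_cong)
    fix z assume "z \<in> keys c"
    then show "push_gen J s (a \<otimes>\<^bsub>N w\<^esub> b) z = push_gen J s a z \<otimes>\<^bsub>dsum J s\<^esub> push_gen J s b z"
      using hom_mult[OF push_gen_hom[OF s, where j = "fst z" and \<rho> = "snd z" and w = w] a b] c by auto
  qed (use cl a b in auto)
  then show "frag_eval (dsum J s) (push_gen J s (a \<otimes>\<^bsub>N w\<^esub> b)) c =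
      frag_eval (dsum J s) (push_gen J s a) c \<otimes>\<^bsub>dsum J s\<^esub> frag_eval (dsum J s) (push_gen J s b) c"
    using D.frag_eval_mult[OF cl[OF _ a] cl[OF _ b]] by simp
qed

lemma push_def': "push I s J s' N act A =
    lin_ext I (mods s) (dsum J s') (\<lambda>i a. frag_eval (dsum J s') (push_gen J s' a) (A i))"
  by (simp add: push_def dsum_def mods_def push_gen_def)

context
  fixes I :: "'i set" and s :: "'i \<Rightarrow> 'a" and J :: "'j set" and s' :: "'j \<Rightarrow> 'a" and A
  assumes A: "operator \<Lambda> I s J s' A" and s': "\<And>j. j \<in> J \<Longrightarrow> s' j \<in> Obj \<Lambda>"
begin

lemma push_component_hom:
  assumes "i \<in> I"
  shows "(\<lambda>a. frag_eval (dsum J s') (push_gen J s' a) (A i)) \<in> hom (mods s i) (dsum J s')"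
  unfolding mods_def by (rule push_eval_hom) (use A s' assms in \<open>auto simp: operator_def\<close>)

lemma push_hom: "push I s J s' N act A \<in> hom (dsum I s) (dsum J s')"
  unfolding push_def' dsum_def[of I]
  using A s'
  by (intro lin_ext_hom comm_group_dsum comm_group_mods push_component_hom) (auto simp: operator_def)

lemma push_gen_eq:
  assumes "i \<in> I" "a \<in> carrier (mods s i)"
  shows "push I s J s' N act A (gen I (mods s) i a) = frag_eval (dsum J s') (push_gen J s' a) (A i)"
  unfolding push_def'
  by (rule lin_ext_gen)
    (use assms A s' push_component_hom in \<open>auto simp: comm_group_mods comm_group_dsum operator_def\<close>)

text \<open>
  Homomorphisms out of a direct sum are determined on generators.  The laws for \<open>push\<close> below follow
  by comparing values there.
\<close>

lemma push_eqI:
  assumes "h \<in> hom (dsum I s) (dsum J s')"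
    and "\<And>i a. \<lbrakk>i \<in> I; a \<in> carrier (mods s i)\<rbrakk> \<Longrightarrow>
      h (gen I (mods s) i a) = frag_eval (dsum J s') (push_gen J s' a) (A i)"
    and "x \<in> carrier (dsum I s)"
  shows "h x = push I s J s' N act A x"
proof -
  interpret comm_group "dsum J s'" by (rule comm_group_dsum) (rule s')
  show ?thesis
    by (rule sum_group_hom_eqI[where I = I and G = "mods s" and H = "dsum J s'"])
      (use assms push_hom push_gen_eq A in \<open>auto simp: dsum_def[of I] operator_def intro: comm_group_mods\<close>)
qed

end

lemma push_add:
  assumes A: "operator \<Lambda> I s J s' A" and B: "operator \<Lambda> I s J s' B"
    and s': "\<And>j. j \<in> J \<Longrightarrow> s' j \<in> Obj \<Lambda>" and x: "x \<in> carrier (dsum I s)"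
  shows "push I s J s' N act A x \<otimes>\<^bsub>dsum J s'\<^esub> push I s J s' N act B x = push I s J s' N act (\<lambda>i. A i + B i) x"
proof -
  interpret J: comm_group "dsum J s'" by (rule comm_group_dsum) (rule s')
  interpret I: comm_group "dsum I s" by (rule comm_group_dsum) (use A in \<open>auto simp: operator_def\<close>)
  have AB: "operator \<Lambda> I s J s' (\<lambda>i. A i + B i)"
    using A B Poly_Mapping.keys_add by (fastforce simp: operator_def)
  note hA = push_hom[OF A s'] and hB = push_hom[OF B s']
  show ?thesis
  proof (rule push_eqI[OF AB s' _ _ x, where h = "\<lambda>x. push I s J s' N act A x \<otimes>\<^bsub>dsum J s'\<^esub> push I s J s' N act B x"])
    show "(\<lambda>x. push I s J s' N act A x \<otimes>\<^bsub>dsum J s'\<^esub> push I s J s' N act B x) \<in> hom (dsum I s) (dsum J s')"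
      using hA hB by (intro homI) (auto simp: hom_mult hom_in_carrier J.m_ac)
    fix i a assume i: "i \<in> I" "a \<in> carrier (mods s i)"
    have "push_gen J s' a \<in> keys (A i) \<union> keys (B i) \<rightarrow> carrier (dsum J s')"
      by (rule push_gen_closed[OF s']) (use i A B in \<open>auto simp: operator_def mods_def\<close>)
    then show "push I s J s' N act A (gen I (mods s) i a) \<otimes>\<^bsub>dsum J s'\<^esub> push I s J s' N act B (gen I (mods s) i a)
        = frag_eval (dsum J s') (push_gen J s' a) (A i + B i)"
      using push_gen_eq[OF A s' i] push_gen_eq[OF B s' i] by (simp add: J.frag_eval_add)
  qed
qed

lemma push_unit:
  assumes s: "\<And>i. i \<in> I \<Longrightarrow> s i \<in> Obj \<Lambda>" and x: "x \<in> carrier (dsum I s)"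
  shows "push I s I s N act (\<lambda>i. frag_of (i, s i)) x = x"
proof -
  interpret I: comm_group "dsum I s" by (rule comm_group_dsum) (rule s)
  have op: "operator \<Lambda> I s I s (\<lambda>i. frag_of (i, s i))"
    using s by (auto simp: operator_def cells_def keys_frag_of Obj_Mor rng_Obj src_Obj)
  have "id x = push I s I s N act (\<lambda>i. frag_of (i, s i)) x"
  proof (rule push_eqI[OF op s _ _ x])
    fix i a assume i: "i \<in> I" "a \<in> carrier (mods s i)"
    have "push_gen I s a (i, s i) \<in> carrier (dsum I s)"
      by (rule push_gen_closed1[where w = "s i"])
        (use s i in \<open>auto simp: cells_def Obj_Mor rng_Obj src_Obj mods_def\<close>)
    then show "id (gen I (mods s) i a) = frag_eval (dsum I s) (push_gen I s a) (frag_of (i, s i))"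
      using i s by (simp add: push_gen_def act_id mods_def)
  qed (auto simp: hom_def)
  then show ?thesis by simp
qed

lemma push_zero:
  assumes s: "\<And>i. i \<in> I \<Longrightarrow> s i \<in> Obj \<Lambda>" "\<And>i. i \<in> J \<Longrightarrow> s' i \<in> Obj \<Lambda>" and x: "x \<in> carrier (dsum I s)"
  shows "push I s J s' N act (\<lambda>i. 0) x = \<one>\<^bsub>dsum J s'\<^esub>"
proof -
  interpret J: comm_group "dsum J s'" by (rule comm_group_dsum) (rule s(2))
  have "(\<lambda>x. \<one>\<^bsub>dsum J s'\<^esub>) x = push I s J s' N act (\<lambda>i. 0) x"
    by (rule push_eqI[OF _ s(2) _ _ x]) (use s(1) in \<open>auto simp: operator_def hom_def\<close>)
  then show ?thesis by simp
qed

lemma push_cong: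
  assumes "\<And>i. i \<in> I \<Longrightarrow> A i = B i" "operator \<Lambda> I s J s' A" "\<And>j. j \<in> J \<Longrightarrow> s' j \<in> Obj \<Lambda>" "x \<in> carrier (dsum I s)"
  shows "push I s J s' N act A x = push I s J s' N act B x"
  by (rule push_eqI[OF _ assms(3) push_hom[OF assms(2,3)] _ assms(4)])
    (use assms push_gen_eq[OF assms(2,3)] in \<open>auto simp: operator_def\<close>)

text \<open>
  As for cochains, but covariant: an identity between composites of operators becomes one between
  composites of maps of chains, in the same order.
\<close>

lemma push_push:
  assumes A: "operator \<Lambda> I s J s' A" and B: "operator \<Lambda> J s' L s'' B"
    and s'': "\<And>l. l \<in> L \<Longrightarrow> s'' l \<in> Obj \<Lambda>" and x: "x \<in> carrier (dsum I s)"
  shows "push J s' L s'' N act B (push I s J s' N act A x) = push I s L s'' N act (\<lambda>i. lin \<Lambda> B (A i)) x"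
proof -
  have s': "\<And>j. j \<in> J \<Longrightarrow> s' j \<in> Obj \<Lambda>" using B by (auto simp: operator_def)
  interpret J: comm_group "dsum J s'" by (rule comm_group_dsum) (rule s')
  interpret L: comm_group "dsum L s''" by (rule comm_group_dsum) (rule s'')
  note hB = push_hom[OF B s'']
  have "(\<lambda>x. push J s' L s'' N act B (push I s J s' N act A x)) x = push I s L s'' N act (\<lambda>i. lin \<Lambda> B (A i)) x"
  proof (rule push_eqI[OF operator_compose[OF A B] s'' _ _ x])
    show "(\<lambda>x. push J s' L s'' N act B (push I s J s' N act A x)) \<in> hom (dsum I s) (dsum L s'')"
      using hom_compose[OF push_hom[OF A s'] hB] by (simp add: o_def)
    fix i a assume i: "i \<in> I" and a: "a \<in> carrier (mods s i)"
    note kA = operatorD(2)[OF A i]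
    have key: "keys (rtrans \<Lambda> \<rho> (B j)) \<subseteq> cells \<Lambda> L s'' (s i)"
      "push J s' L s'' N act B (push_gen J s' a (j, \<rho>)) = frag_eval (dsum L s'') (push_gen L s'' a) (rtrans \<Lambda> \<rho> (B j))"
      if "(j, \<rho>) \<in> keys (A i)" for j \<rho>
    proof -
      from that kA have j: "j \<in> J" and \<rho>: "\<rho> \<in> Mor \<Lambda>" "rng \<Lambda> \<rho> = s' j" "src \<Lambda> \<rho> = s i"
        by (auto simp: cells_def)
      note kB = operatorD(2)[OF B j]
      show k: "keys (rtrans \<Lambda> \<rho> (B j)) \<subseteq> cells \<Lambda> L s'' (s i)"
        using keys_rtrans[of "B j" L s'' \<rho>] \<rho> kB by simp
      have a': "act \<rho> a \<in> carrier (mods s' j)"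
        using act_closed[OF \<rho>(1)] \<rho> a by (simp add: mods_def)
      have "push J s' L s'' N act B (push_gen J s' a (j, \<rho>)) = frag_eval (dsum L s'') (push_gen L s'' (act \<rho> a)) (B j)"
        using push_gen_eq[OF B s'' j a'] by (simp add: push_gen_def)
      also have "\<dots> = frag_eval (dsum L s'') (\<lambda>z. frag_eval (dsum L s'') (push_gen L s'' a) ((\<lambda>(l, \<tau>). frag_of (l, \<tau> \<cdot> \<rho>)) z)) (B j)"
      proof -
        have *: "push_gen L s'' (act \<rho> a) (l, \<tau>) = push_gen L s'' a (l, \<tau> \<cdot> \<rho>)"
          "push_gen L s'' a (l, \<tau> \<cdot> \<rho>) \<in> carrier (dsum L s'')"
          if "(l, \<tau>) \<in> keys (B j)" for l \<tau>
        proof -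
          have \<tau>: "l \<in> L" "\<tau> \<in> Mor \<Lambda>" "rng \<Lambda> \<tau> = s'' l" "src \<Lambda> \<tau> = s' j"
            using that kB by (auto simp: cells_def)
          then show "push_gen L s'' (act \<rho> a) (l, \<tau>) = push_gen L s'' a (l, \<tau> \<cdot> \<rho>)"
            using \<rho> a by (simp add: push_gen_def act_cmp mods_def)
          show "push_gen L s'' a (l, \<tau> \<cdot> \<rho>) \<in> carrier (dsum L s'')"
            by (rule push_gen_closed1[where w = "s i"])
              (use s'' \<tau> \<rho> a in \<open>auto simp: cells_def cmp_closed rng_cmp src_cmp mods_def\<close>)
        qed
        show ?thesis
          by (rule L.frag_eval_cong) (use * in \<open>auto split: prod.splits\<close>)
      qed
      also have "\<dots> = frag_eval (dsum L s'') (push_gen L s'' a) (rtrans \<Lambda> \<rho> (B j))"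
        unfolding rtrans_def
      proof (rule L.frag_eval_extend[symmetric])
        fix z assume "z \<in> keys (B j)"
        then show "push_gen L s'' a \<in> keys ((\<lambda>(l, \<tau>). frag_of (l, \<tau> \<cdot> \<rho>)) z) \<rightarrow> carrier (dsum L s'')"
          using kB \<rho> a
          by (intro push_gen_closed[OF s'', where w = "s i"]) (auto simp: keys_frag_of cells_def cmp_closed rng_cmp src_cmp mods_def)
      qed
      finally show "push J s' L s'' N act B (push_gen J s' a (j, \<rho>)) = frag_eval (dsum L s'') (push_gen L s'' a) (rtrans \<Lambda> \<rho> (B j))" .
    qed
    have a': "a \<in> carrier (N (s i))" using a by (simp add: mods_def)
    have "push J s' L s'' N act B (push I s J s' N act A (gen I (mods s) i a))
        = push J s' L s'' N act B (frag_eval (dsum J s') (push_gen J s' a) (A i))"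
      using push_gen_eq[OF A s' i a] by simp
    also have "\<dots> = frag_eval (dsum L s'') (\<lambda>z. push J s' L s'' N act B (push_gen J s' a z)) (A i)"
      by (rule J.frag_eval_hom[OF L.comm_group_axioms hB push_gen_closed[OF s' kA a']])
    also have "\<dots> = frag_eval (dsum L s'') (\<lambda>z. frag_eval (dsum L s'') (push_gen L s'' a) ((\<lambda>(j, \<rho>). rtrans \<Lambda> \<rho> (B j)) z)) (A i)"
      by (rule L.frag_eval_cong)
        (use key(2) L.frag_eval_closed[OF push_gen_closed[OF s'' key(1) a']] in \<open>auto split: prod.splits\<close>)
    also have "\<dots> = frag_eval (dsum L s'') (push_gen L s'' a) (lin \<Lambda> B (A i))"
      unfolding lin_def
    proof (rule L.frag_eval_extend[symmetric])
      fix z assume "z \<in> keys (A i)"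
      then show "push_gen L s'' a \<in> keys ((\<lambda>(j, \<rho>). rtrans \<Lambda> \<rho> (B j)) z) \<rightarrow> carrier (dsum L s'')"
        using push_gen_closed[OF s'' key(1)[of "fst z" "snd z"] a'] by (simp add: case_prod_beta)
    qed
    finally show "push J s' L s'' N act B (push I s J s' N act A (gen I (mods s) i a))
        = frag_eval (dsum L s'') (push_gen L s'' a) (lin \<Lambda> B (A i))" .
  qed
  then show ?thesis .
qed

end

section \<open>Segments of a morphism\<close>

\<comment> \<open>Vectors are functions, and the simplifier would otherwise expand sums of them under a \<open>\<lambda>\<close>, where
  the vector-level lemmas below no longer match.\<close>
declare plus_fun_apply [simp del] minus_apply [simp del]

lemma vec_add_diff: "a \<le> b \<Longrightarrow> a + (b - a) = (b :: vec)"
  by (rule ext) (simp add: le_fun_def plus_fun_apply minus_apply)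

lemma vec_diff_add_diff: "a \<le> b \<Longrightarrow> b \<le> c \<Longrightarrow> (b - a) + (c - b) = (c - a :: vec)"
proof
  fix i assume "a \<le> b" "b \<le> c"
  then have "a i \<le> b i" "b i \<le> c i" by (simp_all add: le_funD)
  then show "((b - a) + (c - b)) i = (c - a) i" unfolding plus_fun_apply minus_apply by linarith
qed

lemma vec_le_add: "a \<le> a + (b :: vec)"
  by (auto simp: le_fun_def plus_fun_apply minus_apply)

lemma vec_add_le_mono: "b \<le> c \<Longrightarrow> a + b \<le> a + (c :: vec)"
  by (auto simp: le_fun_def plus_fun_apply minus_apply)

lemma vec_diff_mono: "b \<le> c \<Longrightarrow> b - a \<le> c - (a :: vec)"
  by (simp add: le_fun_def minus_apply diff_le_mono)

lemma vec_zero_le [simp]: "0 \<le> (a :: vec)"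
  by (auto simp: le_fun_def)

lemma Nvec_add: "a \<in> Nvec k \<Longrightarrow> b \<in> Nvec k \<Longrightarrow> a + b \<in> Nvec k"
  and Nvec_diff: "a \<in> Nvec k \<Longrightarrow> a - b \<in> Nvec k"
  and Nvec_le: "a \<le> b \<Longrightarrow> b \<in> Nvec k \<Longrightarrow> a \<in> Nvec k"
  and Nvec_zero [simp]: "0 \<in> Nvec k"
  by (simp_all add: Nvec_def le_fun_def plus_fun_apply minus_apply) (metis le_zero_eq)

context k_graph
begin

lemma rng_Mor [simp]: "\<mu> \<in> Mor \<Lambda> \<Longrightarrow> rng \<Lambda> \<mu> \<in> Mor \<Lambda>"
  and src_Mor [simp]: "\<mu> \<in> Mor \<Lambda> \<Longrightarrow> src \<Lambda> \<mu> \<in> Mor \<Lambda>"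
  and rng_rng [simp]: "\<mu> \<in> Mor \<Lambda> \<Longrightarrow> rng \<Lambda> (rng \<Lambda> \<mu>) = rng \<Lambda> \<mu>"
  and src_rng [simp]: "\<mu> \<in> Mor \<Lambda> \<Longrightarrow> src \<Lambda> (rng \<Lambda> \<mu>) = rng \<Lambda> \<mu>"
  and rng_src [simp]: "\<mu> \<in> Mor \<Lambda> \<Longrightarrow> rng \<Lambda> (src \<Lambda> \<mu>) = src \<Lambda> \<mu>"
  and src_src [simp]: "\<mu> \<in> Mor \<Lambda> \<Longrightarrow> src \<Lambda> (src \<Lambda> \<mu>) = src \<Lambda> \<mu>"
  using rng_closed src_closed by (auto simp: Obj_def)

lemma factor_unique:
  assumes "\<mu> \<in> Mor \<Lambda>" "\<nu> \<in> Mor \<Lambda>" "src \<Lambda> \<mu> = rng \<Lambda> \<nu>"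
    and "\<mu>' \<in> Mor \<Lambda>" "\<nu>' \<in> Mor \<Lambda>" "src \<Lambda> \<mu>' = rng \<Lambda> \<nu>'"
    and "\<mu> \<cdot> \<nu> = \<mu>' \<cdot> \<nu>'" "deg \<Lambda> \<mu> = deg \<Lambda> \<mu>'"
  shows "\<mu> = \<mu>'" "\<nu> = \<nu>'"
proof -
  have "deg \<Lambda> \<mu> + deg \<Lambda> \<nu> = deg \<Lambda> \<mu>' + deg \<Lambda> \<nu>'"
    using assms by (metis deg_cmp)
  then have deg: "deg \<Lambda> \<nu> = deg \<Lambda> \<nu>'"
    using assms(8) by (auto simp: fun_eq_iff plus_fun_apply minus_apply)
  have "\<exists>!(\<alpha>, \<beta>). \<alpha> \<in> Mor \<Lambda> \<and> \<beta> \<in> Mor \<Lambda> \<and> src \<Lambda> \<alpha> = rng \<Lambda> \<beta> \<and>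
      deg \<Lambda> \<alpha> = deg \<Lambda> \<mu> \<and> deg \<Lambda> \<beta> = deg \<Lambda> \<nu> \<and> \<mu> \<cdot> \<nu> = \<alpha> \<cdot> \<beta>"
    by (rule factorization) (use assms(1-3) in \<open>simp_all add: cmp_closed deg_closed deg_cmp\<close>)
  note ex1 = this
  have "(\<mu>, \<nu>) = (\<mu>', \<nu>')"
    by (rule trans[OF the1_equality[OF ex1, symmetric] the1_equality[OF ex1]]) (use assms deg in simp_all)
  then show "\<mu> = \<mu>'" "\<nu> = \<nu>'" by auto
qed

lemma factor:
  assumes "\<xi> \<in> Mor \<Lambda>" "m \<le> deg \<Lambda> \<xi>"
  obtains \<mu> \<nu> where "\<mu> \<in> Mor \<Lambda>" "\<nu> \<in> Mor \<Lambda>" "src \<Lambda> \<mu> = rng \<Lambda> \<nu>" "\<xi> = \<mu> \<cdot> \<nu>"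
    "deg \<Lambda> \<mu> = m" "deg \<Lambda> \<nu> = deg \<Lambda> \<xi> - m"
proof -
  have "m \<in> Nvec k" "deg \<Lambda> \<xi> - m \<in> Nvec k" "deg \<Lambda> \<xi> = m + (deg \<Lambda> \<xi> - m)"
    using assms deg_closed[of \<xi>] Nvec_le[of m] by (simp_all add: vec_add_diff Nvec_diff)
  from ex1_implies_ex[OF factorization[OF assms(1) this]] show thesis
    using that by (auto simp only: split_paired_Ex prod.case)
qed

text \<open>
  A factorization into three factors is determined by the degrees of the factors, since the
  outer one splits off by unique factorization and then the inner one.
\<close>

lemma segI:
  assumes "\<alpha> \<in> Mor \<Lambda>" "\<mu> \<in> Mor \<Lambda>" "\<beta> \<in> Mor \<Lambda>" "src \<Lambda> \<alpha> = rng \<Lambda> \<mu>" "src \<Lambda> \<mu> = rng \<Lambda> \<beta>"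
    and "\<xi> = \<alpha> \<cdot> \<mu> \<cdot> \<beta>" "deg \<Lambda> \<alpha> = m" "deg \<Lambda> \<mu> = n - m"
  shows "seg \<Lambda> \<xi> m n = \<mu>"
  unfolding seg_def
proof (rule the_equality)
  show "\<mu> \<in> Mor \<Lambda> \<and> deg \<Lambda> \<mu> = n - m \<and> (\<exists>\<alpha>\<in>Mor \<Lambda>. \<exists>\<beta>\<in>Mor \<Lambda>. src \<Lambda> \<alpha> = rng \<Lambda> \<mu> \<and> src \<Lambda> \<mu> = rng \<Lambda> \<beta> \<and>
     \<xi> = \<alpha> \<cdot> \<mu> \<cdot> \<beta> \<and> deg \<Lambda> \<alpha> = m)"
    using assms by auto
  fix \<mu>' assume "\<mu>' \<in> Mor \<Lambda> \<and> deg \<Lambda> \<mu>' = n - m \<and> (\<exists>\<alpha>\<in>Mor \<Lambda>. \<exists>\<beta>\<in>Mor \<Lambda>. src \<Lambda> \<alpha> = rng \<Lambda> \<mu>' \<and> src \<Lambda> \<mu>' = rng \<Lambda> \<beta> \<and>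
     \<xi> = \<alpha> \<cdot> \<mu>' \<cdot> \<beta> \<and> deg \<Lambda> \<alpha> = m)"
  then obtain \<alpha>' \<beta>' where *: "\<mu>' \<in> Mor \<Lambda>" "deg \<Lambda> \<mu>' = n - m" "\<alpha>' \<in> Mor \<Lambda>" "\<beta>' \<in> Mor \<Lambda>"
    "src \<Lambda> \<alpha>' = rng \<Lambda> \<mu>'" "src \<Lambda> \<mu>' = rng \<Lambda> \<beta>'" "\<xi> = \<alpha>' \<cdot> \<mu>' \<cdot> \<beta>'" "deg \<Lambda> \<alpha>' = m"
    by blast
  have "\<mu> \<cdot> \<beta> = \<mu>' \<cdot> \<beta>'"
    by (rule factor_unique(2)[of \<alpha> "\<mu> \<cdot> \<beta>" \<alpha>' "\<mu>' \<cdot> \<beta>'"])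
      (use assms * in \<open>auto simp: cmp_closed rng_cmp cmp_assoc\<close>)
  then show "\<mu>' = \<mu>"
    by (rule factor_unique(1)[of \<mu>' \<beta>' \<mu> \<beta>, rotated -2, OF sym]) (use assms * in auto)
qed

lemma seg_factorization:
  assumes "\<xi> \<in> Mor \<Lambda>" "m \<le> n" "n \<le> deg \<Lambda> \<xi>"
  obtains \<alpha> \<beta> where "\<alpha> \<in> Mor \<Lambda>" "\<beta> \<in> Mor \<Lambda>" "src \<Lambda> \<alpha> = rng \<Lambda> (seg \<Lambda> \<xi> m n)"
    "src \<Lambda> (seg \<Lambda> \<xi> m n) = rng \<Lambda> \<beta>" "\<xi> = \<alpha> \<cdot> seg \<Lambda> \<xi> m n \<cdot> \<beta>" "deg \<Lambda> \<alpha> = m"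
    "seg \<Lambda> \<xi> m n \<in> Mor \<Lambda>" "deg \<Lambda> (seg \<Lambda> \<xi> m n) = n - m"
proof -
  obtain \<gamma> \<beta> where 1: "\<gamma> \<in> Mor \<Lambda>" "\<beta> \<in> Mor \<Lambda>" "src \<Lambda> \<gamma> = rng \<Lambda> \<beta>" "\<xi> = \<gamma> \<cdot> \<beta>" "deg \<Lambda> \<gamma> = n"
    using factor[OF assms(1,3)] by metis
  obtain \<alpha> \<mu> where 2: "\<alpha> \<in> Mor \<Lambda>" "\<mu> \<in> Mor \<Lambda>" "src \<Lambda> \<alpha> = rng \<Lambda> \<mu>" "\<gamma> = \<alpha> \<cdot> \<mu>" "deg \<Lambda> \<alpha> = m"
    "deg \<Lambda> \<mu> = n - m"
    using factor[OF 1(1), of m] assms 1 by metis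
  have "seg \<Lambda> \<xi> m n = \<mu>"
    by (rule segI[of \<alpha> \<mu> \<beta>]) (use 1 2 in \<open>auto simp: src_cmp\<close>)
  then show thesis
    using that[of \<alpha> \<beta>] 1 2 by (auto simp: src_cmp)
qed

lemma seg_Mor: "\<lbrakk>\<xi> \<in> Mor \<Lambda>; m \<le> n; n \<le> deg \<Lambda> \<xi>\<rbrakk> \<Longrightarrow> seg \<Lambda> \<xi> m n \<in> Mor \<Lambda>"
  and deg_seg: "\<lbrakk>\<xi> \<in> Mor \<Lambda>; m \<le> n; n \<le> deg \<Lambda> \<xi>\<rbrakk> \<Longrightarrow> deg \<Lambda> (seg \<Lambda> \<xi> m n) = n - m"
  by (erule (2) seg_factorization, assumption)+

text \<open>
  Both \<open>\<mu> \<cdot> s(\<mu>)\<close> and \<open>r(\<mu>) \<cdot> \<mu>\<close> factor \<open>\<mu>\<close> with first factor of degree \<open>0\<close>, so \<open>\<mu> = r(\<mu>)\<close>.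
\<close>

lemma deg_zero_Obj: "\<mu> \<in> Mor \<Lambda> \<Longrightarrow> deg \<Lambda> \<mu> = 0 \<Longrightarrow> \<mu> \<in> Obj \<Lambda>"
  using factor_unique(1)[of \<mu> "src \<Lambda> \<mu>" "rng \<Lambda> \<mu>" \<mu>] rng_closed[of \<mu>]
  by (simp add: deg_id cmp_src_id rng_cmp_id)

lemma seg_full: "\<xi> \<in> Mor \<Lambda> \<Longrightarrow> seg \<Lambda> \<xi> 0 (deg \<Lambda> \<xi>) = \<xi>"
  by (rule segI[of "rng \<Lambda> \<xi>" \<xi> "src \<Lambda> \<xi>"])
    (auto simp: rng_cmp_id cmp_src_id deg_id rng_closed)

lemma seg_seg:
  assumes "\<xi> \<in> Mor \<Lambda>" "a \<le> b" "b \<le> deg \<Lambda> \<xi>" "c \<le> d" "d \<le> b - a"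
  shows "seg \<Lambda> (seg \<Lambda> \<xi> a b) c d = seg \<Lambda> \<xi> (a + c) (a + d)"
proof -
  obtain \<alpha> \<beta> where 1: "\<alpha> \<in> Mor \<Lambda>" "\<beta> \<in> Mor \<Lambda>" "src \<Lambda> \<alpha> = rng \<Lambda> (seg \<Lambda> \<xi> a b)"
    "src \<Lambda> (seg \<Lambda> \<xi> a b) = rng \<Lambda> \<beta>" "\<xi> = \<alpha> \<cdot> seg \<Lambda> \<xi> a b \<cdot> \<beta>" "deg \<Lambda> \<alpha> = a"
    "seg \<Lambda> \<xi> a b \<in> Mor \<Lambda>" "deg \<Lambda> (seg \<Lambda> \<xi> a b) = b - a"
    using seg_factorization[OF assms(1-3)] by metis
  define \<mu> where "\<mu> = seg \<Lambda> \<xi> a b"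
  note 1 = 1[folded \<mu>_def]
  obtain \<alpha>' \<beta>' where 2: "\<alpha>' \<in> Mor \<Lambda>" "\<beta>' \<in> Mor \<Lambda>" "src \<Lambda> \<alpha>' = rng \<Lambda> (seg \<Lambda> \<mu> c d)"
    "src \<Lambda> (seg \<Lambda> \<mu> c d) = rng \<Lambda> \<beta>'" "\<mu> = \<alpha>' \<cdot> seg \<Lambda> \<mu> c d \<cdot> \<beta>'" "deg \<Lambda> \<alpha>' = c"
    "seg \<Lambda> \<mu> c d \<in> Mor \<Lambda>" "deg \<Lambda> (seg \<Lambda> \<mu> c d) = d - c"
    using seg_factorization[of \<mu> c d] 1 assms by metis
  define \<nu> where "\<nu> = seg \<Lambda> \<mu> c d"
  note 2 = 2[folded \<nu>_def]
  have r: "rng \<Lambda> \<mu> = rng \<Lambda> \<alpha>'" "src \<Lambda> \<mu> = src \<Lambda> \<beta>'"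
    using 2 by (simp_all add: rng_cmp src_cmp cmp_closed)
  have "seg \<Lambda> \<xi> (a + c) (a + d) = \<nu>"
  proof (rule segI[of "\<alpha> \<cdot> \<alpha>'" \<nu> "\<beta>' \<cdot> \<beta>"])
    show "\<xi> = \<alpha> \<cdot> \<alpha>' \<cdot> \<nu> \<cdot> (\<beta>' \<cdot> \<beta>)"
      using 1 2 r by (simp add: cmp_assoc cmp_closed rng_cmp src_cmp)
    show "deg \<Lambda> \<nu> = a + d - (a + c)" using 2 by (auto simp: fun_eq_iff plus_fun_apply minus_apply)
  qed (use 1 2 r in \<open>simp_all add: cmp_closed rng_cmp src_cmp deg_cmp\<close>)
  then show ?thesis by (simp add: \<nu>_def \<mu>_def)
qed

lemma seg_cmp_left:
  assumes "\<alpha> \<in> Mor \<Lambda>" "\<beta> \<in> Mor \<Lambda>" "src \<Lambda> \<alpha> = rng \<Lambda> \<beta>"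
  shows "seg \<Lambda> (\<alpha> \<cdot> \<beta>) 0 (deg \<Lambda> \<alpha>) = \<alpha>"
  by (rule segI[of "rng \<Lambda> \<alpha>" \<alpha> \<beta>]) (use assms in \<open>auto simp: rng_cmp_id deg_id rng_closed\<close>)

lemma seg_cmp_right:
  assumes "\<alpha> \<in> Mor \<Lambda>" "\<beta> \<in> Mor \<Lambda>" "src \<Lambda> \<alpha> = rng \<Lambda> \<beta>"
  shows "seg \<Lambda> (\<alpha> \<cdot> \<beta>) (deg \<Lambda> \<alpha>) (deg \<Lambda> (\<alpha> \<cdot> \<beta>)) = \<beta>"
  by (rule segI[of \<alpha> \<beta> "src \<Lambda> \<beta>"])
    (use assms in \<open>auto simp: cmp_src_id cmp_closed src_cmp deg_cmp fun_eq_iff plus_fun_apply minus_apply cmp_assoc\<close>)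

lemma seg_split:
  assumes "\<xi> \<in> Mor \<Lambda>" "a \<le> b" "b \<le> c" "c \<le> deg \<Lambda> \<xi>"
  shows "src \<Lambda> (seg \<Lambda> \<xi> a b) = rng \<Lambda> (seg \<Lambda> \<xi> b c)" "seg \<Lambda> \<xi> a b \<cdot> seg \<Lambda> \<xi> b c = seg \<Lambda> \<xi> a c"
proof -
  let ?\<mu> = "seg \<Lambda> \<xi> a c"
  have ac: "a \<le> c" using assms by auto
  have \<mu>: "?\<mu> \<in> Mor \<Lambda>" "deg \<Lambda> ?\<mu> = c - a" using assms ac by (simp_all add: seg_Mor deg_seg)
  have le: "b - a \<le> c - a" using assms by (simp add: vec_diff_mono)
  obtain \<alpha> \<beta> where 1: "\<alpha> \<in> Mor \<Lambda>" "\<beta> \<in> Mor \<Lambda>" "src \<Lambda> \<alpha> = rng \<Lambda> \<beta>" "?\<mu> = \<alpha> \<cdot> \<beta>" "deg \<Lambda> \<alpha> = b - a"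
    using factor[OF \<mu>(1), of "b - a"] \<mu>(2) le by metis
  have "\<alpha> = seg \<Lambda> ?\<mu> 0 (b - a)" using seg_cmp_left[OF 1(1-3)] 1 by simp
  also have "\<dots> = seg \<Lambda> \<xi> a b" using assms ac le by (simp add: seg_seg vec_add_diff)
  finally have \<alpha>: "\<alpha> = seg \<Lambda> \<xi> a b" .
  have "\<beta> = seg \<Lambda> ?\<mu> (b - a) (c - a)" using seg_cmp_right[OF 1(1-3)] 1 \<mu> by simp
  also have "\<dots> = seg \<Lambda> \<xi> b c" using assms ac le by (simp add: seg_seg vec_add_diff)
  finally have \<beta>: "\<beta> = seg \<Lambda> \<xi> b c" .
  show "src \<Lambda> (seg \<Lambda> \<xi> a b) = rng \<Lambda> (seg \<Lambda> \<xi> b c)" "seg \<Lambda> \<xi> a b \<cdot> seg \<Lambda> \<xi> b c = ?\<mu>"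
    using 1 \<alpha> \<beta> by auto
qed

lemma seg_point:
  assumes "\<xi> \<in> Mor \<Lambda>" "a \<le> b" "b \<le> deg \<Lambda> \<xi>"
  shows "seg \<Lambda> \<xi> a a = rng \<Lambda> (seg \<Lambda> \<xi> a b)" "seg \<Lambda> \<xi> b b = src \<Lambda> (seg \<Lambda> \<xi> a b)"
    "seg \<Lambda> \<xi> a a \<in> Obj \<Lambda>"
proof -
  have o: "seg \<Lambda> \<xi> x x \<in> Obj \<Lambda>" if "x \<le> deg \<Lambda> \<xi>" for x
    using deg_zero_Obj[of "seg \<Lambda> \<xi> x x"] assms that by (simp add: deg_seg seg_Mor fun_eq_iff plus_fun_apply minus_apply)
  have "a \<le> deg \<Lambda> \<xi>" using assms by auto
  then show "seg \<Lambda> \<xi> a a \<in> Obj \<Lambda>" by (rule o)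
  then show "seg \<Lambda> \<xi> a a = rng \<Lambda> (seg \<Lambda> \<xi> a b)"
    using seg_split(1)[of \<xi> a a b] assms by (simp add: src_Obj)
  show "seg \<Lambda> \<xi> b b = src \<Lambda> (seg \<Lambda> \<xi> a b)"
    using seg_split(1)[of \<xi> a b b] assms o[of b] by (simp add: rng_Obj)
qed

lemma src_seg_deg: "\<xi> \<in> Mor \<Lambda> \<Longrightarrow> m \<le> deg \<Lambda> \<xi> \<Longrightarrow> src \<Lambda> (seg \<Lambda> \<xi> m (deg \<Lambda> \<xi>)) = src \<Lambda> \<xi>"
  using seg_point(2)[of \<xi> m "deg \<Lambda> \<xi>"] seg_point(2)[of \<xi> 0 "deg \<Lambda> \<xi>"] by (simp add: seg_full)

section \<open>Tuples and cubes as chains of lattice points\<close>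

text \<open>
  A chain \<open>p\<^sub>0 \<le> \<dots> \<le> p\<^sub>n\<close> of points below \<open>d(\<xi>)\<close> cuts \<open>\<xi>\<close> into the composable tuple of the segments
  \<open>\<xi>(p\<^sub>i, p\<^sub>i\<^sub>+\<^sub>1)\<close> and a trailing morphism \<open>\<xi>(p\<^sub>n, d(\<xi>))\<close>; the initial segment \<open>\<xi>(0, p\<^sub>0)\<close> is
  forgotten, as in the first face of a tuple.  In the same way, a set \<open>K\<close> of directions and a lower
  corner \<open>a\<close> cut out a cube and a trailing morphism (\<open>cube\<close>).  The results are cells of the free modules on
  tuples and on cubes.
\<close>

definition simplex :: "'a \<Rightarrow> vec list \<Rightarrow> 'a tup \<times> 'a" where
  "simplex \<xi> ps = ((seg \<Lambda> \<xi> (hd ps) (hd ps), map2 (seg \<Lambda> \<xi>) ps (tl ps)), seg \<Lambda> \<xi> (last ps) (deg \<Lambda> \<xi>))"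

definition cube :: "'a \<Rightarrow> nat set \<times> vec \<Rightarrow> 'a \<times> 'a" where
  "cube \<xi> = (\<lambda>(K, a). (seg \<Lambda> \<xi> a (a + set_vec K), seg \<Lambda> \<xi> (a + set_vec K) (deg \<Lambda> \<xi>)))"

end

definition lattice_chain :: "vec \<Rightarrow> vec list \<Rightarrow> bool" where
  "lattice_chain D ps \<longleftrightarrow> ps \<noteq> [] \<and> sorted_wrt (\<le>) ps \<and> last ps \<le> D"

lemma lattice_chain_simps [simp]:
  "\<not> lattice_chain D []"
  "lattice_chain D [p] \<longleftrightarrow> p \<le> D"
  "lattice_chain D (p # q # ps) \<longleftrightarrow> p \<le> q \<and> lattice_chain D (q # ps)"
  unfolding lattice_chain_def
  by (auto intro: order_trans)

lemma lattice_chain_le: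
  "lattice_chain D ps \<Longrightarrow> p \<in> set ps \<Longrightarrow> hd ps \<le> p \<and> p \<le> last ps \<and> last ps \<le> D"
proof (induction ps arbitrary: p)
  case (Cons x ps)
  show ?case
  proof (cases ps)
    case (Cons y ys)
    with Cons.prems Cons.IH[of y] Cons.IH[of p] show ?thesis by auto
  qed (use Cons.prems in auto)
qed simp

fun psums :: "vec \<Rightarrow> vec list \<Rightarrow> vec list" where
  "psums a [] = [a]"
| "psums a (d # ds) = a # psums (a + d) ds"

text \<open>
  The chain, starting at \<open>0\<close>, along which the entries of \<open>t\<close> cut their product.
\<close>

definition points :: "'a kgraph \<Rightarrow> 'a tup \<Rightarrow> vec list" where
  "points \<Lambda> t = psums 0 (map (deg \<Lambda>) (snd t))"

lemma psums_neq_Nil [simp]: "psums a ds \<noteq> []" and hd_psums [simp]: "hd (psums a ds) = a"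
  and length_psums [simp]: "length (psums a ds) = Suc (length ds)"
  by (induction ds arbitrary: a) auto

lemma psums_Cons_tl: "psums a ds = a # tl (psums a ds)"
  by (cases ds) auto

lemma lattice_chain_psums: "last (psums a ds) \<le> D \<Longrightarrow> lattice_chain D (psums a ds)"
proof (induction ds arbitrary: a)
  case (Cons d ds)
  moreover obtain qs where "psums (a + d) ds = (a + d) # qs"
    using psums_Cons_tl by blast
  ultimately show ?case using Cons.IH[of "a + d"] Cons.prems by (simp add: vec_le_add)
qed simp

lemma psums_nth: "i \<le> length ds \<Longrightarrow> psums a ds ! i = a + (\<Sum>j<i. ds ! j)"
proof (induction ds arbitrary: a i)
  case (Cons d ds)
  then show ?case
    by (cases i) (auto simp: sum.lessThan_Suc_shift add.assoc simp del: sum.lessThan_Suc)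
qed simp

context k_graph
begin

abbreviation "bar_cells n \<equiv> cells \<Lambda> (tuples \<Lambda> n) (tup_src \<Lambda>)"
abbreviation "cub_cells n \<equiv> cells \<Lambda> (cubes k \<Lambda> n) (src \<Lambda>)"

lemma foldl_seg:
  assumes "\<xi> \<in> Mor \<Lambda>" "a \<le> p" "lattice_chain (deg \<Lambda> \<xi>) (p # ps)"
  shows "foldl (\<cdot>) (seg \<Lambda> \<xi> a p) (map2 (seg \<Lambda> \<xi>) (p # ps) ps) = seg \<Lambda> \<xi> a (last (p # ps))"
  using assms(2,3)
proof (induction ps arbitrary: p)
  case (Cons q ps)
  then have "q \<le> deg \<Lambda> \<xi>" using lattice_chain_le[of "deg \<Lambda> \<xi>" "q # ps" q] by auto
  with Cons.prems have "seg \<Lambda> \<xi> a p \<cdot> seg \<Lambda> \<xi> p q = seg \<Lambda> \<xi> a q"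
    by (auto intro!: seg_split(2)[OF assms(1)])
  moreover have "a \<le> q" using Cons.prems by auto
  ultimately show ?case using Cons by simp
qed simp

lemma simplex_tuple:
  assumes \<xi>: "\<xi> \<in> Mor \<Lambda>" and ps: "lattice_chain (deg \<Lambda> \<xi>) ps"
  shows "fst (simplex \<xi> ps) \<in> tuples \<Lambda> (length ps - 1)"
    and "tup_prod \<Lambda> (fst (simplex \<xi> ps)) = seg \<Lambda> \<xi> (hd ps) (last ps)"
    and "tup_src \<Lambda> (fst (simplex \<xi> ps)) = seg \<Lambda> \<xi> (last ps) (last ps)"
proof -
  note le = lattice_chain_le[OF ps]
  have hl: "hd ps \<le> last ps" "last ps \<le> deg \<Lambda> \<xi>" using le[of "hd ps"] ps by (auto simp: lattice_chain_def)
  have ne: "ps \<noteq> []" using ps by (auto simp: lattice_chain_def)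
  have nth: "ps ! i \<le> ps ! Suc i" "ps ! Suc i \<le> deg \<Lambda> \<xi>" if "Suc i < length ps" for i
    using ps that le[of "ps ! Suc i"] by (auto simp: lattice_chain_def sorted_wrt_nth_less)
  let ?ms = "map2 (seg \<Lambda> \<xi>) ps (tl ps)"
  have ms: "?ms ! i = seg \<Lambda> \<xi> (ps ! i) (ps ! Suc i)" if "Suc i < length ps" for i
    using that by (simp add: nth_tl)
  have len: "length ?ms = length ps - 1" by simp
  have v: "seg \<Lambda> \<xi> (hd ps) (hd ps) \<in> Obj \<Lambda>" using seg_point[OF \<xi> hl] by simp
  have Mor: "set ?ms \<subseteq> Mor \<Lambda>"
    using nth ms by (auto simp: in_set_conv_nth nth_tl seg_Mor[OF \<xi>])
  have succ: "successively (\<lambda>\<mu> \<nu>. src \<Lambda> \<mu> = rng \<Lambda> \<nu>) ?ms"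
    unfolding successively_conv_nth
    using nth ms by (auto simp: nth_tl intro!: seg_split(1)[OF \<xi>])
  have first: "seg \<Lambda> \<xi> (hd ps) (hd ps) = rng \<Lambda> (hd ?ms)" if "?ms \<noteq> []"
  proof -
    have "Suc 0 < length ps" using that by (cases ps; cases "tl ps") auto
    then show ?thesis using that nth[of 0] seg_point(1)[OF \<xi>, of "ps ! 0" "ps ! 1"] ms[of 0] ne
      by (simp add: hd_conv_nth)
  qed
  show "fst (simplex \<xi> ps) \<in> tuples \<Lambda> (length ps - 1)"
    using v Mor succ first by (auto simp: tuples_def simplex_def)
  show "tup_prod \<Lambda> (fst (simplex \<xi> ps)) = seg \<Lambda> \<xi> (hd ps) (last ps)"
    using foldl_seg[OF \<xi>, of "hd ps" "hd ps" "tl ps"] ps ne by (simp add: tup_prod_def simplex_def)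
  show "tup_src \<Lambda> (fst (simplex \<xi> ps)) = seg \<Lambda> \<xi> (last ps) (last ps)"
  proof (cases "?ms = []")
    case True
    then have "hd ps = last ps" using ne by (cases ps; cases "tl ps") auto
    then show ?thesis using True by (simp add: tup_src_def simplex_def)
  next
    case False
    then have l: "length ps \<ge> 2" by (cases ps; cases "tl ps") auto
    then have "last ?ms = seg \<Lambda> \<xi> (ps ! (length ps - 2)) (ps ! Suc (length ps - 2))"
      using False ms[of "length ps - 2"] by (subst last_conv_nth) (auto simp: numeral_2_eq_2)
    moreover have "ps ! Suc (length ps - 2) = last ps" using l ne by (simp add: last_conv_nth Suc_diff_Suc numeral_2_eq_2)
    ultimately show ?thesis
      using False seg_point(2)[OF \<xi> nth, of "length ps - 2"] l by (auto simp: tup_src_def simplex_def)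
  qed
qed

lemma simplex_cells:
  assumes \<xi>: "\<xi> \<in> Mor \<Lambda>" and ps: "lattice_chain (deg \<Lambda> \<xi>) ps" and n: "length ps = Suc n"
  shows "simplex \<xi> ps \<in> bar_cells n (src \<Lambda> \<xi>)"
proof -
  have l: "last ps \<le> deg \<Lambda> \<xi>" using ps by (auto simp: lattice_chain_def)
  have "snd (simplex \<xi> ps) \<in> Mor \<Lambda>" "src \<Lambda> (snd (simplex \<xi> ps)) = src \<Lambda> \<xi>"
    "rng \<Lambda> (snd (simplex \<xi> ps)) = seg \<Lambda> \<xi> (last ps) (last ps)"
    using l \<xi> seg_point(1)[OF \<xi> l] by (simp_all add: simplex_def seg_Mor src_seg_deg)
  then show ?thesis
    using simplex_tuple[OF \<xi> ps] n by (cases "simplex \<xi> ps") (auto simp: cells_def)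
qed

text \<open>
  The product begins with its first factor, and its remaining data are those of the two ends.
  The induction needs all of these facts at once.
\<close>

lemma foldl_cmp_factor:
  assumes "\<alpha> \<in> Mor \<Lambda>" "set ms \<subseteq> Mor \<Lambda>" "successively (\<lambda>\<mu> \<nu>. src \<Lambda> \<mu> = rng \<Lambda> \<nu>) (\<alpha> # ms)"
  shows "foldl (\<cdot>) \<alpha> ms \<in> Mor \<Lambda> \<and> rng \<Lambda> (foldl (\<cdot>) \<alpha> ms) = rng \<Lambda> \<alpha>
    \<and> src \<Lambda> (foldl (\<cdot>) \<alpha> ms) = src \<Lambda> (last (\<alpha> # ms))
    \<and> (\<exists>\<beta>\<in>Mor \<Lambda>. rng \<Lambda> \<beta> = src \<Lambda> \<alpha> \<and> foldl (\<cdot>) \<alpha> ms = \<alpha> \<cdot> \<beta>)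
    \<and> deg \<Lambda> (foldl (\<cdot>) \<alpha> ms) = last (psums (deg \<Lambda> \<alpha>) (map (deg \<Lambda>) ms))"
  using assms
proof (induction ms arbitrary: \<alpha>)
  case Nil
  then show ?case using cmp_src_id[of \<alpha>] by (auto intro!: bexI[of _ "src \<Lambda> \<alpha>"])
next
  case (Cons \<mu> ms)
  then have \<mu>: "\<mu> \<in> Mor \<Lambda>" "src \<Lambda> \<alpha> = rng \<Lambda> \<mu>" by auto
  with Cons.prems have "successively (\<lambda>\<mu> \<nu>. src \<Lambda> \<mu> = rng \<Lambda> \<nu>) (\<alpha> \<cdot> \<mu> # ms)"
    by (cases ms) (auto simp: src_cmp)
  with Cons.IH[of "\<alpha> \<cdot> \<mu>"] Cons.prems \<mu> have IH: "foldl (\<cdot>) (\<alpha> \<cdot> \<mu>) ms \<in> Mor \<Lambda>"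
    "rng \<Lambda> (foldl (\<cdot>) (\<alpha> \<cdot> \<mu>) ms) = rng \<Lambda> \<alpha>" "src \<Lambda> (foldl (\<cdot>) (\<alpha> \<cdot> \<mu>) ms) = src \<Lambda> (last (\<alpha> \<cdot> \<mu> # ms))"
    "\<exists>\<beta>\<in>Mor \<Lambda>. rng \<Lambda> \<beta> = src \<Lambda> (\<alpha> \<cdot> \<mu>) \<and> foldl (\<cdot>) (\<alpha> \<cdot> \<mu>) ms = \<alpha> \<cdot> \<mu> \<cdot> \<beta>"
    "deg \<Lambda> (foldl (\<cdot>) (\<alpha> \<cdot> \<mu>) ms) = last (psums (deg \<Lambda> \<alpha> + deg \<Lambda> \<mu>) (map (deg \<Lambda>) ms))"
    by (auto simp: cmp_closed rng_cmp deg_cmp)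
  then obtain \<beta> where \<beta>: "\<beta> \<in> Mor \<Lambda>" "rng \<Lambda> \<beta> = src \<Lambda> \<mu>" "foldl (\<cdot>) (\<alpha> \<cdot> \<mu>) ms = \<alpha> \<cdot> \<mu> \<cdot> \<beta>"
    using Cons.prems \<mu> by (auto simp: src_cmp)
  have "\<exists>\<beta>\<in>Mor \<Lambda>. rng \<Lambda> \<beta> = src \<Lambda> \<alpha> \<and> foldl (\<cdot>) (\<alpha> \<cdot> \<mu>) ms = \<alpha> \<cdot> \<beta>"
    by (rule bexI[of _ "\<mu> \<cdot> \<beta>"]) (use Cons.prems \<mu> \<beta> in \<open>auto simp: cmp_assoc rng_cmp cmp_closed\<close>)
  moreover have "src \<Lambda> (last (\<alpha> \<cdot> \<mu> # ms)) = src \<Lambda> (last (\<mu> # ms))"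
    using Cons.prems \<mu> by (simp add: src_cmp)
  ultimately show ?case using IH by simp
qed

lemma simplex_points_aux:
  assumes "\<alpha> \<in> Mor \<Lambda>" "set ms \<subseteq> Mor \<Lambda>" "successively (\<lambda>\<mu> \<nu>. src \<Lambda> \<mu> = rng \<Lambda> \<nu>) (\<alpha> # ms)"
    and "\<rho> \<in> Mor \<Lambda>" "rng \<Lambda> \<rho> = src \<Lambda> (last (\<alpha> # ms))" "\<xi> = foldl (\<cdot>) \<alpha> ms \<cdot> \<rho>"
  shows "map2 (seg \<Lambda> \<xi>) (psums (deg \<Lambda> \<alpha>) (map (deg \<Lambda>) ms)) (tl (psums (deg \<Lambda> \<alpha>) (map (deg \<Lambda>) ms))) = ms"
  using assms
proof (induction ms arbitrary: \<alpha>)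
  case (Cons \<mu> ms)
  then have \<mu>: "\<mu> \<in> Mor \<Lambda>" "src \<Lambda> \<alpha> = rng \<Lambda> \<mu>" by auto
  with Cons.prems have s: "successively (\<lambda>\<mu> \<nu>. src \<Lambda> \<mu> = rng \<Lambda> \<nu>) (\<alpha> \<cdot> \<mu> # ms)"
    by (cases ms) (auto simp: src_cmp)
  have lst: "src \<Lambda> (last (\<alpha> \<cdot> \<mu> # ms)) = src \<Lambda> (last (\<mu> # ms))"
    using Cons.prems \<mu> by (simp add: src_cmp)
  have ff: "foldl (\<cdot>) (\<alpha> \<cdot> \<mu>) ms \<in> Mor \<Lambda> \<and> rng \<Lambda> (foldl (\<cdot>) (\<alpha> \<cdot> \<mu>) ms) = rng \<Lambda> (\<alpha> \<cdot> \<mu>)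
    \<and> src \<Lambda> (foldl (\<cdot>) (\<alpha> \<cdot> \<mu>) ms) = src \<Lambda> (last (\<alpha> \<cdot> \<mu> # ms))
    \<and> (\<exists>\<beta>\<in>Mor \<Lambda>. rng \<Lambda> \<beta> = src \<Lambda> (\<alpha> \<cdot> \<mu>) \<and> foldl (\<cdot>) (\<alpha> \<cdot> \<mu>) ms = \<alpha> \<cdot> \<mu> \<cdot> \<beta>)
    \<and> deg \<Lambda> (foldl (\<cdot>) (\<alpha> \<cdot> \<mu>) ms) = last (psums (deg \<Lambda> (\<alpha> \<cdot> \<mu>)) (map (deg \<Lambda>) ms))"
    by (rule foldl_cmp_factor) (use Cons.prems \<mu> s in \<open>auto simp: cmp_closed\<close>)
  then obtain \<beta> where \<beta>: "\<beta> \<in> Mor \<Lambda>" "rng \<Lambda> \<beta> = src \<Lambda> \<mu>" "foldl (\<cdot>) (\<alpha> \<cdot> \<mu>) ms = \<alpha> \<cdot> \<mu> \<cdot> \<beta>"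
    using Cons.prems \<mu> by (auto simp: src_cmp)
  have src\<beta>: "src \<Lambda> \<beta> = rng \<Lambda> \<rho>"
    using ff \<beta> lst Cons.prems \<mu> by (simp add: src_cmp rng_cmp cmp_closed)
  have "seg \<Lambda> \<xi> (deg \<Lambda> \<alpha>) (deg \<Lambda> \<alpha> + deg \<Lambda> \<mu>) = \<mu>"
    by (rule segI[of \<alpha> \<mu> "\<beta> \<cdot> \<rho>"])
      (use Cons.prems \<mu> \<beta> src\<beta> in \<open>auto simp: cmp_assoc cmp_closed rng_cmp src_cmp fun_eq_iff plus_fun_apply minus_apply\<close>)
  moreover have "map2 (seg \<Lambda> \<xi>) (psums (deg \<Lambda> (\<alpha> \<cdot> \<mu>)) (map (deg \<Lambda>) ms)) (tl (psums (deg \<Lambda> (\<alpha> \<cdot> \<mu>)) (map (deg \<Lambda>) ms))) = ms"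
    by (rule Cons.IH) (use Cons.prems \<mu> s lst in \<open>auto simp: cmp_closed\<close>)
  moreover obtain qs where "psums (deg \<Lambda> \<alpha> + deg \<Lambda> \<mu>) (map (deg \<Lambda>) ms) = (deg \<Lambda> \<alpha> + deg \<Lambda> \<mu>) # qs"
    using psums_Cons_tl by blast
  ultimately show ?case
    using Cons.prems \<mu> by (simp add: deg_cmp)
qed simp

lemma tup_prod:
  assumes "t \<in> tuples \<Lambda> n"
  shows "tup_prod \<Lambda> t \<in> Mor \<Lambda>" "rng \<Lambda> (tup_prod \<Lambda> t) = fst t" "src \<Lambda> (tup_prod \<Lambda> t) = tup_src \<Lambda> t"
    "deg \<Lambda> (tup_prod \<Lambda> t) = last (points \<Lambda> t)" "tup_src \<Lambda> t \<in> Obj \<Lambda>"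
proof -
  obtain v ms where t: "t = (v, ms)" by (cases t)
  have v: "v \<in> Obj \<Lambda>" "set ms \<subseteq> Mor \<Lambda>" "successively (\<lambda>\<mu> \<nu>. src \<Lambda> \<mu> = rng \<Lambda> \<nu>) (v # ms)"
    using assms src_Obj by (cases ms; auto simp: tuples_def t)+
  note * = foldl_cmp_factor[OF Obj_Mor[OF v(1)] v(2,3)]
  show "tup_prod \<Lambda> t \<in> Mor \<Lambda>" "rng \<Lambda> (tup_prod \<Lambda> t) = fst t"
    "deg \<Lambda> (tup_prod \<Lambda> t) = last (points \<Lambda> t)"
    using * v by (auto simp: tup_prod_def t points_def rng_Obj deg_id)
  show s: "src \<Lambda> (tup_prod \<Lambda> t) = tup_src \<Lambda> t"
    using * v by (auto simp: tup_prod_def t tup_src_def src_Obj)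
  show "tup_src \<Lambda> t \<in> Obj \<Lambda>"
    using src_closed[of "tup_prod \<Lambda> t"] * s by (simp add: tup_prod_def t)
qed

text \<open>
  Every cell \<open>(t, \<rho>)\<close> of the free module on tuples is cut out of the product of its entries and
  \<open>\<rho>\<close>.  Therefore linear maps on that module may be computed on simplices inside one morphism.
\<close>

lemma simplex_points:
  assumes "(t, \<rho>) \<in> bar_cells n w"
  shows "simplex (tup_prod \<Lambda> t \<cdot> \<rho>) (points \<Lambda> t) = (t, \<rho>)"
    "lattice_chain (deg \<Lambda> (tup_prod \<Lambda> t \<cdot> \<rho>)) (points \<Lambda> t)" "tup_prod \<Lambda> t \<cdot> \<rho> \<in> Mor \<Lambda>"
    "src \<Lambda> (tup_prod \<Lambda> t \<cdot> \<rho>) = w"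
proof -
  from assms have t: "t \<in> tuples \<Lambda> n" and \<rho>: "\<rho> \<in> Mor \<Lambda>" "rng \<Lambda> \<rho> = tup_src \<Lambda> t" "src \<Lambda> \<rho> = w"
    by (auto simp: cells_def)
  note P = tup_prod[OF t]
  show \<xi>: "tup_prod \<Lambda> t \<cdot> \<rho> \<in> Mor \<Lambda>" and "src \<Lambda> (tup_prod \<Lambda> t \<cdot> \<rho>) = w"
    using P \<rho> by (simp_all add: cmp_closed src_cmp)
  show "lattice_chain (deg \<Lambda> (tup_prod \<Lambda> t \<cdot> \<rho>)) (points \<Lambda> t)"
    unfolding points_def
    by (rule lattice_chain_psums) (use P \<rho> in \<open>auto simp: deg_cmp points_def vec_le_add\<close>)
  obtain v ms where tv: "t = (v, ms)" by (cases t)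
  have v: "v \<in> Obj \<Lambda>" "set ms \<subseteq> Mor \<Lambda>" "successively (\<lambda>\<mu> \<nu>. src \<Lambda> \<mu> = rng \<Lambda> \<nu>) (v # ms)"
    "tup_src \<Lambda> t = src \<Lambda> (last (v # ms))"
    using t src_Obj by (cases ms; auto simp: tuples_def tv tup_src_def)+
  have "map2 (seg \<Lambda> (tup_prod \<Lambda> t \<cdot> \<rho>)) (points \<Lambda> t) (tl (points \<Lambda> t)) = ms"
    using simplex_points_aux[OF Obj_Mor[OF v(1)] v(2,3), of \<rho>] \<rho> v
    by (simp add: points_def tv deg_id tup_prod_def)
  moreover have "seg \<Lambda> (tup_prod \<Lambda> t \<cdot> \<rho>) (last (points \<Lambda> t)) (deg \<Lambda> (tup_prod \<Lambda> t \<cdot> \<rho>)) = \<rho>"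
    using seg_cmp_right[of "tup_prod \<Lambda> t" \<rho>] P \<rho> by simp
  moreover have "seg \<Lambda> (tup_prod \<Lambda> t \<cdot> \<rho>) 0 0 = v"
    using seg_point(1)[OF \<xi>, of 0 "deg \<Lambda> (tup_prod \<Lambda> t \<cdot> \<rho>)"] P \<rho> by (simp add: seg_full \<xi> rng_cmp) (simp add: tv)
  ultimately show "simplex (tup_prod \<Lambda> t \<cdot> \<rho>) (points \<Lambda> t) = (t, \<rho>)"
    by (simp add: simplex_def tv points_def)
qed

text \<open>
  The tuple cut out by \<open>ps\<close> remembers \<open>ps\<close> only up to translation, because its own chain of points
  starts at \<open>0\<close>.
\<close>

lemma points_simplex:
  assumes \<xi>: "\<xi> \<in> Mor \<Lambda>" and ps: "lattice_chain (deg \<Lambda> \<xi>) ps"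
  shows "map ((+) (hd ps)) (points \<Lambda> (fst (simplex \<xi> ps))) = ps"
proof -
  have "lattice_chain (deg \<Lambda> \<xi>) (p # ps) \<Longrightarrow> a \<le> p \<Longrightarrow> map ((+) a) (psums (p - a) (map (deg \<Lambda>) (map2 (seg \<Lambda> \<xi>) (p # ps) ps))) = p # ps"
    for a p ps
  proof (induction ps arbitrary: p)
    case (Cons q ps)
    then have "p \<le> q" "q \<le> deg \<Lambda> \<xi>" using lattice_chain_le[of "deg \<Lambda> \<xi>" "q # ps" q] by auto
    then have "(p - a) + deg \<Lambda> (seg \<Lambda> \<xi> p q) = q - a"
      using Cons.prems by (simp add: deg_seg \<xi> vec_diff_add_diff)
    moreover have "a \<le> q" using \<open>p \<le> q\<close> Cons.prems by auto
    ultimately show ?case using Cons by (simp add: vec_add_diff)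
  qed (simp add: vec_add_diff)
  from this[of "hd ps" "tl ps" "hd ps"] ps have "map ((+) (hd ps)) (psums (hd ps - hd ps) (map (deg \<Lambda>) (map2 (seg \<Lambda> \<xi>) ps (tl ps)))) = ps"
    by (cases ps) auto
  moreover have "hd ps - hd ps = 0" by (simp add: fun_eq_iff plus_fun_apply minus_apply)
  ultimately show ?thesis by (simp add: points_def simplex_def)
qed

text \<open>
  Cutting inside a segment of \<open>\<xi>\<close> and translating the result by the rest of \<open>\<xi>\<close> is cutting \<open>\<xi>\<close> at
  the translated points.  Together with \<open>cube_seg\<close> below, this is why operators on cells are
  described by translation-equivariant operators in the lattice.
\<close>

lemma simplex_seg:
  assumes \<xi>: "\<xi> \<in> Mor \<Lambda>" and ab: "a \<le> b" "b \<le> deg \<Lambda> \<xi>" and qs: "lattice_chain (b - a) qs"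
  shows "simplex \<xi> (map ((+) a) qs) = (case simplex (seg \<Lambda> \<xi> a b) qs of (t, \<tau>) \<Rightarrow> (t, \<tau> \<cdot> seg \<Lambda> \<xi> b (deg \<Lambda> \<xi>)))"
proof -
  have ne: "qs \<noteq> []" using qs by (auto simp: lattice_chain_def)
  note le = lattice_chain_le[OF qs]
  have le': "q \<le> b - a" if "q \<in> set qs" for q using le[OF that] by auto
  have l: "last qs \<le> b - a" "hd qs \<le> b - a" using le' ne by auto
  have "seg \<Lambda> (seg \<Lambda> \<xi> a b) (hd qs) (hd qs) = seg \<Lambda> \<xi> (a + hd qs) (a + hd qs)"
    by (rule seg_seg[OF \<xi> ab]) (use l in auto)
  moreover have "map2 (seg \<Lambda> (seg \<Lambda> \<xi> a b)) qs (tl qs) = map2 (seg \<Lambda> \<xi>) (map ((+) a) qs) (map ((+) a) (tl qs))"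
  proof (rule nth_equalityI)
    fix i assume "i < length (map2 (seg \<Lambda> (seg \<Lambda> \<xi> a b)) qs (tl qs))"
    then have i: "Suc i < length qs" by auto
    then have "qs ! i \<le> qs ! Suc i" "qs ! Suc i \<le> b - a"
      using qs le'[of "qs ! Suc i"] by (auto simp: lattice_chain_def sorted_wrt_nth_less)
    then show "map2 (seg \<Lambda> (seg \<Lambda> \<xi> a b)) qs (tl qs) ! i = map2 (seg \<Lambda> \<xi>) (map ((+) a) qs) (map ((+) a) (tl qs)) ! i"
      using i by (simp add: nth_tl seg_seg[OF \<xi> ab])
  qed simp
  moreover have "seg \<Lambda> (seg \<Lambda> \<xi> a b) (last qs) (b - a) \<cdot> seg \<Lambda> \<xi> b (deg \<Lambda> \<xi>) = seg \<Lambda> \<xi> (a + last qs) (deg \<Lambda> \<xi>)"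
    using seg_split(2)[OF \<xi>, of "a + last qs" b "deg \<Lambda> \<xi>"] seg_seg[OF \<xi> ab, of "last qs" "b - a"] l ab
      vec_add_le_mono[OF l(1), of a] by (simp add: vec_add_diff)
  ultimately show ?thesis
    using ne \<xi> ab by (simp add: simplex_def deg_seg last_map hd_map map_tl)
qed

end

lemma sum_vec_apply: "(\<Sum>x\<in>A. f x) i = (\<Sum>x\<in>A. f x i :: nat)"
  by (induction A rule: infinite_finite_induct) (auto simp: plus_fun_apply minus_apply)

lemma set_vec_apply: "finite K \<Longrightarrow> set_vec K i = of_bool (i \<in> K)"
  by (simp add: set_vec_def sum_vec_apply scaled_unit_def)

section \<open>Enumerating finite sets of naturals\<close>

text \<open>
  For \<open>j \<in> K\<close> this is the position of \<open>j\<close> in \<open>K\<close>, counted from \<open>0\<close>, whereas \<open>nth_smallest\<close> counts from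
  \<open>1\<close>.  For \<open>j \<notin> K\<close> it is the position at which \<open>j\<close> would be inserted.
\<close>

definition rank :: "nat set \<Rightarrow> nat \<Rightarrow> nat" where
  "rank K j = card {x \<in> K. x < j}"

lemma rank_Suc: "finite K \<Longrightarrow> rank K (Suc j) = rank K j + of_bool (j \<in> K)"
proof -
  assume K: "finite K"
  have "{x \<in> K. x < Suc j} = (if j \<in> K then insert j {x \<in> K. x < j} else {x \<in> K. x < j})"
    by (auto simp: less_Suc_eq)
  then show ?thesis using K by (auto simp: rank_def)
qed

lemma rank_mono: "finite K \<Longrightarrow> i \<le> j \<Longrightarrow> rank K i \<le> rank K j"
  unfolding rank_def by (rule card_mono) auto

lemma rank_less: "finite K \<Longrightarrow> i \<in> K \<Longrightarrow> i < j \<Longrightarrow> rank K i < rank K j"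
  using rank_mono[of K "Suc i" j] by (simp add: rank_Suc)

lemma rank_le_card: "finite K \<Longrightarrow> rank K j \<le> card K"
  unfolding rank_def by (rule card_mono) auto

lemma rank_less_card: "finite K \<Longrightarrow> j \<in> K \<Longrightarrow> rank K j < card K"
  using rank_le_card[of K "Suc j"] by (simp add: rank_Suc)

lemma rank_insert: "finite K \<Longrightarrow> j \<notin> K \<Longrightarrow> rank (insert j K) i = rank K i + of_bool (j < i)"
proof -
  assume K: "finite K" "j \<notin> K"
  have "{x \<in> insert j K. x < i} = (if j < i then insert j {x \<in> K. x < i} else {x \<in> K. x < i})"
    by auto
  then show ?thesis using K by (auto simp: rank_def)
qed

lemma rank_inj: "finite K \<Longrightarrow> inj_on (rank K) K"
proof (rule linorder_inj_onI')
  fix i j assume "finite K" "i \<in> K" "j \<in> K" "i < j"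
  then show "rank K i \<noteq> rank K j" using rank_less[of K i j] by simp
qed

lemma bij_betw_rank: "finite K \<Longrightarrow> bij_betw (rank K) K {..<card K}"
  unfolding bij_betw_def
  by (intro conjI rank_inj card_subset_eq) (auto simp: rank_less_card card_image rank_inj)

lemma nth_smallest_in: 
  assumes "finite K" "i \<in> {1..card K}"
  shows "nth_smallest K i \<in> K" "rank K (nth_smallest K i) = i - 1"
proof -
  let ?xs = "sorted_list_of_set K"
  have xs: "set ?xs = K" "sorted_wrt (<) ?xs" "length ?xs = card K"
    using assms(1) by simp_all
  have i: "i - 1 < length ?xs" using assms(2) by (auto simp: xs(3))
  then show "nth_smallest K i \<in> K"
    unfolding nth_smallest_def using nth_mem[OF i] xs(1) by simp
  have "{x \<in> K. x < ?xs ! (i - 1)} = (!) ?xs ` {..<i - 1}"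
  proof (intro equalityI subsetI)
    fix x assume "x \<in> {x \<in> K. x < ?xs ! (i - 1)}"
    then obtain l where l: "l < length ?xs" "?xs ! l = x" "x < ?xs ! (i - 1)"
      using xs(1) by (metis (mono_tags, lifting) in_set_conv_nth mem_Collect_eq)
    have "l < i - 1"
    proof (rule ccontr)
      assume "\<not> l < i - 1"
      then have "?xs ! (i - 1) \<le> ?xs ! l" using l(1) sorted_nth_mono[of ?xs "i - 1" l] by simp
      then show False using l by simp
    qed
    then show "x \<in> (!) ?xs ` {..<i - 1}" using l by auto
  next
    fix x assume "x \<in> (!) ?xs ` {..<i - 1}"
    then obtain l where l: "l < i - 1" "x = ?xs ! l" by auto
    then have "x < ?xs ! (i - 1)" using sorted_wrt_nth_less[OF xs(2), of l "i - 1"] i by simp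
    moreover have "x \<in> K" using l i nth_mem[of l ?xs] xs(1) by simp
    ultimately show "x \<in> {x \<in> K. x < ?xs ! (i - 1)}" by simp
  qed
  moreover have "inj_on ((!) ?xs) {..<i - 1}"
    using i by (auto intro!: inj_on_nth)
  ultimately show "rank K (nth_smallest K i) = i - 1"
    by (simp add: rank_def nth_smallest_def card_image)
qed

lemma nth_smallest_rank:
  assumes "finite K" "j \<in> K"
  shows "nth_smallest K (Suc (rank K j)) = j"
proof -
  have "Suc (rank K j) \<in> {1..card K}" using rank_less_card[OF assms] by simp
  from nth_smallest_in[OF assms(1) this] rank_inj[OF assms(1)] assms(2) show ?thesis
    by (auto simp: inj_on_def)
qed

lemma bij_betw_nth_smallest: "finite K \<Longrightarrow> bij_betw (nth_smallest K) {1..card K} K"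
  by (rule bij_betw_byWitness[where f' = "\<lambda>j. Suc (rank K j)"])
    (auto simp: nth_smallest_in nth_smallest_rank Suc_le_eq rank_less_card)

lemma nth_smallest_less_iff:
  assumes "finite K" "i \<in> {1..card K}"
  shows "nth_smallest K i < j \<longleftrightarrow> i \<le> rank K j"
proof -
  note n = nth_smallest_in[OF assms]
  show ?thesis
    using rank_less[OF assms(1) n(1), of j] rank_mono[OF assms(1), of j "nth_smallest K i"] n(2) assms(2)
    by (cases "nth_smallest K i < j") auto
qed

text \<open>
  The increasing map that misses the value \<open>j\<close>; it enumerates a list without its \<open>j\<close>-th entry.
\<close>

definition skip :: "nat \<Rightarrow> nat \<Rightarrow> nat" where
  "skip j i = (if i < j then i else Suc i)"

lemma nth_smallest_Diff:
  assumes K: "finite K" and j: "j \<in> {1..card K}" and i: "i \<in> {1..card K - 1}"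
  shows "nth_smallest (K - {nth_smallest K j}) i = nth_smallest K (skip j i)"
proof -
  let ?y = "nth_smallest K j" and ?x = "nth_smallest K (skip j i)"
  have s: "skip j i \<in> {1..card K}" "skip j i \<noteq> j" using i j by (auto simp: skip_def)
  note x = nth_smallest_in[OF K s(1)] and y = nth_smallest_in[OF K j]
  have "?x \<noteq> ?y" using x(2) y(2) s j by auto
  then have x': "?x \<in> K - {?y}" using x by simp
  have "rank K ?x = rank (K - {?y}) ?x + of_bool (?y < ?x)"
    using rank_insert[of "K - {?y}" ?y ?x] K y(1) by (simp add: insert_absorb)
  moreover have "?y < ?x \<longleftrightarrow> j \<le> skip j i - 1"
    using nth_smallest_less_iff[OF K j, of ?x] x(2) by simp
  ultimately have "rank (K - {?y}) ?x = i - 1"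
    using x(2) i by (auto simp: skip_def split: if_splits)
  then show ?thesis
    using nth_smallest_rank[OF _ x'] K i by (simp add: Suc_diff_1 Suc_le_eq)
qed

section \<open>Boundaries in the lattice\<close>

definition omit :: "nat \<Rightarrow> 'p list \<Rightarrow> 'p list" where
  "omit i ps = take i ps @ drop (Suc i) ps"

text \<open>
  A chain of \<open>n + 1\<close> points is an \<open>n\<close>-simplex, with the ordinary simplicial boundary.  In \<open>cube_bd\<close>
  the direction \<open>j\<close> is the \<open>(rank K j + 1)\<close>-st one of the cube, which explains the sign.
\<close>

definition simp_bd :: "'p list \<Rightarrow> 'p list \<Rightarrow>\<^sub>0 int" where
  "simp_bd ps = (\<Sum>i<length ps. frag_cmul ((- 1) ^ i) (frag_of (omit i ps)))"

definition cube_bd :: "nat set \<times> vec \<Rightarrow> nat set \<times> vec \<Rightarrow>\<^sub>0 int" where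
  "cube_bd = (\<lambda>(K, a). \<Sum>j\<in>K. frag_cmul ((- 1) ^ Suc (rank K j))
     (frag_of (K - {j}, a) - frag_of (K - {j}, a + unit_vec j)))"

lemma omit_0 [simp]: "omit 0 ps = tl ps" by (simp add: omit_def drop_Suc)

lemma omit_Suc [simp]: "omit (Suc i) (p # ps) = p # omit i ps" by (simp add: omit_def)

lemma length_omit: "i < length ps \<Longrightarrow> length (omit i ps) = length ps - 1" by (simp add: omit_def)

lemma omit_last: "omit (length ps - 1) ps = butlast ps"
  by (cases "ps = []") (auto simp: omit_def butlast_conv_take)

lemma nth_omit: "i < length ps \<Longrightarrow> j < length ps - 1 \<Longrightarrow> omit i ps ! j = ps ! skip i j"
  by (auto simp: omit_def skip_def nth_append min_def)

lemma omit_append: "i < length ps \<Longrightarrow> omit i (ps @ [q]) = omit i ps @ [q]"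
  by (simp add: omit_def)

lemma lattice_chain_nth:
  assumes "lattice_chain D ps" "i \<le> j" "j < length ps"
  shows "hd ps \<le> ps ! i" "ps ! i \<le> ps ! j" "ps ! j \<le> last ps"
proof -
  show "hd ps \<le> ps ! i" "ps ! j \<le> last ps" using lattice_chain_le[OF assms(1)] assms(2,3) by auto
  show "ps ! i \<le> ps ! j"
    using assms sorted_wrt_nth_less[of "(\<le>)" ps i j] by (cases "i = j") (auto simp: lattice_chain_def)
qed

lemma lattice_chain_omit:
  assumes "lattice_chain D ps" "length ps \<ge> 2" "i < length ps"
  shows "lattice_chain D (omit i ps)"
proof -
  have "sorted_wrt (\<le>) (take i ps @ ps ! i # drop (Suc i) ps)"
    using assms(1,3) by (simp add: lattice_chain_def flip: id_take_nth_drop)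
  then have "sorted_wrt (\<le>) (omit i ps)"
    by (simp add: omit_def sorted_wrt_append)
  moreover have ne: "omit i ps \<noteq> []"
    using length_omit[OF assms(3)] assms(2) by (metis One_nat_def diff_is_0_eq list.size(3) numeral_2_eq_2 not_less_eq_eq)
  moreover have "set (omit i ps) \<subseteq> set ps"
    unfolding omit_def by (auto dest: in_set_takeD in_set_dropD)
  ultimately show ?thesis
    using lattice_chain_le[OF assms(1), of "last (omit i ps)"] last_in_set[OF ne]
    unfolding lattice_chain_def by (metis order_trans subsetD)
qed

text \<open>
  The recursion for the boundary of a cone with apex \<open>p\<close>.  It makes \<open>simp_bd_simp_bd\<close> an induction on
  the number of points.
\<close>

lemma simp_bd_Cons:
  "simp_bd (p # ps) = frag_of ps - frag_extend (\<lambda>qs. frag_of (p # qs)) (simp_bd ps)"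
proof -
  have "frag_extend (\<lambda>qs. frag_of (p # qs)) (simp_bd ps) = (\<Sum>i<length ps. frag_cmul ((- 1) ^ i) (frag_of (p # omit i ps)))"
    unfolding simp_bd_def by (simp add: frag_extend_sum frag_extend_cmul o_def)
  also have "\<dots> = - (\<Sum>i<length ps. frag_cmul ((- 1) ^ Suc i) (frag_of (p # omit i ps)))"
    by (simp add: sum_negf del: minus_frag_cmul flip: minus_frag_cmul)
  finally show ?thesis
    by (simp add: simp_bd_def sum.lessThan_Suc_shift del: sum.lessThan_Suc)
qed

lemma simp_bd_simp_bd: "frag_extend simp_bd (simp_bd ps) = 0"
proof (induction ps)
  case (Cons p ps)
  have "frag_extend simp_bd (frag_extend (\<lambda>qs. frag_of (p # qs)) c)
      = c - frag_extend (\<lambda>qs. frag_of (p # qs)) (frag_extend simp_bd c)" for c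
  proof -
    have "frag_extend simp_bd (frag_extend (\<lambda>qs. frag_of (p # qs)) c) = frag_extend (\<lambda>qs. simp_bd (p # qs)) c"
      using frag_extend_compose[of simp_bd "(#) p" c] by (simp add: o_def)
    also have "\<dots> = c - frag_extend (\<lambda>qs. frag_of (p # qs)) (frag_extend simp_bd c)"
      by (induction c rule: frag_induction[OF subset_UNIV]) (simp_all add: simp_bd_Cons frag_extend_diff)
    finally show ?thesis .
  qed
  then show ?case using Cons.IH by (simp add: simp_bd_Cons frag_extend_diff)
qed (simp add: simp_bd_def)

lemma simp_bd_snoc:
  "simp_bd (ps @ [q]) = frag_extend (\<lambda>qs. frag_of (qs @ [q])) (simp_bd ps) + frag_cmul ((- 1) ^ length ps) (frag_of ps)"
proof -
  have "frag_extend (\<lambda>qs. frag_of (qs @ [q])) (simp_bd ps) = (\<Sum>i<length ps. frag_cmul ((- 1) ^ i) (frag_of (omit i ps @ [q])))"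
    unfolding simp_bd_def by (simp add: frag_extend_sum frag_extend_cmul o_def)
  moreover have "omit (length ps) (ps @ [q]) = ps" by (simp add: omit_def)
  ultimately show ?thesis
    by (simp add: simp_bd_def omit_append)
qed

section \<open>The box operator in the lattice\<close>

text \<open>
  The condition on coordinate \<open>j\<close> for the cube with directions \<open>K\<close> and lower corner \<open>a\<close> to occur in the
  image of the simplex \<open>ps\<close>.  The Alexander-Whitney map projects the simplex to its edge number
  \<open>rank K j\<close> if \<open>j \<in> K\<close>, and to its vertex number \<open>rank K j\<close> otherwise.  In the first case the interval
  from \<open>a j\<close> to \<open>a j + 1\<close> has to be one of the unit intervals that subdivide the projection of the
  edge; in the second case \<open>a j\<close> has to be the coordinate of the vertex.
\<close>

definition box_cond :: "nat set \<Rightarrow> vec list \<Rightarrow> vec \<Rightarrow> nat \<Rightarrow> bool" where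
  "box_cond K ps a j = (if j \<in> K then (ps ! rank K j) j \<le> a j \<and> a j < (ps ! Suc (rank K j)) j
     else a j = (ps ! rank K j) j)"

definition box_cubes :: "nat \<Rightarrow> vec list \<Rightarrow> (nat set \<times> vec) set" where
  "box_cubes k ps = {(K, a). K \<subseteq> {1..k} \<and> Suc (card K) = length ps \<and> a \<in> Nvec k \<and> (\<forall>j\<in>{1..k}. box_cond K ps a j)}"

definition box_sum :: "nat \<Rightarrow> vec list \<Rightarrow> nat set \<times> vec \<Rightarrow>\<^sub>0 int" where
  "box_sum k ps = (\<Sum>x\<in>box_cubes k ps. frag_of x)"

lemma finite_Nvec_le: "finite {a \<in> Nvec k. a \<le> D}"
proof -
  let ?B = "{..(\<Sum>j\<in>{1..k}. D j)}"
  have "D j \<le> (\<Sum>j\<in>{1..k}. D j)" if "j \<in> {1..k}" for j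
    by (rule member_le_sum) (use that in auto)
  then have "{a \<in> Nvec k. a \<le> D} \<subseteq> {a. \<forall>j. (j \<in> {1..k} \<longrightarrow> a j \<in> ?B) \<and> (j \<notin> {1..k} \<longrightarrow> a j = 0)}"
    by (auto simp: Nvec_def le_fun_def) (meson atLeastAtMost_iff order_trans)+
  then show ?thesis
    by (rule finite_subset) (rule finite_set_of_finite_funs; simp)
qed

lemma box_cubes_le:
  assumes ps: "lattice_chain D ps" and D: "D \<in> Nvec k" and x: "(K, a) \<in> box_cubes k ps"
  shows "hd ps \<le> a" "a + set_vec K \<le> last ps"
proof -
  have K: "K \<subseteq> {1..k}" "Suc (card K) = length ps" "a \<in> Nvec k"
    and cond: "\<And>j. j \<in> {1..k} \<Longrightarrow> box_cond K ps a j"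
    using x by (auto simp: box_cubes_def)
  have fin: "finite K" using K(1) finite_subset by auto
  have ne: "ps \<noteq> []" using ps by (auto simp: lattice_chain_def)
  have "last ps \<in> Nvec k" "hd ps \<in> Nvec k"
    using lattice_chain_le[OF ps hd_in_set[OF ne]] Nvec_le D by (auto intro: Nvec_le order_trans)
  then have out: "hd ps j = 0" "last ps j = 0" "a j = 0" "j \<notin> K" if "j \<notin> {1..k}" for j
    using that K by (auto simp: Nvec_def)
  have "hd ps j \<le> a j \<and> a j + of_bool (j \<in> K) \<le> last ps j" for j
  proof (cases "j \<in> {1..k}")
    case True
    have r: "rank K j < length ps" using rank_le_card[OF fin, of j] K(2) by simp
    note 1 = lattice_chain_nth[OF ps order_refl r, THEN le_funD, of j]
    show ?thesis
    proof (cases "j \<in> K")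
      case j: True
      have "Suc (rank K j) < length ps" using rank_less_card[OF fin j] K(2) by simp
      from lattice_chain_nth(3)[OF ps order_refl this, THEN le_funD, of j] 1 cond[OF True] j
      show ?thesis by (auto simp: box_cond_def)
    next
      case False
      then show ?thesis using 1 cond[OF True] by (auto simp: box_cond_def)
    qed
  qed (simp add: out)
  then show "hd ps \<le> a" "a + set_vec K \<le> last ps"
    by (auto simp: le_fun_def plus_fun_apply set_vec_apply fin)
qed

lemma finite_box_cubes:
  assumes "lattice_chain D ps" "D \<in> Nvec k"
  shows "finite (box_cubes k ps)"
proof (rule finite_subset)
  show "box_cubes k ps \<subseteq> Pow {1..k} \<times> {a \<in> Nvec k. a \<le> last ps}"
  proof
    fix x assume x: "x \<in> box_cubes k ps"
    obtain K a where xK: "x = (K, a)" by (cases x)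
    show "x \<in> Pow {1..k} \<times> {a \<in> Nvec k. a \<le> last ps}"
      using order_trans[OF vec_le_add box_cubes_le(2)[OF assms x[unfolded xK]]] x by (auto simp: box_cubes_def xK)
  qed
qed (simp add: finite_Nvec_le)

lemma lookup_box_sum: "finite (box_cubes k ps) \<Longrightarrow> lookup (box_sum k ps) x = of_bool (x \<in> box_cubes k ps)"
  by (simp add: box_sum_def lookup_sum)

lemma sum_of_bool_eq: "finite B \<Longrightarrow> (\<Sum>x\<in>B. of_bool (x = y) * f x) = of_bool (y \<in> B) * (f y :: int)"
  by (simp add: of_bool_def if_distrib[of "\<lambda>z. z * _"] cong: if_cong)

text \<open>
  A cube \<open>(K, a)\<close> is a face in direction \<open>j\<close> of two cubes, namely the lower one of \<open>(insert j K, a)\<close>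
  and the upper one of \<open>(insert j K, a - e\<^sub>j)\<close>.  Subtraction of vectors truncates, so that the second
  cube exists only if \<open>1 \<le> a j\<close>.
\<close>

lemma lookup_cube_bd_box_sum:
  assumes fin: "finite (box_cubes k ps)" and K: "finite K"
  shows "lookup (frag_extend cube_bd (box_sum k ps)) (K, a) =
    (\<Sum>j\<in>{1..k} - K. (- 1) ^ Suc (rank K j) *
       (of_bool ((insert j K, a) \<in> box_cubes k ps) -
        of_bool (1 \<le> a j \<and> (insert j K, a - unit_vec j) \<in> box_cubes k ps)))"
proof -
  let ?B = "box_cubes k ps" and ?s = "\<lambda>j. (- 1) ^ Suc (rank K j) :: int"
  have "lookup (frag_extend cube_bd (box_sum k ps)) (K, a) =
      (\<Sum>x\<in>?B. lookup (cube_bd x) (K, a))"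
    using fin by (simp add: box_sum_def frag_extend_sum lookup_sum)
  also have "\<dots> = (\<Sum>x\<in>?B. \<Sum>j\<in>{1..k} - K. ?s j * (of_bool (x = (insert j K, a)) - of_bool (1 \<le> a j \<and> x = (insert j K, a - unit_vec j))))"
  proof (rule sum.cong[OF refl])
    fix x assume x: "x \<in> ?B"
    obtain L b where xL: "x = (L, b)" by (cases x)
    have L: "L \<subseteq> {1..k}" using x by (auto simp: xL box_cubes_def)
    then have finL: "finite L" using finite_subset by auto
    have bj: "b + unit_vec j = a \<longleftrightarrow> 1 \<le> a j \<and> b = a - unit_vec j" for j
      by (auto simp: fun_eq_iff plus_fun_apply minus_apply scaled_unit_def)
    have Lj: "j \<in> L \<and> L - {j} = K \<longleftrightarrow> j \<notin> K \<and> L = insert j K" for j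
      by auto
    have rk: "rank L j = rank K j" if "j \<notin> K" "L = insert j K" for j
      using that by (simp add: rank_insert K)
    have "lookup (cube_bd x) (K, a) =
        (\<Sum>j\<in>L. (- 1) ^ Suc (rank L j) * (of_bool (L - {j} = K \<and> b = a) - of_bool (L - {j} = K \<and> b + unit_vec j = a)))"
      by (simp add: xL cube_bd_def lookup_sum lookup_minus eq_commute[of K] eq_commute[of a] of_bool_def)
    also have "\<dots> = (\<Sum>j\<in>L. ?s j * (of_bool (x = (insert j K, a) \<and> j \<notin> K) - of_bool (1 \<le> a j \<and> x = (insert j K, a - unit_vec j) \<and> j \<notin> K)))"
    proof (rule sum.cong[OF refl])
      fix j assume "j \<in> L"
      then show "(- 1) ^ Suc (rank L j) * (of_bool (L - {j} = K \<and> b = a) - of_bool (L - {j} = K \<and> b + unit_vec j = a)) =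
        ?s j * (of_bool (x = (insert j K, a) \<and> j \<notin> K) - of_bool (1 \<le> a j \<and> x = (insert j K, a - unit_vec j) \<and> j \<notin> K))"
        using Lj[of j] rk[of j] by (cases "j \<notin> K \<and> L = insert j K") (auto simp: xL bj simp del: One_nat_def)
    qed
    also have "\<dots> = (\<Sum>j\<in>{1..k} - K. ?s j * (of_bool (x = (insert j K, a)) - of_bool (1 \<le> a j \<and> x = (insert j K, a - unit_vec j))))"
      by (rule sum.mono_neutral_cong) (use L finL in \<open>auto simp: xL\<close>)
    finally show "lookup (cube_bd x) (K, a) =
      (\<Sum>j\<in>{1..k} - K. ?s j * (of_bool (x = (insert j K, a)) - of_bool (1 \<le> a j \<and> x = (insert j K, a - unit_vec j))))" .
  qed
  also have "\<dots> = (\<Sum>j\<in>{1..k} - K. \<Sum>x\<in>?B. ?s j * (of_bool (x = (insert j K, a)) - of_bool (1 \<le> a j \<and> x = (insert j K, a - unit_vec j))))"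
    by (rule sum.swap)
  also have "\<dots> = (\<Sum>j\<in>{1..k} - K. ?s j * (of_bool ((insert j K, a) \<in> ?B) - of_bool (1 \<le> a j \<and> (insert j K, a - unit_vec j) \<in> ?B)))"
  proof (rule sum.cong[OF refl])
    fix j
    have "(\<Sum>x\<in>?B. of_bool (x = (insert j K, a)) :: int) = of_bool ((insert j K, a) \<in> ?B)"
      using sum_of_bool_eq[OF fin, of "(insert j K, a)" "\<lambda>_. 1"] by simp
    moreover have "(\<Sum>x\<in>?B. of_bool (1 \<le> a j \<and> x = (insert j K, a - unit_vec j)) :: int) = of_bool (1 \<le> a j \<and> (insert j K, a - unit_vec j) \<in> ?B)"
      using sum_of_bool_eq[OF fin, of "(insert j K, a - unit_vec j)" "\<lambda>_. 1"] by (cases "1 \<le> a j") simp_all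
    ultimately show "(\<Sum>x\<in>?B. ?s j * (of_bool (x = (insert j K, a)) - of_bool (1 \<le> a j \<and> x = (insert j K, a - unit_vec j))))
      = ?s j * (of_bool ((insert j K, a) \<in> ?B) - of_bool (1 \<le> a j \<and> (insert j K, a - unit_vec j) \<in> ?B))"
      by (simp only: sum_distrib_left[symmetric] sum_subtractf)
  qed
  finally show ?thesis .
qed

text \<open>
  The length of \<open>ps\<close> here exceeds by one what suits the cube \<open>(K, a)\<close>, so one point has to be dropped.
  Dropping the last one leaves the positions of the other points unchanged, dropping the first one
  shifts them, and \<open>hybrid\<close> mixes the resulting conditions: coordinates below the threshold \<open>\<theta>\<close> use
  the unshifted chain and the others use the shifted one.  Moving the threshold over one
  coordinate \<open>j\<close> at a time connects the coefficients for the last and the first face.  A step at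
  \<open>j \<in> K\<close> contributes an inner face of \<open>ps\<close>, and a step at \<open>j \<notin> K\<close> the two cubes that have \<open>(K, a)\<close> as
  a face in direction \<open>j\<close>.
\<close>

definition hybrid :: "nat \<Rightarrow> nat set \<Rightarrow> vec list \<Rightarrow> vec \<Rightarrow> nat \<Rightarrow> int" where
  "hybrid k K ps a \<theta> = (\<Prod>j\<in>{1..<\<theta>}. of_bool (box_cond K (butlast ps) a j)) * (\<Prod>j\<in>{\<theta>..k}. of_bool (box_cond K (tl ps) a j))"

lemma of_bool_ball: "finite A \<Longrightarrow> of_bool (\<forall>j\<in>A. P j) = (\<Prod>j\<in>A. of_bool (P j) :: int)"
  by (induction A rule: finite_induct) auto

lemma prod_split_at:
  assumes "j \<in> {1..k}"
  shows "(\<Prod>i\<in>{1..k}. f i) = (\<Prod>i\<in>{1..<j}. f i) * f j * (\<Prod>i\<in>{Suc j..k}. f i :: int)"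
proof -
  have "{1..k} = {1..<j} \<union> ({j} \<union> {Suc j..k})" using assms by auto
  then have "(\<Prod>i\<in>{1..k}. f i) = (\<Prod>i\<in>{1..<j} \<union> ({j} \<union> {Suc j..k}). f i)" by simp
  also have "\<dots> = (\<Prod>i\<in>{1..<j}. f i) * (\<Prod>i\<in>{j} \<union> {Suc j..k}. f i)"
    by (rule prod.union_disjoint) auto
  also have "(\<Prod>i\<in>{j} \<union> {Suc j..k}. f i) = f j * (\<Prod>i\<in>{Suc j..k}. f i)"
    by (subst prod.union_disjoint) auto
  finally show ?thesis by (simp add: mult.assoc)
qed

lemma hybrid_at:
  assumes "j \<in> {1..k}"
  shows "hybrid k K ps a j = (\<Prod>j\<in>{1..<j}. of_bool (box_cond K (butlast ps) a j)) *
      of_bool (box_cond K (tl ps) a j) * (\<Prod>j\<in>{Suc j..k}. of_bool (box_cond K (tl ps) a j))"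
    and "hybrid k K ps a (Suc j) = (\<Prod>j\<in>{1..<j}. of_bool (box_cond K (butlast ps) a j)) *
      of_bool (box_cond K (butlast ps) a j) * (\<Prod>j\<in>{Suc j..k}. of_bool (box_cond K (tl ps) a j))"
proof -
  have "{j..k} = insert j {Suc j..k}" "{1..<Suc j} = insert j {1..<j}" using assms by auto
  then show "hybrid k K ps a j = (\<Prod>j\<in>{1..<j}. of_bool (box_cond K (butlast ps) a j)) *
      of_bool (box_cond K (tl ps) a j) * (\<Prod>j\<in>{Suc j..k}. of_bool (box_cond K (tl ps) a j))"
    "hybrid k K ps a (Suc j) = (\<Prod>j\<in>{1..<j}. of_bool (box_cond K (butlast ps) a j)) *
      of_bool (box_cond K (butlast ps) a j) * (\<Prod>j\<in>{Suc j..k}. of_bool (box_cond K (tl ps) a j))"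
    by (simp_all add: hybrid_def mult_ac)
qed

context
  fixes k :: nat and D :: vec and ps :: "vec list" and K :: "nat set" and a :: vec
  assumes ps: "lattice_chain D ps" and K: "K \<subseteq> {1..k}" and card_K: "length ps = Suc (Suc (card K))"
    and a: "a \<in> Nvec k"
begin

lemma finite_K: "finite K"
  using K finite_subset by auto

lemma box_cond_butlast: "box_cond K (butlast ps) a j =
    (if j \<in> K then (ps ! rank K j) j \<le> a j \<and> a j < (ps ! Suc (rank K j)) j else a j = (ps ! rank K j) j)"
  using rank_le_card[OF finite_K, of j] rank_less_card[OF finite_K, of j] card_K
  by (auto simp: box_cond_def nth_butlast)

lemma box_cond_tl: "box_cond K (tl ps) a j =
    (if j \<in> K then (ps ! Suc (rank K j)) j \<le> a j \<and> a j < (ps ! Suc (Suc (rank K j))) j else a j = (ps ! Suc (rank K j)) j)"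
  using rank_le_card[OF finite_K, of j] rank_less_card[OF finite_K, of j] card_K
  by (auto simp: box_cond_def nth_tl)

text \<open>
  A new direction \<open>j\<close> raises the rank of exactly the coordinates above \<open>j\<close>, so that these see the
  chain shifted by one point.
\<close>

lemma box_cond_insert:
  assumes "j \<notin> K" "i \<noteq> j"
  shows "box_cond (insert j K) ps b i = (if i < j then box_cond K (butlast ps) b i else box_cond K (tl ps) b i)"
proof -
  have "rank (insert j K) i = rank K i + of_bool (j < i)" by (rule rank_insert[OF finite_K assms(1)])
  then show ?thesis
    using assms rank_le_card[OF finite_K, of i] rank_less_card[OF finite_K, of i] card_K
    by (auto simp: box_cond_def nth_butlast nth_tl)
qed

lemma box_cond_omit:
  assumes "i \<le> Suc (card K)"
  shows "Suc (rank K j) < i \<Longrightarrow> box_cond K (omit i ps) a j = box_cond K (butlast ps) a j"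
    and "j \<notin> K \<Longrightarrow> rank K j < i \<Longrightarrow> box_cond K (omit i ps) a j = box_cond K (butlast ps) a j"
    and "i \<le> rank K j \<Longrightarrow> box_cond K (omit i ps) a j = box_cond K (tl ps) a j"
  using assms rank_le_card[OF finite_K, of j] rank_less_card[OF finite_K, of j] card_K
  by (auto simp: box_cond_def nth_omit skip_def nth_butlast nth_tl)

text \<open>
  Only coordinate \<open>j\<close> distinguishes the two sides.  There, with \<open>x \<le> y\<close> the \<open>j\<close>-coordinates of
  consecutive points, the indicator functions of \<open>{x..<y}\<close> and of its translate by \<open>1\<close> differ by
  those of the end points \<open>x\<close> and \<open>y\<close>.
\<close>

lemma box_cubes_insert_hybrid:
  assumes j: "j \<in> {1..k} - K"
  shows "of_bool ((insert j K, a) \<in> box_cubes k ps) - of_bool (1 \<le> a j \<and> (insert j K, a - unit_vec j) \<in> box_cubes k ps)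
    = hybrid k K ps a (Suc j) - hybrid k K ps a j"
proof -
  let ?P = "(\<Prod>j\<in>{1..<j}. of_bool (box_cond K (butlast ps) a j)) :: int"
  let ?Q = "(\<Prod>j\<in>{Suc j..k}. of_bool (box_cond K (tl ps) a j)) :: int"
  let ?r = "rank K j"
  have rk: "rank (insert j K) j = ?r" using j by (simp add: rank_insert[OF finite_K])
  have main: "of_bool ((insert j K, b) \<in> box_cubes k ps) =
      ?P * of_bool ((ps ! ?r) j \<le> b j \<and> b j < (ps ! Suc ?r) j) * ?Q"
    if b: "b \<in> Nvec k" "\<And>i. i \<noteq> j \<Longrightarrow> b i = a i" for b
  proof -
    have ba: "box_cond L qs b i = box_cond L qs a i" if "i \<noteq> j" for L qs i
      using b(2)[OF that] by (simp add: box_cond_def)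
    have "(insert j K, b) \<in> box_cubes k ps \<longleftrightarrow> (\<forall>i\<in>{1..k}. box_cond (insert j K) ps b i)"
      using K j b(1) card_K finite_K by (auto simp: box_cubes_def)
    also have "of_bool \<dots> = (\<Prod>i\<in>{1..k}. of_bool (box_cond (insert j K) ps b i) :: int)"
      by (rule of_bool_ball) simp
    also have "\<dots> = (\<Prod>i\<in>{1..<j}. of_bool (box_cond (insert j K) ps b i)) * of_bool (box_cond (insert j K) ps b j)
        * (\<Prod>i\<in>{Suc j..k}. of_bool (box_cond (insert j K) ps b i))"
      by (rule prod_split_at) (use j in auto)
    also have "(\<Prod>i\<in>{1..<j}. of_bool (box_cond (insert j K) ps b i)) = ?P"
      by (rule prod.cong) (use j in \<open>auto simp: box_cond_insert ba\<close>)
    also have "(\<Prod>i\<in>{Suc j..k}. of_bool (box_cond (insert j K) ps b i)) = ?Q"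
      by (rule prod.cong) (use j in \<open>auto simp: box_cond_insert ba\<close>)
    also have "box_cond (insert j K) ps b j \<longleftrightarrow> (ps ! ?r) j \<le> b j \<and> b j < (ps ! Suc ?r) j"
      by (simp add: box_cond_def rk)
    finally show ?thesis .
  qed
  have 2: "of_bool (1 \<le> a j \<and> (insert j K, a - unit_vec j) \<in> box_cubes k ps) =
      ?P * of_bool (1 \<le> a j \<and> (ps ! ?r) j \<le> a j - 1 \<and> a j - 1 < (ps ! Suc ?r) j) * ?Q"
    using main[of "a - unit_vec j"] Nvec_diff[OF a] by (auto simp: minus_apply scaled_unit_def)
  have le: "(ps ! ?r) j \<le> (ps ! Suc ?r) j"
    using lattice_chain_nth(2)[OF ps, of ?r "Suc ?r"] rank_le_card[OF finite_K, of j] card_K by (simp add: le_fun_def)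
  have step: "of_bool (x \<le> c \<and> c < y) - of_bool (1 \<le> c \<and> x \<le> c - 1 \<and> c - 1 < y) = (of_bool (c = x) - of_bool (c = y) :: int)"
    if "x \<le> y" for x y c :: nat
    using that by (cases c) (auto simp: of_bool_def)
  let ?U = "of_bool (a j = (ps ! ?r) j) :: int" and ?V = "of_bool (a j = (ps ! Suc ?r) j) :: int"
  have "of_bool ((insert j K, a) \<in> box_cubes k ps) - of_bool (1 \<le> a j \<and> (insert j K, a - unit_vec j) \<in> box_cubes k ps)
      = ?P * (of_bool ((ps ! ?r) j \<le> a j \<and> a j < (ps ! Suc ?r) j)
          - of_bool (1 \<le> a j \<and> (ps ! ?r) j \<le> a j - 1 \<and> a j - 1 < (ps ! Suc ?r) j)) * ?Q"
    unfolding main[OF a refl] 2 by (simp only: right_diff_distrib left_diff_distrib)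
  also have "\<dots> = ?P * (?U - ?V) * ?Q"
    by (simp only: step[OF le])
  also have "\<dots> = ?P * ?U * ?Q - ?P * ?V * ?Q"
    by (simp only: right_diff_distrib left_diff_distrib)
  also have "\<dots> = hybrid k K ps a (Suc j) - hybrid k K ps a j"
    using hybrid_at[of j k K ps a] j by (simp add: box_cond_butlast box_cond_tl)
  finally show ?thesis .
qed

lemma box_cubes_omit: "i \<le> Suc (card K) \<Longrightarrow> of_bool ((K, a) \<in> box_cubes k (omit i ps)) = (\<Prod>j\<in>{1..k}. of_bool (box_cond K (omit i ps) a j) :: int)"
  using K a card_K by (simp add: box_cubes_def length_omit of_bool_ball[symmetric])

lemma box_cubes_omit_first: "of_bool ((K, a) \<in> box_cubes k (omit 0 ps)) = hybrid k K ps a 1"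
  by (subst box_cubes_omit) (simp_all add: hybrid_def)

lemma box_cubes_omit_last: "of_bool ((K, a) \<in> box_cubes k (omit (Suc (card K)) ps)) = hybrid k K ps a (Suc k)"
  using omit_last[of ps] card_K by (subst box_cubes_omit) (auto simp: hybrid_def atLeastLessThanSuc_atLeastAtMost)

text \<open>
  Dropping an inner point merges two consecutive edges.  In direction \<open>j\<close> the merged interval is the
  disjoint union of the two, while the coordinates below \<open>j\<close> do not see the shift and those above
  \<open>j\<close> do.
\<close>

lemma box_cubes_omit_inner:
  assumes j: "j \<in> K"
  shows "of_bool ((K, a) \<in> box_cubes k (omit (Suc (rank K j)) ps)) = hybrid k K ps a j + hybrid k K ps a (Suc j)"
proof -
  let ?r = "rank K j"
  have r: "?r < card K" using rank_less_card[OF finite_K j] .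
  have jk: "j \<in> {1..k}" using j K by auto
  let ?P = "(\<Prod>j\<in>{1..<j}. of_bool (box_cond K (butlast ps) a j)) :: int"
  let ?Q = "(\<Prod>j\<in>{Suc j..k}. of_bool (box_cond K (tl ps) a j)) :: int"
  have "of_bool ((K, a) \<in> box_cubes k (omit (Suc ?r) ps)) = (\<Prod>i\<in>{1..k}. of_bool (box_cond K (omit (Suc ?r) ps) a i) :: int)"
    using r by (simp add: box_cubes_omit)
  also have "\<dots> = (\<Prod>i\<in>{1..<j}. of_bool (box_cond K (omit (Suc ?r) ps) a i)) * of_bool (box_cond K (omit (Suc ?r) ps) a j)
        * (\<Prod>i\<in>{Suc j..k}. of_bool (box_cond K (omit (Suc ?r) ps) a i))"
    by (rule prod_split_at[OF jk])
  also have "(\<Prod>i\<in>{1..<j}. of_bool (box_cond K (omit (Suc ?r) ps) a i)) = ?P"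
  proof (rule prod.cong[OF refl])
    fix i assume "i \<in> {1..<j}"
    then have "rank K i \<le> ?r" "i \<in> K \<Longrightarrow> rank K i < ?r"
      using rank_mono[OF finite_K, of i j] rank_less[OF finite_K, of i j] by auto
    then show "of_bool (box_cond K (omit (Suc ?r) ps) a i) = (of_bool (box_cond K (butlast ps) a i) :: int)"
      using r box_cond_omit(1,2)[of "Suc ?r" i] by (cases "i \<in> K") auto
  qed
  also have "(\<Prod>i\<in>{Suc j..k}. of_bool (box_cond K (omit (Suc ?r) ps) a i)) = ?Q"
  proof (rule prod.cong[OF refl])
    fix i assume "i \<in> {Suc j..k}"
    then have "Suc ?r \<le> rank K i" using rank_less[OF finite_K j, of i] by auto
    then show "of_bool (box_cond K (omit (Suc ?r) ps) a i) = (of_bool (box_cond K (tl ps) a i) :: int)"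
      using r box_cond_omit(3)[of "Suc ?r" i] by auto
  qed
  also have "box_cond K (omit (Suc ?r) ps) a j \<longleftrightarrow> (ps ! ?r) j \<le> a j \<and> a j < (ps ! Suc (Suc ?r)) j"
    using r card_K j by (simp add: box_cond_def nth_omit skip_def)
  also have "of_bool \<dots> = (of_bool (box_cond K (tl ps) a j) + of_bool (box_cond K (butlast ps) a j) :: int)"
  proof -
    have "(ps ! ?r) j \<le> (ps ! Suc ?r) j" "(ps ! Suc ?r) j \<le> (ps ! Suc (Suc ?r)) j"
      using lattice_chain_nth(2)[OF ps, of ?r "Suc ?r"] lattice_chain_nth(2)[OF ps, of "Suc ?r" "Suc (Suc ?r)"] r card_K
      by (simp_all add: le_fun_def)
    then show ?thesis using j by (auto simp: box_cond_tl box_cond_butlast of_bool_def)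
  qed
  finally show ?thesis using hybrid_at[OF jk, of K ps a] by (simp add: algebra_simps)
qed

text \<open>
  The terms \<open>S \<theta>\<close> carry the sign \<open>(-1)\<close> to the power \<open>rank K \<theta>\<close>.  This sign changes across the
  elements of \<open>K\<close> only, so a step of the telescope is a sum of two hybrids at \<open>j \<in> K\<close> and a difference
  at \<open>j \<notin> K\<close>, as \<open>box_cubes_omit_inner\<close> and \<open>box_cubes_insert_hybrid\<close> require.
\<close>

lemma box_telescope:
  "(\<Sum>j\<in>{1..k} - K. (- 1) ^ Suc (rank K j) *
       (of_bool ((insert j K, a) \<in> box_cubes k ps) -
        of_bool (1 \<le> a j \<and> (insert j K, a - unit_vec j) \<in> box_cubes k ps)))
    = (\<Sum>i<length ps. (- 1) ^ i * of_bool ((K, a) \<in> box_cubes k (omit i ps)) :: int)"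
proof -
  let ?E = "hybrid k K ps a" and ?X = "\<lambda>i. of_bool ((K, a) \<in> box_cubes k (omit i ps)) :: int"
  define S where "S \<theta> = (- 1) ^ rank K \<theta> * ?E \<theta>" for \<theta>
  \<comment> \<open>The two ends of the telescope are the last and the first face of \<open>ps\<close>.\<close>
  have "(\<Sum>j\<in>{1..k}. S (Suc j) - S j) = S (Suc k) - S 1"
    by (rule sum_Suc_diff) simp
  also have "S (Suc k) = (- 1) ^ card K * ?X (Suc (card K))"
  proof -
    have "{x \<in> K. x < Suc k} = K" using K by auto
    then show ?thesis by (simp add: S_def rank_def box_cubes_omit_last)
  qed
  also have "S 1 = ?X 0"
  proof -
    have "{x \<in> K. x < 1} = {}" using K by auto
    then have "rank K 1 = 0" unfolding rank_def by (simp only: card.empty)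
    then show ?thesis unfolding S_def by (simp add: box_cubes_omit_first del: omit_0 One_nat_def)
  qed
  also have "(\<Sum>j\<in>{1..k}. S (Suc j) - S j) = (\<Sum>j\<in>K. S (Suc j) - S j) + (\<Sum>j\<in>{1..k} - K. S (Suc j) - S j)"
    using K by (subst sum.subset_diff[of K]) (auto simp: add.commute)
  also have "(\<Sum>j\<in>K. S (Suc j) - S j) = (\<Sum>j\<in>K. (- 1) ^ Suc (rank K j) * ?X (Suc (rank K j)))"
    by (rule sum.cong) (auto simp: S_def rank_Suc[OF finite_K] box_cubes_omit_inner algebra_simps)
  also have "\<dots> = (\<Sum>i<card K. (- 1) ^ Suc i * ?X (Suc i))"
    by (rule sum.reindex_bij_betw[OF bij_betw_rank[OF finite_K]])
  also have "(\<Sum>j\<in>{1..k} - K. S (Suc j) - S j) = - (\<Sum>j\<in>{1..k} - K. (- 1) ^ Suc (rank K j) *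
       (of_bool ((insert j K, a) \<in> box_cubes k ps) -
        of_bool (1 \<le> a j \<and> (insert j K, a - unit_vec j) \<in> box_cubes k ps)))"
    unfolding sum_negf[symmetric]
  proof (rule sum.cong[OF refl])
    fix j assume j: "j \<in> {1..k} - K"
    show "S (Suc j) - S j = - ((- 1) ^ Suc (rank K j) *
       (of_bool ((insert j K, a) \<in> box_cubes k ps) -
        of_bool (1 \<le> a j \<and> (insert j K, a - unit_vec j) \<in> box_cubes k ps)))"
      unfolding box_cubes_insert_hybrid[OF j]
      using j by (simp add: S_def rank_Suc[OF finite_K] algebra_simps)
  qed
  finally have tele: "(\<Sum>i<card K. (- 1) ^ Suc i * ?X (Suc i)) + - (\<Sum>j\<in>{1..k} - K. (- 1) ^ Suc (rank K j) *
       (of_bool ((insert j K, a) \<in> box_cubes k ps) -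
        of_bool (1 \<le> a j \<and> (insert j K, a - unit_vec j) \<in> box_cubes k ps)))
      = (- 1) ^ card K * ?X (Suc (card K)) - ?X 0" .
  have "(\<Sum>i<Suc (Suc n). f i) = f 0 + (\<Sum>i<n. f (Suc i)) + f (Suc n)" for f :: "nat \<Rightarrow> int" and n
    by (simp only: sum.lessThan_Suc[of f "Suc n"] sum.lessThan_Suc_shift[of f n])
  from this[of "\<lambda>i. (- 1) ^ i * ?X i" "card K"] tele show ?thesis
    unfolding card_K power_0 power_Suc[of _ "card K"] by linarith
qed

end

text \<open>
  The coefficients of both sides at a cube agree by \<open>box_telescope\<close> if the cube lies in
  \<open>\<nat>\<^sup>k\<close> and has the right dimension; otherwise both vanish.
\<close>

lemma box_sum_chain_map:
  assumes ps: "lattice_chain D ps" and D: "D \<in> Nvec k" and len: "2 \<le> length ps"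
  shows "frag_extend cube_bd (box_sum k ps) = frag_extend (box_sum k) (simp_bd ps)"
proof (rule poly_mapping_eqI)
  fix x :: "nat set \<times> vec"
  obtain K a where x: "x = (K, a)" by (cases x)
  have fin: "finite (box_cubes k ps)" by (rule finite_box_cubes[OF ps D])
  have "finite (box_cubes k (omit i ps))" if "i < length ps" for i
    by (rule finite_box_cubes[OF lattice_chain_omit[OF ps len that] D])
  then have R: "lookup (frag_extend (box_sum k) (simp_bd ps)) x
      = (\<Sum>i<length ps. (- 1) ^ i * of_bool (x \<in> box_cubes k (omit i ps)))"
    by (simp add: simp_bd_def frag_extend_sum frag_extend_cmul lookup_sum lookup_box_sum)
  show "lookup (frag_extend cube_bd (box_sum k ps)) x = lookup (frag_extend (box_sum k) (simp_bd ps)) x"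
  proof (cases "finite K")
    case finK: True
    note L = lookup_cube_bd_box_sum[OF fin finK, of a]
    show ?thesis
    proof (cases "K \<subseteq> {1..k} \<and> length ps = Suc (Suc (card K)) \<and> a \<in> Nvec k")
      case True
      then show ?thesis unfolding R unfolding x L using box_telescope[OF ps] by simp
    next
      case False
      have omit: "(K, a) \<notin> box_cubes k (omit i ps)" if "i < length ps" for i
        using False len that by (auto simp: box_cubes_def length_omit)
      have ins: "(insert j K, a) \<notin> box_cubes k ps" if "j \<in> {1..k} - K" for j
        using False that finK by (auto simp: box_cubes_def)
      have ins': "\<not> (1 \<le> a j \<and> (insert j K, a - unit_vec j) \<in> box_cubes k ps)" if j: "j \<in> {1..k} - K" for j
      proof
        assume *: "1 \<le> a j \<and> (insert j K, a - unit_vec j) \<in> box_cubes k ps"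
        then have "a i = 0" if "i \<notin> {1..k}" for i
          using that j by (auto simp: box_cubes_def Nvec_def minus_apply scaled_unit_def split: if_splits)
        then have "a \<in> Nvec k" by (auto simp: Nvec_def)
        with * False j finK show False by (auto simp: box_cubes_def)
      qed
      have "lookup (frag_extend cube_bd (box_sum k ps)) (K, a) = 0"
        unfolding L
      proof (rule sum.neutral, rule ballI)
        fix j assume "j \<in> {1..k} - K"
        from ins[OF this] ins'[OF this]
        show "(- 1) ^ Suc (rank K j) * (of_bool ((insert j K, a) \<in> box_cubes k ps) -
            of_bool (1 \<le> a j \<and> (insert j K, a - unit_vec j) \<in> box_cubes k ps)) = (0 :: int)"
          by (simp only: of_bool_eq diff_self mult_zero_right)
      qed
      then show ?thesis unfolding R using omit by (simp add: x)
    qed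
  next
    case False
    then have K: "\<not> K \<subseteq> {1..k}" using finite_subset by auto
    have "lookup (cube_bd (L, b)) (K, a) = 0" if "(L, b) \<in> box_cubes k ps" for L b
    proof -
      have "K \<noteq> L - {j}" for j using that K by (auto simp: box_cubes_def)
      then show ?thesis by (auto simp: cube_bd_def lookup_sum lookup_minus)
    qed
    then have "lookup (frag_extend cube_bd (box_sum k ps)) x = 0"
      using fin by (auto simp: box_sum_def frag_extend_sum lookup_sum x intro!: sum.neutral)
    moreover have "x \<notin> box_cubes k (omit i ps)" for i
      using K by (auto simp: box_cubes_def x)
    ultimately show ?thesis unfolding R by simp
  qed
qed

section \<open>Signed sums over permutations\<close>

text \<open>
  The cycle with \<open>m + 1 \<mapsto> j\<close> that maps \<open>{1..m}\<close> increasingly to the other values.  Permutations of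
  \<open>{1..m + 1}\<close> with last value \<open>j\<close> are its composites with permutations of \<open>{1..m}\<close>, and unlike a
  transposition it keeps the remaining directions in order.
\<close>

definition to_end :: "nat \<Rightarrow> nat \<Rightarrow> nat \<Rightarrow> nat" where
  "to_end m j = (\<lambda>i. if i = Suc m then j else if j \<le> i \<and> i \<le> m then Suc i else i)"

lemma to_end_permutes_sign:
  assumes "1 \<le> j" "j \<le> Suc m"
  shows "to_end m j permutes {1..Suc m} \<and> sign (to_end m j) = (- 1) ^ (Suc m - j)"
  using assms(2,1)
proof (induction j rule: inc_induct)
  case base
  have "to_end m (Suc m) = id" by (auto simp: to_end_def)
  then show ?case by (simp only: permutes_id sign_id) simp
next
  case (step j)
  let ?t = "transpose j (Suc j)"
  have eq: "to_end m j = ?t \<circ> to_end m (Suc j)"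
    using step.hyps by (auto simp: to_end_def transpose_def fun_eq_iff)
  have t: "?t permutes {1..Suc m}" using step by (intro permutes_swap_id) auto
  have IH: "to_end m (Suc j) permutes {1..Suc m}" "sign (to_end m (Suc j)) = (- 1) ^ (m - j)"
    using step.IH by auto
  have "sign (to_end m j) = sign ?t * sign (to_end m (Suc j))"
    unfolding eq by (intro sign_compose permutes_imp_permutation[OF _ t] permutes_imp_permutation[OF _ IH(1)]) auto
  then have "sign (to_end m j) = (- 1) ^ (Suc m - j)"
    using IH(2) step.hyps by (simp add: sign_swap_id Suc_diff_le)
  moreover have "to_end m j permutes {1..Suc m}"
    using permutes_compose[OF IH(1) t] unfolding eq .
  ultimately show ?case by simp
qed

lemmas to_end_permutes = to_end_permutes_sign[THEN conjunct1]
  and sign_to_end = to_end_permutes_sign[THEN conjunct2]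

lemma sum_permutations_by_last:
  "(\<Sum>\<sigma> | \<sigma> permutes {1..Suc m}. f \<sigma>) =
    (\<Sum>j\<in>{1..Suc m}. \<Sum>\<tau> | \<tau> permutes {1..m}. f (to_end m j \<circ> \<tau>))"
proof -
  have ins: "{1..Suc m} = insert (Suc m) {1..m}" by auto
  have "(\<Sum>\<sigma> | \<sigma> permutes {1..Suc m}. f \<sigma>) = (\<Sum>j\<in>{1..Suc m}. \<Sum>\<tau> | \<tau> permutes {1..m}. f (transpose (Suc m) j \<circ> \<tau>))"
    unfolding ins by (rule sum_over_permutations_insert) auto
  also have "\<dots> = (\<Sum>j\<in>{1..Suc m}. \<Sum>\<tau> | \<tau> permutes {1..m}. f (to_end m j \<circ> \<tau>))"
  proof (rule sum.cong[OF refl])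
    fix j assume j: "j \<in> {1..Suc m}"
    \<comment> \<open>The library groups permutations by composing with transpositions.  The transposition and
      \<open>to_end m j\<close> differ by the permutation \<open>?q\<close>, which fixes \<open>m + 1\<close> and is absorbed into \<open>\<tau>\<close>.\<close>
    let ?t = "transpose (Suc m) j" and ?q = "transpose (Suc m) j \<circ> to_end m j"
    have "?q permutes {1..Suc m}"
      using j by (intro permutes_compose[OF to_end_permutes] permutes_swap_id) auto
    then have q: "?q permutes {1..m}"
      by (rule permutes_superset) (auto simp: to_end_def not_le le_Suc_eq)
    have "(\<Sum>\<tau> | \<tau> permutes {1..m}. f (?t \<circ> \<tau>)) = (\<Sum>\<tau> | \<tau> permutes {1..m}. f (?t \<circ> (?q \<circ> \<tau>)))"
      by (rule setum_permutations_compose_left[OF q])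
    also have "\<dots> = (\<Sum>\<tau> | \<tau> permutes {1..m}. f (to_end m j \<circ> \<tau>))"
      by (simp add: o_assoc[symmetric]) (simp add: o_assoc transpose_comp_involutory)
    finally show "(\<Sum>\<tau> | \<tau> permutes {1..m}. f (?t \<circ> \<tau>)) = (\<Sum>\<tau> | \<tau> permutes {1..m}. f (to_end m j \<circ> \<tau>))" .
  qed
  finally show ?thesis .
qed

section \<open>The nabla operator in the lattice\<close>

definition path :: "vec \<Rightarrow> nat list \<Rightarrow> vec list" where
  "path a js = psums a (map (\<lambda>j. unit_vec j) js)"

text \<open>
  Here \<open>c\<close> enumerates the \<open>n\<close> directions of a cube with lower corner \<open>a\<close>; the enumeration is a
  parameter because the faces of the cube use \<open>c \<circ> skip j\<close>.
\<close>

definition path_sum :: "nat \<Rightarrow> (nat \<Rightarrow> nat) \<Rightarrow> vec \<Rightarrow> vec list \<Rightarrow>\<^sub>0 int" where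
  "path_sum n c a = (\<Sum>\<sigma> | \<sigma> permutes {1..n}. frag_cmul (sign \<sigma>) (frag_of (path a (map (\<lambda>i. c (\<sigma> i)) [1..<Suc n]))))"

definition nabla_sum :: "nat set \<times> vec \<Rightarrow> vec list \<Rightarrow>\<^sub>0 int" where
  "nabla_sum = (\<lambda>(K, a). path_sum (card K) (nth_smallest K) a)"

lemma length_path [simp]: "length (path a js) = Suc (length js)"
  by (simp add: path_def)

lemma hd_path [simp]: "hd (path a js) = a"
  by (simp add: path_def)

lemma path_Cons: "path a (j # js) = a # path (a + unit_vec j) js"
  by (simp add: path_def)

lemma path_neq_Nil [simp]: "path a js \<noteq> []"
  by (simp add: path_def)

lemma path_nth: "i \<le> length js \<Longrightarrow> path a js ! i = a + (\<Sum>l<i. unit_vec (js ! l))"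
  by (simp add: path_def psums_nth cong: sum.cong_simp)

lemma butlast_path: "butlast (path a (js @ [j])) = path a js"
  by (induction js arbitrary: a) (simp_all add: path_Cons path_def[of _ "[]"])

lemma omit_path_swap:
  "omit (Suc (length is)) (path a (is @ i # j # js)) = omit (Suc (length is)) (path a (is @ j # i # js))"
  by (induction "is" arbitrary: a) (simp_all add: path_Cons add_ac)

lemma frag_eq_minus_self: "(x :: 'z \<Rightarrow>\<^sub>0 int) = - x \<Longrightarrow> x = 0"
proof (rule poly_mapping_eqI)
  fix z assume "x = - x"
  then have "lookup x z = lookup (- x) z" by simp
  then show "lookup x z = lookup 0 z" by simp
qed

lemma frag_cmul_diff_distrib2: "frag_cmul n (a - b) = frag_cmul n a - frag_cmul n b"
  by (rule poly_mapping_eqI) (simp add: lookup_minus right_diff_distrib)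

text \<open>
  Skipping the vertex between steps \<open>i\<close> and \<open>i + 1\<close> forgets their order.  Exchanging them is a sign
  reversing bijection on the permutations, so the sum equals its negative.
\<close>

lemma path_sum_inner_face:
  assumes "i \<in> {1..<n}"
  shows "(\<Sum>\<sigma> | \<sigma> permutes {1..n}. frag_cmul (sign \<sigma>) (frag_of (omit i (path a (map (\<lambda>i. c (\<sigma> i)) [1..<Suc n]))))) = 0"
    (is "?S = 0")
proof (rule frag_eq_minus_self)
  let ?t = "transpose i (Suc i)"
  have t: "?t permutes {1..n}" using assms by (intro permutes_swap_id) auto
  have split: "[1..<Suc n] = [1..<i] @ i # Suc i # [Suc (Suc i)..<Suc n]"
    using assms upt_add_eq_append[of 1 i "Suc n - i"] by (auto simp: upt_conv_Cons)
  have "?S = (\<Sum>\<sigma> | \<sigma> permutes {1..n}. frag_cmul (sign (\<sigma> \<circ> ?t)) (frag_of (omit i (path a (map (\<lambda>i. c ((\<sigma> \<circ> ?t) i)) [1..<Suc n])))))"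
    by (rule sum_permutations_compose_right[OF t])
  also have "\<dots> = (\<Sum>\<sigma> | \<sigma> permutes {1..n}. - frag_cmul (sign \<sigma>) (frag_of (omit i (path a (map (\<lambda>i. c (\<sigma> i)) [1..<Suc n])))))"
  proof (rule sum.cong[OF refl])
    fix \<sigma> assume "\<sigma> \<in> {\<sigma>. \<sigma> permutes {1..n}}"
    then have \<sigma>: "\<sigma> permutes {1..n}" by simp
    have "sign (\<sigma> \<circ> ?t) = sign \<sigma> * sign ?t"
      by (intro sign_compose permutes_imp_permutation[OF _ t] permutes_imp_permutation[OF _ \<sigma>]) auto
    then have sgn: "sign (\<sigma> \<circ> ?t) = - sign \<sigma>" by (simp add: sign_swap_id)
    have m: "map (\<lambda>l. c (\<sigma> (?t l))) [1..<i] = map (\<lambda>l. c (\<sigma> l)) [1..<i]"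
      "map (\<lambda>l. c (\<sigma> (?t l))) [Suc (Suc i)..<Suc n] = map (\<lambda>l. c (\<sigma> l)) [Suc (Suc i)..<Suc n]"
      by (auto simp: transpose_def)
    have len: "Suc (length (map (\<lambda>l. c (\<sigma> l)) [1..<i])) = i" using assms by simp
    have "omit i (path a (map (\<lambda>i. c ((\<sigma> \<circ> ?t) i)) [1..<Suc n])) = omit i (path a (map (\<lambda>i. c (\<sigma> i)) [1..<Suc n]))"
      using omit_path_swap[of "map (\<lambda>l. c (\<sigma> l)) [1..<i]" a "c (\<sigma> (Suc i))" "c (\<sigma> i)" "map (\<lambda>l. c (\<sigma> l)) [Suc (Suc i)..<Suc n]"]
      unfolding len split map_append list.map o_apply m transpose_apply_first transpose_apply_second .
    then show "frag_cmul (sign (\<sigma> \<circ> ?t)) (frag_of (omit i (path a (map (\<lambda>i. c ((\<sigma> \<circ> ?t) i)) [1..<Suc n]))))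
      = - frag_cmul (sign \<sigma>) (frag_of (omit i (path a (map (\<lambda>i. c (\<sigma> i)) [1..<Suc n]))))"
      by (simp add: sgn)
  qed
  also have "\<dots> = - ?S" by (simp only: sum_negf)
  finally show "?S = - ?S" .
qed

lemma sign_mult_to_end:
  assumes "j \<in> {1..Suc m}" "\<tau> permutes {1..m}"
  shows "sign (to_end m j \<circ> \<tau>) = (- 1) ^ (Suc m - j) * sign \<tau>"
proof -
  have "permutation (to_end m j)" using to_end_permutes[of j m] assms by (intro permutes_imp_permutation[of "{1..Suc m}"]) auto
  moreover have "permutation \<tau>" using assms(2) by (intro permutes_imp_permutation[of "{1..m}"]) auto
  ultimately show ?thesis using sign_to_end[of j m] assms by (simp add: sign_compose)
qed

lemma to_end_skip: "\<tau> permutes {1..m} \<Longrightarrow> i \<in> {1..m} \<Longrightarrow> to_end m j (\<tau> i) = skip j (\<tau> i)"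
  using permutes_in_image[of \<tau> "{1..m}" i] by (auto simp: to_end_def skip_def)

text \<open>
  Without its last vertex, a path stays in the lower face belonging to its last direction; the
  permutations are grouped by that direction.
\<close>

lemma path_sum_last_face:
  "(\<Sum>\<sigma> | \<sigma> permutes {1..Suc m}. frag_cmul (sign \<sigma>) (frag_of (path a (map (\<lambda>i. c (\<sigma> i)) [1..<Suc m]))))
    = (\<Sum>j\<in>{1..Suc m}. frag_cmul ((- 1) ^ (Suc m - j)) (path_sum m (c \<circ> skip j) a))"
  unfolding sum_permutations_by_last path_sum_def frag_cmul_sum
proof (intro sum.cong refl)
  fix j \<tau> assume j: "j \<in> {1..Suc m}" and "\<tau> \<in> {\<tau>. \<tau> permutes {1..m}}"
  then have \<tau>: "\<tau> permutes {1..m}" by simp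
  have "map (\<lambda>i. c ((to_end m j \<circ> \<tau>) i)) [1..<Suc m] = map (\<lambda>i. (c \<circ> skip j) (\<tau> i)) [1..<Suc m]"
    using to_end_skip[OF \<tau>] by auto
  then show "frag_cmul (sign (to_end m j \<circ> \<tau>)) (frag_of (path a (map (\<lambda>i. c ((to_end m j \<circ> \<tau>) i)) [1..<Suc m])))
    = frag_cmul ((- 1) ^ (Suc m - j)) (frag_cmul (sign \<tau>) (frag_of (path a (map (\<lambda>i. (c \<circ> skip j) (\<tau> i)) [1..<Suc m]))))"
    by (simp only: sign_mult_to_end[OF j \<tau>] frag_cmul_cmul)
qed

text \<open>
  Without its first vertex, a path runs in the upper face belonging to its first direction.  A
  cyclic rotation of the positions turns the first direction into the last one, so that the
  permutations can be grouped as before.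
\<close>

lemma path_sum_first_face:
  "(\<Sum>\<sigma> | \<sigma> permutes {1..Suc m}. frag_cmul (sign \<sigma>) (frag_of (path (a + unit_vec (c (\<sigma> 1))) (map (\<lambda>i. c (\<sigma> i)) [2..<Suc (Suc m)]))))
    = (\<Sum>j\<in>{1..Suc m}. frag_cmul ((- 1) ^ (j - 1)) (path_sum m (c \<circ> skip j) (a + unit_vec (c j))))"
proof -
  \<comment> \<open>The rotation \<open>1 \<mapsto> m + 1\<close>, \<open>i + 1 \<mapsto> i\<close> of the positions, of sign \<open>(-1)\<close> to the power \<open>m\<close>.\<close>
  let ?q = "inv_into UNIV (to_end m 1)"
  let ?f = "\<lambda>\<sigma>. frag_cmul (sign \<sigma>) (frag_of (path (a + unit_vec (c (\<sigma> 1))) (map (\<lambda>i. c (\<sigma> i)) [2..<Suc (Suc m)])))"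
  have e: "to_end m 1 permutes {1..Suc m}" by (rule to_end_permutes) auto
  have q: "?q permutes {1..Suc m}" by (rule permutes_inv[OF e])
  have q1: "?q 1 = Suc m" by (rule permutes_inv_eq[OF e, THEN iffD2]) (simp add: to_end_def)
  have q2: "?q (Suc i) = i" if "i \<in> {1..m}" for i
    by (rule permutes_inv_eq[OF e, THEN iffD2]) (use that in \<open>simp add: to_end_def\<close>)
  have "sign ?q = (- 1) ^ m"
    using sign_inverse[OF permutes_imp_permutation[OF _ e]] sign_to_end[of 1 m] by simp
  then have sq: "sign (\<sigma> \<circ> ?q) = (- 1) ^ m * sign \<sigma>" if "\<sigma> permutes {1..Suc m}" for \<sigma>
    using sign_compose[OF permutes_imp_permutation[OF _ that] permutes_imp_permutation[OF _ q]] by simp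
  have upt: "[2..<Suc (Suc m)] = map Suc [1..<Suc m]" by (simp only: map_Suc_upt numeral_2_eq_2 One_nat_def)
  have "sum ?f {\<sigma>. \<sigma> permutes {1..Suc m}} = (\<Sum>\<sigma> | \<sigma> permutes {1..Suc m}. ?f (\<sigma> \<circ> ?q))"
    by (rule sum_permutations_compose_right[OF q])
  also have "\<dots> = (\<Sum>\<sigma> | \<sigma> permutes {1..Suc m}. frag_cmul ((- 1) ^ m * sign \<sigma>) (frag_of (path (a + unit_vec (c (\<sigma> (Suc m)))) (map (\<lambda>i. c (\<sigma> i)) [1..<Suc m]))))"
  proof (rule sum.cong[OF refl])
    fix \<sigma> assume "\<sigma> \<in> {\<sigma>. \<sigma> permutes {1..Suc m}}"
    moreover have "map (\<lambda>i. c ((\<sigma> \<circ> ?q) i)) [2..<Suc (Suc m)] = map (\<lambda>i. c (\<sigma> i)) [1..<Suc m]"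
      unfolding upt map_map o_apply by (rule map_cong) (auto simp: q2 simp del: One_nat_def)
    ultimately show "?f (\<sigma> \<circ> ?q) = frag_cmul ((- 1) ^ m * sign \<sigma>) (frag_of (path (a + unit_vec (c (\<sigma> (Suc m)))) (map (\<lambda>i. c (\<sigma> i)) [1..<Suc m])))"
      using q1 by (simp add: sq del: upt_Suc One_nat_def)
  qed
  also have "\<dots> = (\<Sum>j\<in>{1..Suc m}. frag_cmul ((- 1) ^ (j - 1)) (path_sum m (c \<circ> skip j) (a + unit_vec (c j))))"
    unfolding sum_permutations_by_last path_sum_def frag_cmul_sum
  proof (intro sum.cong refl)
    fix j \<tau> assume j: "j \<in> {1..Suc m}" and "\<tau> \<in> {\<tau>. \<tau> permutes {1..m}}"
    then have \<tau>: "\<tau> permutes {1..m}" by simp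
    have "map (\<lambda>i. c ((to_end m j \<circ> \<tau>) i)) [1..<Suc m] = map (\<lambda>i. (c \<circ> skip j) (\<tau> i)) [1..<Suc m]"
      using to_end_skip[OF \<tau>] by auto
    moreover have "(to_end m j \<circ> \<tau>) (Suc m) = j"
      using permutes_not_in[OF \<tau>, of "Suc m"] by (simp add: to_end_def)
    moreover have "(- 1) ^ m * sign (to_end m j \<circ> \<tau>) = (- 1) ^ (j - 1) * sign \<tau>"
    proof -
      have "(- 1) ^ m * (- 1) ^ (Suc m - j) = ((- 1) ^ (j - 1) :: int)"
      proof -
        have "m + (Suc m - j) = (j - 1) + 2 * (Suc m - j)" using j by auto
        then show ?thesis by (metis power_add power_minus1_even mult_1_right)
      qed
      then show ?thesis by (simp only: sign_mult_to_end[OF j \<tau>] mult.assoc[symmetric])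
    qed
    ultimately show "frag_cmul ((- 1) ^ m * sign (to_end m j \<circ> \<tau>)) (frag_of (path (a + unit_vec (c ((to_end m j \<circ> \<tau>) (Suc m)))) (map (\<lambda>i. c ((to_end m j \<circ> \<tau>) i)) [1..<Suc m])))
      = frag_cmul ((- 1) ^ (j - 1)) (frag_cmul (sign \<tau>) (frag_of (path (a + unit_vec (c j)) (map (\<lambda>i. (c \<circ> skip j) (\<tau> i)) [1..<Suc m]))))"
      by (simp only: frag_cmul_cmul)
  qed
  finally show ?thesis .
qed

text \<open>
  Only the first and the last faces survive.  The last face has sign \<open>(-1)\<close> to the power \<open>m + 1\<close>
  and the rotation of directions contributes \<open>(-1)\<close> to the power \<open>m + 1 - j\<close>, together \<open>(-1)\<^sup>j\<close>; the
  first face contributes the opposite sign.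
\<close>

lemma simp_bd_path_sum:
  "frag_extend simp_bd (path_sum (Suc m) c a) =
    (\<Sum>j\<in>{1..Suc m}. frag_cmul ((- 1) ^ j) (path_sum m (c \<circ> skip j) a - path_sum m (c \<circ> skip j) (a + unit_vec (c j))))"
proof -
  let ?P = "{\<sigma>. \<sigma> permutes {1..Suc m}}"
  let ?p = "\<lambda>\<sigma>. path a (map (\<lambda>i. c (\<sigma> i)) [1..<Suc (Suc m)])"
  have "frag_extend simp_bd (path_sum (Suc m) c a) =
      (\<Sum>\<sigma>\<in>?P. frag_cmul (sign \<sigma>) (\<Sum>i<Suc (Suc m). frag_cmul ((- 1) ^ i) (frag_of (omit i (?p \<sigma>)))))"
    by (simp add: path_sum_def frag_extend_sum frag_extend_cmul o_def simp_bd_def finite_permutations del: sum.lessThan_Suc upt_Suc)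
  also have "\<dots> = (\<Sum>i<Suc (Suc m). frag_cmul ((- 1) ^ i) (\<Sum>\<sigma>\<in>?P. frag_cmul (sign \<sigma>) (frag_of (omit i (?p \<sigma>)))))"
    unfolding frag_cmul_sum frag_cmul_cmul by (subst sum.swap) (simp only: mult.commute)
  also have "\<dots> = (\<Sum>\<sigma>\<in>?P. frag_cmul (sign \<sigma>) (frag_of (omit 0 (?p \<sigma>))))
      + (\<Sum>i<m. frag_cmul ((- 1) ^ Suc i) (\<Sum>\<sigma>\<in>?P. frag_cmul (sign \<sigma>) (frag_of (omit (Suc i) (?p \<sigma>)))))
      + frag_cmul ((- 1) ^ Suc m) (\<Sum>\<sigma>\<in>?P. frag_cmul (sign \<sigma>) (frag_of (omit (Suc m) (?p \<sigma>))))"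
    by (simp only: sum.lessThan_Suc[of _ "Suc m"] sum.lessThan_Suc_shift[of _ m] power_0 frag_cmul_one)
  also have "(\<Sum>i<m. frag_cmul ((- 1) ^ Suc i) (\<Sum>\<sigma>\<in>?P. frag_cmul (sign \<sigma>) (frag_of (omit (Suc i) (?p \<sigma>))))) = 0"
    by (rule sum.neutral, rule ballI, subst path_sum_inner_face) auto
  also have "(\<Sum>\<sigma>\<in>?P. frag_cmul (sign \<sigma>) (frag_of (omit 0 (?p \<sigma>)))) =
      (\<Sum>j\<in>{1..Suc m}. frag_cmul ((- 1) ^ (j - 1)) (path_sum m (c \<circ> skip j) (a + unit_vec (c j))))"
  proof -
    have "omit 0 (?p \<sigma>) = path (a + unit_vec (c (\<sigma> 1))) (map (\<lambda>i. c (\<sigma> i)) [2..<Suc (Suc m)])" for \<sigma>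
      by (subst upt_conv_Cons) (simp_all add: path_Cons numeral_2_eq_2)
    then show ?thesis by (simp only: path_sum_first_face)
  qed
  also have "(\<Sum>\<sigma>\<in>?P. frag_cmul (sign \<sigma>) (frag_of (omit (Suc m) (?p \<sigma>)))) =
      (\<Sum>j\<in>{1..Suc m}. frag_cmul ((- 1) ^ (Suc m - j)) (path_sum m (c \<circ> skip j) a))"
  proof -
    have "omit (Suc m) (?p \<sigma>) = path a (map (\<lambda>i. c (\<sigma> i)) [1..<Suc m])" for \<sigma>
    proof -
      have "omit (Suc m) (?p \<sigma>) = butlast (?p \<sigma>)" using omit_last[of "?p \<sigma>"] by (simp del: upt_Suc)
      also have "\<dots> = path a (map (\<lambda>i. c (\<sigma> i)) [1..<Suc m])"
        by (simp add: butlast_path)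
      finally show ?thesis .
    qed
    then show ?thesis by (simp only: path_sum_last_face)
  qed
  also have "(\<Sum>j\<in>{1..Suc m}. frag_cmul ((- 1) ^ (j - 1)) (path_sum m (c \<circ> skip j) (a + unit_vec (c j)))) + 0
      + frag_cmul ((- 1) ^ Suc m) (\<Sum>j\<in>{1..Suc m}. frag_cmul ((- 1) ^ (Suc m - j)) (path_sum m (c \<circ> skip j) a))
      = (\<Sum>j\<in>{1..Suc m}. frag_cmul ((- 1) ^ j) (path_sum m (c \<circ> skip j) a - path_sum m (c \<circ> skip j) (a + unit_vec (c j))))"
    unfolding frag_cmul_sum add_0_right sum.distrib[symmetric]
  proof (rule sum.cong[OF refl])
    fix j assume j: "j \<in> {1..Suc m}"
    have 1: "(- 1) ^ Suc m * (- 1) ^ (Suc m - j) = ((- 1) ^ j :: int)"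
    proof -
      have "Suc m + (Suc m - j) = j + 2 * (Suc m - j)" using j by auto
      then show ?thesis by (metis power_add power_minus1_even mult_1_right)
    qed
    have 2: "(- 1) ^ (j - 1) = (- ((- 1) ^ j) :: int)" using j by (cases j) auto
    show "frag_cmul ((- 1) ^ (j - 1)) (path_sum m (c \<circ> skip j) (a + unit_vec (c j))) +
        frag_cmul ((- 1) ^ Suc m) (frag_cmul ((- 1) ^ (Suc m - j)) (path_sum m (c \<circ> skip j) a))
      = frag_cmul ((- 1) ^ j) (path_sum m (c \<circ> skip j) a - path_sum m (c \<circ> skip j) (a + unit_vec (c j)))"
      unfolding frag_cmul_cmul 1 2 frag_cmul_diff_distrib2 minus_frag_cmul[symmetric] by (simp only: add.commute diff_conv_add_uminus)
  qed
  finally show ?thesis .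
qed

lemma path_sum_cong:
  assumes "\<And>i. i \<in> {1..n} \<Longrightarrow> c i = c' i"
  shows "path_sum n c a = path_sum n c' a"
  unfolding path_sum_def
proof (rule sum.cong[OF refl])
  fix \<sigma> assume "\<sigma> \<in> {\<sigma>. \<sigma> permutes {1..n}}"
  then have "\<sigma> i \<in> {1..n}" if "i \<in> {1..n}" for i
    using that permutes_in_image[of \<sigma> "{1..n}" i] by simp
  then have "map (\<lambda>i. c (\<sigma> i)) [1..<Suc n] = map (\<lambda>i. c' (\<sigma> i)) [1..<Suc n]"
    using assms by (simp add: less_Suc_eq_le del: upt_Suc)
  then show "frag_cmul (sign \<sigma>) (frag_of (path a (map (\<lambda>i. c (\<sigma> i)) [1..<Suc n]))) = frag_cmul (sign \<sigma>) (frag_of (path a (map (\<lambda>i. c' (\<sigma> i)) [1..<Suc n])))"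
    by (simp only:)
qed

text \<open>
  The faces in \<open>simp_bd_path_sum\<close> are indexed by positions \<open>j\<close> and those in \<open>cube_bd\<close> by elements of \<open>K\<close>.
  Removing the \<open>j\<close>-th smallest element of \<open>K\<close> leaves the enumeration \<open>nth_smallest K \<circ> skip j\<close>.
\<close>

lemma nabla_sum_chain_map:
  assumes K: "finite K" "K \<noteq> {}"
  shows "frag_extend simp_bd (nabla_sum (K, a)) = frag_extend nabla_sum (cube_bd (K, a))"
proof -
  obtain m where m: "card K = Suc m" using K by (metis card_eq_0_iff not0_implies_Suc)
  let ?c = "nth_smallest K"
  have "frag_extend nabla_sum (cube_bd (K, a)) =
      (\<Sum>j\<in>K. frag_cmul ((- 1) ^ Suc (rank K j)) (nabla_sum (K - {j}, a) - nabla_sum (K - {j}, a + unit_vec j)))"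
    using K by (simp add: cube_bd_def frag_extend_sum frag_extend_cmul frag_extend_diff o_def)
  also have "\<dots> = (\<Sum>j\<in>{1..Suc m}. frag_cmul ((- 1) ^ Suc (rank K (?c j))) (nabla_sum (K - {?c j}, a) - nabla_sum (K - {?c j}, a + unit_vec (?c j))))"
    by (rule sum.reindex_bij_betw[symmetric]) (use bij_betw_nth_smallest[OF K(1)] in \<open>simp only: m\<close>)
  also have "\<dots> = (\<Sum>j\<in>{1..Suc m}. frag_cmul ((- 1) ^ j) (path_sum m (?c \<circ> skip j) a - path_sum m (?c \<circ> skip j) (a + unit_vec (?c j))))"
  proof (rule sum.cong[OF refl])
    fix j assume j: "j \<in> {1..Suc m}"
    then have cj: "?c j \<in> K" "rank K (?c j) = j - 1" using nth_smallest_in[OF K(1), of j] m by auto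
    have "card (K - {?c j}) = m" using cj(1) K(1) m by simp
    moreover have "path_sum m (nth_smallest (K - {?c j})) b = path_sum m (?c \<circ> skip j) b" for b
      by (rule path_sum_cong) (use nth_smallest_Diff[OF K(1)] j m in auto)
    ultimately have "nabla_sum (K - {?c j}, b) = path_sum m (?c \<circ> skip j) b" for b
      by (simp add: nabla_sum_def)
    moreover have "Suc (rank K (?c j)) = j" using cj(2) j by simp
    ultimately show "frag_cmul ((- 1) ^ Suc (rank K (?c j))) (nabla_sum (K - {?c j}, a) - nabla_sum (K - {?c j}, a + unit_vec (?c j)))
      = frag_cmul ((- 1) ^ j) (path_sum m (?c \<circ> skip j) a - path_sum m (?c \<circ> skip j) (a + unit_vec (?c j)))"
      by (simp only:)
  qed
  also have "\<dots> = frag_extend simp_bd (nabla_sum (K, a))"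
    by (simp only: nabla_sum_def prod.case m simp_bd_path_sum)
  finally show ?thesis by simp
qed

text \<open>
  A cube \<open>(L, b)\<close> in the image of a path of unit steps needs, for each \<open>j \<in> L\<close>, that step number
  \<open>rank L j\<close> of the path runs in direction \<open>j\<close>.  So the steps are the elements of \<open>L\<close> in increasing
  order, and \<open>L\<close> is the set \<open>K\<close> of directions of the path.
\<close>

lemma box_cubes_path:
  assumes K: "K \<subseteq> {1..k}" and a: "a \<in> Nvec k" and \<sigma>: "\<sigma> permutes {1..card K}"
  shows "box_cubes k (path a (map (\<lambda>i. nth_smallest K (\<sigma> i)) [1..<Suc (card K)])) = (if \<sigma> = id then {(K, a)} else {})"
proof -
  let ?c = "nth_smallest K" and ?n = "card K"
  let ?js = "map (\<lambda>i. nth_smallest K (\<sigma> i)) [1..<Suc (card K)]"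
  have fin: "finite K" using K finite_subset by auto
  note bij = bij_betw_nth_smallest[OF fin]
  have js: "?js ! l = ?c (\<sigma> (Suc l))" if "l < ?n" for l using that by (simp del: upt_Suc)
  have nth: "(path a ?js ! i) x = a x + (\<Sum>l<i. of_bool (?c (\<sigma> (Suc l)) = x))" if "i \<le> ?n" for i x
  proof -
    have "path a ?js ! i = a + (\<Sum>l<i. unit_vec (?js ! l))" by (rule path_nth) (use that in simp)
    also have "(\<Sum>l<i. unit_vec (?js ! l)) = (\<Sum>l<i. unit_vec (?c (\<sigma> (Suc l))))"
      by (rule sum.cong) (use that js in auto)
    finally have "(path a ?js ! i) x = (a + (\<Sum>l<i. unit_vec (?c (\<sigma> (Suc l))))) x"
      by (rule arg_cong)
    also have "\<dots> = a x + (\<Sum>l<i. of_bool (?c (\<sigma> (Suc l)) = x))"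
      by (auto simp: plus_fun_apply sum_vec_apply scaled_unit_def of_bool_def intro!: sum.cong)
    finally show ?thesis .
  qed
  have \<sigma>_in: "\<sigma> i \<in> {1..?n}" if "i \<in> {1..?n}" for i
    using that permutes_in_image[OF \<sigma>, of i] by simp
  have rank_n: "rank L j \<le> card L" if "finite L" for L j using rank_le_card[OF that] .
  have main: "L = K \<and> b = a \<and> \<sigma> = id" if L: "(L, b) \<in> box_cubes k (path a ?js)" for L b
  proof -
    have L1: "L \<subseteq> {1..k}" and cL: "card L = ?n" and b: "b \<in> Nvec k"
      and cond: "\<And>j. j \<in> {1..k} \<Longrightarrow> box_cond L (path a ?js) b j"
      using L by (auto simp: box_cubes_def)
    have finL: "finite L" using L1 finite_subset by auto
    \<comment> \<open>Otherwise the step does not move in direction \<open>j\<close>, and the interval required by \<open>box_cond\<close> is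
      empty.\<close>
    have step: "?c (\<sigma> (Suc (rank L j))) = j" if j: "j \<in> L" for j
    proof (rule ccontr)
      assume ne: "?c (\<sigma> (Suc (rank L j))) \<noteq> j"
      have r: "rank L j < ?n" using rank_less_card[OF finL j] cL by simp
      have "(path a ?js ! Suc (rank L j)) j = (path a ?js ! rank L j) j"
        using r ne by (simp add: nth del: upt_Suc One_nat_def)
      then show False using cond[OF subsetD[OF L1 j]] j by (auto simp: box_cond_def simp del: upt_Suc)
    qed
    have "L \<subseteq> K"
    proof
      fix j assume j: "j \<in> L"
      have "Suc (rank L j) \<in> {1..?n}" using rank_less_card[OF finL j] cL by simp
      then have "?c (\<sigma> (Suc (rank L j))) \<in> K" using bij \<sigma>_in by (auto simp: bij_betw_def)
      then show "j \<in> K" using step[OF j] by simp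
    qed
    then have LK: "L = K" using cL fin by (simp add: card_subset_eq)
    have \<sigma>i: "\<sigma> i = i" if i: "i \<in> {1..?n}" for i
    proof -
      have "?c i \<in> K" "rank K (?c i) = i - 1" using nth_smallest_in[OF fin i] by auto
      then have "?c (\<sigma> i) = ?c i" using step[of "?c i"] LK i by simp
      then show ?thesis using inj_onD[OF bij_betw_imp_inj_on[OF bij]] i \<sigma>_in[OF i] by blast
    qed
    have "\<sigma> = id"
    proof
      fix i show "\<sigma> i = id i" using \<sigma>i permutes_not_in[OF \<sigma>, of i] by (cases "i \<in> {1..?n}") auto
    qed
    moreover have "b = a"
    proof
      fix j
      show "b j = a j"
      proof (cases "j \<in> {1..k}")
        case True
        have r: "rank K j \<le> ?n" by (rule rank_le_card[OF fin])
        have nn: "?c (\<sigma> (Suc l)) \<noteq> j" if "l < rank K j" for l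
          using that r \<sigma>i[of "Suc l"] nth_smallest_less_iff[OF fin, of "Suc l" j] by auto
        then have p: "(path a ?js ! rank K j) j = a j" by (simp add: nth r del: upt_Suc One_nat_def)
        show ?thesis
        proof (cases "j \<in> K")
          case jK: True
          have "(path a ?js ! Suc (rank K j)) j = Suc (a j)"
            using rank_less_card[OF fin jK] nn step[of j] jK LK by (simp add: nth del: upt_Suc One_nat_def)
          then show ?thesis using cond[OF True] p jK LK by (simp add: box_cond_def del: upt_Suc)
        next
          case False
          then show ?thesis using cond[OF True] p LK by (simp add: box_cond_def del: upt_Suc)
        qed
      qed (use a b in \<open>simp add: Nvec_def\<close>)
    qed
    ultimately show ?thesis using LK by simp
  qed
  have "(K, a) \<in> box_cubes k (path a ?js)" if id: "\<sigma> = id"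
  proof -
    have "box_cond K (path a ?js) a j" if "j \<in> {1..k}" for j
    proof -
      have r: "rank K j \<le> ?n" by (rule rank_le_card[OF fin])
      have nn: "?c (Suc l) \<noteq> j" if "l < rank K j" for l
        using that r nth_smallest_less_iff[OF fin, of "Suc l" j] by auto
      then have "(path a ?js ! rank K j) j = a j" unfolding nth[OF r] by (simp add: id)
      moreover have "(path a ?js ! Suc (rank K j)) j = Suc (a j)" if "j \<in> K"
        unfolding nth[OF Suc_leI[OF rank_less_card[OF fin that]]]
        using nn nth_smallest_rank[OF fin that] by (simp add: id)
      ultimately show ?thesis by (simp add: box_cond_def)
    qed
    then show ?thesis using K a by (simp add: box_cubes_def del: upt_Suc One_nat_def)
  qed
  then show ?thesis using main by (cases "\<sigma> = id") (force simp del: upt_Suc One_nat_def)+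
qed

lemma box_sum_nabla_sum:
  assumes K: "K \<subseteq> {1..k}" and a: "a \<in> Nvec k"
  shows "frag_extend (box_sum k) (nabla_sum (K, a)) = frag_of (K, a)"
proof -
  have "frag_extend (box_sum k) (nabla_sum (K, a)) =
      (\<Sum>\<sigma> | \<sigma> permutes {1..card K}. frag_cmul (sign \<sigma>) (box_sum k (path a (map (\<lambda>i. nth_smallest K (\<sigma> i)) [1..<Suc (card K)]))))"
    by (simp add: nabla_sum_def path_sum_def frag_extend_sum frag_extend_cmul o_def finite_permutations del: upt_Suc One_nat_def)
  also have "\<dots> = (\<Sum>\<sigma> | \<sigma> permutes {1..card K}. if \<sigma> = id then frag_of (K, a) else 0)"
  proof (rule sum.cong[OF refl])
    fix \<sigma> assume "\<sigma> \<in> {\<sigma>. \<sigma> permutes {1..card K}}"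
    then have \<sigma>: "\<sigma> permutes {1..card K}" by simp
    show "frag_cmul (sign \<sigma>) (box_sum k (path a (map (\<lambda>i. nth_smallest K (\<sigma> i)) [1..<Suc (card K)])))
      = (if \<sigma> = id then frag_of (K, a) else 0)"
      unfolding box_sum_def box_cubes_path[OF K a \<sigma>] by (simp add: sign_id)
  qed
  also have "\<dots> = frag_of (K, a)"
    by (simp add: finite_permutations permutes_id)
  finally show ?thesis .
qed

section \<open>Translations\<close>

lemma simp_bd_map: "simp_bd (map f ps) = frag_extend (\<lambda>qs. frag_of (map f qs)) (simp_bd ps)"
  by (simp add: simp_bd_def frag_extend_sum frag_extend_cmul o_def omit_def take_map drop_map)

lemma path_translate: "path (a + b) js = map ((+) a) (path b js)"
  by (induction js arbitrary: b) (simp_all add: path_Cons path_def[of _ "[]"] add.assoc)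

lemma nabla_sum_translate:
  "nabla_sum (K, a + b) = frag_extend (\<lambda>qs. frag_of (map ((+) a) qs)) (nabla_sum (K, b))"
  by (simp add: nabla_sum_def path_sum_def path_translate frag_extend_sum frag_extend_cmul o_def finite_permutations del: upt_Suc)

lemma cube_bd_translate:
  "finite K \<Longrightarrow> cube_bd (K, a + b) = frag_extend (\<lambda>(L, c). frag_of (L, a + c)) (cube_bd (K, b))"
  by (simp add: cube_bd_def frag_extend_sum frag_extend_cmul frag_extend_diff o_def add.assoc)

lemma lattice_chain_translate: "lattice_chain (a + D) (map ((+) a) ps) \<longleftrightarrow> lattice_chain D ps"
proof (induction ps)
  case (Cons p ps)
  have le: "a + x \<le> a + y \<longleftrightarrow> x \<le> y" for x y :: vec
    by (simp add: le_fun_def plus_fun_apply)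
  from Cons show ?case by (cases ps) (simp_all add: le)
qed simp

lemma box_cubes_translate:
  assumes ps: "lattice_chain D ps" and D: "a + D \<in> Nvec k"
  shows "box_cubes k (map ((+) a) ps) = (\<lambda>(K, c). (K, a + c)) ` box_cubes k ps"
proof -
  have a: "a \<in> Nvec k" by (rule Nvec_le[OF vec_le_add D])
  have ne: "ps \<noteq> []" using ps by (auto simp: lattice_chain_def)
  have eq: "(K, a + c) \<in> box_cubes k (map ((+) a) ps) \<longleftrightarrow> (K, c) \<in> box_cubes k ps" for K c
  proof -
    have "a + c \<in> Nvec k \<longleftrightarrow> c \<in> Nvec k"
      using a by (auto simp: Nvec_def plus_fun_apply)
    moreover have "box_cond K (map ((+) a) ps) (a + c) j \<longleftrightarrow> box_cond K ps c j"
      if "K \<subseteq> {1..k}" "Suc (card K) = length ps" for j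
    proof -
      have fin: "finite K" using that finite_subset by auto
      show ?thesis using rank_le_card[OF fin, of j] rank_less_card[OF fin, of j] that
        by (auto simp: box_cond_def plus_fun_apply)
    qed
    ultimately show ?thesis by (auto simp: box_cubes_def)
  qed
  have "x \<in> (\<lambda>(K, c). (K, a + c)) ` box_cubes k ps" if x: "x \<in> box_cubes k (map ((+) a) ps)" for x
  proof -
    obtain K b where xb: "x = (K, b)" by (cases x)
    have "hd (map ((+) a) ps) \<le> b"
      by (rule box_cubes_le(1)[OF _ D]) (use x xb ps in \<open>auto simp: lattice_chain_translate\<close>)
    then have "a \<le> b" using ne vec_le_add[of a "hd ps"] by (simp add: hd_map)
    then have "b = a + (b - a)" by (simp add: vec_add_diff)
    then show ?thesis using x xb eq[of K "b - a"] by force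
  qed
  then show ?thesis using eq by auto
qed

lemma box_sum_translate:
  assumes "lattice_chain D ps" "a + D \<in> Nvec k"
  shows "box_sum k (map ((+) a) ps) = frag_extend (\<lambda>(K, c). frag_of (K, a + c)) (box_sum k ps)"
proof -
  have D: "D \<in> Nvec k" using assms(2) by (auto simp: Nvec_def plus_fun_apply)
  have inj: "inj_on (\<lambda>(K, c). (K, a + c)) (box_cubes k ps)"
    by (auto simp: inj_on_def)
  have "box_sum k (map ((+) a) ps) = (\<Sum>x\<in>box_cubes k ps. frag_of ((\<lambda>(K, c). (K, a + c)) x))"
    unfolding box_sum_def box_cubes_translate[OF assms] by (simp add: sum.reindex[OF inj] o_def)
  also have "\<dots> = frag_extend (\<lambda>(K, c). frag_of (K, a + c)) (box_sum k ps)"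
    unfolding box_sum_def frag_extend_sum[OF finite_box_cubes[OF assms(1) D]]
    by (simp add: o_def case_prod_beta)
  finally show ?thesis .
qed

lemma keys_simp_bd:
  assumes "lattice_chain D ps" "2 \<le> length ps"
  shows "keys (simp_bd ps) \<subseteq> {qs. lattice_chain D qs \<and> Suc (length qs) = length ps}"
proof -
  have "keys (simp_bd ps) \<subseteq> (\<Union>i<length ps. {omit i ps})"
    unfolding simp_bd_def using keys_cmul
    by (intro order.trans[OF Poly_Mapping.keys_sum] UN_mono) (auto simp: keys_frag_of)
  moreover have "lattice_chain D (omit i ps) \<and> Suc (length (omit i ps)) = length ps" if "i < length ps" for i
    using lattice_chain_omit[OF assms that] length_omit[OF that] assms(2) by simp
  ultimately show ?thesis by blast
qed

lemma keys_box_sum: "keys (box_sum k ps) \<subseteq> box_cubes k ps"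
  unfolding box_sum_def by (rule order.trans[OF Poly_Mapping.keys_sum]) (simp add: keys_frag_of)

lemma keys_cube_bd:
  "keys (cube_bd (K, a)) \<subseteq> (\<Union>j\<in>K. {(K - {j}, a), (K - {j}, a + unit_vec j)})"
proof -
  have "keys (frag_cmul n (frag_of x - frag_of y)) \<subseteq> {x, y}" for n and x y :: "'z"
    using keys_cmul[of n "frag_of x - frag_of y"] keys_diff[of "frag_of x" "frag_of y"] by (auto simp: keys_frag_of)
  then show ?thesis
    unfolding cube_bd_def prod.case by (intro order.trans[OF Poly_Mapping.keys_sum] UN_mono order_refl)
qed

lemma set_vec_insert: "finite K \<Longrightarrow> j \<notin> K \<Longrightarrow> set_vec (insert j K) = unit_vec j + set_vec K"
  by (simp add: set_vec_def)

lemma last_path: "last (path a js) = a + sum_list (map (\<lambda>j. unit_vec j) js)"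
  by (induction js arbitrary: a) (simp_all add: path_Cons path_def[of _ "[]"] add.assoc)

lemma lattice_chain_path: "lattice_chain (last (path a js)) (path a js)"
  unfolding path_def by (rule lattice_chain_psums) simp

lemma lattice_chain_mono: "lattice_chain D ps \<Longrightarrow> D \<le> D' \<Longrightarrow> lattice_chain D' ps"
  by (auto simp: lattice_chain_def intro: order_trans)

lemma last_path_permutes:
  assumes K: "finite K" and \<sigma>: "\<sigma> permutes {1..card K}"
  shows "last (path a (map (\<lambda>i. nth_smallest K (\<sigma> i)) [1..<Suc (card K)])) = a + set_vec K"
proof -
  have "bij_betw (nth_smallest K \<circ> \<sigma>) {1..card K} K"
    by (rule bij_betw_trans[OF permutes_imp_bij[OF \<sigma>] bij_betw_nth_smallest[OF K]])
  then have "(\<Sum>i\<in>{1..card K}. unit_vec ((nth_smallest K \<circ> \<sigma>) i)) = set_vec K"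
    unfolding set_vec_def by (rule sum.reindex_bij_betw)
  moreover have "sum_list (map (\<lambda>i. unit_vec (nth_smallest K (\<sigma> i))) [1..<Suc (card K)]) = (\<Sum>i\<in>{1..card K}. unit_vec (nth_smallest K (\<sigma> i)))"
    by (simp only: sum_list_distinct_conv_sum_set distinct_upt set_upt atLeastLessThanSuc_atLeastAtMost)
  ultimately show ?thesis by (simp add: last_path o_def del: upt_Suc)
qed

lemma keys_nabla_sum:
  assumes K: "finite K"
  shows "keys (nabla_sum (K, a)) \<subseteq>
    {ps. lattice_chain (a + set_vec K) ps \<and> hd ps = a \<and> last ps = a + set_vec K \<and> length ps = Suc (card K)}"
proof -
  let ?p = "\<lambda>\<sigma>. path a (map (\<lambda>i. nth_smallest K (\<sigma> i)) [1..<Suc (card K)])"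
  have sub: "keys (nabla_sum (K, a)) \<subseteq> (\<Union>\<sigma>\<in>{\<sigma>. \<sigma> permutes {1..card K}}. {?p \<sigma>})"
    unfolding nabla_sum_def path_sum_def prod.case using keys_cmul
    by (intro order.trans[OF Poly_Mapping.keys_sum] UN_mono) (auto simp: keys_frag_of)
  have "last (?p \<sigma>) = a + set_vec K" if "\<sigma> permutes {1..card K}" for \<sigma>
    by (rule last_path_permutes[OF K that])
  moreover have "lattice_chain (last (?p \<sigma>)) (?p \<sigma>)" "hd (?p \<sigma>) = a" "length (?p \<sigma>) = Suc (card K)" for \<sigma>
    by (simp_all add: lattice_chain_path del: upt_Suc)
  ultimately have "?p \<sigma> \<in> {ps. lattice_chain (a + set_vec K) ps \<and> hd ps = a \<and> last ps = a + set_vec K \<and> length ps = Suc (card K)}"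
    if "\<sigma> permutes {1..card K}" for \<sigma>
    using that unfolding mem_Collect_eq by metis
  with sub show ?thesis by blast
qed

section \<open>The operators on tuples and cubes\<close>

context k_graph
begin

text \<open>
  Linear extension of \<open>simplex \<xi>\<close> and \<open>cube \<xi>\<close>, which are passed as the argument \<open>R\<close>.
\<close>

definition realize :: "('a \<Rightarrow> 'c \<Rightarrow> 'y \<times> 'a) \<Rightarrow> 'a \<Rightarrow> ('c \<Rightarrow>\<^sub>0 int) \<Rightarrow> ('y \<times> 'a \<Rightarrow>\<^sub>0 int)" where
  "realize R \<xi> c = frag_extend (\<lambda>x. frag_of (R \<xi> x)) c"

lemma realize_of [simp]: "realize R \<xi> (frag_of x) = frag_of (R \<xi> x)"
  and realize_zero [simp]: "realize R \<xi> 0 = 0"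
  and realize_diff: "realize R \<xi> (c - d) = realize R \<xi> c - realize R \<xi> d"
  and realize_add: "realize R \<xi> (c + d) = realize R \<xi> c + realize R \<xi> d"
  and realize_cmul: "realize R \<xi> (frag_cmul n c) = frag_cmul n (realize R \<xi> c)"
  by (simp_all add: realize_def frag_extend_diff frag_extend_add frag_extend_cmul)

lemma realize_sum: "finite A \<Longrightarrow> realize R \<xi> (\<Sum>i\<in>A. c i) = (\<Sum>i\<in>A. realize R \<xi> (c i))"
  by (simp add: realize_def frag_extend_sum o_def)

lemma keys_realize:
  assumes "\<And>x. x \<in> keys c \<Longrightarrow> R \<xi> x \<in> S"
  shows "keys (realize R \<xi> c) \<subseteq> S"
  unfolding realize_def using assms by (intro order.trans[OF keys_frag_extend]) (auto simp: keys_frag_of)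

text \<open>
  This turns identities in the lattice into identities between operators.  Only the values of \<open>A\<close> on
  single cells cut out of \<open>\<xi>\<close> have to be known.
\<close>

lemma lin_realize:
  assumes "\<And>x. x \<in> keys c \<Longrightarrow> lin \<Lambda> A (frag_of (R \<xi> x)) = realize R' \<xi> (F x)"
  shows "lin \<Lambda> A (realize R \<xi> c) = realize R' \<xi> (frag_extend F c)"
proof -
  have "keys c \<subseteq> {x. lin \<Lambda> A (frag_of (R \<xi> x)) = realize R' \<xi> (F x)}"
    using assms by auto
  then show ?thesis
    by (induction c rule: frag_induction) (simp_all add: realize_diff lin_diff frag_extend_diff)
qed

lemma realize_simplex_seg:
  assumes \<xi>: "\<xi> \<in> Mor \<Lambda>" and ab: "a \<le> b" "b \<le> deg \<Lambda> \<xi>"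
    and c: "keys c \<subseteq> {qs. lattice_chain (b - a) qs}"
  shows "rtrans \<Lambda> (seg \<Lambda> \<xi> b (deg \<Lambda> \<xi>)) (realize simplex (seg \<Lambda> \<xi> a b) c)
    = realize simplex \<xi> (frag_extend (\<lambda>qs. frag_of (map ((+) a) qs)) c)"
  using c
proof (induction c rule: frag_induction)
  case (one qs)
  then show ?case by (cases "simplex (seg \<Lambda> \<xi> a b) qs") (simp add: simplex_seg[OF \<xi> ab])
qed (simp_all add: realize_diff rtrans_diff frag_extend_diff)

lemma cube_seg:
  assumes \<xi>: "\<xi> \<in> Mor \<Lambda>" and ab: "a \<le> b" "b \<le> deg \<Lambda> \<xi>" and c: "c + set_vec K \<le> b - a"
  shows "cube \<xi> (K, a + c) = (case cube (seg \<Lambda> \<xi> a b) (K, c) of (\<eta>, \<tau>) \<Rightarrow> (\<eta>, \<tau> \<cdot> seg \<Lambda> \<xi> b (deg \<Lambda> \<xi>)))"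
proof -
  let ?e = "set_vec K"
  have 1: "seg \<Lambda> (seg \<Lambda> \<xi> a b) c (c + ?e) = seg \<Lambda> \<xi> (a + c) (a + c + ?e)"
    using seg_seg[OF \<xi> ab vec_le_add[of c ?e] c] by (simp add: add.assoc)
  have le: "a + c + ?e \<le> b" using vec_add_le_mono[OF c, of a] ab by (simp add: vec_add_diff add.assoc)
  have 2: "seg \<Lambda> (seg \<Lambda> \<xi> a b) (c + ?e) (b - a) = seg \<Lambda> \<xi> (a + c + ?e) b"
    using seg_seg[OF \<xi> ab c order_refl] ab by (simp add: vec_add_diff add.assoc)
  have "seg \<Lambda> \<xi> (a + c + ?e) b \<cdot> seg \<Lambda> \<xi> b (deg \<Lambda> \<xi>) = seg \<Lambda> \<xi> (a + c + ?e) (deg \<Lambda> \<xi>)"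
    by (rule seg_split(2)[OF \<xi> le ab(2) order_refl])
  with 1 2 show ?thesis by (simp only: cube_def deg_seg[OF \<xi> ab] prod.case)
qed

lemma realize_cube_seg:
  assumes \<xi>: "\<xi> \<in> Mor \<Lambda>" and ab: "a \<le> b" "b \<le> deg \<Lambda> \<xi>"
    and c: "keys c \<subseteq> {(K, x). x + set_vec K \<le> b - a}"
  shows "rtrans \<Lambda> (seg \<Lambda> \<xi> b (deg \<Lambda> \<xi>)) (realize cube (seg \<Lambda> \<xi> a b) c)
    = realize cube \<xi> (frag_extend (\<lambda>(K, x). frag_of (K, a + x)) c)"
  using c
proof (induction c rule: frag_induction)
  case (one y)
  obtain K x where y: "y = (K, x)" by (cases y)
  with one show ?case by (cases "cube (seg \<Lambda> \<xi> a b) (K, x)") (simp add: cube_seg[OF \<xi> ab])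
qed (simp_all add: realize_diff rtrans_diff frag_extend_diff)

lemma cube_cells:
  assumes \<xi>: "\<xi> \<in> Mor \<Lambda>" and K: "K \<subseteq> {1..k}" and le: "a + set_vec K \<le> deg \<Lambda> \<xi>"
  shows "cube \<xi> (K, a) \<in> cub_cells (card K) (src \<Lambda> \<xi>)"
proof -
  have fin: "finite K" using K finite_subset by auto
  let ?\<eta> = "seg \<Lambda> \<xi> a (a + set_vec K)" and ?\<rho> = "seg \<Lambda> \<xi> (a + set_vec K) (deg \<Lambda> \<xi>)"
  have d: "deg \<Lambda> ?\<eta> = set_vec K"
    by (simp add: deg_seg[OF \<xi> vec_le_add le])
  have "(\<Sum>i=1..k. set_vec K i) = card K"
    using K by (simp add: set_vec_apply[OF fin] Int_absorb1 del: One_nat_def)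
  then have "?\<eta> \<in> cubes k \<Lambda> (card K)"
    using seg_Mor[OF \<xi> vec_le_add le] d by (simp add: cubes_def set_vec_apply[OF fin] del: One_nat_def)
  then show ?thesis
    using seg_split(1)[OF \<xi> vec_le_add le order_refl] seg_Mor[OF \<xi> le order_refl] src_seg_deg[OF \<xi> le]
    by (simp add: cube_def cells_def)
qed

definition dirs :: "'a \<Rightarrow> nat set" where
  "dirs \<eta> = {i. deg \<Lambda> \<eta> i \<noteq> 0}"

lemma cubes_dirs:
  assumes "\<eta> \<in> cubes k \<Lambda> n"
  shows "\<eta> \<in> Mor \<Lambda>" "dirs \<eta> \<subseteq> {1..k}" "finite (dirs \<eta>)" "card (dirs \<eta>) = n" "deg \<Lambda> \<eta> = set_vec (dirs \<eta>)"
proof -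
  show \<eta>: "\<eta> \<in> Mor \<Lambda>" using assms by (simp add: cubes_def)
  show K: "dirs \<eta> \<subseteq> {1..k}"
  proof
    fix i assume "i \<in> dirs \<eta>"
    then show "i \<in> {1..k}"
      using deg_closed[OF \<eta>] unfolding dirs_def Nvec_def mem_Collect_eq by metis
  qed
  show fin: "finite (dirs \<eta>)" using K finite_subset by auto
  have b: "deg \<Lambda> \<eta> i = of_bool (i \<in> dirs \<eta>)" for i
  proof (cases "i \<in> {1..k}")
    case True
    then have "deg \<Lambda> \<eta> i \<in> {0, 1}" using assms unfolding cubes_def by blast
    then show ?thesis by (auto simp: dirs_def)
  qed (use K in \<open>auto simp: dirs_def\<close>)
  then show d: "deg \<Lambda> \<eta> = set_vec (dirs \<eta>)"
    by (simp add: fun_eq_iff set_vec_apply[OF fin])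
  have "n = (\<Sum>i=1..k. deg \<Lambda> \<eta> i)" using assms by (simp add: cubes_def)
  also have "\<dots> = card (dirs \<eta>)" using K by (simp add: b Int_absorb1)
  finally show "card (dirs \<eta>) = n" by simp
qed

lemma dirs_eqI: "finite K \<Longrightarrow> deg \<Lambda> \<eta> = set_vec K \<Longrightarrow> dirs \<eta> = K"
  by (simp add: dirs_def set_vec_apply)

text \<open>
  Each operator is the realization, in the product of the tuple or in the cube itself, of the
  corresponding operator in the lattice.  The boundary of a \<open>0\<close>-tuple is set to \<open>0\<close>, whereas
  \<open>simp_bd\<close> of a single point is the list without points, which is not a simplex.
\<close>

definition bar_bd :: "'a tup \<Rightarrow> 'a tup \<times> 'a \<Rightarrow>\<^sub>0 int" where
  "bar_bd t = (if snd t = [] then 0 else realize simplex (tup_prod \<Lambda> t) (simp_bd (points \<Lambda> t)))"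

definition cub_bd :: "'a \<Rightarrow> 'a \<times> 'a \<Rightarrow>\<^sub>0 int" where
  "cub_bd \<eta> = realize cube \<eta> (cube_bd (dirs \<eta>, 0))"

definition nabla :: "'a \<Rightarrow> 'a tup \<times> 'a \<Rightarrow>\<^sub>0 int" where
  "nabla \<eta> = realize simplex \<eta> (nabla_sum (dirs \<eta>, 0))"

definition box :: "'a tup \<Rightarrow> 'a \<times> 'a \<Rightarrow>\<^sub>0 int" where
  "box t = realize cube (tup_prod \<Lambda> t) (box_sum k (points \<Lambda> t))"

text \<open>
  Operators on tuples are defined through the tuple's own product and points.  For a tuple cut out
  of \<open>\<xi>\<close> these are a segment of \<open>\<xi>\<close> and the chain \<open>ps\<close> translated to start at \<open>0\<close>.
\<close>

lemma simplex_cases: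
  assumes \<xi>: "\<xi> \<in> Mor \<Lambda>" and ps: "lattice_chain (deg \<Lambda> \<xi>) ps"
  obtains t where "simplex \<xi> ps = (t, seg \<Lambda> \<xi> (last ps) (deg \<Lambda> \<xi>))"
    "tup_prod \<Lambda> t = seg \<Lambda> \<xi> (hd ps) (last ps)" "map ((+) (hd ps)) (points \<Lambda> t) = ps"
    "lattice_chain (last ps - hd ps) (points \<Lambda> t)" "hd ps \<le> last ps" "last ps \<le> deg \<Lambda> \<xi>"
    "length (snd t) = length ps - 1"
proof -
  let ?t = "fst (simplex \<xi> ps)"
  have ne: "ps \<noteq> []" using ps by (auto simp: lattice_chain_def)
  have le: "hd ps \<le> last ps" "last ps \<le> deg \<Lambda> \<xi>" using lattice_chain_le[OF ps, of "hd ps"] ne by auto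
  have map: "map ((+) (hd ps)) (points \<Lambda> ?t) = ps" by (rule points_simplex[OF \<xi> ps])
  have "lattice_chain (hd ps + (last ps - hd ps)) (map ((+) (hd ps)) (points \<Lambda> ?t))"
    using ps ne by (simp add: map vec_add_diff[OF le(1)] lattice_chain_def)
  then have "lattice_chain (last ps - hd ps) (points \<Lambda> ?t)"
    by (simp only: lattice_chain_translate)
  then show thesis
    using that[of ?t] simplex_tuple[OF \<xi> ps] map le by (simp add: simplex_def)
qed

lemma bar_bd_0: "t \<in> tuples \<Lambda> 0 \<Longrightarrow> bar_bd t = 0"
  by (auto simp: bar_bd_def tuples_def)

text \<open>
  The operators are defined by cutting the tuple or the cube itself.  This lemma and its analogues
  for \<open>box\<close>, \<open>cub_bd\<close> and \<open>nabla\<close> say that cutting a larger morphism gives the same, by translation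
  equivariance.
\<close>

lemma lin_bar_bd_simplex:
  assumes \<xi>: "\<xi> \<in> Mor \<Lambda>" and ps: "lattice_chain (deg \<Lambda> \<xi>) ps" and len: "2 \<le> length ps"
  shows "lin \<Lambda> bar_bd (frag_of (simplex \<xi> ps)) = realize simplex \<xi> (simp_bd ps)"
proof -
  obtain t where t: "simplex \<xi> ps = (t, seg \<Lambda> \<xi> (last ps) (deg \<Lambda> \<xi>))"
    "tup_prod \<Lambda> t = seg \<Lambda> \<xi> (hd ps) (last ps)" "map ((+) (hd ps)) (points \<Lambda> t) = ps"
    "lattice_chain (last ps - hd ps) (points \<Lambda> t)" "hd ps \<le> last ps" "last ps \<le> deg \<Lambda> \<xi>"
    "length (snd t) = length ps - 1"
    using simplex_cases[OF \<xi> ps] by metis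
  have len': "2 \<le> length (points \<Lambda> t)" using t(3) len length_map by metis
  have "lin \<Lambda> bar_bd (frag_of (simplex \<xi> ps)) =
      rtrans \<Lambda> (seg \<Lambda> \<xi> (last ps) (deg \<Lambda> \<xi>)) (realize simplex (seg \<Lambda> \<xi> (hd ps) (last ps)) (simp_bd (points \<Lambda> t)))"
    using t(7) len by (auto simp: t(1,2) bar_bd_def)
  also have "\<dots> = realize simplex \<xi> (frag_extend (\<lambda>qs. frag_of (map ((+) (hd ps)) qs)) (simp_bd (points \<Lambda> t)))"
    by (rule realize_simplex_seg[OF \<xi> t(5,6)]) (use keys_simp_bd[OF t(4) len'] in auto)
  also have "\<dots> = realize simplex \<xi> (simp_bd ps)"
    by (simp only: simp_bd_map[symmetric] t(3))
  finally show ?thesis .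
qed

lemma lin_box_simplex:
  assumes \<xi>: "\<xi> \<in> Mor \<Lambda>" and ps: "lattice_chain (deg \<Lambda> \<xi>) ps"
  shows "lin \<Lambda> box (frag_of (simplex \<xi> ps)) = realize cube \<xi> (box_sum k ps)"
proof -
  obtain t where t: "simplex \<xi> ps = (t, seg \<Lambda> \<xi> (last ps) (deg \<Lambda> \<xi>))"
    "tup_prod \<Lambda> t = seg \<Lambda> \<xi> (hd ps) (last ps)" "map ((+) (hd ps)) (points \<Lambda> t) = ps"
    "lattice_chain (last ps - hd ps) (points \<Lambda> t)" "hd ps \<le> last ps" "last ps \<le> deg \<Lambda> \<xi>"
    "length (snd t) = length ps - 1"
    using simplex_cases[OF \<xi> ps] by metis
  have N: "last ps \<in> Nvec k" using Nvec_le[OF t(6) deg_closed[OF \<xi>]] .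
  have pt: "last (points \<Lambda> t) \<le> last ps - hd ps" using t(4) by (auto simp: lattice_chain_def)
  have k: "keys (box_sum k (points \<Lambda> t)) \<subseteq> {(K, x). x + set_vec K \<le> last ps - hd ps}"
  proof (rule order.trans[OF keys_box_sum], clarify)
    fix K x assume "(K, x) \<in> box_cubes k (points \<Lambda> t)"
    then show "x + set_vec K \<le> last ps - hd ps"
      using box_cubes_le(2)[OF t(4) Nvec_diff[OF N]] pt by (blast intro: order_trans)
  qed
  have "lin \<Lambda> box (frag_of (simplex \<xi> ps)) =
      rtrans \<Lambda> (seg \<Lambda> \<xi> (last ps) (deg \<Lambda> \<xi>)) (realize cube (seg \<Lambda> \<xi> (hd ps) (last ps)) (box_sum k (points \<Lambda> t)))"
    by (simp add: t(1,2) box_def)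
  also have "\<dots> = realize cube \<xi> (frag_extend (\<lambda>(K, x). frag_of (K, hd ps + x)) (box_sum k (points \<Lambda> t)))"
    by (rule realize_cube_seg[OF \<xi> t(5,6) k])
  also have "\<dots> = realize cube \<xi> (box_sum k ps)"
    using box_sum_translate[OF t(4), of "hd ps"] N by (simp add: vec_add_diff[OF t(5)] t(3))
  finally show ?thesis .
qed

lemma cube_cases:
  assumes \<xi>: "\<xi> \<in> Mor \<Lambda>" and K: "finite K" and le: "a + set_vec K \<le> deg \<Lambda> \<xi>"
  shows "cube \<xi> (K, a) = (seg \<Lambda> \<xi> a (a + set_vec K), seg \<Lambda> \<xi> (a + set_vec K) (deg \<Lambda> \<xi>))"
    and "dirs (seg \<Lambda> \<xi> a (a + set_vec K)) = K" and "a + set_vec K - a = set_vec K"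
proof -
  show d: "a + set_vec K - a = set_vec K" by (simp add: fun_eq_iff plus_fun_apply minus_apply)
  show "cube \<xi> (K, a) = (seg \<Lambda> \<xi> a (a + set_vec K), seg \<Lambda> \<xi> (a + set_vec K) (deg \<Lambda> \<xi>))"
    by (simp add: cube_def)
  show "dirs (seg \<Lambda> \<xi> a (a + set_vec K)) = K"
    by (rule dirs_eqI[OF K]) (simp add: deg_seg[OF \<xi> vec_le_add le] d)
qed

lemma set_vec_Diff_le: "finite K \<Longrightarrow> j \<in> K \<Longrightarrow> set_vec (K - {j}) + unit_vec j = set_vec K"
  using set_vec_insert[of "K - {j}" j] by (simp add: insert_absorb add.commute)

lemma keys_cube_bd_le:
  assumes "finite K" "(L, x) \<in> keys (cube_bd (K, a))"
  shows "x + set_vec L \<le> a + set_vec K" "L \<subseteq> K" "Suc (card L) = card K"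
proof -
  obtain j where j: "j \<in> K" "L = K - {j}" "x = a \<or> x = a + unit_vec j"
    using subsetD[OF keys_cube_bd assms(2)] by auto
  show "L \<subseteq> K" "Suc (card L) = card K" using j card_Suc_Diff1[OF assms(1) j(1)] by auto
  have "set_vec K = set_vec L + unit_vec j" using set_vec_Diff_le[OF assms(1) j(1)] j(2) by simp
  then show "x + set_vec L \<le> a + set_vec K"
    using j(3) by (auto simp: le_fun_def plus_fun_apply)
qed

lemma lin_cub_bd_cube:
  assumes \<xi>: "\<xi> \<in> Mor \<Lambda>" and K: "finite K" and le: "a + set_vec K \<le> deg \<Lambda> \<xi>"
  shows "lin \<Lambda> cub_bd (frag_of (cube \<xi> (K, a))) = realize cube \<xi> (cube_bd (K, a))"
proof -
  let ?b = "a + set_vec K"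
  note c = cube_cases[OF assms]
  have "lin \<Lambda> cub_bd (frag_of (cube \<xi> (K, a))) =
      rtrans \<Lambda> (seg \<Lambda> \<xi> ?b (deg \<Lambda> \<xi>)) (realize cube (seg \<Lambda> \<xi> a ?b) (cube_bd (K, 0)))"
    by (simp add: c(1,2) cub_bd_def)
  also have "\<dots> = realize cube \<xi> (frag_extend (\<lambda>(K, x). frag_of (K, a + x)) (cube_bd (K, 0)))"
    by (rule realize_cube_seg[OF \<xi> vec_le_add le]) (use keys_cube_bd_le(1)[OF K, of _ _ 0] in \<open>auto simp: c(3)\<close>)
  also have "\<dots> = realize cube \<xi> (cube_bd (K, a))"
    using cube_bd_translate[OF K, of a 0] by simp
  finally show ?thesis .
qed

lemma lin_nabla_cube:
  assumes \<xi>: "\<xi> \<in> Mor \<Lambda>" and K: "finite K" and le: "a + set_vec K \<le> deg \<Lambda> \<xi>"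
  shows "lin \<Lambda> nabla (frag_of (cube \<xi> (K, a))) = realize simplex \<xi> (nabla_sum (K, a))"
proof -
  let ?b = "a + set_vec K"
  note c = cube_cases[OF assms]
  have "lin \<Lambda> nabla (frag_of (cube \<xi> (K, a))) =
      rtrans \<Lambda> (seg \<Lambda> \<xi> ?b (deg \<Lambda> \<xi>)) (realize simplex (seg \<Lambda> \<xi> a ?b) (nabla_sum (K, 0)))"
    by (simp add: c(1,2) nabla_def)
  also have "\<dots> = realize simplex \<xi> (frag_extend (\<lambda>qs. frag_of (map ((+) a) qs)) (nabla_sum (K, 0)))"
    by (rule realize_simplex_seg[OF \<xi> vec_le_add le]) (use keys_nabla_sum[OF K, of 0] in \<open>auto simp: c(3)\<close>)
  also have "\<dots> = realize simplex \<xi> (nabla_sum (K, a))"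
    using nabla_sum_translate[of K a 0] by simp
  finally show ?thesis .
qed

lemma tuple_simplex:
  assumes t: "t \<in> tuples \<Lambda> n"
  shows "simplex (tup_prod \<Lambda> t) (points \<Lambda> t) = (t, tup_src \<Lambda> t)"
    "lattice_chain (deg \<Lambda> (tup_prod \<Lambda> t)) (points \<Lambda> t)" "length (points \<Lambda> t) = Suc n"
proof -
  note P = tup_prod[OF t]
  have c: "(t, tup_src \<Lambda> t) \<in> bar_cells n (tup_src \<Lambda> t)"
    using t P Obj_Mor rng_Obj src_Obj by (auto simp: cells_def)
  have e: "tup_prod \<Lambda> t \<cdot> tup_src \<Lambda> t = tup_prod \<Lambda> t" using cmp_src_id[OF P(1)] P by simp
  show "simplex (tup_prod \<Lambda> t) (points \<Lambda> t) = (t, tup_src \<Lambda> t)"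
    "lattice_chain (deg \<Lambda> (tup_prod \<Lambda> t)) (points \<Lambda> t)"
    using simplex_points(1,2)[OF c] by (simp_all only: e)
  show "length (points \<Lambda> t) = Suc n" using t by (auto simp: points_def tuples_def)
qed

lemma cube_cube:
  assumes \<eta>: "\<eta> \<in> cubes k \<Lambda> n"
  shows "cube \<eta> (dirs \<eta>, 0) = (\<eta>, src \<Lambda> \<eta>)" "0 + set_vec (dirs \<eta>) \<le> deg \<Lambda> \<eta>"
  using cubes_dirs[OF \<eta>] seg_full[of \<eta>] seg_point(2)[of \<eta> 0 "deg \<Lambda> \<eta>"] by (simp_all add: cube_def)

lemma operator_bar_bd: "operator \<Lambda> (tuples \<Lambda> (Suc n)) (tup_src \<Lambda>) (tuples \<Lambda> n) (tup_src \<Lambda>) bar_bd"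
  unfolding operator_def
proof (intro ballI conjI)
  fix t assume t: "t \<in> tuples \<Lambda> (Suc n)"
  note P = tup_prod[OF t] and s = tuple_simplex[OF t]
  show "tup_src \<Lambda> t \<in> Obj \<Lambda>" by (rule P)
  show "keys (bar_bd t) \<subseteq> bar_cells n (tup_src \<Lambda> t)"
  proof (cases "snd t = []")
    case False
    have "keys (realize simplex (tup_prod \<Lambda> t) (simp_bd (points \<Lambda> t)))
        \<subseteq> bar_cells n (src \<Lambda> (tup_prod \<Lambda> t))"
      by (rule keys_realize, rule simplex_cells[OF P(1)]) (use keys_simp_bd[OF s(2)] s(3) in auto)
    with False show ?thesis by (simp add: bar_bd_def P(3))
  qed (simp add: bar_bd_def)
qed

lemma operator_box: "operator \<Lambda> (tuples \<Lambda> n) (tup_src \<Lambda>) (cubes k \<Lambda> n) (src \<Lambda>) box"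
  unfolding operator_def
proof (intro ballI conjI)
  fix t assume t: "t \<in> tuples \<Lambda> n"
  note P = tup_prod[OF t] and s = tuple_simplex[OF t]
  show "tup_src \<Lambda> t \<in> Obj \<Lambda>" by (rule P)
  show "keys (box t) \<subseteq> cub_cells n (tup_src \<Lambda> t)"
    unfolding box_def
  proof (rule keys_realize)
    fix x assume "x \<in> keys (box_sum k (points \<Lambda> t))"
    then have x: "x \<in> box_cubes k (points \<Lambda> t)" using keys_box_sum by blast
    obtain K a where xK: "x = (K, a)" by (cases x)
    have "a + set_vec K \<le> deg \<Lambda> (tup_prod \<Lambda> t)"
      using box_cubes_le(2)[OF s(2) deg_closed[OF P(1)]] x P(4) by (simp add: xK)
    moreover have "K \<subseteq> {1..k}" "card K = n" using x s(3) by (auto simp: xK box_cubes_def)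
    ultimately show "cube (tup_prod \<Lambda> t) x \<in> cub_cells n (tup_src \<Lambda> t)"
      using cube_cells[OF P(1)] P(3) xK by metis
  qed
qed

lemma operator_cub_bd: "operator \<Lambda> (cubes k \<Lambda> (Suc n)) (src \<Lambda>) (cubes k \<Lambda> n) (src \<Lambda>) cub_bd"
  unfolding operator_def
proof (intro ballI conjI)
  fix \<eta> assume \<eta>: "\<eta> \<in> cubes k \<Lambda> (Suc n)"
  note d = cubes_dirs[OF \<eta>] and c = cube_cube[OF \<eta>]
  show "src \<Lambda> \<eta> \<in> Obj \<Lambda>" using d src_closed by simp
  show "keys (cub_bd \<eta>) \<subseteq> cub_cells n (src \<Lambda> \<eta>)"
    unfolding cub_bd_def
  proof (rule keys_realize)
    fix x assume x: "x \<in> keys (cube_bd (dirs \<eta>, 0))"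
    obtain K a where xK: "x = (K, a)" by (cases x)
    note k = keys_cube_bd_le[OF d(3) x[unfolded xK]]
    have "a + set_vec K \<le> deg \<Lambda> \<eta>" using k(1) c(2) by (rule order_trans)
    moreover have "K \<subseteq> {1..k}" "card K = n" using k d by auto
    ultimately show "cube \<eta> x \<in> cub_cells n (src \<Lambda> \<eta>)"
      using cube_cells[OF d(1)] xK by metis
  qed
qed

lemma operator_nabla: "operator \<Lambda> (cubes k \<Lambda> n) (src \<Lambda>) (tuples \<Lambda> n) (tup_src \<Lambda>) nabla"
  unfolding operator_def
proof (intro ballI conjI)
  fix \<eta> assume \<eta>: "\<eta> \<in> cubes k \<Lambda> n"
  note d = cubes_dirs[OF \<eta>] and c = cube_cube[OF \<eta>]
  show "src \<Lambda> \<eta> \<in> Obj \<Lambda>" using d src_closed by simp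
  show "keys (nabla \<eta>) \<subseteq> bar_cells n (src \<Lambda> \<eta>)"
    unfolding nabla_def
    by (rule keys_realize, rule simplex_cells[OF d(1)])
      (use keys_nabla_sum[OF d(3), of 0] c(2) d(4) lattice_chain_mono in auto)
qed

section \<open>Identities between the operators\<close>

lemma bar_bd_bar_bd:
  assumes t: "t \<in> tuples \<Lambda> (Suc n)"
  shows "lin \<Lambda> bar_bd (bar_bd t) = 0"
proof (cases n)
  case 0
  have "keys (bar_bd t) \<subseteq> bar_cells 0 (tup_src \<Lambda> t)"
    using operatorD(2)[OF operator_bar_bd] t 0 by blast
  then show ?thesis
    unfolding lin_def by (intro frag_extend_eq_0) (auto simp: cells_def tuples_def bar_bd_def)
next
  case (Suc m)
  note P = tup_prod[OF t] and s = tuple_simplex[OF t]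
  have "snd t \<noteq> []" using t by (auto simp: tuples_def)
  then have "lin \<Lambda> bar_bd (bar_bd t) = lin \<Lambda> bar_bd (realize simplex (tup_prod \<Lambda> t) (simp_bd (points \<Lambda> t)))"
    by (simp add: bar_bd_def)
  also have "\<dots> = realize simplex (tup_prod \<Lambda> t) (frag_extend simp_bd (simp_bd (points \<Lambda> t)))"
    by (rule lin_realize, rule lin_bar_bd_simplex[OF P(1)]) (use keys_simp_bd[OF s(2)] s(3) Suc in auto)
  finally show ?thesis by (simp add: simp_bd_simp_bd)
qed

lemma bar_bd_nabla:
  assumes \<eta>: "\<eta> \<in> cubes k \<Lambda> (Suc n)"
  shows "lin \<Lambda> bar_bd (nabla \<eta>) = lin \<Lambda> nabla (cub_bd \<eta>)"
proof -
  note d = cubes_dirs[OF \<eta>] and c = cube_cube[OF \<eta>]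
  have "lin \<Lambda> bar_bd (nabla \<eta>) = realize simplex \<eta> (frag_extend simp_bd (nabla_sum (dirs \<eta>, 0)))"
    unfolding nabla_def
    by (rule lin_realize, rule lin_bar_bd_simplex[OF d(1)])
      (use keys_nabla_sum[OF d(3), of 0] c(2) d(4) lattice_chain_mono in auto)
  also have "\<dots> = realize simplex \<eta> (frag_extend nabla_sum (cube_bd (dirs \<eta>, 0)))"
    using nabla_sum_chain_map[OF d(3)] d(4) by fastforce
  also have "\<dots> = lin \<Lambda> nabla (cub_bd \<eta>)"
    unfolding cub_bd_def
  proof (rule lin_realize[symmetric])
    fix x assume x: "x \<in> keys (cube_bd (dirs \<eta>, 0))"
    obtain K a where xK: "x = (K, a)" by (cases x)
    note k = keys_cube_bd_le[OF d(3) x[unfolded xK]]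
    show "lin \<Lambda> nabla (frag_of (cube \<eta> x)) = realize simplex \<eta> (nabla_sum x)"
      unfolding xK by (rule lin_nabla_cube[OF d(1) finite_subset[OF k(2) d(3)] order_trans[OF k(1) c(2)]])
  qed
  finally show ?thesis .
qed

lemma cub_bd_box:
  assumes t: "t \<in> tuples \<Lambda> (Suc n)"
  shows "lin \<Lambda> cub_bd (box t) = lin \<Lambda> box (bar_bd t)"
proof -
  note P = tup_prod[OF t] and s = tuple_simplex[OF t]
  have len: "2 \<le> length (points \<Lambda> t)" using s(3) by simp
  have "lin \<Lambda> cub_bd (box t) = realize cube (tup_prod \<Lambda> t) (frag_extend cube_bd (box_sum k (points \<Lambda> t)))"
    unfolding box_def
  proof (rule lin_realize)
    fix x assume "x \<in> keys (box_sum k (points \<Lambda> t))"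
    then have x: "x \<in> box_cubes k (points \<Lambda> t)" using keys_box_sum by blast
    obtain K a where xK: "x = (K, a)" by (cases x)
    have "a + set_vec K \<le> deg \<Lambda> (tup_prod \<Lambda> t)"
      using box_cubes_le(2)[OF s(2) deg_closed[OF P(1)]] x P(4) by (simp add: xK)
    moreover have "finite K" using x finite_subset by (auto simp: xK box_cubes_def)
    ultimately show "lin \<Lambda> cub_bd (frag_of (cube (tup_prod \<Lambda> t) x)) = realize cube (tup_prod \<Lambda> t) (cube_bd x)"
      unfolding xK by (intro lin_cub_bd_cube[OF P(1)])
  qed
  also have "\<dots> = realize cube (tup_prod \<Lambda> t) (frag_extend (box_sum k) (simp_bd (points \<Lambda> t)))"
    by (simp only: box_sum_chain_map[OF s(2) deg_closed[OF P(1)] len])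
  also have "\<dots> = lin \<Lambda> box (realize simplex (tup_prod \<Lambda> t) (simp_bd (points \<Lambda> t)))"
    by (rule lin_realize[symmetric], rule lin_box_simplex[OF P(1)]) (use keys_simp_bd[OF s(2) len] in auto)
  also have "\<dots> = lin \<Lambda> box (bar_bd t)"
    using t by (auto simp: bar_bd_def tuples_def)
  finally show ?thesis .
qed

lemma box_nabla:
  assumes \<eta>: "\<eta> \<in> cubes k \<Lambda> n"
  shows "lin \<Lambda> box (nabla \<eta>) = frag_of (\<eta>, src \<Lambda> \<eta>)"
proof -
  note d = cubes_dirs[OF \<eta>] and c = cube_cube[OF \<eta>]
  have "lin \<Lambda> box (nabla \<eta>) = realize cube \<eta> (frag_extend (box_sum k) (nabla_sum (dirs \<eta>, 0)))"
    unfolding nabla_def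
    by (rule lin_realize, rule lin_box_simplex[OF d(1)])
      (use keys_nabla_sum[OF d(3), of 0] c(2) lattice_chain_mono in auto)
  then show ?thesis by (simp add: box_sum_nabla_sum[OF d(2)] c(1))
qed

text \<open>
  Since \<open>box\<close> is a left inverse of \<open>nabla\<close>, the latter is injective.  It carries the square of the
  cubical boundary to the square of the simplicial one, which is zero.
\<close>

lemma cub_bd_cub_bd:
  assumes \<eta>: "\<eta> \<in> cubes k \<Lambda> (Suc (Suc n))"
  shows "lin \<Lambda> cub_bd (cub_bd \<eta>) = 0"
proof -
  let ?w = "src \<Lambda> \<eta>"
  have k1: "keys (cub_bd \<eta>) \<subseteq> cub_cells (Suc n) ?w"
    by (rule operatorD(2)[OF operator_cub_bd \<eta>])
  have k2: "keys (lin \<Lambda> cub_bd (cub_bd \<eta>)) \<subseteq> cub_cells n ?w"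
    by (rule keys_lin[OF operator_cub_bd k1])
  have k3: "keys (nabla \<eta>) \<subseteq> bar_cells (Suc (Suc n)) ?w"
    by (rule operatorD(2)[OF operator_nabla \<eta>])
  have "lin \<Lambda> nabla (lin \<Lambda> cub_bd (cub_bd \<eta>)) = lin \<Lambda> (\<lambda>\<eta>. lin \<Lambda> nabla (cub_bd \<eta>)) (cub_bd \<eta>)"
    by (rule lin_lin[OF operator_cub_bd operator_nabla k1])
  also have "\<dots> = lin \<Lambda> (\<lambda>\<eta>. lin \<Lambda> bar_bd (nabla \<eta>)) (cub_bd \<eta>)"
    by (rule lin_cong[OF _ k1]) (simp add: bar_bd_nabla)
  also have "\<dots> = lin \<Lambda> bar_bd (lin \<Lambda> nabla (cub_bd \<eta>))"
    by (rule lin_lin[OF operator_nabla operator_bar_bd k1, symmetric])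
  also have "\<dots> = lin \<Lambda> bar_bd (lin \<Lambda> bar_bd (nabla \<eta>))"
    by (simp add: bar_bd_nabla[OF \<eta>])
  also have "\<dots> = lin \<Lambda> (\<lambda>t. lin \<Lambda> bar_bd (bar_bd t)) (nabla \<eta>)"
    by (rule lin_lin[OF operator_bar_bd operator_bar_bd k3])
  also have "\<dots> = 0"
    using k3 unfolding lin_def
    by (intro frag_extend_eq_0) (auto simp: cells_def bar_bd_bar_bd simp flip: lin_def)
  finally have zero: "lin \<Lambda> nabla (lin \<Lambda> cub_bd (cub_bd \<eta>)) = 0" .
  \<comment> \<open>The square of the boundary is recovered by applying \<open>box\<close>.\<close>
  have "lin \<Lambda> cub_bd (cub_bd \<eta>) = lin \<Lambda> (\<lambda>\<eta>. frag_of (\<eta>, src \<Lambda> \<eta>)) (lin \<Lambda> cub_bd (cub_bd \<eta>))"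
    by (rule lin_unit[OF k2, symmetric])
  also have "\<dots> = lin \<Lambda> (\<lambda>\<eta>. lin \<Lambda> box (nabla \<eta>)) (lin \<Lambda> cub_bd (cub_bd \<eta>))"
    by (rule lin_cong[OF _ k2]) (simp add: box_nabla)
  also have "\<dots> = lin \<Lambda> box (lin \<Lambda> nabla (lin \<Lambda> cub_bd (cub_bd \<eta>)))"
    by (rule lin_lin[OF operator_nabla operator_box k2, symmetric])
  finally show ?thesis using zero by simp
qed

text \<open>
  In the image of a single point only the \<open>0\<close>-cube at that point occurs.
\<close>

lemma nabla_box_0:
  assumes t: "t \<in> tuples \<Lambda> 0"
  shows "lin \<Lambda> nabla (box t) = frag_of (t, tup_src \<Lambda> t)"
proof -
  note P = tup_prod[OF t] and s = tuple_simplex[OF t]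
  have p: "points \<Lambda> t = [0]" using t by (auto simp: points_def tuples_def)
  have a0: "a = 0" if "a \<in> Nvec k" "\<forall>j\<in>{1..k}. a j = 0" for a
  proof
    fix i show "a i = 0 i" using that by (cases "i \<in> {1..k}") (auto simp: Nvec_def)
  qed
  have "box_cubes k [0] = {({}, 0)}"
    using finite_subset[of _ "{1..k}"] a0
    by (auto simp: box_cubes_def box_cond_def rank_def card_eq_0_iff)
  then have b: "box_sum k [0] = frag_of ({}, 0)" by (simp add: box_sum_def)
  have "box t = frag_of (cube (tup_prod \<Lambda> t) ({}, 0))" by (simp add: box_def p b)
  then have "lin \<Lambda> nabla (box t) = realize simplex (tup_prod \<Lambda> t) (nabla_sum ({}, 0))"
    using lin_nabla_cube[OF P(1), of "{}" 0] by (simp add: set_vec_def)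
  also have "nabla_sum ({}, 0) = frag_of [0]"
    by (simp add: nabla_sum_def path_sum_def path_def sign_id[unfolded id_def])
  finally show ?thesis using s(1) by (simp add: p)
qed

section \<open>The homotopy\<close>

text \<open>
  In the lattice of \<open>\<xi>\<close>, appending the trailing morphism as a last entry joins a simplex to the
  terminal vertex \<open>d(\<xi>)\<close> (\<open>cone_simplex\<close>).  With the sign \<open>(-1)\<close> to the power \<open>n + 1\<close> on \<open>n\<close>-simplices
  this is a contraction.  It does not commute with translation by morphisms, and so it acts on
  formal sums without coming from an operator.
\<close>

definition cone :: "('a tup \<times> 'a \<Rightarrow>\<^sub>0 int) \<Rightarrow> ('a tup \<times> 'a \<Rightarrow>\<^sub>0 int)" where
  "cone c = frag_extend (\<lambda>((v, ms), \<rho>). frag_cmul ((- 1) ^ Suc (length ms)) (frag_of ((v, ms @ [\<rho>]), src \<Lambda> \<rho>))) c"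

lemma cone_zero [simp]: "cone 0 = 0"
  and cone_diff: "cone (c - d) = cone c - cone d"
  by (simp_all add: cone_def frag_extend_diff)

lemma cone_simplex:
  assumes \<xi>: "\<xi> \<in> Mor \<Lambda>" and ps: "lattice_chain (deg \<Lambda> \<xi>) ps"
  shows "cone (frag_of (simplex \<xi> ps)) = frag_cmul ((- 1) ^ length ps) (frag_of (simplex \<xi> (ps @ [deg \<Lambda> \<xi>])))"
    and "lattice_chain (deg \<Lambda> \<xi>) (ps @ [deg \<Lambda> \<xi>])"
proof -
  have ne: "ps \<noteq> []" and l: "last ps \<le> deg \<Lambda> \<xi>" using ps by (auto simp: lattice_chain_def)
  have s: "src \<Lambda> (seg \<Lambda> \<xi> (last ps) (deg \<Lambda> \<xi>)) = seg \<Lambda> \<xi> (deg \<Lambda> \<xi>) (deg \<Lambda> \<xi>)"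
    using seg_point(2)[OF \<xi> l order_refl] by simp
  have snoc: "map2 f (xs @ [D]) (tl xs @ [D]) = map2 f xs (tl xs) @ [f (last xs) D]" if "xs \<noteq> []" for f :: "vec \<Rightarrow> vec \<Rightarrow> 'a" and xs D
    using that by (induction xs rule: induct_list012) auto
  have len: "Suc (length (map2 (seg \<Lambda> \<xi>) ps (tl ps))) = length ps" using ne by (cases ps) auto
  show "cone (frag_of (simplex \<xi> ps)) = frag_cmul ((- 1) ^ length ps) (frag_of (simplex \<xi> (ps @ [deg \<Lambda> \<xi>])))"
    by (simp only: cone_def simplex_def len s snoc[OF ne] frag_extend_of prod.case hd_append2[OF ne] tl_append2[OF ne] last_snoc refl)
  show "lattice_chain (deg \<Lambda> \<xi>) (ps @ [deg \<Lambda> \<xi>])"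
    using lattice_chain_le[OF ps] ps by (auto simp: lattice_chain_def sorted_wrt_append intro: order_trans)
qed

lemma simplex_cell:
  assumes "x \<in> bar_cells n w"
  obtains \<xi> ps where "\<xi> \<in> Mor \<Lambda>" "src \<Lambda> \<xi> = w" "lattice_chain (deg \<Lambda> \<xi>) ps" "length ps = Suc n" "x = simplex \<xi> ps"
proof -
  obtain t \<rho> where x: "x = (t, \<rho>)" by (cases x)
  have "t \<in> tuples \<Lambda> n" using assms by (simp add: x cells_def)
  then have "length (points \<Lambda> t) = Suc n" by (rule tuple_simplex(3))
  then show thesis using that[of "tup_prod \<Lambda> t \<cdot> \<rho>" "points \<Lambda> t"] simplex_points[OF assms[unfolded x]] x by metis
qed

lemma keys_cone:
  assumes "keys c \<subseteq> bar_cells n w"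
  shows "keys (cone c) \<subseteq> bar_cells (Suc n) w"
  using assms
proof (induction c rule: frag_induction)
  case (one x)
  then obtain \<xi> ps where x: "\<xi> \<in> Mor \<Lambda>" "src \<Lambda> \<xi> = w" "lattice_chain (deg \<Lambda> \<xi>) ps" "length ps = Suc n" "x = simplex \<xi> ps"
    by (rule simplex_cell)
  have "simplex \<xi> (ps @ [deg \<Lambda> \<xi>]) \<in> bar_cells (Suc n) w"
    using simplex_cells[OF x(1) cone_simplex(2)[OF x(1,3)], of "Suc n"] x by simp
  then show ?case
    unfolding x(5) cone_simplex(1)[OF x(1,3)] by (intro order.trans[OF keys_cmul]) (simp add: keys_frag_of)
next
  case (diff a b)
  then show ?case unfolding cone_diff by (intro order.trans[OF keys_diff]) simp
qed simp

text \<open>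
  The face of the joined simplex opposite to the new vertex is the old simplex, and the signs make
  the other faces cancel.
\<close>

lemma bar_bd_cone:
  assumes "keys c \<subseteq> bar_cells (Suc n) w"
  shows "lin \<Lambda> bar_bd (cone c) + cone (lin \<Lambda> bar_bd c) = c"
  using assms
proof (induction c rule: frag_induction)
  case (one x)
  then obtain \<xi> ps where x: "\<xi> \<in> Mor \<Lambda>" "src \<Lambda> \<xi> = w" "lattice_chain (deg \<Lambda> \<xi>) ps" "length ps = Suc (Suc n)" "x = simplex \<xi> ps"
    by (rule simplex_cell)
  let ?D = "deg \<Lambda> \<xi>" and ?s = "(- 1) ^ length ps :: int"
  let ?snoc = "\<lambda>c. frag_extend (\<lambda>qs. frag_of (qs @ [?D])) c"
  have "lin \<Lambda> bar_bd (cone (frag_of x)) = frag_cmul ?s (realize simplex \<xi> (simp_bd (ps @ [?D])))"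
    unfolding x(5) cone_simplex(1)[OF x(1,3)] lin_cmul
    using lin_bar_bd_simplex[OF x(1) cone_simplex(2)[OF x(1,3)]] x(4) by simp
  also have "\<dots> = frag_cmul ?s (realize simplex \<xi> (?snoc (simp_bd ps))) + frag_of x"
    by (simp add: simp_bd_snoc realize_add realize_cmul frag_cmul_distrib2 x(5) flip: power_add)
  finally have 1: "lin \<Lambda> bar_bd (cone (frag_of x)) = frag_cmul ?s (realize simplex \<xi> (?snoc (simp_bd ps))) + frag_of x" .
  have sn: "cone (realize simplex \<xi> c) = frag_cmul (- ?s) (realize simplex \<xi> (?snoc c))"
    if "keys c \<subseteq> {qs. lattice_chain ?D qs \<and> Suc (length qs) = length ps}" for c
    using that
  proof (induction c rule: frag_induction)
    case (one qs)
    then have q: "lattice_chain ?D qs" and "length ps = Suc (length qs)" by auto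
    then have "(- 1) ^ length qs = - ?s" by simp
    then show ?case using cone_simplex(1)[OF x(1) q] by simp
  next
    case (diff a b)
    then show ?case by (simp add: cone_diff realize_diff frag_extend_diff frag_cmul_diff_distrib2)
  qed simp
  have "cone (lin \<Lambda> bar_bd (frag_of x)) = frag_cmul (- ?s) (realize simplex \<xi> (?snoc (simp_bd ps)))"
    unfolding x(5) using lin_bar_bd_simplex[OF x(1,3)] sn[OF keys_simp_bd[OF x(3)]] x(4) by simp
  with 1 show ?case by (simp flip: minus_frag_cmul)
qed (simp_all add: cone_diff lin_diff algebra_simps)

text \<open>
  The index is shifted by one: \<open>homotopy (Suc n)\<close> raises the degree from \<open>n\<close> to \<open>n + 1\<close>, and
  \<open>homotopy 0 = 0\<close> stands for the homotopy out of degree \<open>-1\<close>.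
\<close>

fun homotopy :: "nat \<Rightarrow> 'a tup \<Rightarrow> ('a tup \<times> 'a \<Rightarrow>\<^sub>0 int)" where
  "homotopy 0 t = 0"
| "homotopy (Suc n) t =
    cone (lin \<Lambda> nabla (box t) - frag_of (t, tup_src \<Lambda> t) - lin \<Lambda> (homotopy n) (bar_bd t))"

lemma keys_unit: "s i \<in> Obj \<Lambda> \<Longrightarrow> i \<in> I \<Longrightarrow> keys (frag_of (i, s i)) \<subseteq> cells \<Lambda> I s (s i)"
  by (simp add: keys_frag_of cells_def Obj_Mor rng_Obj src_Obj)

text \<open>
  In degree \<open>0\<close> the argument of \<open>cone\<close> vanishes, because \<open>nabla \<circ> box\<close> is the identity there.
\<close>

lemma operator_homotopy:
  "operator \<Lambda> (tuples \<Lambda> n) (tup_src \<Lambda>) (tuples \<Lambda> (Suc n)) (tup_src \<Lambda>) (homotopy (Suc n))"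
proof (induction n)
  case 0
  have "homotopy (Suc 0) t = 0" if "t \<in> tuples \<Lambda> 0" for t
    using nabla_box_0[OF that] bar_bd_0[OF that] by simp
  then show ?case using tup_prod(5) by (auto simp: operator_def simp del: homotopy.simps)
next
  case (Suc n)
  show ?case
    unfolding operator_def
  proof (intro ballI conjI)
    fix t assume t: "t \<in> tuples \<Lambda> (Suc n)"
    let ?c = "bar_cells (Suc n) (tup_src \<Lambda> t)"
    show o: "tup_src \<Lambda> t \<in> Obj \<Lambda>" by (rule tup_prod(5)[OF t])
    have "keys (lin \<Lambda> nabla (box t)) \<subseteq> ?c"
      by (rule keys_lin[OF operator_nabla operatorD(2)[OF operator_box t]])
    moreover have "keys (lin \<Lambda> (homotopy (Suc n)) (bar_bd t)) \<subseteq> ?c"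
      by (rule keys_lin[OF Suc.IH operatorD(2)[OF operator_bar_bd t]])
    moreover have "keys (frag_of (t, tup_src \<Lambda> t)) \<subseteq> ?c"
      by (rule keys_unit[where s = "tup_src \<Lambda>", OF o t])
    ultimately have "keys (lin \<Lambda> nabla (box t) - frag_of (t, tup_src \<Lambda> t) - lin \<Lambda> (homotopy (Suc n)) (bar_bd t)) \<subseteq> ?c"
      using keys_diff[of "lin \<Lambda> nabla (box t) - frag_of (t, tup_src \<Lambda> t)" "lin \<Lambda> (homotopy (Suc n)) (bar_bd t)"]
        keys_diff[of "lin \<Lambda> nabla (box t)" "frag_of (t, tup_src \<Lambda> t)"] by blast
    then show "keys (homotopy (Suc (Suc n)) t) \<subseteq> bar_cells (Suc (Suc n)) (tup_src \<Lambda> t)"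
      unfolding homotopy.simps(2)[of "Suc n"] by (rule keys_cone)
  qed
qed

lemma homotopy_0: "t \<in> tuples \<Lambda> 0 \<Longrightarrow> homotopy (Suc 0) t = 0"
  by (simp add: nabla_box_0 bar_bd_0)

lemma lin_fun_diff:
  assumes "keys c \<subseteq> UNIV"
  shows "lin \<Lambda> (\<lambda>i. A i - B i) c = lin \<Lambda> A c - lin \<Lambda> B c"
  using assms
proof (induction c rule: frag_induction)
  case (one x)
  then show ?case by (cases x) (simp add: rtrans_diff)
qed (simp_all add: lin_diff)

text \<open>
  The argument of \<open>cone\<close> in the definition of \<open>homotopy (Suc n) t\<close> is a cycle, by the induction
  hypothesis in the preceding degree and because \<open>nabla\<close> and \<open>box\<close> commute with the boundaries.  By
  \<open>bar_bd_cone\<close> it is the boundary of its cone.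
\<close>

lemma homotopy:
  assumes "t \<in> tuples \<Lambda> n"
  shows "lin \<Lambda> bar_bd (homotopy (Suc n) t) =
    lin \<Lambda> nabla (box t) - frag_of (t, tup_src \<Lambda> t) - lin \<Lambda> (homotopy n) (bar_bd t)"
  using assms
proof (induction n arbitrary: t)
  case 0
  then show ?case by (simp add: nabla_box_0 homotopy_0 bar_bd_0 del: homotopy.simps)
next
  case (Suc n)
  note t = \<open>t \<in> tuples \<Lambda> (Suc n)\<close>
  let ?w = "tup_src \<Lambda> t" and ?d = "bar_bd t"
  let ?X = "lin \<Lambda> nabla (box t) - frag_of (t, ?w) - lin \<Lambda> (homotopy (Suc n)) ?d"
  let ?c = "bar_cells (Suc n) ?w"
  have kd: "keys ?d \<subseteq> bar_cells n ?w"
    by (rule operatorD(2)[OF operator_bar_bd t])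
  have kb: "keys (box t) \<subseteq> cub_cells (Suc n) ?w"
    by (rule operatorD(2)[OF operator_box t])
  have "keys (lin \<Lambda> nabla (box t)) \<subseteq> ?c"
    by (rule keys_lin[OF operator_nabla kb])
  moreover have "keys (lin \<Lambda> (homotopy (Suc n)) ?d) \<subseteq> ?c"
    by (rule keys_lin[OF operator_homotopy kd])
  moreover have "keys (frag_of (t, ?w)) \<subseteq> ?c"
    by (rule keys_unit[where s = "tup_src \<Lambda>", OF tup_prod(5)[OF t] t])
  ultimately have kX: "keys ?X \<subseteq> ?c"
    using keys_diff[of "lin \<Lambda> nabla (box t) - frag_of (t, ?w)" "lin \<Lambda> (homotopy (Suc n)) ?d"]
      keys_diff[of "lin \<Lambda> nabla (box t)" "frag_of (t, ?w)"] by blast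
  have "lin \<Lambda> bar_bd (lin \<Lambda> nabla (box t)) = lin \<Lambda> (\<lambda>\<eta>. lin \<Lambda> bar_bd (nabla \<eta>)) (box t)"
    by (rule lin_lin[OF operator_nabla operator_bar_bd kb])
  also have "\<dots> = lin \<Lambda> (\<lambda>\<eta>. lin \<Lambda> nabla (cub_bd \<eta>)) (box t)"
    by (rule lin_cong[OF bar_bd_nabla kb])
  also have "\<dots> = lin \<Lambda> nabla (lin \<Lambda> cub_bd (box t))"
    by (rule lin_lin[OF operator_cub_bd operator_nabla kb, symmetric])
  also have "\<dots> = lin \<Lambda> nabla (lin \<Lambda> box ?d)"
    by (simp only: cub_bd_box[OF t])
  also have "\<dots> = lin \<Lambda> (\<lambda>t. lin \<Lambda> nabla (box t)) ?d"
    by (rule lin_lin[OF operator_box operator_nabla kd])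
  finally have 1: "lin \<Lambda> bar_bd (lin \<Lambda> nabla (box t)) = lin \<Lambda> (\<lambda>t. lin \<Lambda> nabla (box t)) ?d" .
  have 2: "lin \<Lambda> bar_bd (frag_of (t, ?w)) = ?d"
    by (simp add: rtrans_src[OF kd])
  have "lin \<Lambda> bar_bd (lin \<Lambda> (homotopy (Suc n)) ?d) = lin \<Lambda> (\<lambda>t. lin \<Lambda> bar_bd (homotopy (Suc n) t)) ?d"
    by (rule lin_lin[OF operator_homotopy operator_bar_bd kd])
  also have "\<dots> = lin \<Lambda> (\<lambda>t. lin \<Lambda> nabla (box t) - frag_of (t, tup_src \<Lambda> t) - lin \<Lambda> (homotopy n) (bar_bd t)) ?d"
    by (rule lin_cong[OF Suc.IH kd])
  also have "\<dots> = lin \<Lambda> (\<lambda>t. lin \<Lambda> nabla (box t)) ?d - ?d - lin \<Lambda> (\<lambda>t. lin \<Lambda> (homotopy n) (bar_bd t)) ?d"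
    by (simp only: lin_fun_diff[OF subset_UNIV] lin_unit[OF kd])
  \<comment> \<open>The remaining term vanishes because it contains the square of the boundary, or in the lowest
    degree because \<open>homotopy 0\<close> is zero.\<close>
  also have "lin \<Lambda> (\<lambda>t. lin \<Lambda> (homotopy n) (bar_bd t)) ?d = 0"
  proof (cases n)
    case 0
    have "rtrans \<Lambda> \<rho> (lin \<Lambda> (homotopy 0) (bar_bd t)) = 0" for \<rho> t
      by (simp add: lin_def frag_extend_eq_0 case_prod_beta)
    then show ?thesis unfolding 0 lin_def[of _ "\<lambda>t. lin \<Lambda> (homotopy 0) (bar_bd t)"]
      by (intro frag_extend_eq_0) auto
  next
    case (Suc m)
    have "lin \<Lambda> (\<lambda>t. lin \<Lambda> (homotopy n) (bar_bd t)) ?d = lin \<Lambda> (homotopy n) (lin \<Lambda> bar_bd ?d)"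
      unfolding Suc by (rule lin_lin[OF operator_bar_bd operator_homotopy kd[unfolded Suc], symmetric])
    then show ?thesis using bar_bd_bar_bd[OF t] by simp
  qed
  finally have "lin \<Lambda> bar_bd ?X = 0"
    by (simp add: lin_diff 1 2 del: homotopy.simps lin_of)
  then show ?case
    unfolding homotopy.simps(2)[of "Suc n"] using bar_bd_cone[OF kX] by (simp del: homotopy.simps)
qed

end

section \<open>Homotopy equivalences induce isomorphisms\<close>

lemma comm_group_subgroup:
  assumes "comm_group G" "subgroup H G"
  shows "comm_group (G\<lparr>carrier := H\<rparr>)"
proof -
  interpret comm_group G by fact
  interpret S: Group.group "G\<lparr>carrier := H\<rparr>" by (rule subgroup.subgroup_is_group[OF assms(2) is_group])
  show ?thesis
    by (rule S.group_comm_groupI) (use subgroup.mem_carrier[OF assms(2)] in \<open>auto simp: m_comm\<close>)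
qed

lemma quotient_map_coset:
  assumes G: "comm_group G" and H: "comm_group H" and A: "subgroup A G" and B: "subgroup B H"
    and f: "f \<in> hom G H" "f ` A \<subseteq> B" and x: "x \<in> carrier G"
  shows "(\<Union>y\<in>A #>\<^bsub>G\<^esub> x. B #>\<^bsub>H\<^esub> f y) = B #>\<^bsub>H\<^esub> f x"
proof -
  interpret G: comm_group G by fact
  interpret H: comm_group H by fact
  have fx: "f x \<in> carrier H" using hom_in_carrier[OF f(1) x] .
  have "B #>\<^bsub>H\<^esub> f y = B #>\<^bsub>H\<^esub> f x" if y: "y \<in> A #>\<^bsub>G\<^esub> x" for y
  proof -
    obtain a where a: "a \<in> A" "y = a \<otimes>\<^bsub>G\<^esub> x" using y by (auto simp: r_coset_def)
    have "f y = f a \<otimes>\<^bsub>H\<^esub> f x" using hom_mult[OF f(1) subgroup.mem_carrier[OF A a(1)] x] a by simp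
    then have "f y \<in> B #>\<^bsub>H\<^esub> f x" using a(1) f(2) by (auto simp: r_coset_def)
    then show ?thesis using H.repr_independence[OF _ fx B] by simp
  qed
  moreover have "x \<in> A #>\<^bsub>G\<^esub> x" by (rule G.rcos_self[OF x A])
  ultimately show ?thesis by blast
qed

lemma quotient_map_hom:
  assumes G: "comm_group G" and H: "comm_group H" and A: "subgroup A G" and B: "subgroup B H"
    and f: "f \<in> hom G H" "f ` A \<subseteq> B"
  shows "(\<lambda>X. \<Union>x\<in>X. B #>\<^bsub>H\<^esub> f x) \<in> hom (G Mod A) (H Mod B)"
proof (rule homI)
  interpret G: comm_group G by fact
  interpret H: comm_group H by fact
  interpret A: normal A G by (rule G.subgroup_imp_normal[OF A])
  interpret B: normal B H by (rule H.subgroup_imp_normal[OF B])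
  note c = quotient_map_coset[OF G H A B f]
  note fc = hom_in_carrier[OF f(1)]
  fix X assume "X \<in> carrier (G Mod A)"
  then obtain x where x: "x \<in> carrier G" "X = A #>\<^bsub>G\<^esub> x" by (auto simp: carrier_FactGroup)
  show "(\<Union>x\<in>X. B #>\<^bsub>H\<^esub> f x) \<in> carrier (H Mod B)"
    using c[OF x(1)] fc[OF x(1)] by (auto simp: x(2) carrier_FactGroup)
  fix Y assume "Y \<in> carrier (G Mod A)"
  then obtain y where y: "y \<in> carrier G" "Y = A #>\<^bsub>G\<^esub> y" by (auto simp: carrier_FactGroup)
  have "X \<otimes>\<^bsub>G Mod A\<^esub> Y = A #>\<^bsub>G\<^esub> (x \<otimes>\<^bsub>G\<^esub> y)"
    using A.rcos_sum[OF x(1) y(1)] by (simp add: FactGroup_def x y)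
  moreover have "(B #>\<^bsub>H\<^esub> f x) \<otimes>\<^bsub>H Mod B\<^esub> (B #>\<^bsub>H\<^esub> f y) = B #>\<^bsub>H\<^esub> f (x \<otimes>\<^bsub>G\<^esub> y)"
    using B.rcos_sum[OF fc[OF x(1)] fc[OF y(1)]] by (simp add: FactGroup_def hom_mult[OF f(1) x(1) y(1)])
  ultimately show "(\<Union>x\<in>X \<otimes>\<^bsub>G Mod A\<^esub> Y. B #>\<^bsub>H\<^esub> f x) =
      (\<Union>x\<in>X. B #>\<^bsub>H\<^esub> f x) \<otimes>\<^bsub>H Mod B\<^esub> (\<Union>x\<in>Y. B #>\<^bsub>H\<^esub> f x)"
    using c[OF x(1)] c[OF y(1)] c[OF G.m_closed[OF x(1) y(1)]] x(2) y(2) by simp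
qed

text \<open>
  Homology is a quotient of abelian groups in every degree, and chain maps that are inverse up to
  homotopy are inverse modulo boundaries on cycles.  This lemma carries out the remaining step for
  both homology and cohomology.
\<close>

lemma quotient_isomorphisms:
  assumes G: "comm_group G" and H: "comm_group H" and A: "subgroup A G" and B: "subgroup B H"
    and f: "f \<in> hom G H" "f ` A \<subseteq> B" and g: "g \<in> hom H G" "g ` B \<subseteq> A"
    and gf: "\<And>x. x \<in> carrier G \<Longrightarrow> g (f x) \<in> A #>\<^bsub>G\<^esub> x" and fg: "\<And>y. y \<in> carrier H \<Longrightarrow> f (g y) \<in> B #>\<^bsub>H\<^esub> y"
  shows "group_isomorphisms (G Mod A) (H Mod B) (\<lambda>X. \<Union>x\<in>X. B #>\<^bsub>H\<^esub> f x) (\<lambda>Y. \<Union>y\<in>Y. A #>\<^bsub>G\<^esub> g y)"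
proof -
  interpret G: comm_group G by fact
  interpret H: comm_group H by fact
  have gf': "(\<Union>y\<in>(\<Union>x\<in>X. B #>\<^bsub>H\<^esub> f x). A #>\<^bsub>G\<^esub> g y) = X" if "X \<in> carrier (G Mod A)" for X
  proof -
    obtain x where x: "x \<in> carrier G" "X = A #>\<^bsub>G\<^esub> x" using \<open>X \<in> carrier (G Mod A)\<close> by (auto simp: carrier_FactGroup)
    show ?thesis
      unfolding x(2) quotient_map_coset[OF G H A B f x(1)] quotient_map_coset[OF H G B A g hom_in_carrier[OF f(1) x(1)]]
      by (rule G.repr_independence[OF gf[OF x(1)] x(1) A, symmetric])
  qed
  have fg': "(\<Union>x\<in>(\<Union>y\<in>Y. A #>\<^bsub>G\<^esub> g y). B #>\<^bsub>H\<^esub> f x) = Y" if "Y \<in> carrier (H Mod B)" for Y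
  proof -
    obtain y where y: "y \<in> carrier H" "Y = B #>\<^bsub>H\<^esub> y" using \<open>Y \<in> carrier (H Mod B)\<close> by (auto simp: carrier_FactGroup)
    show ?thesis
      unfolding y(2) quotient_map_coset[OF H G B A g y(1)] quotient_map_coset[OF G H A B f hom_in_carrier[OF g(1) y(1)]]
      by (rule H.repr_independence[OF fg[OF y(1)] y(1) B, symmetric])
  qed
  show ?thesis
    unfolding group_isomorphisms_def
    by (intro conjI ballI quotient_map_hom[OF G H A B f] quotient_map_hom[OF H G B A g] gf' fg')
qed

lemma hom_one':
  "comm_group G \<Longrightarrow> comm_group H \<Longrightarrow> f \<in> hom G H \<Longrightarrow> f \<one>\<^bsub>G\<^esub> = \<one>\<^bsub>H\<^esub>"
  using hom_one[of f G H] by (simp add: comm_group.axioms(2))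

lemma kernel_comm_group:
  assumes "comm_group G" "comm_group H" "f \<in> hom G H"
  shows "subgroup (kernel G H f) G" "comm_group (G\<lparr>carrier := kernel G H f\<rparr>)"
proof -
  interpret group_hom G H f
    using assms by (simp add: group_hom_def group_hom_axioms_def comm_group.axioms(2))
  show "subgroup (kernel G H f) G" by (rule subgroup_kernel)
  then show "comm_group (G\<lparr>carrier := kernel G H f\<rparr>)" by (rule comm_group_subgroup[OF assms(1)])
qed

lemma image_subgroup:
  assumes "comm_group G" "comm_group H" "f \<in> hom G H" "subgroup S H" "f ` carrier G \<subseteq> S"
  shows "subgroup (f ` carrier G) (H\<lparr>carrier := S\<rparr>)"
proof -
  interpret group_hom G H f
    using assms by (simp add: group_hom_def group_hom_axioms_def comm_group.axioms(2))
  show ?thesis by (rule H.subgroup_incl[OF img_is_subgroup assms(4,5)])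
qed

lemma one_subgroup:
  assumes "comm_group G" "subgroup S G"
  shows "subgroup {\<one>\<^bsub>G\<^esub>} (G\<lparr>carrier := S\<rparr>)"
proof -
  interpret comm_group G by fact
  show ?thesis by (rule subgroup_incl[OF triv_subgroup assms(2)]) (simp add: subgroup.one_closed[OF assms(2)])
qed

lemma cocycle_coboundary_groups:
  assumes C: "cochain_complex C \<delta>"
  shows "comm_group (cocycle_group C \<delta> n)" "subgroup (coboundaries C \<delta> n) (cocycle_group C \<delta> n)"
proof -
  have c: "\<And>n. comm_group (C n)" and h: "\<And>n. \<delta> n \<in> hom (C n) (C (Suc n))"
    and z: "\<And>n x. x \<in> carrier (C n) \<Longrightarrow> \<delta> (Suc n) (\<delta> n x) = \<one>\<^bsub>C (Suc (Suc n))\<^esub>"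
    using C by (auto simp: cochain_complex_def)
  note k = kernel_comm_group[OF c c h]
  show "comm_group (cocycle_group C \<delta> n)" unfolding cocycle_group_def by (rule k)
  show "subgroup (coboundaries C \<delta> n) (cocycle_group C \<delta> n)"
  proof (cases n)
    case 0
    then show ?thesis unfolding cocycle_group_def coboundaries_def using one_subgroup[OF c k(1)] by simp
  next
    case (Suc m)
    have "\<delta> m ` carrier (C m) \<subseteq> kernel (C n) (C (Suc n)) (\<delta> n)"
      using z hom_in_carrier[OF h] by (auto simp: kernel_def Suc)
    then show ?thesis unfolding cocycle_group_def coboundaries_def Suc
      using image_subgroup[OF c c h k(1)] by simp
  qed
qed

lemma cochain_map_cohomology:
  assumes f: "cochain_map C \<delta> D \<epsilon> \<phi>"
  shows "\<phi> n \<in> hom (cocycle_group C \<delta> n) (cocycle_group D \<epsilon> n)" "\<phi> n ` coboundaries C \<delta> n \<subseteq> coboundaries D \<epsilon> n"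
proof -
  have c: "\<And>n. comm_group (C n)" "\<And>n. comm_group (D n)" and h: "\<And>n. \<phi> n \<in> hom (C n) (D n)"
    and z: "\<And>n x. x \<in> carrier (C n) \<Longrightarrow> \<phi> (Suc n) (\<delta> n x) = \<epsilon> n (\<phi> n x)"
    using f by (auto simp: cochain_map_def cochain_complex_def)
  have one: "\<phi> n \<one>\<^bsub>C n\<^esub> = \<one>\<^bsub>D n\<^esub>" for n by (rule hom_one'[OF c h])
  show "\<phi> n \<in> hom (cocycle_group C \<delta> n) (cocycle_group D \<epsilon> n)"
    using h[of n] z[of _ n, symmetric] by (auto simp: hom_def cocycle_group_def kernel_def one Pi_def)
  show "\<phi> n ` coboundaries C \<delta> n \<subseteq> coboundaries D \<epsilon> n"
  proof (cases n)
    case 0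
    then show ?thesis by (simp add: coboundaries_def one)
  next
    case (Suc m)
    then show ?thesis using z[of _ m] hom_in_carrier[OF h[of m]] by (auto simp: coboundaries_def)
  qed
qed

text \<open>
  On cocycles the summand of the homotopy formula that starts with the coboundary vanishes, and the
  other summand is a coboundary.
\<close>

lemma cochain_homotopic_id_coset:
  assumes C: "cochain_complex C \<delta>" and h: "cochain_homotopic C \<delta> C \<delta> \<phi> (\<lambda>n. id)"
    and x: "x \<in> carrier (cocycle_group C \<delta> n)"
  shows "\<phi> n x \<in> coboundaries C \<delta> n #>\<^bsub>cocycle_group C \<delta> n\<^esub> x"
proof -
  obtain s where s: "\<And>n. s n \<in> hom (C (Suc n)) (C n)"
    "\<And>x. x \<in> carrier (C 0) \<Longrightarrow> \<phi> 0 x = x \<otimes>\<^bsub>C 0\<^esub> s 0 (\<delta> 0 x)"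
    "\<And>n x. x \<in> carrier (C (Suc n)) \<Longrightarrow> \<phi> (Suc n) x =
        x \<otimes>\<^bsub>C (Suc n)\<^esub> s (Suc n) (\<delta> (Suc n) x) \<otimes>\<^bsub>C (Suc n)\<^esub> \<delta> n (s n x)"
    using h unfolding cochain_homotopic_def id_apply by blast
  have c: "\<And>n. comm_group (C n)" and d: "\<And>n. \<delta> n \<in> hom (C n) (C (Suc n))"
    using C by (auto simp: cochain_complex_def)
  interpret Cn: comm_group "C n" by (rule c)
  have xn: "x \<in> carrier (C n)" "\<delta> n x = \<one>\<^bsub>C (Suc n)\<^esub>"
    using x by (auto simp: cocycle_group_def kernel_def)
  have s1: "s n \<one>\<^bsub>C (Suc n)\<^esub> = \<one>\<^bsub>C n\<^esub>" for n by (rule hom_one'[OF c c s(1)])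
  have "\<exists>b\<in>coboundaries C \<delta> n. \<phi> n x = b \<otimes>\<^bsub>C n\<^esub> x"
  proof (cases n)
    case 0
    then show ?thesis using s(2)[of x] xn s1[of 0] Cn.r_one[OF xn(1)] Cn.l_one[OF xn(1)] by (simp add: coboundaries_def)
  next
    case (Suc m)
    let ?b = "\<delta> m (s m x)"
    have sm: "s m x \<in> carrier (C m)" using hom_in_carrier[OF s(1)] xn Suc by simp
    then have b: "?b \<in> carrier (C n)" using hom_in_carrier[OF d] Suc by simp
    have "\<phi> n x = x \<otimes>\<^bsub>C n\<^esub> \<one>\<^bsub>C n\<^esub> \<otimes>\<^bsub>C n\<^esub> ?b"
      using s(3)[of x m] xn s1[of n] by (simp add: Suc)
    then have "\<phi> n x = ?b \<otimes>\<^bsub>C n\<^esub> x" using xn b by (simp add: Cn.m_comm)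
    then show ?thesis using sm Suc by (auto simp: coboundaries_def)
  qed
  then show ?thesis by (auto simp: r_coset_def cocycle_group_def)
qed

lemma cochain_homotopy_equivalence_isomorphisms:
  assumes "cochain_homotopy_equivalence C \<delta> D \<epsilon> \<phi> \<psi>"
  shows "group_isomorphisms (cohomology_group C \<delta> n) (cohomology_group D \<epsilon> n)
    (cohomology_map D \<epsilon> \<phi> n) (cohomology_map C \<delta> \<psi> n)"
proof -
  have f: "cochain_map C \<delta> D \<epsilon> \<phi>" and g: "cochain_map D \<epsilon> C \<delta> \<psi>"
    and gf: "cochain_homotopic C \<delta> C \<delta> (\<lambda>n. \<psi> n \<circ> \<phi> n) (\<lambda>n. id)"
    and fg: "cochain_homotopic D \<epsilon> D \<epsilon> (\<lambda>n. \<phi> n \<circ> \<psi> n) (\<lambda>n. id)"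
    using assms by (auto simp: cochain_homotopy_equivalence_def)
  then have C: "cochain_complex C \<delta>" and D: "cochain_complex D \<epsilon>" by (auto simp: cochain_map_def)
  have "group_isomorphisms (cohomology_group C \<delta> n) (cohomology_group D \<epsilon> n)
     (\<lambda>X. \<Union>x\<in>X. coboundaries D \<epsilon> n #>\<^bsub>cocycle_group D \<epsilon> n\<^esub> \<phi> n x)
     (\<lambda>Y. \<Union>y\<in>Y. coboundaries C \<delta> n #>\<^bsub>cocycle_group C \<delta> n\<^esub> \<psi> n y)"
    unfolding cohomology_group_def
    using cochain_homotopic_id_coset[OF C gf] cochain_homotopic_id_coset[OF D fg]
    by (intro quotient_isomorphisms cocycle_coboundary_groups[OF C] cocycle_coboundary_groups[OF D]
        cochain_map_cohomology[OF f] cochain_map_cohomology[OF g]) auto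
  then show ?thesis by (simp add: cohomology_map_def[abs_def])
qed

lemma cycle_boundary_groups:
  assumes C: "chain_complex C bd"
  shows "comm_group (cycle_group C bd n)" "subgroup (boundaries C bd n) (cycle_group C bd n)"
proof -
  have c: "\<And>n. comm_group (C n)" and h: "\<And>n. bd (Suc n) \<in> hom (C (Suc n)) (C n)"
    and z: "\<And>n x. x \<in> carrier (C (Suc (Suc n))) \<Longrightarrow> bd (Suc n) (bd (Suc (Suc n)) x) = \<one>\<^bsub>C n\<^esub>"
    using C by (auto simp: chain_complex_def)
  have "comm_group (cycle_group C bd n) \<and> subgroup (boundaries C bd n) (cycle_group C bd n)"
  proof (cases n)
    case 0
    interpret C0: comm_group "C 0" by (rule c)
    have "subgroup (bd 1 ` carrier (C 1)) ((C 0)\<lparr>carrier := carrier (C 0)\<rparr>)"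
      by (rule image_subgroup[OF c c _ C0.subgroup_self]) (use h[of 0] hom_in_carrier[OF h[of 0]] in auto)
    then show ?thesis using c by (simp add: 0 cycle_group_def boundaries_def)
  next
    case (Suc m)
    note k = kernel_comm_group[OF c c h]
    have "bd (Suc n) ` carrier (C (Suc n)) \<subseteq> kernel (C n) (C m) (bd n)"
      using z hom_in_carrier[OF h] by (auto simp: kernel_def Suc)
    then show ?thesis
      using image_subgroup[OF c c h k(1)] k(2) by (simp add: cycle_group_def boundaries_def Suc)
  qed
  then show "comm_group (cycle_group C bd n)" "subgroup (boundaries C bd n) (cycle_group C bd n)" by auto
qed

lemma cycle_group_carrier:
  "x \<in> carrier (cycle_group C bd n) \<longleftrightarrow> x \<in> carrier (C n) \<and> (\<forall>m. n = Suc m \<longrightarrow> bd n x = \<one>\<^bsub>C m\<^esub>)"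
  "monoid.mult (cycle_group C bd n) = monoid.mult (C n)"
  by (cases n; auto simp: cycle_group_def kernel_def)+

lemma chain_map_homology:
  assumes f: "chain_map C bd D bd' \<phi>"
  shows "\<phi> n \<in> hom (cycle_group C bd n) (cycle_group D bd' n)" "\<phi> n ` boundaries C bd n \<subseteq> boundaries D bd' n"
proof -
  have c: "\<And>n. comm_group (C n)" "\<And>n. comm_group (D n)" and h: "\<And>n. \<phi> n \<in> hom (C n) (D n)"
    and z: "\<And>n x. x \<in> carrier (C (Suc n)) \<Longrightarrow> \<phi> n (bd (Suc n) x) = bd' (Suc n) (\<phi> (Suc n) x)"
    using f by (auto simp: chain_map_def chain_complex_def)
  have one: "\<phi> n \<one>\<^bsub>C n\<^esub> = \<one>\<^bsub>D n\<^esub>" for n by (rule hom_one'[OF c h])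
  show "\<phi> n \<in> hom (cycle_group C bd n) (cycle_group D bd' n)"
    using h[of n] by (auto simp: hom_def cycle_group_carrier z[symmetric] one Pi_def)
  show "\<phi> n ` boundaries C bd n \<subseteq> boundaries D bd' n"
    using z[of _ n] hom_in_carrier[OF h[of "Suc n"]] by (auto simp: boundaries_def)
qed

text \<open>
  In degree \<open>0\<close> every chain is a cycle and the homotopy formula has only the summand which is a
  boundary.
\<close>

lemma chain_homotopic_id_coset:
  assumes C: "chain_complex C bd" and h: "chain_homotopic C bd C bd \<phi> (\<lambda>n. id)"
    and x: "x \<in> carrier (cycle_group C bd n)"
  shows "\<phi> n x \<in> boundaries C bd n #>\<^bsub>cycle_group C bd n\<^esub> x"
proof -
  obtain s where s: "\<And>n. s n \<in> hom (C n) (C (Suc n))"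
    "\<And>x. x \<in> carrier (C 0) \<Longrightarrow> \<phi> 0 x = x \<otimes>\<^bsub>C 0\<^esub> bd 1 (s 0 x)"
    "\<And>n x. x \<in> carrier (C (Suc n)) \<Longrightarrow> \<phi> (Suc n) x =
        x \<otimes>\<^bsub>C (Suc n)\<^esub> bd (Suc (Suc n)) (s (Suc n) x) \<otimes>\<^bsub>C (Suc n)\<^esub> s n (bd (Suc n) x)"
    using h unfolding chain_homotopic_def id_apply by blast
  have c: "\<And>n. comm_group (C n)" and d: "\<And>n. bd (Suc n) \<in> hom (C (Suc n)) (C n)"
    using C by (auto simp: chain_complex_def)
  interpret Cn: comm_group "C n" by (rule c)
  have xn: "x \<in> carrier (C n)" using x by (simp add: cycle_group_carrier)
  have s1: "s n \<one>\<^bsub>C n\<^esub> = \<one>\<^bsub>C (Suc n)\<^esub>" for n by (rule hom_one'[OF c c s(1)])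
  have sn: "s n x \<in> carrier (C (Suc n))" by (rule hom_in_carrier[OF s(1) xn])
  then have b: "bd (Suc n) (s n x) \<in> carrier (C n)" by (rule hom_in_carrier[OF d])
  \<comment> \<open>In positive degrees the summand \<open>s m (bd n x)\<close> disappears, as \<open>x\<close> is a cycle.\<close>
  have "\<phi> n x = x \<otimes>\<^bsub>C n\<^esub> bd (Suc n) (s n x)"
  proof (cases n)
    case 0
    then show ?thesis using s(2)[of x] xn by simp
  next
    case (Suc m)
    then have "bd n x = \<one>\<^bsub>C m\<^esub>" using x by (simp add: cycle_group_carrier)
    then have "\<phi> n x = x \<otimes>\<^bsub>C n\<^esub> bd (Suc n) (s n x) \<otimes>\<^bsub>C n\<^esub> \<one>\<^bsub>C n\<^esub>"
      using s(3)[of x m] xn s1[of m] by (simp add: Suc)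
    then show ?thesis using xn b by simp
  qed
  then have "\<phi> n x = bd (Suc n) (s n x) \<otimes>\<^bsub>C n\<^esub> x" using xn b by (simp add: Cn.m_comm)
  then show ?thesis using sn by (auto simp: r_coset_def cycle_group_carrier boundaries_def)
qed

lemma chain_homotopy_equivalence_isomorphisms:
  assumes "chain_homotopy_equivalence C bd D bd' \<phi> \<psi>"
  shows "group_isomorphisms (homology_group D bd' n) (homology_group C bd n)
    (homology_map C bd \<psi> n) (homology_map D bd' \<phi> n)"
proof -
  have f: "chain_map C bd D bd' \<phi>" and g: "chain_map D bd' C bd \<psi>"
    and gf: "chain_homotopic C bd C bd (\<lambda>n. \<psi> n \<circ> \<phi> n) (\<lambda>n. id)"
    and fg: "chain_homotopic D bd' D bd' (\<lambda>n. \<phi> n \<circ> \<psi> n) (\<lambda>n. id)"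
    using assms by (auto simp: chain_homotopy_equivalence_def)
  then have C: "chain_complex C bd" and D: "chain_complex D bd'" by (auto simp: chain_map_def)
  have "group_isomorphisms (homology_group D bd' n) (homology_group C bd n)
     (\<lambda>Y. \<Union>y\<in>Y. boundaries C bd n #>\<^bsub>cycle_group C bd n\<^esub> \<psi> n y)
     (\<lambda>X. \<Union>x\<in>X. boundaries D bd' n #>\<^bsub>cycle_group D bd' n\<^esub> \<phi> n x)"
    unfolding homology_group_def
    using chain_homotopic_id_coset[OF C gf] chain_homotopic_id_coset[OF D fg]
    by (intro quotient_isomorphisms cycle_boundary_groups[OF C] cycle_boundary_groups[OF D]
        chain_map_homology[OF f] chain_map_homology[OF g]) auto
  then show ?thesis by (simp add: homology_map_def[abs_def])
qed

section \<open>The explicit formulas\<close>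

context k_graph
begin

text \<open>
  Omitting the first, the last or an inner point of the chain of \<open>t\<close> gives the three kinds of faces
  of \<open>t\<close>.  Only the omission of the last point changes the trailing morphism, which becomes the last
  entry.
\<close>

lemma simplex_omit_first:
  assumes t: "t \<in> tuples \<Lambda> (Suc n)"
  shows "simplex (tup_prod \<Lambda> t) (omit 0 (points \<Lambda> t)) = (face_first \<Lambda> t, tup_src \<Lambda> t)"
proof -
  let ?\<xi> = "tup_prod \<Lambda> t" and ?ps = "points \<Lambda> t"
  note P = tup_prod[OF t] and s = tuple_simplex[OF t]
  obtain p q ps where ps: "?ps = p # q # ps" using s(3) by (cases ?ps; cases "tl ?ps") auto
  have le: "p \<le> q" "q \<le> deg \<Lambda> ?\<xi>"
    using s(2) lattice_chain_le[OF s(2), of q] by (auto simp: ps)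
  obtain v ms where tv: "t = (v, ms)" by (cases t)
  have "simplex ?\<xi> ?ps = ((v, ms), tup_src \<Lambda> t)" using s(1) tv by simp
  then have "ms = seg \<Lambda> ?\<xi> p q # map2 (seg \<Lambda> ?\<xi>) (q # ps) ps" "tup_src \<Lambda> t = seg \<Lambda> ?\<xi> (last (q # ps)) (deg \<Lambda> ?\<xi>)"
    unfolding ps simplex_def by simp_all
  then have "face_first \<Lambda> (v, ms) = (src \<Lambda> (seg \<Lambda> ?\<xi> p q), map2 (seg \<Lambda> ?\<xi>) (q # ps) ps)"
    "tup_src \<Lambda> t = seg \<Lambda> ?\<xi> (last (q # ps)) (deg \<Lambda> ?\<xi>)"
    unfolding face_first_def by simp_all
  then show ?thesis
    unfolding ps simplex_def using seg_point(2)[OF P(1) le] tv by simp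
qed

lemma simplex_omit_last:
  assumes t: "t \<in> tuples \<Lambda> (Suc n)"
  shows "simplex (tup_prod \<Lambda> t) (omit (Suc n) (points \<Lambda> t)) = (face_last t, last_entry t)"
proof -
  let ?\<xi> = "tup_prod \<Lambda> t" and ?ps = "points \<Lambda> t"
  note P = tup_prod[OF t] and s = tuple_simplex[OF t]
  have "?ps \<noteq> []" "butlast ?ps \<noteq> []" using s(3) by (auto simp: butlast_conv_take)
  then obtain qs q D where ps: "?ps = qs @ [q, D]"
    by (metis append_butlast_last_id append.assoc append_Cons append_Nil)
  have D: "D = deg \<Lambda> ?\<xi>" using P(4) ps by simp
  have "omit (Suc n) ?ps = butlast ?ps" using omit_last[of ?ps] s(3) by simp
  then have o: "omit (Suc n) ?ps = qs @ [q]" by (simp add: ps butlast_append)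
  have m: "map2 f (qs @ [q, D]) (tl (qs @ [q, D])) = map2 f (qs @ [q]) (tl (qs @ [q])) @ [f q D]" for f :: "vec \<Rightarrow> vec \<Rightarrow> 'a"
    by (induction qs rule: induct_list012) auto
  have h: "hd (qs @ [q, D]) = hd (qs @ [q])" by (cases qs) auto
  from s(1) have "t = (seg \<Lambda> ?\<xi> (hd (qs @ [q])) (hd (qs @ [q])), map2 (seg \<Lambda> ?\<xi>) (qs @ [q]) (tl (qs @ [q])) @ [seg \<Lambda> ?\<xi> q D])"
    unfolding simplex_def ps m h by simp
  then show ?thesis
    unfolding o simplex_def by (metis (no_types, lifting) D butlast_snoc case_prod_conv face_last_def last_snoc snd_conv)
qed

lemma simplex_omit_mid:
  assumes t: "t \<in> tuples \<Lambda> (Suc n)" and i: "i < n"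
  shows "simplex (tup_prod \<Lambda> t) (omit (Suc i) (points \<Lambda> t)) = (face_mid \<Lambda> (Suc i) t, tup_src \<Lambda> t)"
proof -
  let ?\<xi> = "tup_prod \<Lambda> t" and ?ps = "points \<Lambda> t"
  note P = tup_prod[OF t] and s = tuple_simplex[OF t]
  let ?qs = "omit (Suc i) ?ps"
  have len: "length ?ps = n + 2" "length ?qs = Suc n" using s(3) i by (auto simp: length_omit)
  have ne: "?ps \<noteq> []" "?qs \<noteq> []" using len by auto
  have hd: "hd ?qs = hd ?ps" using ne len i by (simp add: hd_conv_nth nth_omit skip_def)
  have last: "last ?qs = last ?ps" using ne len i by (simp add: last_conv_nth nth_omit skip_def)
  obtain v ms where tv: "t = (v, ms)" by (cases t)
  have st: "simplex ?\<xi> ?ps = ((v, ms), tup_src \<Lambda> t)" using s(1) tv by simp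
  have ms: "ms = map2 (seg \<Lambda> ?\<xi>) ?ps (tl ?ps)" and v: "v = seg \<Lambda> ?\<xi> (hd ?ps) (hd ?ps)"
    and w: "tup_src \<Lambda> t = seg \<Lambda> ?\<xi> (last ?ps) (deg \<Lambda> ?\<xi>)"
    using st by (simp_all add: simplex_def)
  have lms: "length ms = Suc n" using len by (simp add: ms)
  have msn: "ms ! j = seg \<Lambda> ?\<xi> (?ps ! j) (?ps ! Suc j)" if "j < Suc n" for j
    using that len by (simp add: ms nth_tl)
  have "map2 (seg \<Lambda> ?\<xi>) ?qs (tl ?qs) = take i ms @ [ms ! i \<cdot> ms ! Suc i] @ drop (i + 2) ms"
  proof (rule nth_equalityI)
    show "length (map2 (seg \<Lambda> ?\<xi>) ?qs (tl ?qs)) = length (take i ms @ [ms ! i \<cdot> ms ! Suc i] @ drop (i + 2) ms)"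
      using len lms i by simp
    fix j assume "j < length (map2 (seg \<Lambda> ?\<xi>) ?qs (tl ?qs))"
    then have j: "j < n" using len by simp
    have L: "map2 (seg \<Lambda> ?\<xi>) ?qs (tl ?qs) ! j = seg \<Lambda> ?\<xi> (?ps ! skip (Suc i) j) (?ps ! skip (Suc i) (Suc j))"
      using j len i by (simp add: nth_tl nth_omit)
    consider "j < i" | "j = i" | "j > i" by linarith
    then show "map2 (seg \<Lambda> ?\<xi>) ?qs (tl ?qs) ! j = (take i ms @ [ms ! i \<cdot> ms ! Suc i] @ drop (i + 2) ms) ! j"
    proof cases
      case 1
      then show ?thesis unfolding L using lms i by (simp add: nth_append skip_def msn)
    next
      case 2
      have "?ps ! i \<le> ?ps ! Suc i" "?ps ! Suc i \<le> ?ps ! Suc (Suc i)" "?ps ! Suc (Suc i) \<le> deg \<Lambda> ?\<xi>"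
        using lattice_chain_nth[OF s(2), of i "Suc i"] lattice_chain_nth[OF s(2), of "Suc i" "Suc (Suc i)"] len i P(4) by auto
      from seg_split(2)[OF P(1) this] show ?thesis
        unfolding L using 2 lms i by (simp add: nth_append skip_def msn)
    next
      case 3
      then have "j - i = Suc (j - Suc i)" by simp
      then show ?thesis unfolding L using 3 lms i j by (simp add: nth_append skip_def msn)
    qed
  qed
  then show ?thesis
    unfolding simplex_def hd last v[symmetric] w[symmetric] by (simp add: tv face_mid_def)
qed

lemma bar_bd_formula:
  assumes t: "t \<in> tuples \<Lambda> (Suc n)"
  shows "bar_bd t = frag_of (face_first \<Lambda> t, tup_src \<Lambda> t)
    + (\<Sum>i\<in>{1..n}. frag_cmul ((- 1) ^ i) (frag_of (face_mid \<Lambda> i t, tup_src \<Lambda> t)))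
    + frag_cmul ((- 1) ^ (n + 1)) (frag_of (face_last t, last_entry t))" (is "_ = ?R")
    and "(face_first \<Lambda> t, tup_src \<Lambda> t) \<in> bar_cells n (tup_src \<Lambda> t)"
    and "\<And>i. i \<in> {1..n} \<Longrightarrow> (face_mid \<Lambda> i t, tup_src \<Lambda> t) \<in> bar_cells n (tup_src \<Lambda> t)"
    and "(face_last t, last_entry t) \<in> bar_cells n (tup_src \<Lambda> t)"
proof -
  let ?\<xi> = "tup_prod \<Lambda> t" and ?ps = "points \<Lambda> t"
  note P = tup_prod[OF t] and s = tuple_simplex[OF t]
  have len: "length ?ps = Suc (Suc n)" by (rule s(3))
  have cell: "simplex ?\<xi> (omit i ?ps) \<in> bar_cells n (tup_src \<Lambda> t)" if "i < Suc (Suc n)" for i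
    using simplex_cells[OF P(1) lattice_chain_omit[OF s(2)], of i n] that len P(3) by (simp add: length_omit)
  show "(face_first \<Lambda> t, tup_src \<Lambda> t) \<in> bar_cells n (tup_src \<Lambda> t)"
    using cell[of 0] simplex_omit_first[OF t] by simp
  show "(face_last t, last_entry t) \<in> bar_cells n (tup_src \<Lambda> t)"
    using cell[of "Suc n"] simplex_omit_last[OF t] by simp
  show "(face_mid \<Lambda> i t, tup_src \<Lambda> t) \<in> bar_cells n (tup_src \<Lambda> t)" if "i \<in> {1..n}" for i
    using cell[of i] simplex_omit_mid[OF t, of "i - 1"] that by (cases i) auto
  have "snd t \<noteq> []" using t by (auto simp: tuples_def)
  then have "bar_bd t = (\<Sum>i<Suc (Suc n). frag_cmul ((- 1) ^ i) (frag_of (simplex ?\<xi> (omit i ?ps))))"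
    by (simp add: bar_bd_def simp_bd_def len realize_sum realize_cmul del: sum.lessThan_Suc)
  also have "\<dots> = frag_of (simplex ?\<xi> (omit 0 ?ps)) + (\<Sum>i<n. frag_cmul ((- 1) ^ Suc i) (frag_of (simplex ?\<xi> (omit (Suc i) ?ps))))
      + frag_cmul ((- 1) ^ Suc n) (frag_of (simplex ?\<xi> (omit (Suc n) ?ps)))"
    by (simp only: sum.lessThan_Suc[of _ "Suc n"] sum.lessThan_Suc_shift[of _ n] power_0 frag_cmul_one)
  also have "(\<Sum>i<n. frag_cmul ((- 1) ^ Suc i) (frag_of (simplex ?\<xi> (omit (Suc i) ?ps))))
      = (\<Sum>i<n. frag_cmul ((- 1) ^ Suc i) (frag_of (face_mid \<Lambda> (Suc i) t, tup_src \<Lambda> t)))"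
    by (rule sum.cong) (auto simp: simplex_omit_mid[OF t])
  also have "\<dots> = (\<Sum>i\<in>{1..n}. frag_cmul ((- 1) ^ i) (frag_of (face_mid \<Lambda> i t, tup_src \<Lambda> t)))"
    by (rule sum.reindex_bij_witness[of _ "\<lambda>i. i - 1" Suc]) auto
  finally show "bar_bd t = ?R"
    unfolding simplex_omit_first[OF t] simplex_omit_last[OF t] by simp
qed

lemma cube_dir_dirs: "cube_dir \<Lambda> \<eta> j = nth_smallest (dirs \<eta>) j"
  by (simp add: cube_dir_def dirs_def)

lemma cub_bd_formula:
  assumes \<eta>: "\<eta> \<in> cubes k \<Lambda> (Suc n)"
  shows "cub_bd \<eta> = (\<Sum>i\<in>{1..Suc n}. frag_cmul ((- 1) ^ i)
      (frag_of (face0 \<Lambda> i \<eta>, last_edge \<Lambda> i \<eta>) - frag_of (face1 \<Lambda> i \<eta>, src \<Lambda> \<eta>)))" (is "_ = ?R")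
    and "\<And>i. i \<in> {1..Suc n} \<Longrightarrow> (face0 \<Lambda> i \<eta>, last_edge \<Lambda> i \<eta>) \<in> cub_cells n (src \<Lambda> \<eta>)"
    and "\<And>i. i \<in> {1..Suc n} \<Longrightarrow> (face1 \<Lambda> i \<eta>, src \<Lambda> \<eta>) \<in> cub_cells n (src \<Lambda> \<eta>)"
proof -
  let ?K = "dirs \<eta>" and ?c = "nth_smallest (dirs \<eta>)"
  note d = cubes_dirs[OF \<eta>]
  have faces: "cube \<eta> (?K - {?c i}, 0) = (face0 \<Lambda> i \<eta>, last_edge \<Lambda> i \<eta>)"
    "cube \<eta> (?K - {?c i}, unit_vec (?c i)) = (face1 \<Lambda> i \<eta>, src \<Lambda> \<eta>)"
    "set_vec (?K - {?c i}) \<le> deg \<Lambda> \<eta>" "unit_vec (?c i) + set_vec (?K - {?c i}) = deg \<Lambda> \<eta>"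
    "rank ?K (?c i) = i - 1" "?c i \<in> ?K"
    if i: "i \<in> {1..Suc n}" for i
  proof -
    show c: "?c i \<in> ?K" and "rank ?K (?c i) = i - 1" using nth_smallest_in[OF d(3), of i] d(4) i by auto
    have 1: "set_vec (?K - {?c i}) + unit_vec (?c i) = deg \<Lambda> \<eta>"
      using set_vec_Diff_le[OF d(3) c] d(5) by simp
    have 2: "deg \<Lambda> \<eta> - unit_vec (?c i) = set_vec (?K - {?c i})"
      unfolding 1[symmetric] by (simp add: fun_eq_iff plus_fun_apply minus_apply)
    show 3: "unit_vec (?c i) + set_vec (?K - {?c i}) = deg \<Lambda> \<eta>" using 1 by (simp add: add.commute)
    show "set_vec (?K - {?c i}) \<le> deg \<Lambda> \<eta>" unfolding 1[symmetric] by (rule vec_le_add)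
    show "cube \<eta> (?K - {?c i}, 0) = (face0 \<Lambda> i \<eta>, last_edge \<Lambda> i \<eta>)"
      by (simp add: cube_def face0_def last_edge_def cube_dir_dirs 2 del: One_nat_def)
    have "seg \<Lambda> \<eta> (deg \<Lambda> \<eta>) (deg \<Lambda> \<eta>) = src \<Lambda> \<eta>"
      using seg_point(2)[OF d(1), of 0 "deg \<Lambda> \<eta>"] seg_full[OF d(1)] by simp
    then show "cube \<eta> (?K - {?c i}, unit_vec (?c i)) = (face1 \<Lambda> i \<eta>, src \<Lambda> \<eta>)"
      by (simp add: cube_def face1_def cube_dir_dirs 3 del: One_nat_def)
  qed
  have K: "?K - {j} \<subseteq> {1..k}" for j using d(2) by auto
  have card: "card (?K - {?c i}) = n" if "i \<in> {1..Suc n}" for i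
    using faces(6)[OF that] d(3,4) by simp
  show "(face0 \<Lambda> i \<eta>, last_edge \<Lambda> i \<eta>) \<in> cub_cells n (src \<Lambda> \<eta>)" if i: "i \<in> {1..Suc n}" for i
    using cube_cells[OF d(1) K[of "?c i"], of 0] faces(1,3)[OF i] card[OF i] by simp
  show "(face1 \<Lambda> i \<eta>, src \<Lambda> \<eta>) \<in> cub_cells n (src \<Lambda> \<eta>)" if i: "i \<in> {1..Suc n}" for i
    using cube_cells[OF d(1) K[of "?c i"], of "unit_vec (?c i)"] faces(2,4)[OF i] card[OF i] by (simp del: One_nat_def)
  have "cub_bd \<eta> = (\<Sum>j\<in>?K. frag_cmul ((- 1) ^ Suc (rank ?K j)) (frag_of (cube \<eta> (?K - {j}, 0)) - frag_of (cube \<eta> (?K - {j}, unit_vec j))))"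
    unfolding cub_bd_def cube_bd_def prod.case realize_sum[OF d(3)] realize_cmul realize_diff realize_of add_0_left ..
  also have "\<dots> = (\<Sum>i\<in>{1..Suc n}. frag_cmul ((- 1) ^ Suc (rank ?K (?c i))) (frag_of (cube \<eta> (?K - {?c i}, 0)) - frag_of (cube \<eta> (?K - {?c i}, unit_vec (?c i)))))"
    by (rule sum.reindex_bij_betw[symmetric]) (use bij_betw_nth_smallest[OF d(3)] in \<open>simp only: d(4)\<close>)
  also have "\<dots> = ?R"
  proof (rule sum.cong[OF refl])
    fix i assume i: "i \<in> {1..Suc n}"
    then have "Suc (rank ?K (?c i)) = i" using faces(5)[OF i] by simp
    then show "frag_cmul ((- 1) ^ Suc (rank ?K (?c i))) (frag_of (cube \<eta> (?K - {?c i}, 0)) - frag_of (cube \<eta> (?K - {?c i}, unit_vec (?c i))))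
      = frag_cmul ((- 1) ^ i) (frag_of (face0 \<Lambda> i \<eta>, last_edge \<Lambda> i \<eta>) - frag_of (face1 \<Lambda> i \<eta>, src \<Lambda> \<eta>))"
      by (simp only: faces(1,2)[OF i])
  qed
  finally show "cub_bd \<eta> = ?R" .
qed

text \<open>
  Both descriptions give a factorization of \<open>\<eta>\<close> into edges with directions in the order \<open>\<sigma>\<close>, and
  such a factorization is unique, because its chain of points is determined by the directions.
\<close>

lemma sigma_tup_simplex:
  assumes \<eta>: "\<eta> \<in> cubes k \<Lambda> n" and \<sigma>: "\<sigma> permutes {1..n}"
  shows "simplex \<eta> (path 0 (map (\<lambda>i. nth_smallest (dirs \<eta>) (\<sigma> i)) [1..<Suc n])) = (sigma_tup \<Lambda> n \<eta> \<sigma>, src \<Lambda> \<eta>)"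
    and "(sigma_tup \<Lambda> n \<eta> \<sigma>, src \<Lambda> \<eta>) \<in> bar_cells n (src \<Lambda> \<eta>)"
proof -
  let ?c = "nth_smallest (dirs \<eta>)"
  let ?js = "map (\<lambda>i. ?c (\<sigma> i)) [1..<Suc n]"
  let ?ps = "path 0 ?js"
  note d = cubes_dirs[OF \<eta>]
  have last: "last ?ps = deg \<Lambda> \<eta>"
    using last_path_permutes[OF d(3), of \<sigma> 0] \<sigma> d(4,5) by simp
  have ch: "lattice_chain (deg \<Lambda> \<eta>) ?ps" using lattice_chain_path[of 0 ?js] unfolding last .
  have len: "length ?ps = Suc n" by (simp del: upt_Suc)
  have js: "?js ! l = ?c (\<sigma> (Suc l))" if "l < n" for l using that by (simp del: upt_Suc)
  let ?t = "fst (simplex \<eta> ?ps)"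
  have t: "?t \<in> tuples \<Lambda> n" "tup_prod \<Lambda> ?t = \<eta>"
    using simplex_tuple(1,2)[OF d(1) ch] unfolding len last by (simp_all add: seg_full[OF d(1)])
  have degs: "deg \<Lambda> (snd ?t ! (i - 1)) = unit_vec (cube_dir \<Lambda> \<eta> (\<sigma> i))" if i: "i \<in> {1..n}" for i
  proof -
    obtain l where l: "i = Suc l" "l < n" using i by (cases i) auto
    have "snd ?t ! l = seg \<Lambda> \<eta> (?ps ! l) (?ps ! Suc l)"
      using l len by (simp add: simplex_def nth_tl del: upt_Suc)
    moreover have "?ps ! l \<le> ?ps ! Suc l" "?ps ! Suc l \<le> deg \<Lambda> \<eta>"
      using lattice_chain_nth[OF ch, of l "Suc l"] l len last by auto
    moreover have "?ps ! Suc l - ?ps ! l = unit_vec (?js ! l)"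
      using l by (simp add: path_nth fun_eq_iff plus_fun_apply minus_apply del: upt_Suc One_nat_def)
    ultimately show ?thesis
      using l by (simp add: deg_seg[OF d(1)] js cube_dir_dirs plus_1_eq_Suc del: upt_Suc One_nat_def)
  qed
  have uniq: "t' = ?t" if t': "t' \<in> tuples \<Lambda> n" "tup_prod \<Lambda> t' = \<eta>"
    "\<forall>i\<in>{1..n}. deg \<Lambda> (snd t' ! (i - 1)) = unit_vec (cube_dir \<Lambda> \<eta> (\<sigma> i))" for t'
  proof -
    have l: "length (snd t') = n" using t'(1) by (auto simp: tuples_def)
    have "map (deg \<Lambda>) (snd t') = map (\<lambda>j. unit_vec j) ?js"
    proof (rule nth_equalityI)
      fix i assume "i < length (map (deg \<Lambda>) (snd t'))"
      then have i: "i < n" using l by simp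
      then show "map (deg \<Lambda>) (snd t') ! i = map (\<lambda>j. unit_vec j) ?js ! i"
        using t'(3)[rule_format, of "Suc i"] l by (simp add: cube_dir_dirs del: upt_Suc)
    qed (simp add: l del: upt_Suc)
    then have "points \<Lambda> t' = ?ps" unfolding points_def path_def by (rule arg_cong)
    then show ?thesis using tuple_simplex(1)[OF t'(1)] unfolding t'(2) by simp
  qed
  have st: "sigma_tup \<Lambda> n \<eta> \<sigma> = ?t"
    unfolding sigma_tup_def by (rule the_equality) (use t degs uniq in blast)+
  have "snd (simplex \<eta> ?ps) = src \<Lambda> \<eta>"
    unfolding simplex_def snd_conv last
    using seg_point(2)[OF d(1), of 0 "deg \<Lambda> \<eta>"] seg_full[OF d(1)] by simp
  then show eq: "simplex \<eta> ?ps = (sigma_tup \<Lambda> n \<eta> \<sigma>, src \<Lambda> \<eta>)"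
    unfolding st by (simp add: prod_eq_iff del: upt_Suc)
  show "(sigma_tup \<Lambda> n \<eta> \<sigma>, src \<Lambda> \<eta>) \<in> bar_cells n (src \<Lambda> \<eta>)"
    using simplex_cells[OF d(1) ch len] unfolding eq .
qed

lemma nabla_formula:
  assumes \<eta>: "\<eta> \<in> cubes k \<Lambda> n"
  shows "nabla \<eta> = (\<Sum>\<sigma> | \<sigma> permutes {1..n}. frag_cmul (sign \<sigma>) (frag_of (sigma_tup \<Lambda> n \<eta> \<sigma>, src \<Lambda> \<eta>)))"
proof -
  note d = cubes_dirs[OF \<eta>]
  have "nabla \<eta> = (\<Sum>\<sigma> | \<sigma> permutes {1..n}. frag_cmul (sign \<sigma>)
      (frag_of (simplex \<eta> (path 0 (map (\<lambda>i. nth_smallest (dirs \<eta>) (\<sigma> i)) [1..<Suc n])))))"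
    unfolding nabla_def nabla_sum_def prod.case path_sum_def d(4) realize_sum[OF finite_permutations[OF finite_atLeastAtMost]]
      realize_cmul realize_of ..
  also have "\<dots> = (\<Sum>\<sigma> | \<sigma> permutes {1..n}. frag_cmul (sign \<sigma>) (frag_of (sigma_tup \<Lambda> n \<eta> \<sigma>, src \<Lambda> \<eta>)))"
    by (rule sum.cong) (auto simp: sigma_tup_simplex[OF \<eta>] simp del: upt_Suc One_nat_def)
  finally show ?thesis .
qed

lemma corner_sum_apply:
  "(\<Sum>i\<in>{1..n}. \<Sum>j\<in>{f i..k}. scaled_unit (g i j) j) x = (\<Sum>i\<in>{1..n}. if f i \<le> x \<and> x \<le> k then g i x else 0)"
proof -
  have "(\<Sum>j\<in>{f i..k}. scaled_unit (g i j) j) x = (if f i \<le> x \<and> x \<le> k then g i x else 0)" for i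
    by (simp add: sum_vec_apply scaled_unit_def)
  then show ?thesis by (simp add: sum_vec_apply)
qed

lemma points_nth_apply:
  assumes t: "t \<in> tuples \<Lambda> n" and r: "r \<le> n"
  shows "(points \<Lambda> t ! r) x = (\<Sum>i\<in>{1..r}. deg \<Lambda> (snd t ! (i - 1)) x)"
proof -
  have l: "length (snd t) = n" using t by (auto simp: tuples_def)
  have "(points \<Lambda> t ! r) x = (\<Sum>i<r. deg \<Lambda> (snd t ! i) x)"
    using r l by (auto simp: points_def psums_nth sum_vec_apply intro!: sum.cong)
  also have "\<dots> = (\<Sum>i\<in>{1..r}. deg \<Lambda> (snd t ! (i - 1)) x)"
    by (rule sum.reindex_bij_witness[of _ "\<lambda>i. i - 1" Suc]) auto
  finally show ?thesis .
qed

text \<open>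
  In coordinate \<open>x\<close> the sums defining the corners run over the entries with number \<open>i\<close> such that
  \<open>K\<^bsub>(i)\<^esub> < x\<close>, respectively \<open>K\<^bsub>(i)\<^esub> \<le> x\<close>.  There are \<open>rank K x\<close>, respectively \<open>rank K (x + 1)\<close>, of
  them, and they come first, so each sum is a coordinate of a point of the chain of \<open>t\<close>.
\<close>

lemma corners:
  assumes t: "t \<in> tuples \<Lambda> n" and K: "K \<in> n_subsets k n"
  shows "lower_corner k \<Lambda> n K t x = (if x \<in> {1..k} then (points \<Lambda> t ! rank K x) x else 0)"
    and "upper_corner k \<Lambda> n K t x = (if x \<in> {1..k} then (points \<Lambda> t ! rank K (Suc x)) x else 0)"
proof -
  have fin: "finite K" and card: "card K = n" and sub: "K \<subseteq> {1..k}"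
    using K finite_subset by (auto simp: n_subsets_def)
  let ?g = "\<lambda>i x. deg \<Lambda> (snd t ! (i - 1)) x"
  have sum: "(\<Sum>i\<in>{1..n}. if nth_smallest K i < y \<and> x \<le> k then ?g i x else 0) = (if x \<le> k then (points \<Lambda> t ! rank K y) x else 0)" for y
  proof -
    have r: "rank K y \<le> n" using rank_le_card[OF fin, of y] card by simp
    have "(\<Sum>i\<in>{1..n}. if nth_smallest K i < y \<and> x \<le> k then ?g i x else 0) = (\<Sum>i\<in>{1..n}. if i \<le> rank K y \<and> x \<le> k then ?g i x else 0)"
      by (rule sum.cong) (use nth_smallest_less_iff[OF fin] card in auto)
    also have "\<dots> = (\<Sum>i\<in>{1..rank K y}. if x \<le> k then ?g i x else 0)"
      by (rule sum.mono_neutral_cong_right) (use r in auto)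
    finally show ?thesis by (simp add: points_nth_apply[OF t r])
  qed
  have 0: "(\<Sum>i\<in>{1..n}. if nth_smallest K i < y \<and> 0 \<le> k then ?g i 0 else 0) = 0" for y
  proof -
    have "?g i 0 = 0" if "i \<in> {1..n}" for i
    proof -
      have "length (snd t) = n" "set (snd t) \<subseteq> Mor \<Lambda>" using t by (auto simp: tuples_def)
      then have "snd t ! (i - 1) \<in> Mor \<Lambda>" using that nth_mem[of "i - 1" "snd t"] by auto
      then show ?thesis using deg_closed by (auto simp: Nvec_def)
    qed
    then show ?thesis by (intro sum.neutral) auto
  qed
  have "lower_corner k \<Lambda> n K t x = (\<Sum>i\<in>{1..n}. if nth_smallest K i < x \<and> x \<le> k then ?g i x else 0)"
    unfolding lower_corner_def corner_sum_apply by (simp add: less_eq_Suc_le)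
  then show "lower_corner k \<Lambda> n K t x = (if x \<in> {1..k} then (points \<Lambda> t ! rank K x) x else 0)"
    using sum[of x] 0[of x] by (cases "x = 0") (auto simp: Suc_le_eq)
  have "upper_corner k \<Lambda> n K t x = (\<Sum>i\<in>{1..n}. if nth_smallest K i < Suc x \<and> x \<le> k then ?g i x else 0)"
    unfolding upper_corner_def corner_sum_apply by (simp add: less_Suc_eq_le)
  then show "upper_corner k \<Lambda> n K t x = (if x \<in> {1..k} then (points \<Lambda> t ! rank K (Suc x)) x else 0)"
    using sum[of "Suc x"] 0[of "Suc 0"] by (cases "x = 0") (auto simp: Suc_le_eq)
qed

text \<open>
  With \<open>m = a + e\<^sub>K\<close>, the inequalities \<open>b + e\<^sub>K \<le> m \<le> c\<close> say \<open>b \<le> a\<close> and \<open>a + e\<^sub>K \<le> c\<close>.  In a coordinate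
  outside \<open>K\<close> the two corners agree and force equality.
\<close>

lemma box_points_cubes:
  assumes t: "t \<in> tuples \<Lambda> n" and K: "K \<in> n_subsets k n"
  shows "box_points k \<Lambda> n K t = (\<lambda>a. a + set_vec K) ` {a. (K, a) \<in> box_cubes k (points \<Lambda> t)}"
proof -
  have fin: "finite K" and card: "card K = n" and sub: "K \<subseteq> {1..k}"
    using K finite_subset by (auto simp: n_subsets_def)
  note c = corners[OF t K]
  have rk: "rank K (Suc x) = (if x \<in> K then Suc (rank K x) else rank K x)" for x
    by (simp add: rank_Suc[OF fin])
  have len: "length (points \<Lambda> t) = Suc (card K)" using tuple_simplex(3)[OF t] card by simp
  have N: "set_vec K \<in> Nvec k" using sub by (auto simp: Nvec_def set_vec_apply[OF fin])
  have iff: "a + set_vec K \<in> box_points k \<Lambda> n K t \<longleftrightarrow> (K, a) \<in> box_cubes k (points \<Lambda> t)" for a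
  proof (cases "a \<in> Nvec k")
    case True
    have "lower_corner k \<Lambda> n K t x + of_bool (x \<in> K) \<le> a x + of_bool (x \<in> K) \<and> a x + of_bool (x \<in> K) \<le> upper_corner k \<Lambda> n K t x
        \<longleftrightarrow> (x \<in> {1..k} \<longrightarrow> box_cond K (points \<Lambda> t) a x)" for x
    proof (cases "x \<in> {1..k}")
      case False
      then have "a x = 0" "x \<notin> K" using True sub by (auto simp: Nvec_def)
      then show ?thesis using False by (auto simp: c)
    qed (auto simp: c rk box_cond_def)
    then have "lower_corner k \<Lambda> n K t + set_vec K \<le> a + set_vec K \<and> a + set_vec K \<le> upper_corner k \<Lambda> n K t
        \<longleftrightarrow> (\<forall>j\<in>{1..k}. box_cond K (points \<Lambda> t) a j)"
      unfolding le_fun_def plus_fun_apply set_vec_apply[OF fin] by blast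
    then show ?thesis
      using True Nvec_add[OF True N] sub len by (simp add: box_points_def box_cubes_def)
  next
    case False
    then have "a + set_vec K \<notin> Nvec k" by (auto simp: Nvec_def plus_fun_apply)
    then show ?thesis using False by (simp add: box_points_def box_cubes_def)
  qed
  have "m = (m - set_vec K) + set_vec K" if "m \<in> box_points k \<Lambda> n K t" for m
  proof -
    have "set_vec K \<le> lower_corner k \<Lambda> n K t + set_vec K" using vec_le_add[of "set_vec K" "lower_corner k \<Lambda> n K t"] by (simp add: add.commute)
    then have "set_vec K \<le> m" using that by (auto simp: box_points_def)
    then show ?thesis using vec_add_diff[of "set_vec K" m] by (simp add: add.commute)
  qed
  then show ?thesis using iff by (auto simp: image_iff) metis
qed

lemma box_formula:
  assumes t: "t \<in> tuples \<Lambda> n"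
  shows "box t = (\<Sum>K\<in>n_subsets k n. \<Sum>m\<in>box_points k \<Lambda> n K t.
      frag_of (seg \<Lambda> (tup_prod \<Lambda> t) (m - set_vec K) m, seg \<Lambda> (tup_prod \<Lambda> t) m (deg \<Lambda> (tup_prod \<Lambda> t))))"
    and "finite (n_subsets k n)" and "\<And>K. K \<in> n_subsets k n \<Longrightarrow> finite (box_points k \<Lambda> n K t)"
    and "\<And>K m. K \<in> n_subsets k n \<Longrightarrow> m \<in> box_points k \<Lambda> n K t \<Longrightarrow>
      (seg \<Lambda> (tup_prod \<Lambda> t) (m - set_vec K) m, seg \<Lambda> (tup_prod \<Lambda> t) m (deg \<Lambda> (tup_prod \<Lambda> t)))
        \<in> cub_cells n (tup_src \<Lambda> t)"
proof -
  let ?\<xi> = "tup_prod \<Lambda> t" and ?ps = "points \<Lambda> t"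
  let ?F = "\<lambda>K m. (seg \<Lambda> ?\<xi> (m - set_vec K) m, seg \<Lambda> ?\<xi> m (deg \<Lambda> ?\<xi>))"
  note P = tup_prod[OF t] and s = tuple_simplex[OF t]
  have finB: "finite (box_cubes k ?ps)" by (rule finite_box_cubes[OF s(2) deg_closed[OF P(1)]])
  show finN: "finite (n_subsets k n)"
    unfolding n_subsets_def by (rule finite_subset[of _ "Pow {1..k}"]) auto
  have finA: "finite {a. (K, a) \<in> box_cubes k ?ps}" for K
    by (rule finite_subset[of _ "snd ` box_cubes k ?ps"]) (use finB in force)+
  show "finite (box_points k \<Lambda> n K t)" if "K \<in> n_subsets k n" for K
    unfolding box_points_cubes[OF t that] using finA by (rule finite_imageI)
  have F: "?F K (a + set_vec K) = cube ?\<xi> (K, a)" for K a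
  proof -
    have "a + set_vec K - set_vec K = a" by (simp add: fun_eq_iff plus_fun_apply minus_apply)
    then show ?thesis by (simp add: cube_def)
  qed
  have Sg: "box_cubes k ?ps = Sigma (n_subsets k n) (\<lambda>K. {a. (K, a) \<in> box_cubes k ?ps})"
    using s(3) by (auto simp: box_cubes_def n_subsets_def)
  have "box t = (\<Sum>x\<in>box_cubes k ?ps. frag_of (cube ?\<xi> x))"
    by (simp add: box_def box_sum_def realize_sum[OF finB])
  also have "\<dots> = (\<Sum>K\<in>n_subsets k n. \<Sum>a\<in>{a. (K, a) \<in> box_cubes k ?ps}. frag_of (cube ?\<xi> (K, a)))"
    by (subst Sg, subst sum.Sigma[OF finN]) (auto simp: finA)
  also have "\<dots> = (\<Sum>K\<in>n_subsets k n. \<Sum>m\<in>box_points k \<Lambda> n K t. frag_of (?F K m))"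
  proof (rule sum.cong[OF refl])
    fix K assume K: "K \<in> n_subsets k n"
    have "inj_on (\<lambda>a. a + set_vec K) {a. (K, a) \<in> box_cubes k ?ps}" by (auto simp: inj_on_def)
    then show "(\<Sum>a\<in>{a. (K, a) \<in> box_cubes k ?ps}. frag_of (cube ?\<xi> (K, a))) = (\<Sum>m\<in>box_points k \<Lambda> n K t. frag_of (?F K m))"
      unfolding box_points_cubes[OF t K] by (simp only: sum.reindex o_def F)
  qed
  finally show "box t = (\<Sum>K\<in>n_subsets k n. \<Sum>m\<in>box_points k \<Lambda> n K t. frag_of (?F K m))" .
  fix K m assume K: "K \<in> n_subsets k n" and "m \<in> box_points k \<Lambda> n K t"
  then obtain a where a: "m = a + set_vec K" "(K, a) \<in> box_cubes k ?ps"
    using box_points_cubes[OF t K] by auto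
  have "a + set_vec K \<le> deg \<Lambda> ?\<xi>" using box_cubes_le(2)[OF s(2) deg_closed[OF P(1)] a(2)] P(4) by simp
  then show "?F K m \<in> cub_cells n (tup_src \<Lambda> t)"
    unfolding a(1) F using cube_cells[OF P(1)] K P(3) by (force simp: n_subsets_def)
qed

end

section \<open>Values of the operators in abelian groups\<close>

context k_graph
begin

text \<open>
  In the applications \<open>\<phi>\<close> is the family of all translates of a cochain, or of the generators with a
  fixed coefficient; the evaluations in this section serve for both.
\<close>

lemma eval_bar_bd:
  assumes G: "comm_group G" and t: "t \<in> tuples \<Lambda> (Suc n)"
    and \<phi>: "\<phi> \<in> bar_cells n (tup_src \<Lambda> t) \<rightarrow> carrier G"
  shows "frag_eval G \<phi> (bar_bd t) = \<phi> (face_first \<Lambda> t, tup_src \<Lambda> t)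
     \<otimes>\<^bsub>G\<^esub> (\<Otimes>\<^bsub>G\<^esub>i\<in>{1..n}. \<phi> (face_mid \<Lambda> i t, tup_src \<Lambda> t) [^]\<^bsub>G\<^esub> ((- 1) ^ i :: int))
     \<otimes>\<^bsub>G\<^esub> \<phi> (face_last t, last_entry t) [^]\<^bsub>G\<^esub> ((- 1) ^ (n + 1) :: int)"
proof -
  interpret comm_group G by fact
  note f = bar_bd_formula[OF t]
  note c = funcset_mem[OF \<phi> f(2)] funcset_mem[OF \<phi> f(3)] funcset_mem[OF \<phi> f(4)]
  let ?x = "frag_of (face_first \<Lambda> t, tup_src \<Lambda> t)"
  let ?y = "\<lambda>i. frag_cmul ((- 1) ^ i) (frag_of (face_mid \<Lambda> i t, tup_src \<Lambda> t))"
  let ?z = "frag_cmul ((- 1) ^ (n + 1)) (frag_of (face_last t, last_entry t))"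
  have kx: "\<phi> \<in> keys ?x \<rightarrow> carrier G" using c by (simp add: keys_frag_of)
  have ky: "\<phi> \<in> keys (?y i) \<rightarrow> carrier G" if "i \<in> {1..n}" for i
    using c(2)[OF that] by (auto simp: keys_frag_of)
  have kz: "\<phi> \<in> keys ?z \<rightarrow> carrier G" using c by (auto simp: keys_frag_of)
  have ks: "\<phi> \<in> keys (\<Sum>i\<in>{1..n}. ?y i) \<rightarrow> carrier G"
    using ky Poly_Mapping.keys_sum[of ?y "{1..n}"] by fastforce
  have kxs: "\<phi> \<in> keys (?x + (\<Sum>i\<in>{1..n}. ?y i)) \<rightarrow> carrier G"
    using kx ks Poly_Mapping.keys_add[of ?x "\<Sum>i\<in>{1..n}. ?y i"] by blast
  have "frag_eval G \<phi> (bar_bd t) = frag_eval G \<phi> ?x \<otimes>\<^bsub>G\<^esub> frag_eval G \<phi> (\<Sum>i\<in>{1..n}. ?y i) \<otimes>\<^bsub>G\<^esub> frag_eval G \<phi> ?z"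
    unfolding f(1) using kx ks kz kxs by (simp only: frag_eval_add funcset_Un_left)
  also have "frag_eval G \<phi> (\<Sum>i\<in>{1..n}. ?y i) = (\<Otimes>\<^bsub>G\<^esub>i\<in>{1..n}. frag_eval G \<phi> (?y i))"
    by (rule frag_eval_sum[OF _ ky]) auto
  also have "\<dots> = (\<Otimes>\<^bsub>G\<^esub>i\<in>{1..n}. \<phi> (face_mid \<Lambda> i t, tup_src \<Lambda> t) [^]\<^bsub>G\<^esub> ((- 1) ^ i :: int))"
    by (rule finprod_cong') (use c(2) in \<open>auto simp: frag_eval_cmul keys_frag_of\<close>)
  also have "frag_eval G \<phi> ?z = \<phi> (face_last t, last_entry t) [^]\<^bsub>G\<^esub> ((- 1) ^ (n + 1) :: int)"
    using c(3) by (simp add: frag_eval_cmul keys_frag_of del: power_Suc)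
  finally show ?thesis using c(1) by simp
qed

lemma eval_cub_bd:
  assumes G: "comm_group G" and \<eta>: "\<eta> \<in> cubes k \<Lambda> (Suc n)"
    and \<phi>: "\<phi> \<in> cub_cells n (src \<Lambda> \<eta>) \<rightarrow> carrier G"
  shows "frag_eval G \<phi> (cub_bd \<eta>) = (\<Otimes>\<^bsub>G\<^esub>i\<in>{1..Suc n}.
      (\<phi> (face0 \<Lambda> i \<eta>, last_edge \<Lambda> i \<eta>) \<otimes>\<^bsub>G\<^esub> inv\<^bsub>G\<^esub> \<phi> (face1 \<Lambda> i \<eta>, src \<Lambda> \<eta>)) [^]\<^bsub>G\<^esub> ((- 1) ^ i :: int))"
proof -
  interpret comm_group G by fact
  note f = cub_bd_formula[OF \<eta>]
  note c = funcset_mem[OF \<phi> f(2)] funcset_mem[OF \<phi> f(3)]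
  let ?d = "\<lambda>i. frag_of (face0 \<Lambda> i \<eta>, last_edge \<Lambda> i \<eta>) - frag_of (face1 \<Lambda> i \<eta>, src \<Lambda> \<eta>)"
  have kd: "\<phi> \<in> keys (?d i) \<rightarrow> carrier G" if i: "i \<in> {1..Suc n}" for i
    using c(1)[OF i] c(2)[OF i] keys_diff[of "frag_of (face0 \<Lambda> i \<eta>, last_edge \<Lambda> i \<eta>)" "frag_of (face1 \<Lambda> i \<eta>, src \<Lambda> \<eta>)"]
    by (auto simp: keys_frag_of)
  have "frag_eval G \<phi> (cub_bd \<eta>) = (\<Otimes>\<^bsub>G\<^esub>i\<in>{1..Suc n}. frag_eval G \<phi> (frag_cmul ((- 1) ^ i) (?d i)))"
    unfolding f(1) by (rule frag_eval_sum) (use kd keys_cmul in \<open>blast+\<close>)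
  also have "\<dots> = (\<Otimes>\<^bsub>G\<^esub>i\<in>{1..Suc n}.
      (\<phi> (face0 \<Lambda> i \<eta>, last_edge \<Lambda> i \<eta>) \<otimes>\<^bsub>G\<^esub> inv\<^bsub>G\<^esub> \<phi> (face1 \<Lambda> i \<eta>, src \<Lambda> \<eta>)) [^]\<^bsub>G\<^esub> ((- 1) ^ i :: int))"
  proof (rule finprod_cong'[OF refl])
    show "(\<lambda>i. (\<phi> (face0 \<Lambda> i \<eta>, last_edge \<Lambda> i \<eta>) \<otimes>\<^bsub>G\<^esub> inv\<^bsub>G\<^esub> \<phi> (face1 \<Lambda> i \<eta>, src \<Lambda> \<eta>)) [^]\<^bsub>G\<^esub> ((- 1) ^ i :: int)) \<in> {1..Suc n} \<rightarrow> carrier G"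
      using c by (intro Pi_I int_pow_closed m_closed inv_closed) blast+
    fix i assume i: "i \<in> {1..Suc n}"
    have "frag_eval G \<phi> (frag_cmul ((- 1) ^ i) (?d i)) = frag_eval G \<phi> (?d i) [^]\<^bsub>G\<^esub> ((- 1) ^ i :: int)"
      by (rule frag_eval_cmul[OF kd[OF i]])
    also have "frag_eval G \<phi> (?d i) = \<phi> (face0 \<Lambda> i \<eta>, last_edge \<Lambda> i \<eta>) \<otimes>\<^bsub>G\<^esub> inv\<^bsub>G\<^esub> \<phi> (face1 \<Lambda> i \<eta>, src \<Lambda> \<eta>)"
      using c(1)[OF i] c(2)[OF i] by (subst frag_eval_diff) (auto simp: keys_frag_of)
    finally show "frag_eval G \<phi> (frag_cmul ((- 1) ^ i) (?d i)) =
        (\<phi> (face0 \<Lambda> i \<eta>, last_edge \<Lambda> i \<eta>) \<otimes>\<^bsub>G\<^esub> inv\<^bsub>G\<^esub> \<phi> (face1 \<Lambda> i \<eta>, src \<Lambda> \<eta>)) [^]\<^bsub>G\<^esub> ((- 1) ^ i :: int)" .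
  qed
  finally show ?thesis .
qed

lemma eval_nabla:
  assumes G: "comm_group G" and \<eta>: "\<eta> \<in> cubes k \<Lambda> n"
    and \<phi>: "\<phi> \<in> bar_cells n (src \<Lambda> \<eta>) \<rightarrow> carrier G"
  shows "frag_eval G \<phi> (nabla \<eta>) = (\<Otimes>\<^bsub>G\<^esub>\<sigma>\<in>{\<sigma>. \<sigma> permutes {1..n}}. \<phi> (sigma_tup \<Lambda> n \<eta> \<sigma>, src \<Lambda> \<eta>) [^]\<^bsub>G\<^esub> sign \<sigma>)"
proof -
  interpret comm_group G by fact
  note c = funcset_mem[OF \<phi> sigma_tup_simplex(2)[OF \<eta>]]
  have "frag_eval G \<phi> (nabla \<eta>) = (\<Otimes>\<^bsub>G\<^esub>\<sigma>\<in>{\<sigma>. \<sigma> permutes {1..n}}. frag_eval G \<phi> (frag_cmul (sign \<sigma>) (frag_of (sigma_tup \<Lambda> n \<eta> \<sigma>, src \<Lambda> \<eta>))))"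
    unfolding nabla_formula[OF \<eta>] by (rule frag_eval_sum) (use c in \<open>auto simp: keys_frag_of finite_permutations\<close>)
  also have "\<dots> = (\<Otimes>\<^bsub>G\<^esub>\<sigma>\<in>{\<sigma>. \<sigma> permutes {1..n}}. \<phi> (sigma_tup \<Lambda> n \<eta> \<sigma>, src \<Lambda> \<eta>) [^]\<^bsub>G\<^esub> sign \<sigma>)"
    by (rule finprod_cong') (use c in \<open>auto simp: frag_eval_cmul keys_frag_of\<close>)
  finally show ?thesis .
qed

lemma eval_box:
  assumes G: "comm_group G" and t: "t \<in> tuples \<Lambda> n"
    and \<phi>: "\<phi> \<in> cub_cells n (tup_src \<Lambda> t) \<rightarrow> carrier G"
  shows "frag_eval G \<phi> (box t) = (\<Otimes>\<^bsub>G\<^esub>K\<in>n_subsets k n. \<Otimes>\<^bsub>G\<^esub>m\<in>box_points k \<Lambda> n K t.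
      \<phi> (seg \<Lambda> (tup_prod \<Lambda> t) (m - set_vec K) m, seg \<Lambda> (tup_prod \<Lambda> t) m (deg \<Lambda> (tup_prod \<Lambda> t))))"
proof -
  interpret comm_group G by fact
  note f = box_formula[OF t]
  note c = funcset_mem[OF \<phi> f(4)]
  let ?F = "\<lambda>K m. (seg \<Lambda> (tup_prod \<Lambda> t) (m - set_vec K) m, seg \<Lambda> (tup_prod \<Lambda> t) m (deg \<Lambda> (tup_prod \<Lambda> t)))"
  have k: "\<phi> \<in> keys (\<Sum>m\<in>box_points k \<Lambda> n K t. frag_of (?F K m)) \<rightarrow> carrier G" if "K \<in> n_subsets k n" for K
    using c[OF that] Poly_Mapping.keys_sum[of "\<lambda>m. frag_of (?F K m)" "box_points k \<Lambda> n K t"] by (fastforce simp: keys_frag_of)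
  have "frag_eval G \<phi> (box t) = (\<Otimes>\<^bsub>G\<^esub>K\<in>n_subsets k n. frag_eval G \<phi> (\<Sum>m\<in>box_points k \<Lambda> n K t. frag_of (?F K m)))"
    unfolding f(1) by (rule frag_eval_sum[OF f(2) k])
  also have "\<dots> = (\<Otimes>\<^bsub>G\<^esub>K\<in>n_subsets k n. \<Otimes>\<^bsub>G\<^esub>m\<in>box_points k \<Lambda> n K t. \<phi> (?F K m))"
  proof (rule finprod_cong'[OF refl])
    show "(\<lambda>K. \<Otimes>\<^bsub>G\<^esub>m\<in>box_points k \<Lambda> n K t. \<phi> (?F K m)) \<in> n_subsets k n \<rightarrow> carrier G"
      using c by (intro Pi_I finprod_closed) blast
    fix K assume K: "K \<in> n_subsets k n"
    have "frag_eval G \<phi> (\<Sum>m\<in>box_points k \<Lambda> n K t. frag_of (?F K m)) = (\<Otimes>\<^bsub>G\<^esub>m\<in>box_points k \<Lambda> n K t. frag_eval G \<phi> (frag_of (?F K m)))"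
      by (rule frag_eval_sum[OF f(3)[OF K]]) (use c[OF K] in \<open>auto simp: keys_frag_of\<close>)
    also have "\<dots> = (\<Otimes>\<^bsub>G\<^esub>m\<in>box_points k \<Lambda> n K t. \<phi> (?F K m))"
      by (rule finprod_cong') (use c[OF K] in auto)
    finally show "frag_eval G \<phi> (\<Sum>m\<in>box_points k \<Lambda> n K t. frag_of (?F K m)) = (\<Otimes>\<^bsub>G\<^esub>m\<in>box_points k \<Lambda> n K t. \<phi> (?F K m))" .
  qed
  finally show ?thesis .
qed

lemma operator_zero:
  "(\<And>i. i \<in> I \<Longrightarrow> s i \<in> Obj \<Lambda>) \<Longrightarrow> operator \<Lambda> I s J s' (\<lambda>i. 0)"
  by (simp add: operator_def)

lemma tup_src_Obj: "t \<in> tuples \<Lambda> n \<Longrightarrow> tup_src \<Lambda> t \<in> Obj \<Lambda>"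
  by (rule tup_prod(5))

lemma src_cubes_Obj: "\<eta> \<in> cubes k \<Lambda> n \<Longrightarrow> src \<Lambda> \<eta> \<in> Obj \<Lambda>"
  by (auto simp: cubes_def intro: src_closed)

lemma operator_unit: "(\<And>i. i \<in> I \<Longrightarrow> s i \<in> Obj \<Lambda>) \<Longrightarrow> operator \<Lambda> I s I s (\<lambda>i. frag_of (i, s i))"
  unfolding operator_def by (intro ballI conjI keys_unit[where s = s and I = I])

lemma operator_add:
  "operator \<Lambda> I s J s' A \<Longrightarrow> operator \<Lambda> I s J s' B \<Longrightarrow> operator \<Lambda> I s J s' (\<lambda>i. A i + B i)"
  unfolding operator_def
  by (intro ballI conjI order.trans[OF Poly_Mapping.keys_add]) auto

text \<open>
  The homotopy formula as a sum, so that the additivity of \<open>pull\<close> and \<open>push\<close> in the operator applies.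
\<close>

lemma nabla_box_homotopy:
  assumes "t \<in> tuples \<Lambda> n"
  shows "lin \<Lambda> nabla (box t) = frag_of (t, tup_src \<Lambda> t) + lin \<Lambda> bar_bd (homotopy (Suc n) t)
    + lin \<Lambda> (homotopy n) (bar_bd t)"
  using homotopy[OF assms] by (simp add: algebra_simps del: homotopy.simps)

end

section \<open>Cochains\<close>

context k_graph_right_module
begin

abbreviation "Ccat \<equiv> cat_cochains \<Lambda> M"
abbreviation "Ccub \<equiv> cub_cochains k \<Lambda> M"
abbreviation "dcat \<equiv> cat_coboundary \<Lambda> M act"
abbreviation "dcub \<equiv> cub_coboundary k \<Lambda> M act"
abbreviation "nabla_C \<equiv> nabla_cochain k \<Lambda> M"
abbreviation "box_C \<equiv> box_cochain k \<Lambda> M act"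
abbreviation "bar_pull n \<equiv> pull (tuples \<Lambda> n) (tup_src \<Lambda>) M act"
abbreviation "cub_pull n \<equiv> pull (cubes k \<Lambda> n) (src \<Lambda>) M act"

text \<open>
  The explicit formula leaves out the action of the trailing morphism where that is a vertex, which
  acts trivially.
\<close>

lemma cat_coboundary_eq:
  assumes f: "f \<in> carrier (Ccat n)"
  shows "dcat n f = bar_pull (Suc n) bar_bd f"
  unfolding cat_coboundary_def pull_def
proof (rule restrict_ext)
  fix t assume t: "t \<in> tuples \<Lambda> (Suc n)"
  let ?G = "M (tup_src \<Lambda> t)"
  have o: "tup_src \<Lambda> t \<in> Obj \<Lambda>" by (rule tup_src_Obj[OF t])
  have f': "f \<in> (\<Pi>\<^sub>E t\<in>tuples \<Lambda> n. carrier (M (tup_src \<Lambda> t)))" using f by (simp add: cat_cochains_def)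
  have id: "act (tup_src \<Lambda> t) (f x) = f x" if "(x, tup_src \<Lambda> t) \<in> bar_cells n (tup_src \<Lambda> t)" for x
  proof -
    have x: "x \<in> tuples \<Lambda> n" "tup_src \<Lambda> x = tup_src \<Lambda> t" using that rng_Obj[OF o] by (auto simp: cells_def)
    then show ?thesis using act_id[OF o, of "f x"] PiE_mem[OF f' x(1)] by simp
  qed
  note b = bar_bd_formula[OF t]
  interpret G: comm_group ?G by (rule comm_group_M[OF o])
  have "frag_eval ?G (\<lambda>(j, \<rho>). act \<rho> (f j)) (bar_bd t) =
      act (tup_src \<Lambda> t) (f (face_first \<Lambda> t))
     \<otimes>\<^bsub>?G\<^esub> (\<Otimes>\<^bsub>?G\<^esub>i\<in>{1..n}. act (tup_src \<Lambda> t) (f (face_mid \<Lambda> i t)) [^]\<^bsub>?G\<^esub> ((- 1) ^ i :: int))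
     \<otimes>\<^bsub>?G\<^esub> act (last_entry t) (f (face_last t)) [^]\<^bsub>?G\<^esub> ((- 1) ^ (n + 1) :: int)"
    using eval_bar_bd[OF G.comm_group_axioms t act_cell_closed[OF f' order_refl]] by simp
  also have "(\<Otimes>\<^bsub>?G\<^esub>i\<in>{1..n}. act (tup_src \<Lambda> t) (f (face_mid \<Lambda> i t)) [^]\<^bsub>?G\<^esub> ((- 1) ^ i :: int))
      = (\<Otimes>\<^bsub>?G\<^esub>i\<in>{1..n}. f (face_mid \<Lambda> i t) [^]\<^bsub>?G\<^esub> ((- 1) ^ i :: int))"
  proof (rule G.finprod_cong'[OF refl])
    show "(\<lambda>i. f (face_mid \<Lambda> i t) [^]\<^bsub>?G\<^esub> ((- 1) ^ i :: int)) \<in> {1..n} \<rightarrow> carrier ?G"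
    proof (rule Pi_I, rule G.int_pow_closed)
      fix i assume i: "i \<in> {1..n}"
      have "face_mid \<Lambda> i t \<in> tuples \<Lambda> n" "tup_src \<Lambda> (face_mid \<Lambda> i t) = tup_src \<Lambda> t"
        using b(3)[OF i] rng_Obj[OF o] by (auto simp: cells_def)
      then show "f (face_mid \<Lambda> i t) \<in> carrier ?G" using PiE_mem[OF f'] by metis
    qed
  qed (use id[OF b(3)] in simp)
  finally show "(let G = ?G in f (face_first \<Lambda> t)
     \<otimes>\<^bsub>G\<^esub> (\<Otimes>\<^bsub>G\<^esub>i\<in>{1..n}. f (face_mid \<Lambda> i t) [^]\<^bsub>G\<^esub> ((- 1) ^ i :: int))
     \<otimes>\<^bsub>G\<^esub> act (last_entry t) (f (face_last t)) [^]\<^bsub>G\<^esub> ((- 1) ^ (n + 1) :: int))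
     = frag_eval ?G (\<lambda>(j, \<rho>). act \<rho> (f j)) (bar_bd t)"
    using id[OF b(2)] by (simp add: Let_def)
qed

lemma cub_coboundary_eq:
  assumes f: "f \<in> carrier (Ccub n)"
  shows "dcub n f = cub_pull (Suc n) cub_bd f"
  unfolding cub_coboundary_def pull_def
proof (rule restrict_ext)
  fix \<eta> assume \<eta>: "\<eta> \<in> cubes k \<Lambda> (Suc n)"
  let ?G = "M (src \<Lambda> \<eta>)"
  have o: "src \<Lambda> \<eta> \<in> Obj \<Lambda>" by (rule src_cubes_Obj[OF \<eta>])
  have f': "f \<in> (\<Pi>\<^sub>E \<eta>\<in>cubes k \<Lambda> n. carrier (M (src \<Lambda> \<eta>)))" using f by (simp add: cub_cochains_def)
  note b = cub_bd_formula[OF \<eta>]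
  interpret G: comm_group ?G by (rule comm_group_M[OF o])
  note cl = funcset_mem[OF act_cell_closed[OF f' order_refl]]
  have id: "act (src \<Lambda> \<eta>) (f (face1 \<Lambda> i \<eta>)) = f (face1 \<Lambda> i \<eta>)" "f (face1 \<Lambda> i \<eta>) \<in> carrier ?G"
    if i: "i \<in> {1..Suc n}" for i
  proof -
    have x: "face1 \<Lambda> i \<eta> \<in> cubes k \<Lambda> n" "src \<Lambda> (face1 \<Lambda> i \<eta>) = src \<Lambda> \<eta>" using b(3)[OF i] rng_Obj[OF o] by (auto simp: cells_def)
    then show "f (face1 \<Lambda> i \<eta>) \<in> carrier ?G" using PiE_mem[OF f' x(1)] by simp
    then show "act (src \<Lambda> \<eta>) (f (face1 \<Lambda> i \<eta>)) = f (face1 \<Lambda> i \<eta>)" by (rule act_id[OF o])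
  qed
  have "frag_eval ?G (\<lambda>(j, \<rho>). act \<rho> (f j)) (cub_bd \<eta>) = (\<Otimes>\<^bsub>?G\<^esub>i\<in>{1..Suc n}.
       (act (last_edge \<Lambda> i \<eta>) (f (face0 \<Lambda> i \<eta>)) \<otimes>\<^bsub>?G\<^esub> inv\<^bsub>?G\<^esub> (act (src \<Lambda> \<eta>) (f (face1 \<Lambda> i \<eta>))))
         [^]\<^bsub>?G\<^esub> ((- 1) ^ i :: int))"
    using eval_cub_bd[OF G.comm_group_axioms \<eta> act_cell_closed[OF f' order_refl]] by (simp del: One_nat_def)
  also have "\<dots> = (\<Otimes>\<^bsub>?G\<^esub>i\<in>{1..Suc n}.
       (act (last_edge \<Lambda> i \<eta>) (f (face0 \<Lambda> i \<eta>)) \<otimes>\<^bsub>?G\<^esub> inv\<^bsub>?G\<^esub> (f (face1 \<Lambda> i \<eta>)))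
         [^]\<^bsub>?G\<^esub> ((- 1) ^ i :: int))"
    by (rule G.finprod_cong'[OF refl])
      (use id cl[OF b(2)] in \<open>auto intro!: G.int_pow_closed G.m_closed G.inv_closed simp del: One_nat_def\<close>)
  finally show "(let G = ?G in \<Otimes>\<^bsub>G\<^esub>i\<in>{1..Suc n}.
       (act (last_edge \<Lambda> i \<eta>) (f (face0 \<Lambda> i \<eta>)) \<otimes>\<^bsub>G\<^esub> inv\<^bsub>G\<^esub> (f (face1 \<Lambda> i \<eta>)))
         [^]\<^bsub>G\<^esub> ((- 1) ^ i :: int)) = frag_eval ?G (\<lambda>(j, \<rho>). act \<rho> (f j)) (cub_bd \<eta>)"
    by (simp add: Let_def)
qed

lemma nabla_cochain_eq:
  assumes f: "f \<in> carrier (Ccat n)"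
  shows "nabla_C n f = cub_pull n nabla f"
  unfolding nabla_cochain_def pull_def
proof (rule restrict_ext)
  fix \<eta> assume \<eta>: "\<eta> \<in> cubes k \<Lambda> n"
  let ?G = "M (src \<Lambda> \<eta>)"
  have o: "src \<Lambda> \<eta> \<in> Obj \<Lambda>" by (rule src_cubes_Obj[OF \<eta>])
  have f': "f \<in> (\<Pi>\<^sub>E t\<in>tuples \<Lambda> n. carrier (M (tup_src \<Lambda> t)))" using f by (simp add: cat_cochains_def)
  interpret G: comm_group ?G by (rule comm_group_M[OF o])
  have id: "act (src \<Lambda> \<eta>) (f (sigma_tup \<Lambda> n \<eta> \<sigma>)) = f (sigma_tup \<Lambda> n \<eta> \<sigma>)" "f (sigma_tup \<Lambda> n \<eta> \<sigma>) \<in> carrier ?G"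
    if \<sigma>: "\<sigma> permutes {1..n}" for \<sigma>
  proof -
    have x: "sigma_tup \<Lambda> n \<eta> \<sigma> \<in> tuples \<Lambda> n" "tup_src \<Lambda> (sigma_tup \<Lambda> n \<eta> \<sigma>) = src \<Lambda> \<eta>"
      using sigma_tup_simplex(2)[OF \<eta> \<sigma>] rng_Obj[OF o] by (auto simp: cells_def)
    then show "f (sigma_tup \<Lambda> n \<eta> \<sigma>) \<in> carrier ?G" using PiE_mem[OF f' x(1)] by simp
    then show "act (src \<Lambda> \<eta>) (f (sigma_tup \<Lambda> n \<eta> \<sigma>)) = f (sigma_tup \<Lambda> n \<eta> \<sigma>)" by (rule act_id[OF o])
  qed
  have "frag_eval ?G (\<lambda>(j, \<rho>). act \<rho> (f j)) (nabla \<eta>) =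
      (\<Otimes>\<^bsub>?G\<^esub>\<sigma>\<in>{\<sigma>. \<sigma> permutes {1..n}}. act (src \<Lambda> \<eta>) (f (sigma_tup \<Lambda> n \<eta> \<sigma>)) [^]\<^bsub>?G\<^esub> sign \<sigma>)"
    using eval_nabla[OF G.comm_group_axioms \<eta> act_cell_closed[OF f' order_refl]] by (simp del: One_nat_def)
  also have "\<dots> = (\<Otimes>\<^bsub>?G\<^esub>\<sigma>\<in>{\<sigma>. \<sigma> permutes {1..n}}. f (sigma_tup \<Lambda> n \<eta> \<sigma>) [^]\<^bsub>?G\<^esub> sign \<sigma>)"
    by (rule G.finprod_cong'[OF refl]) (use id in \<open>auto intro!: G.int_pow_closed simp del: One_nat_def\<close>)
  finally show "(let G = ?G in \<Otimes>\<^bsub>G\<^esub>\<sigma>\<in>{\<sigma>. \<sigma> permutes {1..n}}. f (sigma_tup \<Lambda> n \<eta> \<sigma>) [^]\<^bsub>G\<^esub> sign \<sigma>)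
      = frag_eval ?G (\<lambda>(j, \<rho>). act \<rho> (f j)) (nabla \<eta>)"
    by (simp add: Let_def)
qed

lemma box_cochain_eq:
  assumes f: "f \<in> carrier (Ccub n)"
  shows "box_C n f = bar_pull n box f"
  unfolding box_cochain_def pull_def
proof (rule restrict_ext)
  fix t assume t: "t \<in> tuples \<Lambda> n"
  let ?G = "M (tup_src \<Lambda> t)"
  have f': "f \<in> (\<Pi>\<^sub>E \<eta>\<in>cubes k \<Lambda> n. carrier (M (src \<Lambda> \<eta>)))" using f by (simp add: cub_cochains_def)
  show "(let G = ?G; \<xi> = tup_prod \<Lambda> t in
     \<Otimes>\<^bsub>G\<^esub>K\<in>n_subsets k n. \<Otimes>\<^bsub>G\<^esub>m\<in>box_points k \<Lambda> n K t.
       act (seg \<Lambda> \<xi> m (deg \<Lambda> \<xi>)) (f (seg \<Lambda> \<xi> (m - set_vec K) m))) =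
    frag_eval ?G (\<lambda>(j, \<rho>). act \<rho> (f j)) (box t)"
    using eval_box[OF comm_group_M[OF tup_src_Obj[OF t]] t act_cell_closed[OF f' order_refl]] by (simp add: Let_def)
qed

lemma cochain_groups:
  "comm_group (Ccat n)" "comm_group (Ccub n)"
  unfolding cat_cochains_def cub_cochains_def
  by (auto intro!: comm_group_product_group comm_group_M tup_src_Obj src_cubes_Obj)

lemma cochain_homs:
  "dcat n \<in> hom (Ccat n) (Ccat (Suc n))"
  "dcub n \<in> hom (Ccub n) (Ccub (Suc n))"
  "nabla_C n \<in> hom (Ccat n) (Ccub n)"
  "box_C n \<in> hom (Ccub n) (Ccat n)"
  "bar_pull n (homotopy (Suc n)) \<in> hom (Ccat (Suc n)) (Ccat n)"
  "cub_pull n (\<lambda>i. 0) \<in> hom (Ccub (Suc n)) (Ccub n)"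
proof -
  note gr = cochain_groups[THEN comm_group.axioms(2)]
  note pulls = pull_hom[OF operator_bar_bd, folded cat_cochains_def] pull_hom[OF operator_cub_bd, folded cub_cochains_def]
    pull_hom[OF operator_nabla, folded cat_cochains_def cub_cochains_def] pull_hom[OF operator_box, folded cat_cochains_def cub_cochains_def]
  show "dcat n \<in> hom (Ccat n) (Ccat (Suc n))"
    by (rule group.hom_restrict[OF gr(1) pulls(1)]) (simp add: cat_coboundary_eq)
  show "dcub n \<in> hom (Ccub n) (Ccub (Suc n))"
    by (rule group.hom_restrict[OF gr(2) pulls(2)]) (simp add: cub_coboundary_eq)
  show "nabla_C n \<in> hom (Ccat n) (Ccub n)"
    by (rule group.hom_restrict[OF gr(1) pulls(3)]) (simp add: nabla_cochain_eq)
  show "box_C n \<in> hom (Ccub n) (Ccat n)"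
    by (rule group.hom_restrict[OF gr(2) pulls(4)]) (simp add: box_cochain_eq)
  show "bar_pull n (homotopy (Suc n)) \<in> hom (Ccat (Suc n)) (Ccat n)"
    unfolding cat_cochains_def by (rule pull_hom[OF operator_homotopy])
  show "cub_pull n (\<lambda>i. 0) \<in> hom (Ccub (Suc n)) (Ccub n)"
    unfolding cub_cochains_def by (rule pull_hom[OF operator_zero[OF src_cubes_Obj]])
qed

lemma cochain_identities:
  shows "x \<in> carrier (Ccat n) \<Longrightarrow>
      dcat (Suc n) (dcat n x) = \<one>\<^bsub>Ccat (Suc (Suc n))\<^esub>" (is "?x \<Longrightarrow> ?A")
    and "y \<in> carrier (Ccub n) \<Longrightarrow>
      dcub (Suc n) (dcub n y) = \<one>\<^bsub>Ccub (Suc (Suc n))\<^esub>" (is "?y \<Longrightarrow> ?B")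
    and "x \<in> carrier (Ccat n) \<Longrightarrow>
      nabla_C (Suc n) (dcat n x) = dcub n (nabla_C n x)" (is "_ \<Longrightarrow> ?C")
    and "y \<in> carrier (Ccub n) \<Longrightarrow>
      box_C (Suc n) (dcub n y) = dcat n (box_C n y)" (is "_ \<Longrightarrow> ?D")
    and "y \<in> carrier (Ccub n) \<Longrightarrow> nabla_C n (box_C n y) = y" (is "_ \<Longrightarrow> ?E")
proof -
  note hs = hom_in_carrier[OF cochain_homs(1)] hom_in_carrier[OF cochain_homs(2)] hom_in_carrier[OF cochain_homs(3)] hom_in_carrier[OF cochain_homs(4)]
  note eqs = cat_coboundary_eq cub_coboundary_eq nabla_cochain_eq box_cochain_eq
  {
    assume x: "x \<in> carrier (Ccat n)"
    then have x': "x \<in> (\<Pi>\<^sub>E t\<in>tuples \<Lambda> n. carrier (M (tup_src \<Lambda> t)))" by (simp add: cat_cochains_def)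
    have "dcat (Suc n) (dcat n x) = bar_pull (Suc (Suc n)) bar_bd (bar_pull (Suc n) bar_bd x)"
      using hs(1)[OF x] x by (simp add: eqs)
    also have "\<dots> = bar_pull (Suc (Suc n)) (\<lambda>t. lin \<Lambda> bar_bd (bar_bd t)) x"
      by (rule pull_pull[OF operator_bar_bd operator_bar_bd x'])
    also have "\<dots> = bar_pull (Suc (Suc n)) (\<lambda>t. 0) x"
      by (rule fun_cong[OF pull_cong]) (rule bar_bd_bar_bd)
    also have "\<dots> = \<one>\<^bsub>Ccat (Suc (Suc n))\<^esub>"
      unfolding cat_cochains_def by (rule pull_zero[OF tup_src_Obj])
    finally show ?A .
    have "nabla_C (Suc n) (dcat n x) = cub_pull (Suc n) nabla (bar_pull (Suc n) bar_bd x)"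
      using hs(1)[OF x] x by (simp add: eqs)
    also have "\<dots> = cub_pull (Suc n) (\<lambda>t. lin \<Lambda> bar_bd (nabla t)) x"
      by (rule pull_pull[OF operator_nabla operator_bar_bd x'])
    also have "\<dots> = cub_pull (Suc n) (\<lambda>t. lin \<Lambda> nabla (cub_bd t)) x"
      by (rule fun_cong[OF pull_cong]) (rule bar_bd_nabla)
    also have "\<dots> = cub_pull (Suc n) cub_bd (cub_pull n nabla x)"
      by (rule pull_pull[OF operator_cub_bd operator_nabla x', symmetric])
    also have "\<dots> = dcub n (nabla_C n x)"
      using hs(3)[OF x] x by (simp add: eqs)
    finally show ?C .
  }
  {
    assume y: "y \<in> carrier (Ccub n)"
    then have y': "y \<in> (\<Pi>\<^sub>E t\<in>cubes k \<Lambda> n. carrier (M (src \<Lambda> t)))" by (simp add: cub_cochains_def)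
    have "dcub (Suc n) (dcub n y) = cub_pull (Suc (Suc n)) cub_bd (cub_pull (Suc n) cub_bd y)"
      using hs(2)[OF y] y by (simp add: eqs)
    also have "\<dots> = cub_pull (Suc (Suc n)) (\<lambda>t. lin \<Lambda> cub_bd (cub_bd t)) y"
      by (rule pull_pull[OF operator_cub_bd operator_cub_bd y'])
    also have "\<dots> = cub_pull (Suc (Suc n)) (\<lambda>t. 0) y"
      by (rule fun_cong[OF pull_cong]) (rule cub_bd_cub_bd)
    also have "\<dots> = \<one>\<^bsub>Ccub (Suc (Suc n))\<^esub>"
      unfolding cub_cochains_def by (rule pull_zero[OF src_cubes_Obj])
    finally show ?B .
    have "box_C (Suc n) (dcub n y) = bar_pull (Suc n) box (cub_pull (Suc n) cub_bd y)"
      using hs(2)[OF y] y by (simp add: eqs)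
    also have "\<dots> = bar_pull (Suc n) (\<lambda>t. lin \<Lambda> cub_bd (box t)) y"
      by (rule pull_pull[OF operator_box operator_cub_bd y'])
    also have "\<dots> = bar_pull (Suc n) (\<lambda>t. lin \<Lambda> box (bar_bd t)) y"
      by (rule fun_cong[OF pull_cong]) (rule cub_bd_box)
    also have "\<dots> = bar_pull (Suc n) bar_bd (bar_pull n box y)"
      by (rule pull_pull[OF operator_bar_bd operator_box y', symmetric])
    also have "\<dots> = dcat n (box_C n y)"
      using hs(4)[OF y] y by (simp add: eqs)
    finally show ?D .
    have "nabla_C n (box_C n y) = cub_pull n nabla (bar_pull n box y)"
      using hs(4)[OF y] y by (simp add: eqs)
    also have "\<dots> = cub_pull n (\<lambda>t. lin \<Lambda> box (nabla t)) y"
      by (rule pull_pull[OF operator_nabla operator_box y'])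
    also have "\<dots> = cub_pull n (\<lambda>\<eta>. frag_of (\<eta>, src \<Lambda> \<eta>)) y"
      by (rule fun_cong[OF pull_cong]) (rule box_nabla)
    also have "\<dots> = y" by (rule pull_unit[OF src_cubes_Obj y'])
    finally show ?E .
  }
qed

text \<open>
  The last summand is a coboundary in positive degrees and trivial in degree \<open>0\<close>; these are the two
  cases in the definition of a cochain homotopy.
\<close>

lemma cochain_homotopy_identity:
  assumes x: "x \<in> carrier (Ccat n)"
  shows "box_C n (nabla_C n x) =
    x \<otimes>\<^bsub>Ccat n\<^esub> bar_pull n (homotopy (Suc n)) (dcat n x)
      \<otimes>\<^bsub>Ccat n\<^esub> bar_pull n (\<lambda>t. lin \<Lambda> (homotopy n) (bar_bd t)) x" (is ?A)
    and "n = Suc m \<Longrightarrow> bar_pull n (\<lambda>t. lin \<Lambda> (homotopy n) (bar_bd t)) x =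
      dcat m (bar_pull m (homotopy (Suc m)) x)"
    and "n = 0 \<Longrightarrow> bar_pull n (\<lambda>t. lin \<Lambda> (homotopy n) (bar_bd t)) x = \<one>\<^bsub>Ccat n\<^esub>"
proof -
  have x': "x \<in> (\<Pi>\<^sub>E t\<in>tuples \<Lambda> n. carrier (M (tup_src \<Lambda> t)))" using x by (simp add: cat_cochains_def)
  let ?s = "tup_src \<Lambda>" and ?I = "tuples \<Lambda> n"
  let ?U = "\<lambda>t. frag_of (t, ?s t)" and ?B = "\<lambda>t. lin \<Lambda> bar_bd (homotopy (Suc n) t)" and ?H = "\<lambda>t. lin \<Lambda> (homotopy n) (bar_bd t)"
  have oU: "operator \<Lambda> ?I ?s ?I ?s ?U" by (rule operator_unit[OF tup_src_Obj])
  have oB: "operator \<Lambda> ?I ?s ?I ?s ?B" by (rule operator_compose[OF operator_homotopy operator_bar_bd])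
  have oH: "operator \<Lambda> ?I ?s ?I ?s ?H"
  proof (cases n)
    case 0
    have "?H t = 0" if "t \<in> ?I" for t using that bar_bd_0[of t] by (simp add: 0)
    then show ?thesis using tup_src_Obj by (simp add: operator_def)
  next
    case (Suc m)
    show ?thesis unfolding Suc by (rule operator_compose[OF operator_bar_bd operator_homotopy])
  qed
  have "box_C n (nabla_C n x) = bar_pull n box (cub_pull n nabla x)"
    using hom_in_carrier[OF cochain_homs(3) x] x by (simp add: nabla_cochain_eq box_cochain_eq)
  also have "\<dots> = bar_pull n (\<lambda>t. lin \<Lambda> nabla (box t)) x"
    by (rule pull_pull[OF operator_box operator_nabla x'])
  also have "\<dots> = bar_pull n (\<lambda>t. ?U t + ?B t + ?H t) x"
    by (rule fun_cong[OF pull_cong]) (rule nabla_box_homotopy)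
  also have "\<dots> = bar_pull n (\<lambda>t. ?U t + ?B t) x \<otimes>\<^bsub>Ccat n\<^esub> bar_pull n ?H x"
    unfolding cat_cochains_def by (rule pull_add[OF operator_add[OF oU oB] oH x'])
  also have "bar_pull n (\<lambda>t. ?U t + ?B t) x = bar_pull n ?U x \<otimes>\<^bsub>Ccat n\<^esub> bar_pull n ?B x"
    unfolding cat_cochains_def by (rule pull_add[OF oU oB x'])
  also have "bar_pull n ?U x = x" by (rule pull_unit[OF tup_src_Obj x'])
  also have "bar_pull n ?B x = bar_pull n (homotopy (Suc n)) (bar_pull (Suc n) bar_bd x)"
    by (rule pull_pull[OF operator_homotopy operator_bar_bd x', symmetric])
  finally show ?A by (simp only: cat_coboundary_eq[OF x])
  show "bar_pull n ?H x = dcat m (bar_pull m (homotopy (Suc m)) x)" if n: "n = Suc m"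
  proof -
    have "bar_pull m (homotopy (Suc m)) x \<in> carrier (Ccat m)"
      using hom_in_carrier[OF cochain_homs(5)] x n by simp
    then show ?thesis
      using pull_pull[OF operator_bar_bd operator_homotopy x'[unfolded n]]
      by (simp add: cat_coboundary_eq n del: homotopy.simps)
  qed
  show "bar_pull n ?H x = \<one>\<^bsub>Ccat n\<^esub>" if n: "n = 0"
  proof -
    have "bar_pull n ?H x = bar_pull n (\<lambda>t. 0) x"
      by (rule fun_cong[OF pull_cong]) (simp add: n bar_bd_0)
    then show ?thesis using pull_zero[where I = ?I and s = ?s, OF tup_src_Obj] by (simp add: cat_cochains_def)
  qed
qed

text \<open>
  By contravariance it is the composite \<open>nabla \<circ> box\<close> of the maps of cochains that is the identity; there
  the zero homotopy serves.
\<close>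

theorem cochain_equivalence:
  "cochain_homotopy_equivalence Ccat dcat
     Ccub dcub nabla_C box_C"
proof -
  note h = cochain_homs and i = cochain_identities and g = cochain_groups
  have C: "cochain_complex Ccat dcat"
    and D: "cochain_complex Ccub dcub"
    unfolding cochain_complex_def using h(1,2) i(1,2) g by blast+
  have f: "cochain_map Ccat dcat
      Ccub dcub nabla_C"
    and f': "cochain_map Ccub dcub
      Ccat dcat box_C"
    unfolding cochain_map_def using C D h(3,4) i(3,4) by blast+
  have "cochain_homotopic Ccat dcat Ccat dcat
      (\<lambda>n. box_C n \<circ> nabla_C n) (\<lambda>n. id)"
    unfolding cochain_homotopic_def o_apply id_apply
  proof (intro exI[of _ "\<lambda>n. bar_pull n (homotopy (Suc n))"] conjI allI ballI h(5))
    fix x assume x: "x \<in> carrier (Ccat 0)"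
    interpret C0: comm_group "Ccat 0" by (rule g)
    have "bar_pull 0 (homotopy (Suc 0)) (dcat 0 x) \<in> carrier (Ccat 0)"
      by (rule hom_in_carrier[OF h(5) hom_in_carrier[OF h(1) x]])
    then show "box_C 0 (nabla_C 0 x) =
       x \<otimes>\<^bsub>Ccat 0\<^esub> bar_pull 0 (homotopy (Suc 0)) (dcat 0 x)"
      unfolding cochain_homotopy_identity(1)[OF x] cochain_homotopy_identity(3)[OF x refl]
      using x by (intro C0.r_one C0.m_closed)
  next
    fix n x assume x: "x \<in> carrier (Ccat (Suc n))"
    show "box_C (Suc n) (nabla_C (Suc n) x) =
       x \<otimes>\<^bsub>Ccat (Suc n)\<^esub> bar_pull (Suc n) (homotopy (Suc (Suc n))) (dcat (Suc n) x)
       \<otimes>\<^bsub>Ccat (Suc n)\<^esub> dcat n (bar_pull n (homotopy (Suc n)) x)"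
      unfolding cochain_homotopy_identity(1)[OF x] cochain_homotopy_identity(2)[OF x refl] ..
  qed
  moreover have "cochain_homotopic Ccub dcub Ccub dcub
      (\<lambda>n. nabla_C n \<circ> box_C n) (\<lambda>n. id)"
    unfolding cochain_homotopic_def o_apply id_apply
  proof (intro exI[of _ "\<lambda>n. cub_pull n (\<lambda>i. 0)"] conjI allI ballI h(6))
    have z: "cub_pull n (\<lambda>i. 0) y = \<one>\<^bsub>Ccub n\<^esub>" for n and y :: "'a \<Rightarrow> 'b"
      unfolding cub_cochains_def by (rule pull_zero[OF src_cubes_Obj])
    fix x assume x: "x \<in> carrier (Ccub 0)"
    interpret D0: comm_group "Ccub 0" by (rule g)
    show "nabla_C 0 (box_C 0 x) =
       x \<otimes>\<^bsub>Ccub 0\<^esub> cub_pull 0 (\<lambda>i. 0) (dcub 0 x)"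
      unfolding i(5)[OF x] z by (rule D0.r_one[OF x, symmetric])
  next
    have z: "cub_pull n (\<lambda>i. 0) y = \<one>\<^bsub>Ccub n\<^esub>" for n and y :: "'a \<Rightarrow> 'b"
      unfolding cub_cochains_def by (rule pull_zero[OF src_cubes_Obj])
    fix n x assume x: "x \<in> carrier (Ccub (Suc n))"
    interpret Dn: comm_group "Ccub (Suc n)" by (rule g)
    have "dcub n \<one>\<^bsub>Ccub n\<^esub> = \<one>\<^bsub>Ccub (Suc n)\<^esub>"
      by (rule hom_one'[OF g(2) g(2) h(2)])
    then show "nabla_C (Suc n) (box_C (Suc n) x) =
       x \<otimes>\<^bsub>Ccub (Suc n)\<^esub> cub_pull (Suc n) (\<lambda>i. 0) (dcub (Suc n) x)
       \<otimes>\<^bsub>Ccub (Suc n)\<^esub> dcub n (cub_pull n (\<lambda>i. 0) x)"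
      unfolding i(5)[OF x] z using x Dn.r_one by metis
  qed
  ultimately show ?thesis
    unfolding cochain_homotopy_equivalence_def using f f' by blast
qed

end

section \<open>Chains\<close>

lemma lin_ext_cong:
  assumes H: "comm_group H" and x: "\<And>i. i \<in> I \<Longrightarrow> x i \<in> carrier (G i)"
    and eq: "\<And>i a. i \<in> I \<Longrightarrow> a \<in> carrier (G i) \<Longrightarrow> \<phi> i a = \<psi> i a"
    and \<psi>: "\<And>i. i \<in> I \<Longrightarrow> \<psi> i \<in> hom (G i) H"
  shows "lin_ext I G H \<phi> x = lin_ext I G H \<psi> x"
proof -
  interpret comm_group H by fact
  show ?thesis
    unfolding lin_ext_def by (rule finprod_cong') (use x eq hom_in_carrier[OF \<psi>] in auto)
qed

context k_graph_left_module
begin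

abbreviation "bars n \<equiv> dsum (tuples \<Lambda> n) (tup_src \<Lambda>)"
abbreviation "cubs n \<equiv> dsum (cubes k \<Lambda> n) (src \<Lambda>)"
abbreviation "dcat \<equiv> cat_boundary \<Lambda> N act"
abbreviation "dcub \<equiv> cub_boundary k \<Lambda> N act"
abbreviation "nabla_N \<equiv> nabla_chain k \<Lambda> N"
abbreviation "box_N \<equiv> box_chain k \<Lambda> N act"

lemma chains_dsum: "cat_chains \<Lambda> N n = bars n" "cub_chains k \<Lambda> N n = cubs n"
  by (simp_all add: cat_chains_def cub_chains_def dsum_def mods_def)

lemma chain_groups: "comm_group (bars n)" "comm_group (cubs n)"
  by (rule comm_group_dsum, erule tup_src_Obj src_cubes_Obj)+

lemma dsum_component: "\<lbrakk>\<And>i. i \<in> I \<Longrightarrow> s i \<in> Obj \<Lambda>; x \<in> carrier (dsum I s); i \<in> I\<rbrakk> \<Longrightarrow> x i \<in> carrier (mods s i)"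
  unfolding dsum_def
  by (subst (asm) carrier_sum_group) (auto intro: comm_group.axioms(2)[OF comm_group_mods])

text \<open>
  The explicit formulas for chains prescribe values \<open>\<phi> i a\<close> on generators for \<open>a\<close> in the group
  belonging to \<open>i\<close>; elsewhere \<open>\<phi>\<close> is arbitrary and need not agree with the evaluation of \<open>A i\<close>.
\<close>

lemma push_eqI_formula:
  assumes A: "operator \<Lambda> I s J s' A" and s': "\<And>j. j \<in> J \<Longrightarrow> s' j \<in> Obj \<Lambda>" and x: "x \<in> carrier (dsum I s)"
    and eq: "\<And>i a. i \<in> I \<Longrightarrow> a \<in> carrier (N (s i)) \<Longrightarrow> \<phi> i a = frag_eval (dsum J s') (push_gen J s' a) (A i)"
  shows "lin_ext I (\<lambda>i. N (s i)) (dsum J s') \<phi> x = push I s J s' N act A x"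
proof -
  have "lin_ext I (mods s) (dsum J s') \<phi> x = push I s J s' N act A x"
    unfolding push_def'
  proof (rule lin_ext_cong)
    show "comm_group (dsum J s')" by (rule comm_group_dsum) (rule s')
    show "x i \<in> carrier (mods s i)" if "i \<in> I" for i
      by (rule dsum_component[OF _ x that]) (use A in \<open>auto simp: operator_def\<close>)
    show "(\<lambda>a. frag_eval (dsum J s') (push_gen J s' a) (A i)) \<in> hom (mods s i) (dsum J s')" if "i \<in> I" for i
      by (rule push_component_hom[OF A s' that])
  qed (use eq in \<open>simp add: mods_def\<close>)
  then show ?thesis by (simp add: mods_def)
qed

text \<open>
  Faces whose trailing morphism is a vertex do not involve the action.
\<close>

lemma push_gen_unit:
  assumes "(j, w) \<in> cells \<Lambda> J s w" "w \<in> Obj \<Lambda>" "a \<in> carrier (N w)"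
  shows "push_gen J s a (j, w) = gen J (\<lambda>j. N (s j)) j a"
  using act_id[OF assms(2,3)] by (simp add: push_gen_def mods_def)

lemma cat_boundary_eq:
  assumes x: "x \<in> carrier (bars (Suc n))"
  shows "dcat (Suc n) x = push (tuples \<Lambda> (Suc n)) (tup_src \<Lambda>) (tuples \<Lambda> n) (tup_src \<Lambda>) N act bar_bd x"
  unfolding cat_boundary_def Let_def diff_Suc_1 chains_dsum
proof (rule push_eqI_formula[OF operator_bar_bd tup_src_Obj x])
  fix t a assume t: "t \<in> tuples \<Lambda> (Suc n)" and a: "a \<in> carrier (N (tup_src \<Lambda> t))"
  let ?P = "push_gen (tuples \<Lambda> n) (tup_src \<Lambda>) a"
  interpret C: comm_group "bars n" by (rule chain_groups)
  note o = tup_src_Obj[OF t] and b = bar_bd_formula[OF t]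
  note cl = push_gen_closed[OF tup_src_Obj order_refl a]
  have u: "?P (face_mid \<Lambda> i t, tup_src \<Lambda> t) = cat_gen \<Lambda> N n (face_mid \<Lambda> i t) a"
    if "i \<in> {1..n}" for i
    by (rule push_gen_unit[OF b(3)[OF that] o a])
  have "frag_eval (bars n) ?P (bar_bd t) =
       ?P (face_first \<Lambda> t, tup_src \<Lambda> t)
       \<otimes>\<^bsub>bars n\<^esub> (\<Otimes>\<^bsub>bars n\<^esub>i\<in>{1..n}. ?P (face_mid \<Lambda> i t, tup_src \<Lambda> t) [^]\<^bsub>bars n\<^esub> ((- 1) ^ i :: int))
       \<otimes>\<^bsub>bars n\<^esub> ?P (face_last t, last_entry t) [^]\<^bsub>bars n\<^esub> ((- 1) ^ (n + 1) :: int)"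
    by (rule eval_bar_bd[OF C.comm_group_axioms t cl])
  also have "(\<Otimes>\<^bsub>bars n\<^esub>i\<in>{1..n}. ?P (face_mid \<Lambda> i t, tup_src \<Lambda> t) [^]\<^bsub>bars n\<^esub> ((- 1) ^ i :: int))
      = (\<Otimes>\<^bsub>bars n\<^esub>i\<in>{1..n}. cat_gen \<Lambda> N n (face_mid \<Lambda> i t) a [^]\<^bsub>bars n\<^esub> ((- 1) ^ i :: int))"
  proof (rule C.finprod_cong'[OF refl])
    show "(\<lambda>i. cat_gen \<Lambda> N n (face_mid \<Lambda> i t) a [^]\<^bsub>bars n\<^esub> ((- 1) ^ i :: int)) \<in> {1..n} \<rightarrow> carrier (bars n)"
    proof (rule Pi_I, rule C.int_pow_closed)
      fix i assume i: "i \<in> {1..n}"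
      show "cat_gen \<Lambda> N n (face_mid \<Lambda> i t) a \<in> carrier (bars n)"
        unfolding u[OF i, symmetric] by (rule funcset_mem[OF cl b(3)[OF i]])
    qed
  qed (simp only: u)
  finally show "cat_gen \<Lambda> N n (face_first \<Lambda> t) a
       \<otimes>\<^bsub>bars n\<^esub> (\<Otimes>\<^bsub>bars n\<^esub>i\<in>{1..n}. cat_gen \<Lambda> N n (face_mid \<Lambda> i t) a [^]\<^bsub>bars n\<^esub> ((- 1) ^ i :: int))
       \<otimes>\<^bsub>bars n\<^esub> cat_gen \<Lambda> N n (face_last t) (act (last_entry t) a) [^]\<^bsub>bars n\<^esub> ((- 1) ^ Suc n :: int)
     = frag_eval (bars n) ?P (bar_bd t)"
    unfolding push_gen_unit[OF b(2) o a] by (simp add: push_gen_def mods_def)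
qed

lemma cub_boundary_eq:
  assumes x: "x \<in> carrier (cubs (Suc n))"
  shows "dcub (Suc n) x = push (cubes k \<Lambda> (Suc n)) (src \<Lambda>) (cubes k \<Lambda> n) (src \<Lambda>) N act cub_bd x"
  unfolding cub_boundary_def Let_def diff_Suc_1 chains_dsum
proof (rule push_eqI_formula[OF operator_cub_bd src_cubes_Obj x])
  fix \<eta> a assume \<eta>: "\<eta> \<in> cubes k \<Lambda> (Suc n)" and a: "a \<in> carrier (N (src \<Lambda> \<eta>))"
  interpret C: comm_group "cubs n" by (rule chain_groups)
  note o = src_cubes_Obj[OF \<eta>] and b = cub_bd_formula[OF \<eta>]
  note cl = push_gen_closed[OF src_cubes_Obj order_refl a]
  let ?P = "push_gen (cubes k \<Lambda> n) (src \<Lambda>) a"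
  have u: "?P (face1 \<Lambda> i \<eta>, src \<Lambda> \<eta>) = cub_gen k \<Lambda> N n (face1 \<Lambda> i \<eta>) a" if "i \<in> {1..Suc n}" for i
    by (rule push_gen_unit[OF b(3)[OF that] o a])
  have v: "?P (face0 \<Lambda> i \<eta>, last_edge \<Lambda> i \<eta>) = cub_gen k \<Lambda> N n (face0 \<Lambda> i \<eta>) (act (last_edge \<Lambda> i \<eta>) a)" for i
    by (simp add: push_gen_def mods_def)
  have "frag_eval (cubs n) ?P (cub_bd \<eta>) = (\<Otimes>\<^bsub>cubs n\<^esub>i\<in>{1..Suc n}.
      (?P (face0 \<Lambda> i \<eta>, last_edge \<Lambda> i \<eta>) \<otimes>\<^bsub>cubs n\<^esub> inv\<^bsub>cubs n\<^esub> ?P (face1 \<Lambda> i \<eta>, src \<Lambda> \<eta>)) [^]\<^bsub>cubs n\<^esub> ((- 1) ^ i :: int))"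
    by (rule eval_cub_bd[OF C.comm_group_axioms \<eta> cl])
  also have "\<dots> = (\<Otimes>\<^bsub>cubs n\<^esub>i\<in>{1..Suc n}.
      (cub_gen k \<Lambda> N n (face0 \<Lambda> i \<eta>) (act (last_edge \<Lambda> i \<eta>) a) \<otimes>\<^bsub>cubs n\<^esub> inv\<^bsub>cubs n\<^esub> (cub_gen k \<Lambda> N n (face1 \<Lambda> i \<eta>) a)) [^]\<^bsub>cubs n\<^esub> ((- 1) ^ i :: int))"
  proof (rule C.finprod_cong'[OF refl])
    show "(\<lambda>i. (cub_gen k \<Lambda> N n (face0 \<Lambda> i \<eta>) (act (last_edge \<Lambda> i \<eta>) a) \<otimes>\<^bsub>cubs n\<^esub> inv\<^bsub>cubs n\<^esub> (cub_gen k \<Lambda> N n (face1 \<Lambda> i \<eta>) a)) [^]\<^bsub>cubs n\<^esub> ((- 1) ^ i :: int))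
        \<in> {1..Suc n} \<rightarrow> carrier (cubs n)"
    proof (intro Pi_I C.int_pow_closed C.m_closed C.inv_closed)
      fix i assume i: "i \<in> {1..Suc n}"
      show "cub_gen k \<Lambda> N n (face0 \<Lambda> i \<eta>) (act (last_edge \<Lambda> i \<eta>) a) \<in> carrier (cubs n)"
        unfolding v[symmetric] by (rule funcset_mem[OF cl b(2)[OF i]])
      show "cub_gen k \<Lambda> N n (face1 \<Lambda> i \<eta>) a \<in> carrier (cubs n)"
        unfolding u[OF i, symmetric] by (rule funcset_mem[OF cl b(3)[OF i]])
    qed
  qed (simp only: u v)
  finally show "(\<Otimes>\<^bsub>cubs n\<^esub>i\<in>{1..Suc n}.
      (cub_gen k \<Lambda> N n (face0 \<Lambda> i \<eta>) (act (last_edge \<Lambda> i \<eta>) a) \<otimes>\<^bsub>cubs n\<^esub> inv\<^bsub>cubs n\<^esub> (cub_gen k \<Lambda> N n (face1 \<Lambda> i \<eta>) a)) [^]\<^bsub>cubs n\<^esub> ((- 1) ^ i :: int))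
      = frag_eval (cubs n) ?P (cub_bd \<eta>)" by simp
qed

lemma nabla_chain_eq:
  assumes x: "x \<in> carrier (cubs n)"
  shows "nabla_N n x = push (cubes k \<Lambda> n) (src \<Lambda>) (tuples \<Lambda> n) (tup_src \<Lambda>) N act nabla x"
  unfolding nabla_chain_def Let_def chains_dsum
proof (rule push_eqI_formula[OF operator_nabla tup_src_Obj x])
  fix \<eta> a assume \<eta>: "\<eta> \<in> cubes k \<Lambda> n" and a: "a \<in> carrier (N (src \<Lambda> \<eta>))"
  interpret C: comm_group "bars n" by (rule chain_groups)
  note o = src_cubes_Obj[OF \<eta>]
  note cl = push_gen_closed[OF tup_src_Obj order_refl a]
  let ?P = "push_gen (tuples \<Lambda> n) (tup_src \<Lambda>) a"
  have u: "?P (sigma_tup \<Lambda> n \<eta> \<sigma>, src \<Lambda> \<eta>) = cat_gen \<Lambda> N n (sigma_tup \<Lambda> n \<eta> \<sigma>) a" if "\<sigma> permutes {1..n}" for \<sigma>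
    by (rule push_gen_unit[OF sigma_tup_simplex(2)[OF \<eta> that] o a])
  have "frag_eval (bars n) ?P (nabla \<eta>) = (\<Otimes>\<^bsub>bars n\<^esub>\<sigma>\<in>{\<sigma>. \<sigma> permutes {1..n}}. ?P (sigma_tup \<Lambda> n \<eta> \<sigma>, src \<Lambda> \<eta>) [^]\<^bsub>bars n\<^esub> sign \<sigma>)"
    by (rule eval_nabla[OF C.comm_group_axioms \<eta> cl])
  also have "\<dots> = (\<Otimes>\<^bsub>bars n\<^esub>\<sigma>\<in>{\<sigma>. \<sigma> permutes {1..n}}. cat_gen \<Lambda> N n (sigma_tup \<Lambda> n \<eta> \<sigma>) a [^]\<^bsub>bars n\<^esub> sign \<sigma>)"
  proof (rule C.finprod_cong'[OF refl])
    show "(\<lambda>\<sigma>. cat_gen \<Lambda> N n (sigma_tup \<Lambda> n \<eta> \<sigma>) a [^]\<^bsub>bars n\<^esub> sign \<sigma>) \<in> {\<sigma>. \<sigma> permutes {1..n}} \<rightarrow> carrier (bars n)"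
    proof (rule Pi_I, rule C.int_pow_closed)
      fix \<sigma> assume "\<sigma> \<in> {\<sigma>. \<sigma> permutes {1..n}}"
      then have \<sigma>: "\<sigma> permutes {1..n}" by simp
      show "cat_gen \<Lambda> N n (sigma_tup \<Lambda> n \<eta> \<sigma>) a \<in> carrier (bars n)"
        unfolding u[OF \<sigma>, symmetric] by (rule funcset_mem[OF cl sigma_tup_simplex(2)[OF \<eta> \<sigma>]])
    qed
  qed (simp only: u mem_Collect_eq)
  finally show "(\<Otimes>\<^bsub>bars n\<^esub>\<sigma>\<in>{\<sigma>. \<sigma> permutes {1..n}}. cat_gen \<Lambda> N n (sigma_tup \<Lambda> n \<eta> \<sigma>) a [^]\<^bsub>bars n\<^esub> sign \<sigma>)
      = frag_eval (bars n) ?P (nabla \<eta>)" by simp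
qed

lemma box_chain_eq:
  assumes x: "x \<in> carrier (bars n)"
  shows "box_N n x = push (tuples \<Lambda> n) (tup_src \<Lambda>) (cubes k \<Lambda> n) (src \<Lambda>) N act box x"
  unfolding box_chain_def Let_def chains_dsum
proof (rule push_eqI_formula[OF operator_box src_cubes_Obj x])
  fix t a assume t: "t \<in> tuples \<Lambda> n" and a: "a \<in> carrier (N (tup_src \<Lambda> t))"
  show "(\<Otimes>\<^bsub>cubs n\<^esub>K\<in>n_subsets k n. \<Otimes>\<^bsub>cubs n\<^esub>m\<in>box_points k \<Lambda> n K t.
      cub_gen k \<Lambda> N n (seg \<Lambda> (tup_prod \<Lambda> t) (m - set_vec K) m) (act (seg \<Lambda> (tup_prod \<Lambda> t) m (deg \<Lambda> (tup_prod \<Lambda> t))) a))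
      = frag_eval (cubs n) (push_gen (cubes k \<Lambda> n) (src \<Lambda>) a) (box t)"
    using eval_box[OF chain_groups(2) t push_gen_closed[OF src_cubes_Obj order_refl a]]
    by (simp add: push_gen_def mods_def)
qed

abbreviation "bar_push A n m \<equiv> push (tuples \<Lambda> n) (tup_src \<Lambda>) (tuples \<Lambda> m) (tup_src \<Lambda>) N act A"
abbreviation "cub_push A n m \<equiv> push (cubes k \<Lambda> n) (src \<Lambda>) (cubes k \<Lambda> m) (src \<Lambda>) N act A"
abbreviation "nabla_push n \<equiv> push (cubes k \<Lambda> n) (src \<Lambda>) (tuples \<Lambda> n) (tup_src \<Lambda>) N act nabla"
abbreviation "box_push n \<equiv> push (tuples \<Lambda> n) (tup_src \<Lambda>) (cubes k \<Lambda> n) (src \<Lambda>) N act box"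

lemma chain_homs:
  "dcat (Suc n) \<in> hom (bars (Suc n)) (bars n)"
  "dcub (Suc n) \<in> hom (cubs (Suc n)) (cubs n)"
  "nabla_N n \<in> hom (cubs n) (bars n)"
  "box_N n \<in> hom (bars n) (cubs n)"
  "bar_push (homotopy (Suc n)) n (Suc n) \<in> hom (bars n) (bars (Suc n))"
  "cub_push (\<lambda>i. 0) n (Suc n) \<in> hom (cubs n) (cubs (Suc n))"
proof -
  note gr = chain_groups[THEN comm_group.axioms(2)]
  show "dcat (Suc n) \<in> hom (bars (Suc n)) (bars n)"
    by (rule group.hom_restrict[OF gr(1) push_hom[OF operator_bar_bd tup_src_Obj]]) (simp_all add: cat_boundary_eq)
  show "dcub (Suc n) \<in> hom (cubs (Suc n)) (cubs n)"
    by (rule group.hom_restrict[OF gr(2) push_hom[OF operator_cub_bd src_cubes_Obj]]) (simp_all add: cub_boundary_eq)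
  show "nabla_N n \<in> hom (cubs n) (bars n)"
    by (rule group.hom_restrict[OF gr(2) push_hom[OF operator_nabla tup_src_Obj]]) (simp_all add: nabla_chain_eq)
  show "box_N n \<in> hom (bars n) (cubs n)"
    by (rule group.hom_restrict[OF gr(1) push_hom[OF operator_box src_cubes_Obj]]) (simp_all add: box_chain_eq)
  show "bar_push (homotopy (Suc n)) n (Suc n) \<in> hom (bars n) (bars (Suc n))"
    by (rule push_hom[OF operator_homotopy tup_src_Obj])
  show "cub_push (\<lambda>i. 0) n (Suc n) \<in> hom (cubs n) (cubs (Suc n))"
    by (rule push_hom[OF operator_zero[OF src_cubes_Obj] src_cubes_Obj])
qed

lemma chain_identities:
  shows "x \<in> carrier (bars (Suc (Suc n))) \<Longrightarrow>
      dcat (Suc n) (dcat (Suc (Suc n)) x) = \<one>\<^bsub>bars n\<^esub>" (is "?x \<Longrightarrow> ?A")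
    and "y \<in> carrier (cubs (Suc (Suc n))) \<Longrightarrow>
      dcub (Suc n) (dcub (Suc (Suc n)) y) = \<one>\<^bsub>cubs n\<^esub>" (is "?y \<Longrightarrow> ?B")
    and "y' \<in> carrier (cubs (Suc n)) \<Longrightarrow>
      nabla_N n (dcub (Suc n) y') = dcat (Suc n) (nabla_N (Suc n) y')" (is "?y' \<Longrightarrow> ?C")
    and "x' \<in> carrier (bars (Suc n)) \<Longrightarrow>
      box_N n (dcat (Suc n) x') = dcub (Suc n) (box_N (Suc n) x')" (is "?x' \<Longrightarrow> ?D")
    and "z \<in> carrier (cubs n) \<Longrightarrow> box_N n (nabla_N n z) = z" (is "?z \<Longrightarrow> ?E")
proof -
  note hs = hom_in_carrier[OF chain_homs(1)] hom_in_carrier[OF chain_homs(2)] hom_in_carrier[OF chain_homs(3)] hom_in_carrier[OF chain_homs(4)]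
  note eqs = cat_boundary_eq cub_boundary_eq nabla_chain_eq box_chain_eq
  show ?A if x: ?x
  proof -
    have "dcat (Suc n) (dcat (Suc (Suc n)) x) = bar_push bar_bd (Suc n) n (bar_push bar_bd (Suc (Suc n)) (Suc n) x)"
      using hs(1)[OF x] x by (simp add: eqs)
    also have "\<dots> = bar_push (\<lambda>t. lin \<Lambda> bar_bd (bar_bd t)) (Suc (Suc n)) n x"
      by (rule push_push[OF operator_bar_bd operator_bar_bd tup_src_Obj x])
    also have "\<dots> = bar_push (\<lambda>t. 0) (Suc (Suc n)) n x"
      by (rule push_cong[OF bar_bd_bar_bd operator_compose[OF operator_bar_bd operator_bar_bd] tup_src_Obj x])
    also have "\<dots> = \<one>\<^bsub>bars n\<^esub>" by (rule push_zero[OF tup_src_Obj tup_src_Obj x])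
    finally show ?thesis .
  qed
  show ?B if y: ?y
  proof -
    have "dcub (Suc n) (dcub (Suc (Suc n)) y) = cub_push cub_bd (Suc n) n (cub_push cub_bd (Suc (Suc n)) (Suc n) y)"
      using hs(2)[OF y] y by (simp add: eqs)
    also have "\<dots> = cub_push (\<lambda>t. lin \<Lambda> cub_bd (cub_bd t)) (Suc (Suc n)) n y"
      by (rule push_push[OF operator_cub_bd operator_cub_bd src_cubes_Obj y])
    also have "\<dots> = cub_push (\<lambda>t. 0) (Suc (Suc n)) n y"
      by (rule push_cong[OF cub_bd_cub_bd operator_compose[OF operator_cub_bd operator_cub_bd] src_cubes_Obj y])
    also have "\<dots> = \<one>\<^bsub>cubs n\<^esub>" by (rule push_zero[OF src_cubes_Obj src_cubes_Obj y])
    finally show ?thesis .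
  qed
  show ?C if y: ?y'
  proof -
    have "nabla_N n (dcub (Suc n) y') = nabla_push n (cub_push cub_bd (Suc n) n y')"
      using hs(2)[OF y] y by (simp add: eqs)
    also have "\<dots> = push (cubes k \<Lambda> (Suc n)) (src \<Lambda>) (tuples \<Lambda> n) (tup_src \<Lambda>) N act (\<lambda>\<eta>. lin \<Lambda> nabla (cub_bd \<eta>)) y'"
      by (rule push_push[OF operator_cub_bd operator_nabla tup_src_Obj y])
    also have "\<dots> = push (cubes k \<Lambda> (Suc n)) (src \<Lambda>) (tuples \<Lambda> n) (tup_src \<Lambda>) N act (\<lambda>\<eta>. lin \<Lambda> bar_bd (nabla \<eta>)) y'"
      by (rule push_cong[OF bar_bd_nabla[symmetric] operator_compose[OF operator_cub_bd operator_nabla] tup_src_Obj y])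
    also have "\<dots> = bar_push bar_bd (Suc n) n (nabla_push (Suc n) y')"
      by (rule push_push[OF operator_nabla operator_bar_bd tup_src_Obj y, symmetric])
    also have "\<dots> = dcat (Suc n) (nabla_N (Suc n) y')"
      using hs(3)[OF y] y by (simp add: eqs)
    finally show ?thesis .
  qed
  show ?D if x: ?x'
  proof -
    have "box_N n (dcat (Suc n) x') = box_push n (bar_push bar_bd (Suc n) n x')"
      using hs(1)[OF x] x by (simp add: eqs)
    also have "\<dots> = push (tuples \<Lambda> (Suc n)) (tup_src \<Lambda>) (cubes k \<Lambda> n) (src \<Lambda>) N act (\<lambda>t. lin \<Lambda> box (bar_bd t)) x'"
      by (rule push_push[OF operator_bar_bd operator_box src_cubes_Obj x])
    also have "\<dots> = push (tuples \<Lambda> (Suc n)) (tup_src \<Lambda>) (cubes k \<Lambda> n) (src \<Lambda>) N act (\<lambda>t. lin \<Lambda> cub_bd (box t)) x'"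
      by (rule push_cong[OF cub_bd_box[symmetric] operator_compose[OF operator_bar_bd operator_box] src_cubes_Obj x])
    also have "\<dots> = cub_push cub_bd (Suc n) n (box_push (Suc n) x')"
      by (rule push_push[OF operator_box operator_cub_bd src_cubes_Obj x, symmetric])
    also have "\<dots> = dcub (Suc n) (box_N (Suc n) x')"
      using hs(4)[OF x] x by (simp add: eqs)
    finally show ?thesis .
  qed
  show ?E if z: ?z
  proof -
    have "box_N n (nabla_N n z) = box_push n (nabla_push n z)"
      using hs(3)[OF z] z by (simp add: eqs)
    also have "\<dots> = cub_push (\<lambda>\<eta>. lin \<Lambda> box (nabla \<eta>)) n n z"
      by (rule push_push[OF operator_nabla operator_box src_cubes_Obj z])
    also have "\<dots> = cub_push (\<lambda>\<eta>. frag_of (\<eta>, src \<Lambda> \<eta>)) n n z"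
      by (rule push_cong[OF box_nabla operator_compose[OF operator_nabla operator_box] src_cubes_Obj z])
    also have "\<dots> = z" by (rule push_unit[OF src_cubes_Obj z])
    finally show ?thesis .
  qed
qed

text \<open>
  As for cochains, the last summand factors through the boundary in positive degrees and is
  trivial in degree \<open>0\<close>.
\<close>

lemma chain_homotopy_identity:
  assumes x: "x \<in> carrier (bars n)"
  shows "nabla_N n (box_N n x) =
    x \<otimes>\<^bsub>bars n\<^esub> dcat (Suc n) (bar_push (homotopy (Suc n)) n (Suc n) x)
      \<otimes>\<^bsub>bars n\<^esub> bar_push (\<lambda>t. lin \<Lambda> (homotopy n) (bar_bd t)) n n x" (is ?A)
    and "n = Suc m \<Longrightarrow> bar_push (\<lambda>t. lin \<Lambda> (homotopy n) (bar_bd t)) n n x =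
      bar_push (homotopy (Suc m)) m (Suc m) (dcat (Suc m) x)"
    and "n = 0 \<Longrightarrow> bar_push (\<lambda>t. lin \<Lambda> (homotopy n) (bar_bd t)) n n x = \<one>\<^bsub>bars n\<^esub>"
proof -
  let ?s = "tup_src \<Lambda>" and ?I = "tuples \<Lambda> n"
  let ?U = "\<lambda>t. frag_of (t, ?s t)" and ?B = "\<lambda>t. lin \<Lambda> bar_bd (homotopy (Suc n) t)" and ?H = "\<lambda>t. lin \<Lambda> (homotopy n) (bar_bd t)"
  have oU: "operator \<Lambda> ?I ?s ?I ?s ?U" by (rule operator_unit[OF tup_src_Obj])
  have oB: "operator \<Lambda> ?I ?s ?I ?s ?B" by (rule operator_compose[OF operator_homotopy operator_bar_bd])
  have oH: "operator \<Lambda> ?I ?s ?I ?s ?H"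
  proof (cases n)
    case 0
    have "?H t = 0" if "t \<in> ?I" for t using that bar_bd_0[of t] by (simp add: 0)
    then show ?thesis using tup_src_Obj by (simp add: operator_def)
  next
    case (Suc m)
    show ?thesis unfolding Suc by (rule operator_compose[OF operator_bar_bd operator_homotopy])
  qed
  have hx: "bar_push (homotopy (Suc n)) n (Suc n) x \<in> carrier (bars (Suc n))"
    by (rule hom_in_carrier[OF chain_homs(5) x])
  have "nabla_N n (box_N n x) = nabla_push n (box_push n x)"
    using hom_in_carrier[OF chain_homs(4) x] x by (simp add: nabla_chain_eq box_chain_eq)
  also have "\<dots> = bar_push (\<lambda>t. lin \<Lambda> nabla (box t)) n n x"
    by (rule push_push[OF operator_box operator_nabla tup_src_Obj x])
  also have "\<dots> = bar_push (\<lambda>t. ?U t + ?B t + ?H t) n n x"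
    by (rule push_cong[OF nabla_box_homotopy operator_compose[OF operator_box operator_nabla] tup_src_Obj x])
  also have "\<dots> = bar_push (\<lambda>t. ?U t + ?B t) n n x \<otimes>\<^bsub>bars n\<^esub> bar_push ?H n n x"
    by (rule push_add[OF operator_add[OF oU oB] oH tup_src_Obj x, symmetric])
  also have "bar_push (\<lambda>t. ?U t + ?B t) n n x = bar_push ?U n n x \<otimes>\<^bsub>bars n\<^esub> bar_push ?B n n x"
    by (rule push_add[OF oU oB tup_src_Obj x, symmetric])
  also have "bar_push ?U n n x = x" by (rule push_unit[OF tup_src_Obj x])
  also have "bar_push ?B n n x = bar_push bar_bd (Suc n) n (bar_push (homotopy (Suc n)) n (Suc n) x)"
    by (rule push_push[OF operator_homotopy operator_bar_bd tup_src_Obj x, symmetric])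
  finally show ?A by (simp only: cat_boundary_eq[OF hx])
  show "bar_push ?H n n x = bar_push (homotopy (Suc m)) m (Suc m) (dcat (Suc m) x)" if n: "n = Suc m"
    unfolding n cat_boundary_eq[OF x[unfolded n]]
    by (rule push_push[OF operator_bar_bd operator_homotopy tup_src_Obj x[unfolded n], symmetric])
  show "bar_push ?H n n x = \<one>\<^bsub>bars n\<^esub>" if n: "n = 0"
  proof -
    have "bar_push ?H n n x = bar_push (\<lambda>t. 0) n n x"
      by (rule push_cong[OF _ oH tup_src_Obj x]) (simp add: n bar_bd_0)
    then show ?thesis using push_zero[OF tup_src_Obj tup_src_Obj x] by simp
  qed
qed

theorem chain_equivalence:
  "chain_homotopy_equivalence (cub_chains k \<Lambda> N) dcub
     (cat_chains \<Lambda> N) dcat nabla_N box_N"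
proof -
  note h = chain_homs and i = chain_identities and g = chain_groups
  have C: "chain_complex (cat_chains \<Lambda> N) dcat"
    and D: "chain_complex (cub_chains k \<Lambda> N) dcub"
    unfolding chain_complex_def chains_dsum using h(1,2) i(1,2) g by blast+
  have f: "chain_map (cub_chains k \<Lambda> N) dcub
      (cat_chains \<Lambda> N) dcat nabla_N"
    and f': "chain_map (cat_chains \<Lambda> N) dcat
      (cub_chains k \<Lambda> N) dcub box_N"
    unfolding chain_map_def using C D h(3,4) i(3,4) unfolding chains_dsum by blast+
  have "chain_homotopic (cat_chains \<Lambda> N) dcat (cat_chains \<Lambda> N) dcat
      (\<lambda>n. nabla_N n \<circ> box_N n) (\<lambda>n. id)"
    unfolding chain_homotopic_def o_apply id_apply chains_dsum
  proof (intro exI[of _ "\<lambda>n. bar_push (homotopy (Suc n)) n (Suc n)"] conjI allI ballI h(5))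
    fix x assume x: "x \<in> carrier (bars 0)"
    interpret C0: comm_group "bars 0" by (rule g)
    have "dcat (Suc 0) (bar_push (homotopy (Suc 0)) 0 (Suc 0) x) \<in> carrier (bars 0)"
      by (rule hom_in_carrier[OF h(1) hom_in_carrier[OF h(5) x]])
    then show "nabla_N 0 (box_N 0 x) =
       x \<otimes>\<^bsub>bars 0\<^esub> dcat 1 (bar_push (homotopy (Suc 0)) 0 (Suc 0) x)"
      unfolding chain_homotopy_identity(1)[OF x] chain_homotopy_identity(3)[OF x refl] One_nat_def
      using x by (intro C0.r_one C0.m_closed)
  next
    fix n x assume x: "x \<in> carrier (bars (Suc n))"
    show "nabla_N (Suc n) (box_N (Suc n) x) =
       x \<otimes>\<^bsub>bars (Suc n)\<^esub> dcat (Suc (Suc n)) (bar_push (homotopy (Suc (Suc n))) (Suc n) (Suc (Suc n)) x)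
       \<otimes>\<^bsub>bars (Suc n)\<^esub> bar_push (homotopy (Suc n)) n (Suc n) (dcat (Suc n) x)"
      unfolding chain_homotopy_identity(1)[OF x] chain_homotopy_identity(2)[OF x refl] ..
  qed
  moreover have z: "cub_push (\<lambda>i. 0) n m x = \<one>\<^bsub>cubs m\<^esub>" if "x \<in> carrier (cubs n)" for n m x
    by (rule push_zero[OF src_cubes_Obj src_cubes_Obj that])
  have b1: "dcub (Suc n) \<one>\<^bsub>cubs (Suc n)\<^esub> = \<one>\<^bsub>cubs n\<^esub>" for n
    by (rule hom_one'[OF g(2) g(2) h(2)])
  have "chain_homotopic (cub_chains k \<Lambda> N) dcub (cub_chains k \<Lambda> N) dcub
      (\<lambda>n. box_N n \<circ> nabla_N n) (\<lambda>n. id)"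
    unfolding chain_homotopic_def o_apply id_apply chains_dsum
  proof (intro exI[of _ "\<lambda>n. cub_push (\<lambda>i. 0) n (Suc n)"] conjI allI ballI h(6))
    fix x assume x: "x \<in> carrier (cubs 0)"
    interpret D0: comm_group "cubs 0" by (rule g)
    show "box_N 0 (nabla_N 0 x) =
       x \<otimes>\<^bsub>cubs 0\<^esub> dcub 1 (cub_push (\<lambda>i. 0) 0 (Suc 0) x)"
      unfolding i(5)[OF x] z[OF x] One_nat_def b1 by (rule D0.r_one[OF x, symmetric])
  next
    fix n x assume x: "x \<in> carrier (cubs (Suc n))"
    interpret Dn: comm_group "cubs (Suc n)" by (rule g)
    show "box_N (Suc n) (nabla_N (Suc n) x) =
       x \<otimes>\<^bsub>cubs (Suc n)\<^esub> dcub (Suc (Suc n)) (cub_push (\<lambda>i. 0) (Suc n) (Suc (Suc n)) x)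
       \<otimes>\<^bsub>cubs (Suc n)\<^esub> cub_push (\<lambda>i. 0) n (Suc n) (dcub (Suc n) x)"
      unfolding i(5)[OF x] z[OF x] z[OF hom_in_carrier[OF h(2) x]] b1
      by (simp only: Dn.r_one[OF x])
  qed
  ultimately show ?thesis
    unfolding chain_homotopy_equivalence_def using f f' by blast
qed

end

section \<open>The homotopy equivalences and the isomorphisms\<close>

theorem theorem7p20:
  fixes k :: nat and \<Lambda> :: "'a kgraph"
  assumes "k_graph k \<Lambda>"
  shows
    "(\<forall>(M :: 'a \<Rightarrow> 'b monoid) act. right_module \<Lambda> M act \<longrightarrow>
        cochain_homotopy_equivalence
          (cat_cochains \<Lambda> M) (cat_coboundary \<Lambda> M act)
          (cub_cochains k \<Lambda> M) (cub_coboundary k \<Lambda> M act)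
          (nabla_cochain k \<Lambda> M) (box_cochain k \<Lambda> M act) \<and>
        (\<forall>n. group_isomorphisms
          (cohomology_group (cat_cochains \<Lambda> M) (cat_coboundary \<Lambda> M act) n)
          (cohomology_group (cub_cochains k \<Lambda> M) (cub_coboundary k \<Lambda> M act) n)
          (cohomology_map (cub_cochains k \<Lambda> M) (cub_coboundary k \<Lambda> M act)
             (nabla_cochain k \<Lambda> M) n)
          (cohomology_map (cat_cochains \<Lambda> M) (cat_coboundary \<Lambda> M act)
             (box_cochain k \<Lambda> M act) n)))
     \<and>
     (\<forall>(N :: 'a \<Rightarrow> 'c monoid) act. left_module \<Lambda> N act \<longrightarrow>
        chain_homotopy_equivalence
          (cub_chains k \<Lambda> N) (cub_boundary k \<Lambda> N act)
          (cat_chains \<Lambda> N) (cat_boundary \<Lambda> N act)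
          (nabla_chain k \<Lambda> N) (box_chain k \<Lambda> N act) \<and>
        (\<forall>n. group_isomorphisms
          (homology_group (cat_chains \<Lambda> N) (cat_boundary \<Lambda> N act) n)
          (homology_group (cub_chains k \<Lambda> N) (cub_boundary k \<Lambda> N act) n)
          (homology_map (cub_chains k \<Lambda> N) (cub_boundary k \<Lambda> N act)
             (box_chain k \<Lambda> N act) n)
          (homology_map (cat_chains \<Lambda> N) (cat_boundary \<Lambda> N act)
             (nabla_chain k \<Lambda> N) n)))"
proof (intro conjI allI impI)
  fix M :: "'a \<Rightarrow> 'b monoid" and act n
  assume M: "right_module \<Lambda> M act"
  interpret k_graph_right_module k \<Lambda> M act
    using assms M by (rule k_graph_right_module.intro)
  show "cochain_homotopy_equivalence (cat_cochains \<Lambda> M) (cat_coboundary \<Lambda> M act)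
      (cub_cochains k \<Lambda> M) (cub_coboundary k \<Lambda> M act) (nabla_cochain k \<Lambda> M) (box_cochain k \<Lambda> M act)"
    by (rule cochain_equivalence)
  then show "group_isomorphisms
      (cohomology_group (cat_cochains \<Lambda> M) (cat_coboundary \<Lambda> M act) n)
      (cohomology_group (cub_cochains k \<Lambda> M) (cub_coboundary k \<Lambda> M act) n)
      (cohomology_map (cub_cochains k \<Lambda> M) (cub_coboundary k \<Lambda> M act) (nabla_cochain k \<Lambda> M) n)
      (cohomology_map (cat_cochains \<Lambda> M) (cat_coboundary \<Lambda> M act) (box_cochain k \<Lambda> M act) n)"
    by (rule cochain_homotopy_equivalence_isomorphisms)
next
  fix N :: "'a \<Rightarrow> 'c monoid" and act n
  assume N: "left_module \<Lambda> N act"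
  interpret k_graph_left_module k \<Lambda> N act
    using assms N by (rule k_graph_left_module.intro)
  show "chain_homotopy_equivalence (cub_chains k \<Lambda> N) (cub_boundary k \<Lambda> N act)
      (cat_chains \<Lambda> N) (cat_boundary \<Lambda> N act) (nabla_chain k \<Lambda> N) (box_chain k \<Lambda> N act)"
    by (rule chain_equivalence)
  then show "group_isomorphisms
      (homology_group (cat_chains \<Lambda> N) (cat_boundary \<Lambda> N act) n)
      (homology_group (cub_chains k \<Lambda> N) (cub_boundary k \<Lambda> N act) n)
      (homology_map (cub_chains k \<Lambda> N) (cub_boundary k \<Lambda> N act) (box_chain k \<Lambda> N act) n)
      (homology_map (cat_chains \<Lambda> N) (cat_boundary \<Lambda> N act) (nabla_chain k \<Lambda> N) n)"
    by (rule chain_homotopy_equivalence_isomorphisms)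
qed

end
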